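(* Let $d \geq 1$, let $\Omega \subset \mathbb{R}^d$ be a bounded Lipschitz domain, and let $R := \sup_{x\in\Omega}\delta_\Omega(x) > 0$. Let $p>1$ and $s\in(0,1)$ satisfy $sp=d$, and let $n_0\in\mathbb{N}$ be such that $n_0 \geq p-1 > n_0-1$. Then there exists $\alpha_0>0$ such that for every $\alpha\in[0,\alpha_0)$, $$\sup\left\{ \int_\Omega \Phi_{n_0}\left(\alpha\, X_d(u)(x)^{\frac{d}{d-s}}\right)\frac{dx}{\delta_\Omega(x)^d} \ :\ u\in W^{s,p}_0(\Omega),\ [u]_{W^{s,p}(\Omega)}\leq 1\right\} < \infty .$$ Moreover, for every $\alpha\in(\alpha_d^*,\infty)$, $$\sup\left\{ \int_\Omega \Phi_{n_0}\left(\alpha\, X_d(u)(x)^{\frac{d}{d-s}}\right)\frac{dx}{\delta_\Omega(x)^d} \ :\ u\in W^{s,p}_0(\Omega),\ [u]_{W^{s,p}(\Omega)}\leq 1\right\} = \infty ,$$ where $$\alpha_d^* := d\left( \frac{2(d\omega_d)^2\,\Gamma(p+1)}{d!}\sum_{n=0}^\infty \frac{(d+n-1)!}{n!}\,\frac{1}{(d+2n)^p}\right)^{\frac{s}{d-s}}$$ and $\omega_d$ is the volume of the unit ball in $\mathbb{R}^d$.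
   Context: For a bounded Lipschitz domain $\Omega\subset\mathbb{R}^d$, $\delta_\Omega(x) := \min_{y\in\partial\Omega}|x-y|$ is the distance to the boundary. For $p\in[1,\infty)$ and $s\in(0,1)$, the Gagliardo seminorm is $$[u]_{W^{s,p}(\Omega)} := \left(\int_\Omega\int_\Omega \frac{|u(x)-u(y)|^p}{|x-y|^{d+sp}}\,dx\,dy\right)^{1/p}$$ (so the exponent $d+sp$ equals $2d$ when $sp=d$). $W^{s,p}(\Omega)$ is the space of $u\in L^p(\Omega)$ with $[u]_{W^{s,p}(\Omega)}<\infty$, with norm $\|u\|_{W^{s,p}(\Omega)} := \left([u]_{W^{s,p}(\Omega)}^p+\|u\|_{L^p(\Omega)}^p\right)^{1/p}$, and $W^{s,p}_0(\Omega)$ is the completion (closure) of $C_c^\infty(\Omega)$ with respect to this norm. The average of $u$ is $(u)_\Omega := \frac{1}{|\Omega|}\int_\Omega u(y)\,dy$. For $n_0\in\mathbb{N}$, $\Phi_{n_0}(t) := \exp(t)-\sum_{n=0}^{n_0-1}\frac{t^n}{n!}$ for $t\in\mathbb{R}$. With $R=\sup_{x\in\Omega}\delta_\Omega(x)$, the function $X_d(u)$ on $\Omega$ is $$X_1(u)(x) := \frac{|u(x)-(u)_\Omega|}{\ln\left(\frac{2R}{\delta_\Omega(x)}\right)}\quad\text{if } d=1,\qquad X_d(u)(x) := |u(x)|\quad\text{if } d\geq 2.$$ *)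

theory Defs
  imports "HOL-Analysis.Analysis"
begin

section \<open>Bounded Lipschitz domains\<close>

text \<open>
  Near each boundary point \<open>z\<close> the set lies strictly above the graph of a Lipschitz
  function \<open>g\<close>, in the orthonormal frame with origin \<open>z\<close> and vertical direction \<open>e\<close>.  The vector
  \<open>(x - z) - ((x - z) \<bullet> e) *\<^sub>R e\<close> is the horizontal part of \<open>x - z\<close>.  In dimension one the
  hyperplane orthogonal to \<open>e\<close> is \<open>{0}\<close> and the bounded Lipschitz domains are the
  bounded open intervals.
\<close>

definition lipschitz_boundary :: "'a::euclidean_space set \<Rightarrow> bool" where
  "lipschitz_boundary \<Omega> \<longleftrightarrow>
     (\<forall>z \<in> frontier \<Omega>. \<exists>e r L. \<exists>g :: 'a \<Rightarrow> real.
        norm e = 1 \<and> 0 < r \<and> L-lipschitz_on {y. y \<bullet> e = 0} g \<and>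
        \<Omega> \<inter> ball z r =
          {x \<in> ball z r. g ((x - z) - ((x - z) \<bullet> e) *\<^sub>R e) < (x - z) \<bullet> e})"

definition bounded_lipschitz_domain :: "'a::euclidean_space set \<Rightarrow> bool" where
  "bounded_lipschitz_domain \<Omega> \<longleftrightarrow>
     open \<Omega> \<and> connected \<Omega> \<and> \<Omega> \<noteq> {} \<and> bounded \<Omega> \<and> lipschitz_boundary \<Omega>"

text \<open>
  The frontier is closed and (for the domains above) nonempty, so the infimum in
  \<open>infdist\<close> is the minimum of \<open>dist x y\<close> over the boundary points \<open>y\<close>.
\<close>

definition bdist :: "'a::euclidean_space set \<Rightarrow> 'a \<Rightarrow> real" where
  "bdist \<Omega> x = infdist x (frontier \<Omega>)"

definition inradius :: "'a::euclidean_space set \<Rightarrow> real" where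
  "inradius \<Omega> = (SUP x\<in>\<Omega>. bdist \<Omega> x)"

lemma frontier_nonempty:
  fixes \<Omega> :: "'a::euclidean_space set"
  assumes "bounded_lipschitz_domain \<Omega>"
  shows "frontier \<Omega> \<noteq> {}"
proof -
  have "\<Omega> \<noteq> UNIV"
    using assms not_bounded_UNIV unfolding bounded_lipschitz_domain_def by metis
  then show ?thesis
    using assms by (simp add: bounded_lipschitz_domain_def frontier_eq_empty)
qed

lemma bdist_pos:
  fixes \<Omega> :: "'a::euclidean_space set"
  assumes "bounded_lipschitz_domain \<Omega>" "x \<in> \<Omega>"
  shows "0 < bdist \<Omega> x"
proof -
  have "x \<notin> frontier \<Omega>"
    using assms by (auto simp: bounded_lipschitz_domain_def frontier_def interior_open)
  then show ?thesis
    unfolding bdist_def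
    using infdist_pos_not_in_closed[OF frontier_closed frontier_nonempty[OF assms(1)]] by blast
qed

lemma bdd_above_bdist:
  fixes \<Omega> :: "'a::euclidean_space set"
  assumes "bounded_lipschitz_domain \<Omega>"
  shows "bdd_above (bdist \<Omega> ` \<Omega>)"
proof -
  obtain z where z: "z \<in> frontier \<Omega>"
    using frontier_nonempty[OF assms] by blast
  obtain B where B: "\<And>x. x \<in> \<Omega> \<Longrightarrow> dist z x \<le> B"
    using assms unfolding bounded_lipschitz_domain_def bounded_any_center[of _ z] by blast
  have "bdist \<Omega> x \<le> B" if "x \<in> \<Omega>" for x
    unfolding bdist_def using infdist_le[OF z, of x] B[OF that] by (simp add: dist_commute)
  then show ?thesis
    unfolding bdd_above_def by blast
qed

lemma inradius_pos:
  fixes \<Omega> :: "'a::euclidean_space set"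
  assumes "bounded_lipschitz_domain \<Omega>"
  shows "0 < inradius \<Omega>"
proof -
  obtain x where x: "x \<in> \<Omega>"
    using assms unfolding bounded_lipschitz_domain_def by blast
  have "bdist \<Omega> x \<le> inradius \<Omega>"
    unfolding inradius_def by (rule cSUP_upper[OF x bdd_above_bdist[OF assms]])
  then show ?thesis
    using bdist_pos[OF assms x] by linarith
qed

section \<open>Fractional Sobolev spaces\<close>

text \<open>
  Norms and seminorms take values in \<open>[0, \<infinity>]\<close>, so that finiteness is a genuine condition.
  The power below is meant for exponents \<open>r > 0\<close>.
\<close>

definition ennpowr :: "ennreal \<Rightarrow> real \<Rightarrow> ennreal" where
  "ennpowr a r = (if a = \<infinity> then \<infinity> else ennreal (enn2real a powr r))"

definition lp_norm :: "'a::euclidean_space set \<Rightarrow> real \<Rightarrow> ('a \<Rightarrow> real) \<Rightarrow> ennreal" where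
  "lp_norm \<Omega> p u = ennpowr (\<integral>\<^sup>+x. ennreal (\<bar>u x\<bar> powr p) \<partial>lebesgue_on \<Omega>) (1 / p)"

definition gagliardo :: "'a::euclidean_space set \<Rightarrow> real \<Rightarrow> real \<Rightarrow> ('a \<Rightarrow> real) \<Rightarrow> ennreal" where
  "gagliardo \<Omega> s p u =
     ennpowr
       (\<integral>\<^sup>+y. (\<integral>\<^sup>+x. ennreal (\<bar>u x - u y\<bar> powr p / norm (x - y) powr (real DIM('a) + s * p))
          \<partial>lebesgue_on \<Omega>) \<partial>lebesgue_on \<Omega>)
       (1 / p)"

definition wsp_norm :: "'a::euclidean_space set \<Rightarrow> real \<Rightarrow> real \<Rightarrow> ('a \<Rightarrow> real) \<Rightarrow> ennreal" where
  "wsp_norm \<Omega> s p u = ennpowr (ennpowr (gagliardo \<Omega> s p u) p + ennpowr (lp_norm \<Omega> p u) p) (1 / p)"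

text \<open>
  Elements of the function spaces are represented by functions on the whole space, of which only
  the values on \<open>\<Omega>\<close> matter; they are not identified up to null sets.
\<close>

definition wsp :: "'a::euclidean_space set \<Rightarrow> real \<Rightarrow> real \<Rightarrow> ('a \<Rightarrow> real) set" where
  "wsp \<Omega> s p =
     {u \<in> borel_measurable (lebesgue_on \<Omega>). lp_norm \<Omega> p u < \<infinity> \<and> gagliardo \<Omega> s p u < \<infinity>}"

primrec Ck :: "nat \<Rightarrow> ('a::euclidean_space \<Rightarrow> real) \<Rightarrow> bool" where
  "Ck 0 f \<longleftrightarrow> continuous_on UNIV f"
| "Ck (Suc k) f \<longleftrightarrow>
     (\<forall>x. f differentiable at x) \<and> (\<forall>v. Ck k (\<lambda>x. frechet_derivative f (at x) v))"

definition test_functions :: "'a::euclidean_space set \<Rightarrow> ('a \<Rightarrow> real) set" where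
  "test_functions \<Omega> =
     {f. (\<forall>k. Ck k f) \<and> compact (closure {x. f x \<noteq> 0}) \<and> closure {x. f x \<noteq> 0} \<subseteq> \<Omega>}"

text \<open>
  The completion of the test functions, realised as their closure inside the (complete) space
  \<open>wsp \<Omega> s p\<close>.
\<close>

definition wsp0 :: "'a::euclidean_space set \<Rightarrow> real \<Rightarrow> real \<Rightarrow> ('a \<Rightarrow> real) set" where
  "wsp0 \<Omega> s p =
     {u \<in> wsp \<Omega> s p. \<exists>\<phi>. (\<forall>n::nat. \<phi> n \<in> test_functions \<Omega>) \<and>
        (\<lambda>n. wsp_norm \<Omega> s p (\<lambda>x. \<phi> n x - u x)) \<longlonglongrightarrow> 0}"

section \<open>The Moser--Trudinger functional\<close>

definition average :: "'a::euclidean_space set \<Rightarrow> ('a \<Rightarrow> real) \<Rightarrow> real" where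
  "average \<Omega> u = (1 / measure lebesgue \<Omega>) * (LINT y|lebesgue_on \<Omega>. u y)"

definition trunc_exp :: "nat \<Rightarrow> real \<Rightarrow> real" where
  "trunc_exp n0 t = exp t - (\<Sum>n<n0. t ^ n / fact n)"

definition mt_X :: "'a::euclidean_space set \<Rightarrow> ('a \<Rightarrow> real) \<Rightarrow> 'a \<Rightarrow> real" where
  "mt_X \<Omega> u x =
     (if DIM('a) = 1 then \<bar>u x - average \<Omega> u\<bar> / ln (2 * inradius \<Omega> / bdist \<Omega> x) else \<bar>u x\<bar>)"

text \<open>
  The integrand is nonnegative, since \<open>trunc_exp n0 t \<ge> 0\<close> for \<open>t \<ge> 0\<close>; hence the truncation at \<open>0\<close>
  performed by \<open>ennreal\<close> is harmless for \<open>\<alpha> \<ge> 0\<close>.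
\<close>

definition mt_integral ::
    "'a::euclidean_space set \<Rightarrow> real \<Rightarrow> nat \<Rightarrow> real \<Rightarrow> ('a \<Rightarrow> real) \<Rightarrow> ennreal" where
  "mt_integral \<Omega> s n0 \<alpha> u =
     (\<integral>\<^sup>+x. ennreal (trunc_exp n0 (\<alpha> * mt_X \<Omega> u x powr (real DIM('a) / (real DIM('a) - s)))
             / bdist \<Omega> x ^ DIM('a)) \<partial>lebesgue_on \<Omega>)"

text \<open>
  \<open>unit_ball_vol (real d)\<close> is the volume of the unit ball of a \<open>d\<close>-dimensional Euclidean space
  (see \<open>content_ball\<close>).  The series converges, as \<open>p = d / s > d\<close> in the theorem.
\<close>

definition alpha_star :: "nat \<Rightarrow> real \<Rightarrow> real \<Rightarrow> real" where
  "alpha_star d s p =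
     real d *
     (2 * (real d * unit_ball_vol (real d))\<^sup>2 * Gamma (p + 1) / fact d *
       (\<Sum>n. fact (d + n - 1) / fact n * (1 / real (d + 2 * n) powr p)))
     powr (s / (real d - s))"

end

theory Submission
  imports Defs "HOL-Real_Asymp.Real_Asymp"
begin

text \<open>
  Write \<open>d\<close> for the dimension and \<open>\<delta>\<close> for \<^const>\<open>bdist\<close>.  Since \<open>s p = d\<close>, the \<open>p\<close>-th power of the
  Gagliardo seminorm is the energy with kernel \<open>1 / dist x y ^ (2 * d)\<close>, which is scale invariant.
  Scale invariance governs both halves of the theorem.

  \<^bold>\<open>Large exponents.\<close>  The test functions are Moser's: the logarithm \<open>ln (\<rho> / dist x c)\<close>, cut off at
  the height \<open>L\<close>, vanishing outside a ball of radius \<open>\<rho>\<close>, smoothed and normalised.  For a radial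
  function with the slope of the logarithm, the inner integral of the energy at \<open>x\<close>, over the points
  nearer to \<open>c\<close>, is at most \<open>\<kappa> / dist x c ^ d\<close>, where \<open>\<kappa>\<close> is the integral of \<open>ln (1 / norm y) powr p\<close>
  against the kernel over the unit ball, for \<open>norm x = 1\<close>.  To
  compute \<open>\<kappa>\<close>, slice the logarithm at its levels, which makes the domain of integration a ball; an
  inversion about \<open>x\<close> maps that ball to another ball and the kernel to Lebesgue measure
  (\<open>nn_integral_inverse_power_ball_le\<close>).  Expanding the resulting volume in a binomial series and
  integrating term by term gives the series with the Gamma factor
  (\<open>nn_integral_log_inverse_power_le\<close>).  Hence the energy of the cut-off logarithm is at most
  \<open>\<gamma> * (L + 1 / d)\<close> with \<open>\<gamma> = moser_energy d p\<close>.  After normalisation the function has height about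
  \<open>L powr (1 - 1 / p) / \<gamma> powr (1 / p)\<close> on a ball of volume proportional to \<open>exp (- d * L)\<close>, and the exponential
  integrand there has size \<open>exp (\<alpha> * L / \<gamma> powr (1 / (p - 1)))\<close>.  The product is unbounded in \<open>L\<close> as soon
  as \<open>\<alpha> > d * \<gamma> powr (1 / (p - 1))\<close>, which is exactly \<^const>\<open>alpha_star\<close>.  The ball is placed around a point
  almost furthest from the boundary, where in dimension one the logarithmic weight is at most \<open>1\<close>,
  and is so small that the mean of the function is negligible.

  \<^bold>\<open>Small exponents.\<close>  For a test function \<open>u\<close> and \<open>x \<in> \<Omega>\<close>, telescope the means of \<open>u\<close> over the dyadic
  annuli around \<open>x\<close>, up to the scale \<open>\<delta> x / 2\<close>.  Jensen's inequality with geometric weights bounds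
  \<open>u x\<close> minus the outermost mean by a potential of the energy density, with the weakly singular
  kernel \<open>dist x y powr (- p / (2 * q))\<close> and a constant growing like \<open>q powr (p - 1)\<close>, for every \<open>q \<ge> 1\<close>
  (\<open>mean_deviation_le_potential\<close>).  The outermost mean is controlled in the same way by the density in
  a Hardy inequality.  Raising the potential to the power \<open>q / p\<close> and applying Jensen's inequality
  once more makes the kernel \<open>dist x y powr (- 1 / 2)\<close>, for all \<open>q\<close> simultaneously, and so the \<open>q\<close>-th
  moment of \<open>X\<close> with respect to \<open>dx / \<delta> ^ d\<close> is at most \<open>(B * q powr (p - 1)) powr (q / p) * K\<close>
  (\<open>weighted_moment_bound\<close>).  For \<open>q = n * p / (p - 1)\<close> this is of the order \<open>b ^ n * n ^ n\<close>, which
  the factor \<open>\<alpha> ^ n / fact n\<close> in the exponential series makes summable for small \<open>\<alpha>\<close>.  The moments are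
  available for \<open>q \<ge> p\<close>, that is \<open>n \<ge> p - 1\<close>; this is what removing the first \<open>n0\<close> terms of the
  series achieves.  Fatou's lemma extends the bound to the closure of the test functions.

  The Hardy inequality has a different proof, and a different form, in dimension one.  If \<open>d \<ge> 2\<close>, one
  compares \<open>u x\<close> with the values of \<open>u\<close> on a ball below \<open>x\<close> whose distance to the boundary is about
  \<open>\<delta> x / t\<close>; the values on this ball come back with a factor of order \<open>1 / t\<close> and can be absorbed when \<open>t\<close> is large
  (\<open>hardy_near_boundary\<close>).  If \<open>d = 1\<close>, there is no such gain, and the logarithm in \<open>X\<close> together with
  the subtraction of the mean compensates for it: the means over dyadic intervals shrinking to an
  endpoint satisfy the discrete Hardy inequality with weights \<open>(k + 1) powr (- p)\<close>
  (\<open>discrete_hardy\<close>, \<open>hardy_dimension_one\<close>).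
\<close>

section \<open>Powers, Jensen inequality and polar coordinates\<close>

lemma ennpowr_ennreal: "0 \<le> a \<Longrightarrow> ennpowr (ennreal a) r = ennreal (a powr r)"
  by (simp add: ennpowr_def)

lemma ennpowr_top [simp]: "ennpowr top r = top"
  by (simp add: ennpowr_def)

lemma ennpowr_0 [simp]: "ennpowr 0 r = 0"
  by (simp add: ennpowr_def)

lemma ennpowr_one_exp [simp]: "ennpowr a 1 = a"
  by (cases a) (auto simp: ennpowr_def)

lemma ennpowr_mono: "0 \<le> r \<Longrightarrow> a \<le> b \<Longrightarrow> ennpowr a r \<le> ennpowr b r"
  by (cases a; cases b) (auto simp: ennpowr_ennreal top_unique powr_mono2 intro!: ennreal_leI)

lemma ennpowr_mult: "0 < r \<Longrightarrow> ennpowr (a * b) r = ennpowr a r * ennpowr b r"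
proof (cases a; cases b)
  fix x y assume r: "0 < r" and "a = ennreal x" "b = ennreal y" "0 \<le> x" "0 \<le> y"
  then show ?thesis
    by (simp add: ennpowr_ennreal powr_mult flip: ennreal_mult)
next
  fix x assume r: "0 < r" and x: "a = ennreal x" "0 \<le> x" "b = top"
  show ?thesis using r x
    by (cases "x = 0") (auto simp: ennreal_mult_top ennpowr_ennreal ennpowr_def)
next
  fix x assume r: "0 < r" and x: "b = ennreal x" "0 \<le> x" "a = top"
  show ?thesis using r x
    by (cases "x = 0") (auto simp: ennreal_top_mult ennpowr_ennreal ennpowr_def)
qed (auto simp: ennpowr_def)

lemma ennpowr_ennpowr: "ennpowr (ennpowr a r) t = ennpowr a (r * t)"
  by (cases a) (auto simp: ennpowr_def powr_powr)

lemma ennpowr_inverse_le_iff: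
  assumes "0 < p" "0 \<le> B"
  shows "ennpowr a (1 / p) \<le> ennreal B \<longleftrightarrow> a \<le> ennreal (B powr p)"
proof
  assume "ennpowr a (1 / p) \<le> ennreal B"
  then have "ennpowr (ennpowr a (1 / p)) p \<le> ennpowr (ennreal B) p"
    using assms by (intro ennpowr_mono) auto
  then show "a \<le> ennreal (B powr p)"
    using assms by (simp add: ennpowr_ennpowr ennpowr_ennreal)
next
  assume "a \<le> ennreal (B powr p)"
  then have "ennpowr a (1 / p) \<le> ennpowr (ennreal (B powr p)) (1 / p)"
    using assms by (intro ennpowr_mono) auto
  then show "ennpowr a (1 / p) \<le> ennreal B"
    using assms by (simp add: ennpowr_ennreal powr_powr)
qed

lemma ennpowr_less_top_iff: "ennpowr a r < \<infinity> \<longleftrightarrow> a < \<infinity>"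
  by (cases a) (auto simp: ennpowr_def)

lemma measurable_ennpowr [measurable]:
  assumes [measurable]: "f \<in> borel_measurable M"
  shows "(\<lambda>x. ennpowr (f x) r) \<in> borel_measurable M"
  unfolding ennpowr_def by measurable

lemma powr_ge_tangent:
  fixes a m q :: real
  assumes "1 \<le> q" "0 \<le> a" "0 < m"
  shows "q * m powr (q - 1) * a \<le> a powr q + (q - 1) * m powr q"
proof (cases "a = 0 \<or> q = 1")
  case True
  then show ?thesis using assms by auto
next
  case False
  then have a: "a > 0" and q: "q > 1" using assms by auto
  have "a * m powr (q - 1) \<le> a powr q / q + (m powr (q - 1)) powr (q / (q - 1)) / (q / (q - 1))"
    using q a assms by (intro Youngs_inequality) (auto simp: field_simps)
  also have "(m powr (q - 1)) powr (q / (q - 1)) = m powr q"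
    using q by (simp add: powr_powr)
  finally show ?thesis
    using q by (simp add: field_simps)
qed

text \<open>
  The tangent of \<open>t powr q\<close> at \<open>m\<close> lies below the graph, so integrating it and choosing for \<open>m\<close> the
  integral of \<open>f\<close> gives the inequality.  With total mass at most \<open>1\<close> the constant term of the tangent,
  which is negative, only helps.
\<close>

lemma jensen_ennpowr:
  assumes [measurable]: "f \<in> borel_measurable M"
    and M: "emeasure M (space M) \<le> 1" and q: "1 \<le> q"
  shows "ennpowr (\<integral>\<^sup>+x. f x \<partial>M) q \<le> (\<integral>\<^sup>+x. ennpowr (f x) q \<partial>M)"
proof (cases "(\<integral>\<^sup>+x. ennpowr (f x) q \<partial>M) = \<infinity>")
  case False
  define I where "I = (\<integral>\<^sup>+x. f x \<partial>M)"
  define J where "J = (\<integral>\<^sup>+x. ennpowr (f x) q \<partial>M)"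
  have pw: "ennreal (q * m powr (q - 1)) * t \<le> ennpowr t q + ennreal ((q - 1) * m powr q)"
    if "0 < m" for m t
  proof (cases t)
    case (real a)
    then show ?thesis
      using powr_ge_tangent[OF q _ that, of a] q
      by (simp add: ennpowr_ennreal flip: ennreal_mult ennreal_plus)
  qed (auto simp: ennpowr_def)
  have key: "ennreal (q * m powr (q - 1)) * I \<le> J + ennreal ((q - 1) * m powr q)" if "0 < m" for m
  proof -
    have "ennreal (q * m powr (q - 1)) * I = (\<integral>\<^sup>+x. ennreal (q * m powr (q - 1)) * f x \<partial>M)"
      unfolding I_def by (subst nn_integral_cmult) auto
    also have "\<dots> \<le> (\<integral>\<^sup>+x. ennpowr (f x) q + ennreal ((q - 1) * m powr q) \<partial>M)"
      by (intro nn_integral_mono pw that)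
    also have "\<dots> = J + ennreal ((q - 1) * m powr q) * emeasure M (space M)"
      unfolding J_def by (subst nn_integral_add) auto
    also have "\<dots> \<le> J + ennreal ((q - 1) * m powr q) * 1"
      by (intro add_left_mono mult_left_mono M) auto
    finally show ?thesis by simp
  qed
  obtain j where j: "J = ennreal j" "0 \<le> j"
    using False unfolding J_def by (cases "\<integral>\<^sup>+x. ennpowr (f x) q \<partial>M") auto
  have "I \<noteq> top"
  proof
    assume "I = top"
    then show False using key[of 1] q j by (auto simp: ennreal_mult_top top_unique simp flip: ennreal_plus split: if_splits)
  qed
  then obtain m where m: "I = ennreal m" "0 \<le> m" by (cases I) auto
  have "m powr q \<le> j"
  proof (cases "m = 0")
    case False
    then have "m > 0" using m by auto
    have "q * m powr (q - 1) * m \<le> j + (q - 1) * m powr q"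
      using key[OF \<open>m > 0\<close>] m j q by (simp flip: ennreal_mult ennreal_plus)
    moreover have "q * m powr (q - 1) * m = q * m powr q"
      using \<open>m > 0\<close> by (simp add: powr_diff)
    ultimately show ?thesis by (simp add: left_diff_distrib)
  qed (use j in auto)
  then show ?thesis
    using m j unfolding I_def J_def by (simp add: ennpowr_ennreal)
qed auto

text \<open>
  Jensen's inequality for the density \<open>w\<close> of total mass at most \<open>K\<close>.  All later uses are of this
  form: with geometric weights on the naturals, the indicator of a set, or an energy density.
\<close>

lemma jensen_ennpowr_weighted:
  assumes [measurable]: "f \<in> borel_measurable M" "g \<in> borel_measurable M"
    and M: "(\<integral>\<^sup>+x. g x \<partial>M) \<le> ennreal K" and K: "0 < K" and q: "1 \<le> q"
  shows "ennpowr (\<integral>\<^sup>+x. g x * f x \<partial>M) q \<le> ennreal (K powr (q - 1)) * (\<integral>\<^sup>+x. g x * ennpowr (f x) q \<partial>M)"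
proof -
  define N where "N = density M (\<lambda>x. ennreal (1 / K) * g x)"
  have Kone: "ennreal K * ennreal (1 / K) = 1"
    using K by (simp flip: ennreal_mult)
  have N1: "emeasure N (space N) \<le> 1"
  proof -
    have "emeasure N (space N) = ennreal (1 / K) * (\<integral>\<^sup>+x. g x \<partial>M)"
      unfolding N_def by (simp add: emeasure_density nn_integral_cmult cong: nn_integral_cong)
    also have "\<dots> \<le> ennreal (1 / K) * ennreal K"
      by (intro mult_left_mono M) auto
    finally show ?thesis using Kone by (simp add: mult.commute)
  qed
  have int: "(\<integral>\<^sup>+x. h x \<partial>N) = ennreal (1 / K) * (\<integral>\<^sup>+x. g x * h x \<partial>M)"
    if [measurable]: "h \<in> borel_measurable M" for h
    unfolding N_def by (simp add: nn_integral_density nn_integral_cmult mult.assoc)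
  have "ennpowr (\<integral>\<^sup>+x. g x * f x \<partial>M) q = ennpowr (ennreal K * (\<integral>\<^sup>+x. f x \<partial>N)) q"
    by (simp add: int mult.assoc[symmetric] Kone)
  also have "\<dots> = ennreal (K powr q) * ennpowr (\<integral>\<^sup>+x. f x \<partial>N) q"
    using q K by (subst ennpowr_mult) (auto simp: ennpowr_ennreal)
  also have "\<dots> \<le> ennreal (K powr q) * (\<integral>\<^sup>+x. ennpowr (f x) q \<partial>N)"
    by (intro mult_left_mono jensen_ennpowr N1 q) (auto simp: N_def)
  also have "\<dots> = ennreal (K powr q) * ennreal (1 / K) * (\<integral>\<^sup>+x. g x * ennpowr (f x) q \<partial>M)"
    by (simp add: int mult.assoc)
  also have "ennreal (K powr q) * ennreal (1 / K) = ennreal (K powr (q - 1))"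
    using K by (simp add: powr_diff flip: ennreal_mult)
  finally show ?thesis .
qed

lemma powr_add_le:
  fixes a b p :: real
  assumes "0 \<le> a" "0 \<le> b" "0 \<le> p"
  shows "(a + b) powr p \<le> 2 powr p * (a powr p + b powr p)"
proof -
  have "(a + b) powr p \<le> (2 * max a b) powr p"
    using assms by (intro powr_mono2) auto
  also have "\<dots> = 2 powr p * max a b powr p"
    using assms by (subst powr_mult) auto
  also have "\<dots> \<le> 2 powr p * (a powr p + b powr p)"
    by (intro mult_left_mono) (auto simp: max_def)
  finally show ?thesis .
qed

lemma nn_integral_radial:
  fixes f :: "real \<Rightarrow> ennreal" and c :: "'a::euclidean_space"
  assumes [measurable]: "f \<in> borel_measurable borel"
  shows "(\<integral>\<^sup>+x. f (dist x c) \<partial>lborel) =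
    (\<integral>\<^sup>+r. f r * ennreal (DIM('a) * unit_ball_vol DIM('a) * r ^ (DIM('a) - 1)) * indicator {0..} r \<partial>lborel)"
proof -
  let ?d = "DIM('a)" and ?w = "unit_ball_vol (real DIM('a))"
  define g where "g r = ennreal (?d * ?w * r ^ (?d - 1)) * indicator {0..} r" for r :: real
  have [measurable]: "g \<in> borel_measurable borel" unfolding g_def by measurable
  have meas: "emeasure (density lborel g) {..x} = emeasure (distr lborel borel (\<lambda>x. dist x c)) {..x}"
     for x
  proof (cases "x < 0")
    case True
    have "g r * indicator {..x} r = 0" for r
      using True by (auto simp: g_def indicator_def)
    then have "set_nn_integral lborel {..x} g = 0"
      by (simp only: nn_integral_const mult_zero_left)
    moreover have "(\<lambda>y::'a. dist y c) -` {..x} = {}"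
      using True zero_le_dist by (auto simp: set_eq_iff) (meson dual_order.trans leD order_less_le_trans zero_le_dist)
    ultimately show ?thesis
      by (simp add: emeasure_density emeasure_distr)
  next
    case False
    then have x: "0 \<le> x" by simp
    have "emeasure (density lborel g) {..x} = (\<integral>\<^sup>+r. ennreal (?d * ?w * r ^ (?d - 1)) * indicator {0..x} r \<partial>lborel)"
      by (subst emeasure_density) (auto simp: g_def indicator_def intro!: nn_integral_cong)
    also have "\<dots> = ennreal (?w * x ^ ?d - ?w * 0 ^ ?d)"
    proof (rule nn_integral_FTC_Icc)
      show "DERIV (\<lambda>r. ?w * r ^ ?d) r :> ?d * ?w * r ^ (?d - 1)" for r
        by (auto intro!: derivative_eq_intros)
      show "0 \<le> ?d * ?w * r ^ (?d - 1)" if "r \<in> {0..x}" for r using that by auto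
    qed (use False in auto)
    also have "\<dots> = emeasure lborel (cball c x)"
      using False by (simp add: emeasure_cball)
    also have "cball c x = (\<lambda>y. dist y c) -` {..x}"
      by (auto simp: dist_commute)
    finally show ?thesis by (simp add: emeasure_distr)
  qed
  have eq: "density lborel g = distr lborel borel (\<lambda>x. dist x c)"
  proof (rule measure_eqI_generator_eq[where E="range (\<lambda>a::real. {..a})" and \<Omega>=UNIV and A="\<lambda>n::nat. {..real n}"])
    show "Int_stable (range (\<lambda>a::real. {..a}))"
      by (auto simp: Int_stable_def)
    show "range (\<lambda>a::real. {..a}) \<subseteq> Pow UNIV" by auto
    show "emeasure (density lborel g) X = emeasure (distr lborel borel (\<lambda>x. dist x c)) X"
      if "X \<in> range (\<lambda>a::real. {..a})" for X using that meas by auto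
    show "sets (density lborel g) = sigma_sets UNIV (range (\<lambda>a::real. {..a}))"
      "sets (distr lborel borel (\<lambda>x. dist x c)) = sigma_sets UNIV (range (\<lambda>a::real. {..a}))"
      by (simp_all add: borel_eq_atMost)
    show "range (\<lambda>n::nat. {..real n}) \<subseteq> range (\<lambda>a::real. {..a})" by auto
    show "(\<Union>i::nat. {..real i}) = UNIV" using real_arch_simple by auto
    show "emeasure (density lborel g) {..real i} \<noteq> \<infinity>" for i :: nat
    proof -
      have "emeasure (density lborel g) {..real i} = emeasure lborel (cball c (real i))"
        unfolding meas by (subst emeasure_distr) (auto intro!: arg_cong[where f="emeasure lborel"] simp: dist_commute)
      then show ?thesis by (simp add: emeasure_cball)
    qed
  qed
  have "(\<integral>\<^sup>+x. f (dist x c) \<partial>lborel) = (\<integral>\<^sup>+r. f r \<partial>distr lborel borel (\<lambda>x. dist x c))"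
    by (subst nn_integral_distr) auto
  also have "\<dots> = (\<integral>\<^sup>+r. g r * f r \<partial>lborel)"
    by (subst eq[symmetric], subst nn_integral_density) auto
  finally show ?thesis by (simp add: g_def ac_simps)
qed

section \<open>Inversion and the integral of the kernel over a ball\<close>

text \<open>
  The inversion \<open>w \<mapsto> x + w / norm w ^ 2\<close> pulls a ball not containing \<open>x\<close> back to a ball; squaring both
  conditions reduces them to the same quadratic inequality in \<open>w\<close>.
\<close>

lemma mem_inverted_ball_iff:
  fixes x a w :: "'a::euclidean_space"
  assumes "0 < r" "r < dist x a"
  shows "w \<in> ball ((1 / (dist x a ^ 2 - r ^ 2)) *\<^sub>R (a - x)) (r / (dist x a ^ 2 - r ^ 2)) \<longleftrightarrow>
    w \<noteq> 0 \<and> x + (1 / norm w ^ 2) *\<^sub>R w \<in> ball a r"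
proof -
  define D where "D = dist x a ^ 2 - r ^ 2"
  define b where "b = a - x"
  have nb: "b \<bullet> b = D + r ^ 2"
    by (simp add: D_def b_def dist_norm norm_minus_commute power2_norm_eq_inner)
  have "D > 0"
    using assms by (simp add: D_def power_strict_mono)
  have cm: "w \<in> ball y s \<longleftrightarrow> (w - y) \<bullet> (w - y) < s ^ 2" if "0 < s" for w y :: 'a and s
    using that by (simp add: dist_norm norm_minus_commute norm_lt_square power2_eq_square dot_square_norm
        flip: power2_norm_eq_inner)
  have 1: "w \<in> ball ((1 / D) *\<^sub>R b) (r / D) \<longleftrightarrow> D * (w \<bullet> w) - 2 * (w \<bullet> b) + 1 < 0"
  proof -
    have "(w - (1 / D) *\<^sub>R b) \<bullet> (w - (1 / D) *\<^sub>R b) = w \<bullet> w - 2 * (w \<bullet> b) / D + (D + r ^ 2) / D ^ 2"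
      by (simp add: inner_diff_left inner_diff_right inner_commute nb power2_eq_square)
    also have "\<dots> = (D * (w \<bullet> w) - 2 * (w \<bullet> b) + 1) / D + (r / D) ^ 2"
      using \<open>D > 0\<close> by (simp add: field_simps power2_eq_square)
    finally show ?thesis
      using \<open>D > 0\<close> assms by (subst cm) (auto simp: divide_less_0_iff)
  qed
  have 2: "x + (1 / norm w ^ 2) *\<^sub>R w \<in> ball a r \<longleftrightarrow> D * (w \<bullet> w) - 2 * (w \<bullet> b) + 1 < 0" if "w \<noteq> 0"
  proof -
    define n where "n = w \<bullet> w"
    have n: "n > 0" using that by (simp add: n_def)
    have "x + (1 / norm w ^ 2) *\<^sub>R w - a = (1 / n) *\<^sub>R w - b"
      by (simp add: n_def b_def power2_norm_eq_inner)
    then have "x + (1 / norm w ^ 2) *\<^sub>R w \<in> ball a r \<longleftrightarrow> ((1 / n) *\<^sub>R w - b) \<bullet> ((1 / n) *\<^sub>R w - b) < r ^ 2"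
      using assms by (subst cm) auto
    also have "((1 / n) *\<^sub>R w - b) \<bullet> ((1 / n) *\<^sub>R w - b) = 1 / n - 2 * (w \<bullet> b) / n + (D + r ^ 2)"
      using n by (simp add: inner_diff_left inner_diff_right inner_commute nb power2_eq_square flip: n_def)
    also have "\<dots> < r ^ 2 \<longleftrightarrow> (D * n - 2 * (w \<bullet> b) + 1) / n < 0"
      using n by (simp add: field_simps)
    also have "\<dots> \<longleftrightarrow> D * n - 2 * (w \<bullet> b) + 1 < 0"
      using n by (simp add: divide_less_0_iff)
    finally show ?thesis by (simp add: n_def)
  qed
  show ?thesis
    using 1 2 unfolding D_def[symmetric] b_def[symmetric] by (cases "w = 0") auto
qed

text \<open>
  The kernel is the Jacobian of the inversion about \<open>x\<close>, so the integral is the volume of the inverted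
  ball.  Instead of differentiating the inversion, the proof covers the ball, up to a null set, by disjoint
  tiny balls: on each of them the kernel is almost constant, and the integral is almost the volume of
  the inverted tiny ball.  The inverted tiny balls are disjoint and fill the inverted ball at most once.
\<close>

lemma nn_integral_inverse_power_ball_le:
  fixes x c :: "'a::euclidean_space"
  assumes t: "0 < t" "t < dist x c"
  shows "(\<integral>\<^sup>+y. ennreal (1 / dist x y ^ (2 * DIM('a))) * indicator (ball c t) y \<partial>lborel)
    \<le> ennreal (unit_ball_vol DIM('a) * (t / (dist x c ^ 2 - t ^ 2)) ^ DIM('a))"
    (is "?I \<le> ennreal ?B")
proof -
  let ?d = "DIM('a)" and ?w = "unit_ball_vol (real DIM('a))" and ?D = "dist x c"
  define img where "img = (\<lambda>(a, r). ball ((1 / (dist x a ^ 2 - r ^ 2)) *\<^sub>R (a - x)) (r / (dist x a ^ 2 - r ^ 2)))"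
  define h where "h y = ennreal (1 / dist x y ^ (2 * ?d))" for y
  have [measurable]: "h \<in> borel_measurable borel" unfolding h_def by measurable
  have [measurable]: "ball a r \<in> sets borel" for a :: 'a and r by simp
  \<comment> \<open>the factor bounds \<open>(A + r) / (A - r)\<close> for the tiny balls of radius \<open>r < \<rho>\<close>; it tends to \<open>1\<close> as \<open>\<rho>\<close> tends to \<open>0\<close>\<close>
  have main: "?I \<le> ennreal ((1 + 2 * \<rho> / (?D - t)) ^ ?d * ?B)" if \<rho>: "0 < \<rho>" for \<rho>
  proof -
    define K where "K = {(a, r). 0 < r \<and> r < \<rho> \<and> ball a r \<subseteq> ball c t}"
    have "\<exists>i. i \<in> K \<and> y \<in> ball (fst i) (snd i) \<and> snd i < e" if y: "y \<in> ball c t" and "0 < e" for y e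
    proof -
      obtain s where s: "s > 0" "ball y s \<subseteq> ball c t"
        using y open_ball openE by meson
      define m where "m = min s (min \<rho> e) / 2"
      have "m > 0" "m < s" "m < \<rho>" "m < e"
        using s \<rho> \<open>0 < e\<close> by (auto simp: m_def min_def)
      moreover have "ball y m \<subseteq> ball c t"
        using s \<open>m < s\<close> by (meson less_imp_le order_trans subset_ball)
      ultimately show ?thesis by (intro exI[of _ "(y, m)"]) (auto simp: K_def)
    qed
    then obtain C where C: "countable C" "C \<subseteq> K"
      and disj: "pairwise (\<lambda>i j. disjnt (ball (fst i) (snd i)) (ball (fst j) (snd j))) C"
      and neg: "negligible (ball c t - (\<Union>i\<in>C. ball (fst i) (snd i)))"
      by (rule Vitali_covering_theorem_balls[of "ball c t" K fst snd]) blast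
    let ?U = "\<Union>i\<in>C. ball (fst i) (snd i)"
    have CK: "0 < snd i" "snd i < \<rho>" "dist (fst i) c + snd i \<le> t" if "i \<in> C" for i
      using that C(2) by (cases i; force simp: K_def ball_subset_ball_iff)+
    have far: "snd i < dist x (fst i)" "?D - t \<le> dist x (fst i) - snd i" if "i \<in> C" for i
      using CK[OF that] t dist_triangle[of x c "fst i"] by linarith+
    have imgi: "w \<in> img i \<longleftrightarrow> w \<noteq> 0 \<and> x + (1 / norm w ^ 2) *\<^sub>R w \<in> ball (fst i) (snd i)" if "i \<in> C" for i w
      using mem_inverted_ball_iff[of "snd i" x "fst i" w] CK[OF that] far[OF that]
      by (simp add: img_def case_prod_beta)
    have imgc: "w \<in> img (c, t) \<longleftrightarrow> w \<noteq> 0 \<and> x + (1 / norm w ^ 2) *\<^sub>R w \<in> ball c t" for w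
      using mem_inverted_ball_iff[of t x c w] t by (simp add: img_def)
    have "?I = (\<integral>\<^sup>+y. h y * indicator ?U y \<partial>lborel)"
    proof -
      have ae: "AE y in lborel. y \<notin> ball c t - ?U"
      proof (rule AE_not_in)
        show "ball c t - ?U \<in> null_sets lborel"
          using neg by (simp add: negligible_iff_null_sets null_sets_completion_iff borel_open open_UN)
      qed
      have sub: "?U \<subseteq> ball c t"
      proof (rule UN_least)
        show "ball (fst i) (snd i) \<subseteq> ball c t" if "i \<in> C" for i
          using that C(2) by (cases i) (force simp: K_def)
      qed
      have "indicator (ball c t) y = (indicator ?U y :: ennreal)" if "y \<notin> ball c t - ?U" for y
      proof -
        have "y \<in> ball c t \<longleftrightarrow> y \<in> ?U" using sub that by blast
        then show "indicator (ball c t) y = (indicator ?U y :: ennreal)" by (simp only: indicator_def)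
      qed
      then have "AE y in lborel. indicator (ball c t) y = (indicator ?U y :: ennreal)"
        using ae by (auto elim!: eventually_mono)
      then show ?thesis
        unfolding h_def by (intro nn_integral_cong_AE) (auto elim!: eventually_mono)
    qed
    also have "\<dots> = (\<integral>\<^sup>+y. (\<integral>\<^sup>+i. h y * indicator (ball (fst i) (snd i)) y \<partial>count_space C) \<partial>lborel)"
    proof (rule nn_integral_cong)
      fix y
      show "h y * indicator ?U y = (\<integral>\<^sup>+i. h y * indicator (ball (fst i) (snd i)) y \<partial>count_space C)"
      proof (cases "y \<in> ?U")
        case True
        then obtain j where j: "j \<in> C" "y \<in> ball (fst j) (snd j)" by blast
        have *: "indicator (ball (fst i) (snd i)) y = (indicator {j} i :: ennreal)" if "i \<in> C" for i
        proof (cases "i = j")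
          case False
          then have "disjnt (ball (fst i) (snd i)) (ball (fst j) (snd j))"
            using pairwiseD[OF disj] that j by blast
          then have "y \<notin> ball (fst i) (snd i)" using j(2) by (auto simp: disjnt_iff simp del: mem_ball)
          then show ?thesis using False by simp
        qed (use j in auto)
        have "(\<integral>\<^sup>+i. h y * indicator (ball (fst i) (snd i)) y \<partial>count_space C) =
          (\<integral>\<^sup>+i. h y * indicator {j} i \<partial>count_space C)"
          by (intro nn_integral_cong) (use * in auto)
        also have "\<dots> = h y"
          using j by (subst nn_integral_cmult_indicator) auto
        finally show ?thesis using True by simp
      next
        case False
        then have "(\<integral>\<^sup>+i. h y * indicator (ball (fst i) (snd i)) y \<partial>count_space C) = (\<integral>\<^sup>+i. 0 \<partial>count_space C)"
          by (intro nn_integral_cong) (auto simp: indicator_def)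
        then show ?thesis using False by simp
      qed
    qed
    also have "\<dots> = (\<integral>\<^sup>+i. (\<integral>\<^sup>+y. h y * indicator (ball (fst i) (snd i)) y \<partial>lborel) \<partial>count_space C)"
      by (rule nn_integral_count_space_nn_integral) (use C in auto)
    also have "\<dots> \<le> (\<integral>\<^sup>+i. ennreal ((1 + 2 * \<rho> / (?D - t)) ^ ?d) * emeasure lborel (img i) \<partial>count_space C)"
    proof (rule nn_integral_mono)
      fix i assume "i \<in> space (count_space C)"
      then have i: "i \<in> C" by simp
      define a where "a = fst i"
      define r where "r = snd i"
      define A where "A = dist x a"
      have r: "0 < r" "r < \<rho>" "r < A" "?D - t \<le> A - r"
        using CK[OF i] far[OF i] by (auto simp: a_def r_def A_def)
      have bnd: "h y \<le> ennreal (1 / (A - r) ^ (2 * ?d))" if "y \<in> ball a r" for y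
      proof -
        have "A - r \<le> dist x y"
          using that dist_triangle[of x a y] by (simp add: A_def dist_commute)
        then have "(A - r) ^ (2 * ?d) \<le> dist x y ^ (2 * ?d)"
          using r by (intro power_mono) auto
        then show ?thesis
          unfolding h_def using r \<open>A - r \<le> dist x y\<close>
          by (intro ennreal_leI divide_left_mono mult_pos_pos zero_less_power) auto
      qed
      have "(\<integral>\<^sup>+y. h y * indicator (ball a r) y \<partial>lborel) \<le>
          (\<integral>\<^sup>+y. ennreal (1 / (A - r) ^ (2 * ?d)) * indicator (ball a r) y \<partial>lborel)"
        by (intro nn_integral_mono) (auto split: split_indicator intro: bnd)
      also have "\<dots> = ennreal (?w * (r / (A - r) ^ 2) ^ ?d)"
        using r by (subst nn_integral_cmult_indicator)
          (auto simp: emeasure_ball power_divide power_mult simp flip: ennreal_mult)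
      also have "\<dots> \<le> ennreal (?w * ((1 + 2 * \<rho> / (?D - t)) * (r / (A ^ 2 - r ^ 2))) ^ ?d)"
      proof (intro ennreal_leI mult_left_mono power_mono)
        have "A\<^sup>2 - r\<^sup>2 = (A + r) * (A - r)" by (simp add: power2_eq_square algebra_simps)
        then have e1: "r / (A - r) ^ 2 = (A + r) / (A - r) * (r / (A ^ 2 - r ^ 2))"
          using r by (simp add: power2_eq_square)
        have "(A + r) / (A - r) = 1 + 2 * r / (A - r)"
          using r by (simp add: field_simps)
        also have "\<dots> \<le> 1 + 2 * \<rho> / (?D - t)"
          using r t by (intro add_left_mono frac_le) auto
        finally have e2: "(A + r) / (A - r) \<le> 1 + 2 * \<rho> / (?D - t)" .
        have "0 \<le> r / (A ^ 2 - r ^ 2)"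
          using r by (simp add: power_mono)
        then show "r / (A - r) ^ 2 \<le> (1 + 2 * \<rho> / (?D - t)) * (r / (A ^ 2 - r ^ 2))"
          unfolding e1 by (intro mult_right_mono e2)
      qed (use r in auto)
      also have "\<dots> = ennreal ((1 + 2 * \<rho> / (?D - t)) ^ ?d) * emeasure lborel (img i)"
      proof -
        have "0 \<le> r / (A ^ 2 - r ^ 2)"
          using r by (simp add: power_mono)
        moreover have "img i = ball ((1 / (A ^ 2 - r ^ 2)) *\<^sub>R (a - x)) (r / (A ^ 2 - r ^ 2))"
          by (simp add: img_def a_def r_def A_def case_prod_beta)
        ultimately show ?thesis
          using \<rho> t unfolding power_mult_distrib
          by (simp add: emeasure_ball mult.left_commute flip: ennreal_mult)
      qed
      finally show "(\<integral>\<^sup>+y. h y * indicator (ball (fst i) (snd i)) y \<partial>lborel) \<le>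
        ennreal ((1 + 2 * \<rho> / (?D - t)) ^ ?d) * emeasure lborel (img i)"
        by (simp add: a_def r_def)
    qed
    also have "\<dots> = ennreal ((1 + 2 * \<rho> / (?D - t)) ^ ?d) * (\<integral>\<^sup>+i. emeasure lborel (img i) \<partial>count_space C)"
      by (subst nn_integral_cmult) auto
    also have "(\<integral>\<^sup>+i. emeasure lborel (img i) \<partial>count_space C) = emeasure lborel (\<Union>i\<in>C. img i)"
    proof (rule emeasure_UN_countable[symmetric])
      show "disjoint_family_on img C"
        using disj imgi by (fastforce simp: disjoint_family_on_def pairwise_def disjnt_def)
      show "\<And>i. i \<in> C \<Longrightarrow> img i \<in> sets lborel" by (auto simp: img_def)
    qed (use C in auto)
    also have "\<dots> \<le> emeasure lborel (img (c, t))"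
    proof (rule emeasure_mono)
      show "(\<Union>i\<in>C. img i) \<subseteq> img (c, t)"
        using imgi imgc C(2) by (fastforce simp: K_def)
    qed (auto simp: img_def)
    also have "emeasure lborel (img (c, t)) = ennreal ?B"
    proof -
      have "0 \<le> t / (?D ^ 2 - t ^ 2)" using t by (simp add: power_mono)
      then show ?thesis by (simp add: img_def emeasure_ball)
    qed
    finally have "?I \<le> ennreal ((1 + 2 * \<rho> / (?D - t)) ^ ?d) * ennreal ?B"
      by (simp add: mult_left_mono)
    also have "\<dots> = ennreal ((1 + 2 * \<rho> / (?D - t)) ^ ?d * ?B)"
      using \<rho> t by (intro ennreal_mult[symmetric]) (auto simp: power_mono)
    finally show ?thesis .
  qed
  have "((\<lambda>\<rho>. ennreal ((1 + 2 * \<rho> / (?D - t)) ^ ?d * ?B)) \<longlongrightarrow> ennreal ((1 + 2 * 0 / (?D - t)) ^ ?d * ?B)) (at_right 0)"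
    using t by (intro tendsto_ennrealI tendsto_intros) auto
  then have "((\<lambda>\<rho>. ennreal ((1 + 2 * \<rho> / (?D - t)) ^ ?d * ?B)) \<longlongrightarrow> ennreal ?B) (at_right 0)"
    by simp
  moreover have "eventually (\<lambda>\<rho>. ?I \<le> ennreal ((1 + 2 * \<rho> / (?D - t)) ^ ?d * ?B)) (at_right 0)"
    using main by (intro eventually_at_rightI[of 0 1]) auto
  ultimately show ?thesis
    by (rule tendsto_lowerbound) simp
qed

section \<open>The logarithm against the kernel\<close>

text \<open>
  The negative binomial series; its coefficients are those in the series for the critical exponent.
\<close>

lemma one_minus_power_minus_sums:
  fixes z :: real
  assumes "0 < d" "0 \<le> z" "z < 1"
  shows "(\<lambda>n. real ((d + n - 1) choose n) * z ^ n) sums (1 / (1 - z) ^ d)"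
proof -
  have "(\<lambda>n. (- real d gchoose n) * (- z) ^ n) sums (1 + (- z)) powr (- real d)"
    using assms by (intro gen_binomial_real) auto
  moreover have "(- real d gchoose n) * (- z) ^ n = real ((d + n - 1) choose n) * z ^ n" for n
  proof -
    have "real d + real n - 1 = real (d + n - 1)" using assms(1) by simp
    then have "(- real d gchoose n) = (- 1) ^ n * real ((d + n - 1) choose n)"
      by (subst gbinomial_minus) (simp only: binomial_gbinomial)
    moreover have "(- 1) ^ n * (- z) ^ n = z ^ n"
      by (simp only: power_mult_distrib[symmetric]) simp
    ultimately show ?thesis
      by (simp only: mult.assoc mult.left_commute[of _ "real ((d + n - 1) choose n)"])
  qed
  moreover have "(1 + (- z)) powr (- real d) = 1 / (1 - z) ^ d"
    using assms by (simp add: powr_minus powr_realpow inverse_eq_divide)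
  ultimately show ?thesis by simp
qed

lemma nn_integral_powr_exp:
  fixes a p :: real
  assumes "0 < a" "0 < p"
  shows "(\<integral>\<^sup>+\<tau>. ennreal (p * \<tau> powr (p - 1) * exp (- a * \<tau>)) * indicator {0..} \<tau> \<partial>lborel)
    = ennreal (Gamma (p + 1) / a powr p)"
proof -
  have G: "Gamma (p + 1) = p * Gamma p"
    using assms by (intro Gamma_plus1) (auto elim!: nonpos_Ints_cases)
  have "(\<integral>\<^sup>+\<tau>. ennreal (\<tau> powr (p - 1) / exp \<tau>) * indicator {0..} \<tau> \<partial>lborel) = ennreal (Gamma p)"
    unfolding Gamma_conv_nn_integral_real[OF assms(2)]
    by (intro nn_integral_cong) (auto split: split_indicator)
  moreover have "(\<integral>\<^sup>+\<tau>. ennreal (\<tau> powr (p - 1) / exp \<tau>) * indicator {0..} \<tau> \<partial>lborel) =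
     ennreal a * (\<integral>\<^sup>+\<tau>. ennreal ((a * \<tau>) powr (p - 1) / exp (a * \<tau>)) * indicator {0..} (a * \<tau>) \<partial>lborel)"
    using assms by (subst nn_integral_real_affine[where c=a and t=0]) auto
  also have "(\<integral>\<^sup>+\<tau>. ennreal ((a * \<tau>) powr (p - 1) / exp (a * \<tau>)) * indicator {0..} (a * \<tau>) \<partial>lborel) =
     (\<integral>\<^sup>+\<tau>. ennreal (a powr (p - 1) / p) * (ennreal (p * \<tau> powr (p - 1) * exp (- a * \<tau>)) * indicator {0..} \<tau>) \<partial>lborel)"
    using assms by (intro nn_integral_cong)
      (auto simp: indicator_def zero_le_mult_iff powr_mult exp_minus divide_inverse mult_ac simp flip: ennreal_mult)
  also have "\<dots> = ennreal (a powr (p - 1) / p) * (\<integral>\<^sup>+\<tau>. (ennreal (p * \<tau> powr (p - 1) * exp (- a * \<tau>)) * indicator {0..} \<tau>) \<partial>lborel)"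
    by (subst nn_integral_cmult) auto
  also have "ennreal a * (ennreal (a powr (p - 1) / p) * X) = ennreal (a powr p / p) * X" for X
    using assms by (simp add: mult.assoc[symmetric] powr_diff flip: ennreal_mult)
  finally have *: "ennreal (a powr p / p) * (\<integral>\<^sup>+\<tau>. (ennreal (p * \<tau> powr (p - 1) * exp (- a * \<tau>)) * indicator {0..} \<tau>) \<partial>lborel)
     = ennreal (Gamma p)" by simp
  have "ennreal (p / a powr p) * ennreal (a powr p / p) = 1"
    using assms by (simp flip: ennreal_mult)
  then have "(\<integral>\<^sup>+\<tau>. (ennreal (p * \<tau> powr (p - 1) * exp (- a * \<tau>)) * indicator {0..} \<tau>) \<partial>lborel)
    = ennreal (p / a powr p) * ennreal (Gamma p)"
    unfolding *[symmetric] by (simp add: mult.assoc[symmetric])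
  also have "\<dots> = ennreal (Gamma (p + 1) / a powr p)"
    using assms by (simp add: G Gamma_real_nonneg flip: ennreal_mult)
  finally show ?thesis .
qed

text \<open>
  The integral of \<open>ln (1 / norm y) powr p / dist x y ^ (2 * d)\<close> over the unit ball, for \<open>norm x = 1\<close>.
\<close>

definition log_kernel_const :: "nat \<Rightarrow> real \<Rightarrow> real" where
  "log_kernel_const d p = unit_ball_vol d * (\<Sum>n. real ((d + n - 1) choose n) * (Gamma (p + 1) / real (d + 2 * n) powr p))"

text \<open>
  The terms behave like \<open>n powr (d - 1 - p)\<close>; this is where \<open>p > d\<close>, that is \<open>s < 1\<close>, enters.
\<close>

lemma summable_log_kernel:
  assumes "0 < d" "real d < p"
  shows "summable (\<lambda>n. real ((d + n - 1) choose n) / real (d + 2 * n) powr p)"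
proof (rule summable_comparison_test')
  show "summable (\<lambda>n. real n powr (real d - 1 - p))"
    using assms by (simp add: summable_real_powr_iff)
  show "norm (real ((d + n - 1) choose n) / real (d + 2 * n) powr p) \<le> real n powr (real d - 1 - p)" if "1 \<le> n" for n
  proof -
    have "(d + n - 1) choose n = (d + n - 1) choose (d - 1)"
      using assms by (subst binomial_symmetric) auto
    also have "\<dots> \<le> (d + n - 1) ^ (d - 1)"
      using assms by (intro binomial_le_pow) auto
    finally have "real ((d + n - 1) choose n) \<le> real (d + n - 1) ^ (d - 1)"
      by (metis of_nat_le_iff of_nat_power)
    also have "\<dots> \<le> real (d + 2 * n) ^ (d - 1)"
      by (intro power_mono) auto
    also have "\<dots> = real (d + 2 * n) powr (real d - 1)"
      using assms by (subst powr_realpow[symmetric]) (auto simp: of_nat_diff)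
    finally have "real ((d + n - 1) choose n) / real (d + 2 * n) powr p \<le>
        real (d + 2 * n) powr (real d - 1) / real (d + 2 * n) powr p"
      by (rule divide_right_mono) simp
    also have "\<dots> = real (d + 2 * n) powr (real d - 1 - p)"
      by (rule powr_diff[symmetric])
    finally have "real ((d + n - 1) choose n) / real (d + 2 * n) powr p \<le> real (d + 2 * n) powr (real d - 1 - p)" .
    also have "\<dots> \<le> real n powr (real d - 1 - p)"
      using assms that by (intro powr_mono2') auto
    finally show ?thesis by simp
  qed
qed

lemma log_kernel_const_pos:
  assumes "0 < d" "real d < p"
  shows "0 < log_kernel_const d p"
proof -
  have p: "0 < p" using assms by (meson of_nat_0_less_iff less_trans)
  have "summable (\<lambda>n. real ((d + n - 1) choose n) * (Gamma (p + 1) / real (d + 2 * n) powr p))"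
    using summable_mult[OF summable_log_kernel[OF assms], of "Gamma (p + 1)"] by (simp add: mult_ac)
  moreover have "0 < real ((d + n - 1) choose n) * (Gamma (p + 1) / real (d + 2 * n) powr p)" for n
  proof -
    have "0 < (d + n - 1) choose n" using assms by (intro zero_less_binomial) simp
    moreover have "0 < Gamma (p + 1)" using p by (intro Gamma_real_pos) simp
    moreover have "0 < real (d + 2 * n)" using assms by (simp only: of_nat_0_less_iff)
    ultimately show ?thesis by (simp del: of_nat_add of_nat_mult)
  qed
  ultimately have "0 < (\<Sum>n. real ((d + n - 1) choose n) * (Gamma (p + 1) / real (d + 2 * n) powr p))"
    by (rule suminf_pos)
  then show ?thesis by (simp add: log_kernel_const_def)
qed

text \<open>
  Layer cake: \<open>l powr p\<close> is the integral of \<open>p * \<tau> powr (p - 1)\<close> over \<open>0 < \<tau> < l\<close>, and the logarithm exceeds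
  \<open>\<tau>\<close> exactly on the ball of radius \<open>r0 * exp (- \<tau>)\<close>, where the kernel has been integrated by
  inversion.  With \<open>z = exp (- 2 * \<tau>)\<close>, the volume is a power of \<open>1 / (1 - z)\<close>; its binomial
  series leaves Gamma integrals in \<open>\<tau>\<close>.
\<close>

lemma nn_integral_log_inverse_power_le:
  fixes x c :: "'a::euclidean_space"
  assumes p: "real DIM('a) < p" and r0: "0 < r0" "r0 \<le> dist x c"
  shows "(\<integral>\<^sup>+y. ennreal (ln (r0 / dist y c) powr p / dist x y ^ (2 * DIM('a))) * indicator (ball c r0) y \<partial>lborel)
    \<le> ennreal ((r0 / dist x c ^ 2) ^ DIM('a) * log_kernel_const DIM('a) p)"
proof -
  let ?d = "DIM('a)" and ?w = "unit_ball_vol (real DIM('a))" and ?D = "dist x c"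
  have d: "0 < ?d" by simp
  have p0: "0 < p" using p by (meson d of_nat_0_less_iff less_trans)
  define h where "h y = ennreal (1 / dist x y ^ (2 * ?d))" for y
  define f where "f \<tau> = ennreal (p * \<tau> powr (p - 1))" for \<tau>
  \<comment> \<open>\<open>S \<tau> y\<close> marks the points where the logarithm exceeds the level \<open>\<tau>\<close>\<close>
  define S where "S \<tau> y = (if 0 < \<tau> \<and> \<tau> < ln (r0 / dist y c) \<and> y \<in> ball c r0 then 1 else 0 :: ennreal)" for \<tau> y
  have [measurable]: "h \<in> borel_measurable borel" "f \<in> borel_measurable borel"
    unfolding h_def f_def by measurable
  have [measurable]: "ball a r \<in> sets borel" for a :: 'a and r by simp
  have [measurable]: "(\<lambda>z. S (fst z) (snd z)) \<in> borel_measurable (borel \<Otimes>\<^sub>M borel)"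
    unfolding S_def mem_ball by measurable
  have layer: "ennreal (l powr p) = (\<integral>\<^sup>+\<tau>. f \<tau> * indicator {0<..<l} \<tau> \<partial>lborel)" if "0 \<le> l" for l
  proof -
    have "((\<lambda>\<tau>. p * \<tau> powr (p - 1)) has_integral p * (l powr (p - 1 + 1) / (p - 1 + 1))) {0..l}"
      using p0 that by (intro has_integral_mult_right has_integral_powr_from_0) auto
    then have "(\<integral>\<^sup>+\<tau>. ennreal (indicator {0..l} \<tau> * (p * \<tau> powr (p - 1))) \<partial>lborel) = ennreal (l powr p)"
      using p0 by (subst nn_integral_has_integral_lebesgue) auto
    moreover have "(\<integral>\<^sup>+\<tau>. f \<tau> * indicator {0<..<l} \<tau> \<partial>lborel) = (\<integral>\<^sup>+\<tau>. ennreal (indicator {0..l} \<tau> * (p * \<tau> powr (p - 1))) \<partial>lborel)"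
      using AE_lborel_singleton[of 0] AE_lborel_singleton[of l]
      by (intro nn_integral_cong_AE, eventually_elim) (auto simp: f_def split: split_indicator)
    ultimately show ?thesis by simp
  qed
  have "(\<integral>\<^sup>+y. ennreal (ln (r0 / dist y c) powr p / dist x y ^ (2 * ?d)) * indicator (ball c r0) y \<partial>lborel)
    = (\<integral>\<^sup>+y. (\<integral>\<^sup>+\<tau>. h y * (f \<tau> * S \<tau> y) \<partial>lborel) \<partial>lborel)"
  proof (rule nn_integral_cong)
    fix y
    show "ennreal (ln (r0 / dist y c) powr p / dist x y ^ (2 * ?d)) * indicator (ball c r0) y
      = (\<integral>\<^sup>+\<tau>. h y * (f \<tau> * S \<tau> y) \<partial>lborel)"
    proof (cases "y \<in> ball c r0")
      case True
      have "0 \<le> ln (r0 / dist y c)"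
        using True r0 by (cases "y = c") (auto simp: dist_commute)
      then have "ennreal (ln (r0 / dist y c) powr p) * h y =
         h y * (\<integral>\<^sup>+\<tau>. f \<tau> * indicator {0<..<ln (r0 / dist y c)} \<tau> \<partial>lborel)"
        by (simp add: layer mult.commute)
      also have "\<dots> = (\<integral>\<^sup>+\<tau>. h y * (f \<tau> * indicator {0<..<ln (r0 / dist y c)} \<tau>) \<partial>lborel)"
        by (subst nn_integral_cmult) auto
      also have "\<dots> = (\<integral>\<^sup>+\<tau>. h y * (f \<tau> * S \<tau> y) \<partial>lborel)"
        using True by (intro nn_integral_cong) (auto simp: S_def split: split_indicator)
      finally show ?thesis
        using True by (simp add: h_def flip: ennreal_mult)
    qed (auto simp: S_def)
  qed
  also have "\<dots> = (\<integral>\<^sup>+\<tau>. (\<integral>\<^sup>+y. h y * (f \<tau> * S \<tau> y) \<partial>lborel) \<partial>lborel)"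
  proof (rule lborel_pair.Fubini')
    show "(\<lambda>(\<tau>, y). h y * (f \<tau> * S \<tau> y)) \<in> borel_measurable (lborel \<Otimes>\<^sub>M lborel)"
      by (simp add: case_prod_beta cong: measurable_cong_sets)
  qed
  also have "\<dots> \<le> (\<integral>\<^sup>+\<tau>. (\<Sum>n. ennreal ((r0 / ?D ^ 2) ^ ?d * ?w * real ((?d + n - 1) choose n)) *
      (ennreal (p * \<tau> powr (p - 1) * exp (- real (?d + 2 * n) * \<tau>)) * indicator {0..} \<tau>)) \<partial>lborel)"
  proof (rule nn_integral_mono)
    fix \<tau> :: real
    show "(\<integral>\<^sup>+y. h y * (f \<tau> * S \<tau> y) \<partial>lborel) \<le> (\<Sum>n. ennreal ((r0 / ?D ^ 2) ^ ?d * ?w * real ((?d + n - 1) choose n)) *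
      (ennreal (p * \<tau> powr (p - 1) * exp (- real (?d + 2 * n) * \<tau>)) * indicator {0..} \<tau>))"
    proof (cases "0 < \<tau>")
      case False
      then have "h y * (f \<tau> * S \<tau> y) = 0" for y by (simp add: S_def)
      then have "(\<integral>\<^sup>+y. h y * (f \<tau> * S \<tau> y) \<partial>lborel) = 0" by (simp only: nn_integral_const mult_zero_left)
      then show ?thesis by simp
    next
      case True
      define t where "t = r0 * exp (- \<tau>)"
      define z where "z = exp (- 2 * \<tau>)"
      have z: "0 \<le> z" "z < 1" using True by (auto simp: z_def)
      have t: "0 < t" "t < ?D" using True r0
        by (auto simp: t_def mult_less_cancel_left2 intro: less_le_trans[of _ r0])
      have "(\<integral>\<^sup>+y. h y * (f \<tau> * S \<tau> y) \<partial>lborel) \<le> (\<integral>\<^sup>+y. f \<tau> * (h y * indicator (ball c t) y) \<partial>lborel)"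
      proof (rule nn_integral_mono)
        fix y
        have "y \<in> ball c t" if "\<tau> < ln (r0 / dist y c)" "y \<in> ball c r0"
        proof (cases "y = c")
          case False
          then have "exp \<tau> < r0 / dist y c"
            using that(1) r0 by (metis exp_less_mono exp_ln divide_pos_pos zero_less_dist_iff)
          then show ?thesis
            using False by (simp add: t_def field_simps exp_minus dist_commute)
        qed (use t in auto)
        then show "h y * (f \<tau> * S \<tau> y) \<le> f \<tau> * (h y * indicator (ball c t) y)"
          by (auto simp: S_def mult_ac split: split_indicator)
      qed
      also have "\<dots> = f \<tau> * (\<integral>\<^sup>+y. h y * indicator (ball c t) y \<partial>lborel)"
        by (subst nn_integral_cmult) auto
      also have "\<dots> \<le> f \<tau> * ennreal (?w * (t / (?D ^ 2 - t ^ 2)) ^ ?d)"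
        unfolding h_def by (intro mult_left_mono nn_integral_inverse_power_ball_le t) auto
      also have "\<dots> \<le> f \<tau> * ennreal (?w * ((r0 / ?D ^ 2) * (exp (- \<tau>) / (1 - z))) ^ ?d)"
      proof (intro mult_left_mono ennreal_leI power_mono)
        have "t ^ 2 = r0 ^ 2 * z"
          by (simp add: t_def z_def power_mult_distrib flip: exp_double)
        also have "\<dots> \<le> ?D ^ 2 * z"
          using r0 z by (intro mult_right_mono power_mono) auto
        finally have le: "?D ^ 2 * (1 - z) \<le> ?D ^ 2 - t ^ 2" by (simp add: algebra_simps)
        have "0 < ?D ^ 2 * (1 - z)" using t z by (intro mult_pos_pos) auto
        then have "t / (?D ^ 2 - t ^ 2) \<le> t / (?D ^ 2 * (1 - z))"
          using t by (intro divide_left_mono[OF le _ mult_pos_pos] less_le_trans[OF _ le]) simp_all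
        then show "t / (?D ^ 2 - t ^ 2) \<le> (r0 / ?D ^ 2) * (exp (- \<tau>) / (1 - z))"
          by (simp add: t_def)
        show "0 \<le> t / (?D ^ 2 - t ^ 2)" using t by (simp add: power_mono)
      qed auto
      also have "\<dots> = ennreal ((r0 / ?D ^ 2) ^ ?d * ?w * (p * \<tau> powr (p - 1)) * exp (- real ?d * \<tau>) * (1 / (1 - z) ^ ?d))"
      proof -
        have "exp (- real ?d * \<tau>) = exp (- \<tau>) ^ ?d"
          using exp_of_nat_mult[of ?d "- \<tau>"] by simp
        then have "(p * \<tau> powr (p - 1)) * (?w * ((r0 / ?D ^ 2) * (exp (- \<tau>) / (1 - z))) ^ ?d) =
          (r0 / ?D ^ 2) ^ ?d * ?w * (p * \<tau> powr (p - 1)) * exp (- real ?d * \<tau>) * (1 / (1 - z) ^ ?d)"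
          by (simp only: power_mult_distrib power_divide) simp
        moreover have "0 \<le> p * \<tau> powr (p - 1)" "0 \<le> ?w * ((r0 / ?D ^ 2) * (exp (- \<tau>) / (1 - z))) ^ ?d"
          using p0 z r0 by auto
        ultimately show ?thesis unfolding f_def by (simp only: ennreal_mult[symmetric])
      qed
      also have "\<dots> = (\<Sum>n. ennreal ((r0 / ?D ^ 2) ^ ?d * ?w * (p * \<tau> powr (p - 1)) * exp (- real ?d * \<tau>) * (real ((?d + n - 1) choose n) * z ^ n)))"
        using sums_mult[OF one_minus_power_minus_sums[OF d z], of "(r0 / ?D ^ 2) ^ ?d * ?w * (p * \<tau> powr (p - 1)) * exp (- real ?d * \<tau>)"] p0 r0 z
        by (intro sums_unique sums_ennreal[THEN iffD2]) auto
      also have "\<dots> = (\<Sum>n. ennreal ((r0 / ?D ^ 2) ^ ?d * ?w * real ((?d + n - 1) choose n)) *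
      (ennreal (p * \<tau> powr (p - 1) * exp (- real (?d + 2 * n) * \<tau>)) * indicator {0..} \<tau>))"
      proof (rule suminf_cong)
        fix n
        have "exp (- real (?d + 2 * n) * \<tau>) = exp (- real ?d * \<tau>) * z ^ n"
          unfolding z_def exp_of_nat_mult[symmetric] exp_add[symmetric] by (simp add: algebra_simps)
        then show "ennreal ((r0 / ?D ^ 2) ^ ?d * ?w * (p * \<tau> powr (p - 1)) * exp (- real ?d * \<tau>) * (real ((?d + n - 1) choose n) * z ^ n)) = ennreal ((r0 / ?D ^ 2) ^ ?d * ?w * real ((?d + n - 1) choose n)) *
      (ennreal (p * \<tau> powr (p - 1) * exp (- real (?d + 2 * n) * \<tau>)) * indicator {0..} \<tau>)"
          using True p0 r0 z by (simp add: mult_ac flip: ennreal_mult)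
      qed
      finally show ?thesis .
    qed
  qed
  also have "\<dots> = (\<Sum>n. ennreal ((r0 / ?D ^ 2) ^ ?d * ?w * real ((?d + n - 1) choose n)) *
      (\<integral>\<^sup>+\<tau>. ennreal (p * \<tau> powr (p - 1) * exp (- real (?d + 2 * n) * \<tau>)) * indicator {0..} \<tau> \<partial>lborel))"
    by (subst nn_integral_suminf) (auto intro!: suminf_cong nn_integral_cmult)
  also have "\<dots> = (\<Sum>n. ennreal ((r0 / ?D ^ 2) ^ ?d * ?w * (real ((?d + n - 1) choose n) * (Gamma (p + 1) / real (?d + 2 * n) powr p))))"
  proof (rule suminf_cong)
    fix n
    have "(\<integral>\<^sup>+\<tau>. ennreal (p * \<tau> powr (p - 1) * exp (- real (?d + 2 * n) * \<tau>)) * indicator {0..} \<tau> \<partial>lborel) = ennreal (Gamma (p + 1) / real (?d + 2 * n) powr p)"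
      using p0 by (intro nn_integral_powr_exp) (auto intro!: add_pos_nonneg)
    then show "ennreal ((r0 / ?D ^ 2) ^ ?d * ?w * real ((?d + n - 1) choose n)) *
      (\<integral>\<^sup>+\<tau>. ennreal (p * \<tau> powr (p - 1) * exp (- real (?d + 2 * n) * \<tau>)) * indicator {0..} \<tau> \<partial>lborel)
      = ennreal ((r0 / ?D ^ 2) ^ ?d * ?w * (real ((?d + n - 1) choose n) * (Gamma (p + 1) / real (?d + 2 * n) powr p)))"
      using p0 r0 by (simp only: mult.assoc) (subst ennreal_mult[symmetric], auto simp: Gamma_real_nonneg intro!: mult_nonneg_nonneg divide_nonneg_nonneg)
  qed
  also have "\<dots> = ennreal (\<Sum>n. ((r0 / ?D ^ 2) ^ ?d * ?w * (real ((?d + n - 1) choose n) * (Gamma (p + 1) / real (?d + 2 * n) powr p))))"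
    using summable_mult[OF summable_log_kernel[OF d p], of "(r0 / ?D ^ 2) ^ ?d * ?w * Gamma (p + 1)"] p0 r0
    by (intro suminf_ennreal2) (auto simp: Gamma_real_nonneg mult_ac)
  also have "(\<Sum>n. ((r0 / ?D ^ 2) ^ ?d * ?w * (real ((?d + n - 1) choose n) * (Gamma (p + 1) / real (?d + 2 * n) powr p))))
    = (r0 / ?D ^ 2) ^ ?d * log_kernel_const ?d p"
  proof -
    have "summable (\<lambda>n. real ((?d + n - 1) choose n) * (Gamma (p + 1) / real (?d + 2 * n) powr p))"
      using summable_mult[OF summable_log_kernel[OF d p], of "Gamma (p + 1)"] by (simp add: mult_ac)
    then show ?thesis
      using suminf_mult[of "\<lambda>n. real ((?d + n - 1) choose n) * (Gamma (p + 1) / real (?d + 2 * n) powr p)" "(r0 / ?D ^ 2) ^ ?d * ?w"]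
      by (simp only: log_kernel_const_def mult.assoc)
  qed
  finally show ?thesis .
qed

section \<open>The energy of radial functions\<close>

text \<open>
  For \<open>s p = d\<close>, the \<open>p\<close>-th power of the seminorm \<^const>\<open>gagliardo\<close>, with respect to \<^const>\<open>lborel\<close>.
\<close>

definition energy :: "'a::euclidean_space set \<Rightarrow> real \<Rightarrow> ('a \<Rightarrow> real) \<Rightarrow> ennreal" where
  "energy \<Omega> p u = (\<integral>\<^sup>+y. (\<integral>\<^sup>+x. ennreal (\<bar>u x - u y\<bar> powr p / dist x y ^ (2 * DIM('a)))
     * indicator \<Omega> x \<partial>lborel) * indicator \<Omega> y \<partial>lborel)"

text \<open>
  A radial function growing inwards no faster than the logarithm has inner integral at most that of
  the logarithm.  The shells between the radii \<open>a\<close> and \<open>\<rho>\<close> contribute \<open>ln (\<rho> / a)\<close>, and the exterior of the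
  large ball contributes \<open>1 / d\<close>.
\<close>

lemma energy_radial_le:
  fixes v :: "'a::euclidean_space \<Rightarrow> real" and c :: 'a
  assumes p: "real DIM('a) < p" and a: "0 < a" "a < \<rho>"
    and [measurable]: "v \<in> borel_measurable borel"
    and radial: "\<And>x y. dist x c = dist y c \<Longrightarrow> v x = v y"
    and inner: "\<And>x y. dist x c \<le> a \<Longrightarrow> dist y c \<le> a \<Longrightarrow> v x = v y"
    and outer: "\<And>x. \<rho> \<le> dist x c \<Longrightarrow> v x = 0"
    and lip: "\<And>x y. 0 < dist y c \<Longrightarrow> dist y c < dist x c \<Longrightarrow> dist x c \<le> \<rho> \<Longrightarrow> \<bar>v x - v y\<bar> \<le> ln (dist x c / dist y c)"
  shows "energy UNIV p v \<le> ennreal (2 * log_kernel_const DIM('a) p * (DIM('a) * unit_ball_vol DIM('a)) * (ln (\<rho> / a) + 1 / DIM('a)))"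
proof -
  let ?d = "DIM('a)" and ?w = "unit_ball_vol (real DIM('a))"
  define \<kappa> where "\<kappa> = log_kernel_const ?d p"
  have p0: "0 < p" using p by (meson DIM_positive of_nat_0_less_iff less_trans)
  have ex: "\<exists>x. dist x c = r" if "0 \<le> r" for r
  proof -
    obtain b :: 'a where "b \<in> Basis" using nonempty_Basis by blast
    then show ?thesis using that by (intro exI[of _ "c + r *\<^sub>R b"]) (auto simp: dist_norm)
  qed
  have lip': "\<bar>v y\<bar> \<le> ln (\<rho> / dist y c)" if "0 < dist y c" "dist y c < \<rho>" for y
  proof -
    obtain x where "dist x c = \<rho>" using ex a by (meson less_imp_le less_trans)
    then show ?thesis using lip[of y x] outer[of x] that by auto
  qed
  have \<kappa>: "0 \<le> \<kappa>"
    unfolding \<kappa>_def using log_kernel_const_pos[OF DIM_positive p] by simp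
  define k where "k x y = ennreal (\<bar>v x - v y\<bar> powr p / dist x y ^ (2 * ?d))" for x y
  have [measurable (raw)]: "(\<lambda>z. k (f z) (g z)) \<in> borel_measurable M"
    if [measurable]: "f \<in> borel_measurable M" "g \<in> borel_measurable M" for f g and M :: "'c measure"
    unfolding k_def by measurable
  have ksym: "k x y = k y x" for x y
    by (simp add: k_def dist_commute abs_minus_commute)
  \<comment> \<open>by symmetry it is enough to count the pairs with \<open>y\<close> nearer to the centre, twice\<close>
  define S where "S x y = (if dist y c < dist x c then 1 else 0 :: ennreal)" for x y
  have [measurable (raw)]: "(\<lambda>z. S (f z) (g z)) \<in> borel_measurable M"
    if [measurable]: "f \<in> borel_measurable M" "g \<in> borel_measurable M" for f g and M :: "'c measure"
    unfolding S_def by measurable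
  \<comment> \<open>the bound for the inner integral: the logarithm may be taken relative to the radius \<open>dist x c\<close> up to \<open>\<rho>\<close>, and relative to \<open>\<rho>\<close> beyond\<close>
  define g where "g r = ennreal (\<kappa> / r ^ ?d) * indicator {a..\<rho>} r + ennreal (\<kappa> * \<rho> ^ ?d / r ^ (2 * ?d)) * indicator {\<rho>..} r" for r :: real
  have [measurable]: "g \<in> borel_measurable borel" unfolding g_def by measurable
  have one: "(\<integral>\<^sup>+y. k x y * S x y \<partial>lborel) \<le> g (dist x c)" for x
  proof -
    let ?D = "dist x c"
    consider "?D \<le> a" | "a < ?D" "?D \<le> \<rho>" | "\<rho> < ?D" by linarith
    then show ?thesis
    proof cases
      case 1
      then have "k x y * S x y = 0" for y
        using inner[of x y] by (auto simp: k_def S_def)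
      then have "(\<integral>\<^sup>+y. k x y * S x y \<partial>lborel) = 0" by (simp only: nn_integral_const mult_zero_left)
      then show ?thesis by simp
    next
      case 2
      have "(\<integral>\<^sup>+y. k x y * S x y \<partial>lborel) \<le> (\<integral>\<^sup>+y. ennreal (ln (?D / dist y c) powr p / dist x y ^ (2 * ?d)) * indicator (ball c ?D) y \<partial>lborel)"
      proof (rule nn_integral_mono_AE, rule AE_mp[OF AE_lborel_singleton[of c]], rule AE_I2, rule impI)
        fix y assume "y \<noteq> c"
        then show "k x y * S x y \<le> ennreal (ln (?D / dist y c) powr p / dist x y ^ (2 * ?d)) * indicator (ball c ?D) y"
          using lip[of y x] 2 p0
          by (auto simp: k_def S_def dist_commute intro!: ennreal_leI divide_right_mono powr_mono2)
      qed
      also have "\<dots> \<le> ennreal ((?D / ?D ^ 2) ^ ?d * \<kappa>)"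
        unfolding \<kappa>_def using 2 a by (intro nn_integral_log_inverse_power_le p) auto
      also have "(?D / ?D ^ 2) ^ ?d * \<kappa> = \<kappa> / ?D ^ ?d"
      proof -
        have "?D \<noteq> 0" using 2 a by linarith
        then show ?thesis by (simp add: power2_eq_square power_divide)
      qed
      also have "ennreal \<dots> \<le> g ?D" using 2 by (simp add: g_def)
      finally show ?thesis .
    next
      case 3
      have "(\<integral>\<^sup>+y. k x y * S x y \<partial>lborel) \<le> (\<integral>\<^sup>+y. ennreal (ln (\<rho> / dist y c) powr p / dist x y ^ (2 * ?d)) * indicator (ball c \<rho>) y \<partial>lborel)"
      proof (rule nn_integral_mono_AE, rule AE_mp[OF AE_lborel_singleton[of c]], rule AE_I2, rule impI)
        fix y assume "y \<noteq> c"
        then show "k x y * S x y \<le> ennreal (ln (\<rho> / dist y c) powr p / dist x y ^ (2 * ?d)) * indicator (ball c \<rho>) y"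
          using lip'[of y] 3 p0 outer[of x] outer[of y]
          by (cases "dist y c < \<rho>")
            (auto simp: k_def S_def dist_commute intro!: ennreal_leI divide_right_mono powr_mono2)
      qed
      also have "\<dots> \<le> ennreal ((\<rho> / ?D ^ 2) ^ ?d * \<kappa>)"
        unfolding \<kappa>_def using 3 a by (intro nn_integral_log_inverse_power_le p) auto
      also have "(\<rho> / ?D ^ 2) ^ ?d * \<kappa> = \<kappa> * \<rho> ^ ?d / ?D ^ (2 * ?d)"
        by (simp add: power_divide power_mult)
      also have "ennreal \<dots> \<le> g ?D" using 3 by (simp add: g_def)
      finally show ?thesis .
    qed
  qed
  have "energy UNIV p v = (\<integral>\<^sup>+y. \<integral>\<^sup>+x. k x y * S x y + k x y * S y x \<partial>lborel \<partial>lborel)"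
    unfolding energy_def
  proof (intro nn_integral_cong)
    fix y
    have "(\<integral>\<^sup>+x. ennreal (\<bar>v x - v y\<bar> powr p / dist x y ^ (2 * ?d)) * indicator UNIV x \<partial>lborel) =
      (\<integral>\<^sup>+x. k x y * S x y + k x y * S y x \<partial>lborel)"
    proof (intro nn_integral_cong)
      fix x
      show "ennreal (\<bar>v x - v y\<bar> powr p / dist x y ^ (2 * ?d)) * indicator UNIV x = k x y * S x y + k x y * S y x"
        using radial[of x y] by (cases "dist x c" "dist y c" rule: linorder_cases) (auto simp: k_def S_def)
    qed
    then show "(\<integral>\<^sup>+x. ennreal (\<bar>v x - v y\<bar> powr p / dist x y ^ (2 * ?d)) * indicator UNIV x \<partial>lborel) * indicator UNIV y =
      (\<integral>\<^sup>+x. k x y * S x y + k x y * S y x \<partial>lborel)" by simp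
  qed
  also have "\<dots> = (\<integral>\<^sup>+y. (\<integral>\<^sup>+x. k x y * S x y \<partial>lborel) + (\<integral>\<^sup>+x. k x y * S y x \<partial>lborel) \<partial>lborel)"
    by (intro nn_integral_cong nn_integral_add) auto
  also have "\<dots> = (\<integral>\<^sup>+y. (\<integral>\<^sup>+x. k x y * S x y \<partial>lborel) \<partial>lborel) + (\<integral>\<^sup>+y. (\<integral>\<^sup>+x. k x y * S y x \<partial>lborel) \<partial>lborel)"
    by (intro nn_integral_add) auto
  also have "(\<integral>\<^sup>+y. (\<integral>\<^sup>+x. k x y * S x y \<partial>lborel) \<partial>lborel) = (\<integral>\<^sup>+x. (\<integral>\<^sup>+y. k x y * S x y \<partial>lborel) \<partial>lborel)"
    by (rule lborel_pair.Fubini') measurable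
  also have "(\<integral>\<^sup>+y. (\<integral>\<^sup>+x. k x y * S y x \<partial>lborel) \<partial>lborel) = (\<integral>\<^sup>+x. (\<integral>\<^sup>+y. k x y * S x y \<partial>lborel) \<partial>lborel)"
    by (simp add: ksym)
  also have "(\<integral>\<^sup>+x. (\<integral>\<^sup>+y. k x y * S x y \<partial>lborel) \<partial>lborel) + (\<integral>\<^sup>+x. (\<integral>\<^sup>+y. k x y * S x y \<partial>lborel) \<partial>lborel)
     = 2 * (\<integral>\<^sup>+x. (\<integral>\<^sup>+y. k x y * S x y \<partial>lborel) \<partial>lborel)"
    by (simp add: mult_2)
  also have "\<dots> \<le> 2 * (\<integral>\<^sup>+x. g (dist x c) \<partial>lborel)"
    by (intro mult_left_mono nn_integral_mono one) auto
  also have "(\<integral>\<^sup>+x. g (dist x c) \<partial>lborel) = (\<integral>\<^sup>+r. g r * ennreal (?d * ?w * r ^ (?d - 1)) * indicator {0..} r \<partial>lborel)"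
    by (rule nn_integral_radial) auto
  also have "\<dots> = (\<integral>\<^sup>+r. ennreal (\<kappa> * (?d * ?w) * (1 / r)) * indicator {a..\<rho>} r + ennreal (\<kappa> * (?d * ?w) * (\<rho> ^ ?d / r ^ (?d + 1))) * indicator {\<rho>..} r \<partial>lborel)"
  proof (intro nn_integral_cong)
    fix r :: real
    show "g r * ennreal (?d * ?w * r ^ (?d - 1)) * indicator {0..} r =
       ennreal (\<kappa> * (?d * ?w) * (1 / r)) * indicator {a..\<rho>} r + ennreal (\<kappa> * (?d * ?w) * (\<rho> ^ ?d / r ^ (?d + 1))) * indicator {\<rho>..} r"
    proof (cases "r < a")
      case True
      then show ?thesis using a by (simp add: g_def)
    next
      case False
      then have r: "0 < r" using a by simp
      have "r ^ ?d = r * r ^ (?d - 1)"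
        by (metis DIM_positive power_eq_if less_numeral_extra(3))
      then have e1: "\<kappa> / r ^ ?d * (?d * ?w * r ^ (?d - 1)) = \<kappa> * (?d * ?w) * (1 / r)"
        and e2: "\<kappa> * \<rho> ^ ?d / r ^ (2 * ?d) * (?d * ?w * r ^ (?d - 1)) = \<kappa> * (?d * ?w) * (\<rho> ^ ?d / r ^ (?d + 1))"
        using r by (simp_all add: power_add mult_2)
      have "ennreal (\<kappa> / r ^ ?d) * ennreal (?d * ?w * r ^ (?d - 1)) = ennreal (\<kappa> * (?d * ?w) * (1 / r))"
        unfolding e1[symmetric] using r \<kappa> by (intro ennreal_mult[symmetric]) auto
      moreover have "ennreal (\<kappa> * \<rho> ^ ?d / r ^ (2 * ?d)) * ennreal (?d * ?w * r ^ (?d - 1)) = ennreal (\<kappa> * (?d * ?w) * (\<rho> ^ ?d / r ^ (?d + 1)))"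
        unfolding e2[symmetric] using r \<kappa> a by (intro ennreal_mult[symmetric]) auto
      ultimately show ?thesis
        using r by (auto simp: g_def distrib_right split: split_indicator)
    qed
  qed
  also have "\<dots> = (\<integral>\<^sup>+r. ennreal (\<kappa> * (?d * ?w) * (1 / r)) * indicator {a..\<rho>} r \<partial>lborel) + (\<integral>\<^sup>+r. ennreal (\<kappa> * (?d * ?w) * (\<rho> ^ ?d / r ^ (?d + 1))) * indicator {\<rho>..} r \<partial>lborel)"
    by (intro nn_integral_add) auto
  also have "(\<integral>\<^sup>+r. ennreal (\<kappa> * (?d * ?w) * (1 / r)) * indicator {a..\<rho>} r \<partial>lborel) = ennreal (\<kappa> * (?d * ?w) * ln \<rho> - \<kappa> * (?d * ?w) * ln a)"
  proof (rule nn_integral_FTC_Icc)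
    show "DERIV (\<lambda>r. \<kappa> * (?d * ?w) * ln r) r :> \<kappa> * (?d * ?w) * (1 / r)" if "r \<in> {a..\<rho>}" for r
      using that a by (intro DERIV_cmult DERIV_ln_divide) auto
    show "0 \<le> \<kappa> * (?d * ?w) * (1 / r)" if "r \<in> {a..\<rho>}" for r using that a \<kappa> by auto
  qed (use a in auto)
  also have "(\<integral>\<^sup>+r. ennreal (\<kappa> * (?d * ?w) * (\<rho> ^ ?d / r ^ (?d + 1))) * indicator {\<rho>..} r \<partial>lborel) = ennreal (0 - (\<kappa> * (?d * ?w) * (- (\<rho> ^ ?d / ?d) * inverse (\<rho> ^ ?d))))"
  proof (rule nn_integral_FTC_atLeast[where F="\<lambda>r. \<kappa> * (?d * ?w) * (- (\<rho> ^ ?d / ?d) * inverse (r ^ ?d))" and T=0])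
    show "DERIV (\<lambda>r. \<kappa> * (?d * ?w) * (- (\<rho> ^ ?d / ?d) * inverse (r ^ ?d))) r :> \<kappa> * (?d * ?w) * (\<rho> ^ ?d / r ^ (?d + 1))" if "\<rho> \<le> r" for r
    proof -
      have r: "0 < r" using that a by simp
      have e: "r ^ ?d = r * r ^ (?d - 1)"
        by (metis DIM_positive power_eq_if less_numeral_extra(3))
      have "DERIV (\<lambda>r. inverse (r ^ ?d)) r :> - (inverse (r ^ ?d) * (?d * r ^ (?d - 1)) * inverse (r ^ ?d))"
        using r by (auto intro!: derivative_eq_intros)
      then have "DERIV (\<lambda>r. \<kappa> * (?d * ?w) * (- (\<rho> ^ ?d / ?d) * inverse (r ^ ?d))) r :>
          \<kappa> * (?d * ?w) * (- (\<rho> ^ ?d / ?d) * (- (inverse (r ^ ?d) * (?d * r ^ (?d - 1)) * inverse (r ^ ?d))))"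
        by (intro DERIV_cmult)
      moreover have "- (\<rho> ^ ?d / ?d) * (- (inverse (r ^ ?d) * (?d * r ^ (?d - 1)) * inverse (r ^ ?d))) = \<rho> ^ ?d / r ^ (?d + 1)"
        using r by (simp add: e field_simps)
      ultimately show ?thesis by simp
    qed
    show "0 \<le> \<kappa> * (?d * ?w) * (\<rho> ^ ?d / r ^ (?d + 1))" if "\<rho> \<le> r" for r using that a \<kappa> by auto
    have "((\<lambda>r::real. inverse (r ^ ?d)) \<longlongrightarrow> 0) at_top"
      by (intro tendsto_inverse_0_at_top filterlim_pow_at_top filterlim_ident) auto
    then show "((\<lambda>r. \<kappa> * (?d * ?w) * (- (\<rho> ^ ?d / ?d) * inverse (r ^ ?d))) \<longlongrightarrow> 0) at_top"
      by (intro tendsto_mult_right_zero)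
  qed auto
  also have "ennreal (\<kappa> * (?d * ?w) * ln \<rho> - \<kappa> * (?d * ?w) * ln a) + ennreal (0 - (\<kappa> * (?d * ?w) * (- (\<rho> ^ ?d / ?d) * inverse (\<rho> ^ ?d)))) =
    ennreal (\<kappa> * (?d * ?w) * (ln (\<rho> / a) + 1 / ?d))"
  proof -
    have "0 \<le> \<kappa> * (?d * ?w) * ln \<rho> - \<kappa> * (?d * ?w) * ln a"
      using a \<kappa> by (simp add: mult_left_mono ln_le_cancel_iff)
    moreover have "0 - (\<kappa> * (?d * ?w) * (- (\<rho> ^ ?d / ?d) * inverse (\<rho> ^ ?d))) = \<kappa> * (?d * ?w) * (1 / ?d)"
      using a by simp
    moreover have "0 \<le> \<kappa> * (?d * ?w) * (1 / ?d)" using \<kappa> by simp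
    ultimately show ?thesis
      using a by (simp only: ennreal_plus[symmetric]) (simp add: ln_div algebra_simps)
  qed
  also have "2 * ennreal (\<kappa> * (?d * ?w) * (ln (\<rho> / a) + 1 / ?d)) = ennreal (2 * (\<kappa> * (?d * ?w) * (ln (\<rho> / a) + 1 / ?d)))"
    by (metis ennreal_mult' ennreal_numeral zero_le_numeral)
  finally show ?thesis by (simp add: \<kappa>_def mult.assoc)
qed

section \<open>Smooth cut-off logarithms\<close>

text \<open>
  Dividing the flat function \<open>exp (- 1 / t)\<close> by powers of \<open>t\<close> yields a family closed under
  differentiation.
\<close>

definition flat :: "nat \<Rightarrow> real \<Rightarrow> real" where
  "flat n t = (if t \<le> 0 then 0 else exp (- (1 / t)) / t ^ n)"

lemma DERIV_flat:
  "(flat n has_real_derivative (- real n * flat (n + 1) t + flat (n + 2) t)) (at t)"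
proof -
  consider "t < 0" | "t > 0" | "t = 0" by linarith
  then show ?thesis
  proof cases
    case 1
    have "((\<lambda>_. 0) has_real_derivative 0) (at t)" by simp
    then have "(flat n has_real_derivative 0) (at t)"
      by (rule has_field_derivative_transform_within_open[where S="{..<0}"]) (use 1 in \<open>auto simp: flat_def\<close>)
    then show ?thesis using 1 by (simp add: flat_def)
  next
    case 2
    have "((\<lambda>t. exp (- (1 / t)) / t ^ n) has_real_derivative
        (exp (- (1 / t)) * (1 / t ^ 2) * t ^ n - exp (- (1 / t)) * (real n * t ^ (n - 1))) / (t ^ n * t ^ n)) (at t)"
      using 2 by (auto intro!: derivative_eq_intros simp: power2_eq_square)
    moreover have "(exp (- (1 / t)) * (1 / t ^ 2) * t ^ n - exp (- (1 / t)) * (real n * t ^ (n - 1))) / (t ^ n * t ^ n)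
      = - real n * (exp (- (1 / t)) / t ^ (n + 1)) + exp (- (1 / t)) / t ^ (n + 2)"
      using 2 by (cases n) (simp_all add: field_simps power_add power2_eq_square)
    ultimately have "((\<lambda>t. exp (- (1 / t)) / t ^ n) has_real_derivative
      (- real n * (exp (- (1 / t)) / t ^ (n + 1)) + exp (- (1 / t)) / t ^ (n + 2))) (at t)" by simp
    then have "(flat n has_real_derivative
      (- real n * (exp (- (1 / t)) / t ^ (n + 1)) + exp (- (1 / t)) / t ^ (n + 2))) (at t)"
      by (rule has_field_derivative_transform_within_open[where S="{0<..}"]) (use 2 in \<open>auto simp: flat_def\<close>)
    then show ?thesis using 2 by (simp add: flat_def)
  next
    case 3
    have "((\<lambda>h. inverse h ^ (n + 1) / exp (inverse h)) \<longlongrightarrow> (0::real)) (at_right 0)"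
      by (rule filterlim_compose[OF tendsto_power_div_exp_0 filterlim_inverse_at_top_right])
    then have "((\<lambda>h. flat n h / h) \<longlongrightarrow> 0) (at_right 0)"
      by (rule Lim_transform_eventually)
        (auto simp: eventually_at_right_field flat_def exp_minus field_simps intro!: exI[of _ 1])
    moreover have "((\<lambda>h. flat n h / h) \<longlongrightarrow> 0) (at_left 0)"
      by (rule tendsto_eventually) (auto simp: eventually_at_left_field flat_def intro!: exI[of _ "-1"])
    ultimately have "((\<lambda>h. flat n h / h) \<longlongrightarrow> 0) (at 0)"
      by (simp add: filterlim_at_split)
    then show ?thesis using 3 by (simp add: flat_def DERIV_def)
  qed
qed

text \<open>
  A calculus of functions all of whose derivatives exist for syntactic reasons: every rule produces a
  function whose derivative is again generated by the rules.  The division rule is confined to functions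
  vanishing to the left of a positive number, where \<open>f t / t\<close> has no singularity.
\<close>

inductive smooth_real :: "(real \<Rightarrow> real) \<Rightarrow> bool" where
  const: "smooth_real (\<lambda>_. k)"
| flat_affine: "smooth_real (\<lambda>t. flat n (a * t + b))"
| add: "smooth_real f \<Longrightarrow> smooth_real g \<Longrightarrow> smooth_real (\<lambda>t. f t + g t)"
| mult: "smooth_real f \<Longrightarrow> smooth_real g \<Longrightarrow> smooth_real (\<lambda>t. f t * g t)"
| divide: "smooth_real f \<Longrightarrow> 0 < c \<Longrightarrow> (\<And>t. t \<le> c \<Longrightarrow> f t = 0) \<Longrightarrow> smooth_real (\<lambda>t. f t / t)"
| antiderivative: "smooth_real f \<Longrightarrow> (\<And>t. (g has_real_derivative f t) (at t)) \<Longrightarrow> smooth_real g"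

lemma smooth_real_has_derivative:
  assumes "smooth_real f"
  shows "\<exists>f'. smooth_real f' \<and> (\<forall>t. (f has_real_derivative f' t) (at t))"
  using assms
proof induction
  case (const k)
  show ?case by (intro exI[of _ "\<lambda>_. 0"]) (auto intro: smooth_real.intros)
next
  case (flat_affine n a b)
  have "((\<lambda>t. flat n (a * t + b)) has_real_derivative
    ((- real n * flat (n + 1) (a * t + b) + flat (n + 2) (a * t + b)) * a)) (at t)" for t
    by (rule DERIV_chain'[OF _ DERIV_flat]) (auto intro!: derivative_eq_intros)
  moreover have "smooth_real (\<lambda>t. (- real n * flat (n + 1) (a * t + b) + flat (n + 2) (a * t + b)) * a)"
    by (intro smooth_real.mult smooth_real.add smooth_real.const smooth_real.flat_affine)
  ultimately show ?case by blast
next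
  case (add f g)
  then obtain f' g' where "smooth_real f'" "smooth_real g'"
    "\<And>t. (f has_real_derivative f' t) (at t)" "\<And>t. (g has_real_derivative g' t) (at t)" by blast
  then show ?case
    by (intro exI[of _ "\<lambda>t. f' t + g' t"]) (auto intro: smooth_real.add DERIV_add)
next
  case (mult f g)
  then obtain f' g' where "smooth_real f'" "smooth_real g'"
    "\<And>t. (f has_real_derivative f' t) (at t)" "\<And>t. (g has_real_derivative g' t) (at t)" by blast
  then show ?case using mult.hyps
    by (intro exI[of _ "\<lambda>t. f' t * g t + g' t * f t"]) (auto intro: smooth_real.add smooth_real.mult DERIV_mult)
next
  case (divide f c)
  then obtain f' where f': "smooth_real f'" "\<And>t. (f has_real_derivative f' t) (at t)" by blast
  have f'0: "f' t = 0" if "t \<le> c" for t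
  proof -
    have "((\<lambda>_. 0) has_real_derivative 0) (at t within {..c})" by simp
    then have "(f has_real_derivative 0) (at t within {..c})"
      by (rule has_field_derivative_transform_within[where d=1]) (use that divide.hyps in auto)
    moreover have "(f has_real_derivative f' t) (at t within {..c})"
      using f'(2) by (rule has_field_derivative_at_within)
    moreover have "at t within {..c} \<noteq> bot"
    proof -
      have "at t within {t - 1<..<t} \<noteq> bot" by (simp add: at_within_eq_bot_iff)
      then show ?thesis using that by (metis (no_types, lifting) at_le bot.extremum_uniqueI atMost_iff greaterThanLessThan_iff less_imp_le order_trans subsetI)
    qed
    ultimately show ?thesis
      using tendsto_unique unfolding has_field_derivative_iff by blast
  qed
  have "((\<lambda>t. f t / t) has_real_derivative (f' t + (- 1) * (f t / t)) / t) (at t)" for t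
  proof (cases "t < c")
    case True
    have "((\<lambda>_. 0) has_real_derivative 0) (at t)" by simp
    then have "((\<lambda>t. f t / t) has_real_derivative 0) (at t)"
      by (rule has_field_derivative_transform_within_open[where S="{..<c}"])
        (use True divide.hyps in auto)
    then show ?thesis using True divide.hyps f'0 by simp
  next
    case False
    then have "t \<noteq> 0" using divide.hyps by auto
    then have "((\<lambda>t. f t / t) has_real_derivative (f' t * t - f t * 1) / (t * t)) (at t)"
      by (intro DERIV_divide f' DERIV_ident)
    moreover have "(f' t * t - f t * 1) / (t * t) = (f' t + (- 1) * (f t / t)) / t"
      using \<open>t \<noteq> 0\<close> by (simp add: field_simps)
    ultimately show ?thesis by simp
  qed
  moreover have "smooth_real (\<lambda>t. (f' t + (- 1) * (f t / t)) / t)"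
  proof (rule smooth_real.divide)
    show "smooth_real (\<lambda>t. f' t + - 1 * (f t / t))"
      using divide.hyps f' by (intro smooth_real.add smooth_real.mult smooth_real.const smooth_real.divide)
    show "0 < c" by fact
    show "f' t + - 1 * (f t / t) = 0" if "t \<le> c" for t using that f'0 divide.hyps by simp
  qed
  ultimately show ?case by blast
qed blast

text \<open>
  The multivariate counterpart; it contains the radial functions \<open>F (dist x c ^ 2)\<close>.
\<close>

inductive smooth_fun :: "('a::euclidean_space \<Rightarrow> real) \<Rightarrow> bool" where
  const: "smooth_fun (\<lambda>_. k)"
| inner: "smooth_fun (\<lambda>x. (x - c) \<bullet> v)"
| add: "smooth_fun f \<Longrightarrow> smooth_fun g \<Longrightarrow> smooth_fun (\<lambda>x. f x + g x)"
| mult: "smooth_fun f \<Longrightarrow> smooth_fun g \<Longrightarrow> smooth_fun (\<lambda>x. f x * g x)"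
| compose: "smooth_real g \<Longrightarrow> smooth_fun f \<Longrightarrow> smooth_fun (\<lambda>x. g (f x))"

lemma smooth_fun_has_derivative:
  assumes "smooth_fun f"
  shows "\<exists>f'. (\<forall>x. (f has_derivative f' x) (at x)) \<and> (\<forall>v. smooth_fun (\<lambda>x. f' x v))"
  using assms
proof induction
  case (const k)
  show ?case by (intro exI[of _ "\<lambda>_ _. 0"]) (simp add: smooth_fun.const)
next
  case (inner c v)
  show ?case by (intro exI[of _ "\<lambda>_ y. y \<bullet> v"]) (simp add: smooth_fun.const, intro allI, rule derivative_eq_intros, auto intro!: derivative_eq_intros)
next
  case (add f g)
  then obtain f' g' where "\<And>x. (f has_derivative f' x) (at x)" "\<And>x. (g has_derivative g' x) (at x)"
    "\<And>v. smooth_fun (\<lambda>x. f' x v)" "\<And>v. smooth_fun (\<lambda>x. g' x v)" by blast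
  then show ?case
    by (intro exI[of _ "\<lambda>x v. f' x v + g' x v"]) (simp add: smooth_fun.add)
next
  case (mult f g)
  then obtain f' g' where "\<And>x. (f has_derivative f' x) (at x)" "\<And>x. (g has_derivative g' x) (at x)"
    "\<And>v. smooth_fun (\<lambda>x. f' x v)" "\<And>v. smooth_fun (\<lambda>x. g' x v)" by blast
  then show ?case using mult.hyps
    by (intro exI[of _ "\<lambda>x v. f x * g' x v + f' x v * g x"])
      (simp add: smooth_fun.add smooth_fun.mult)
next
  case (compose g f)
  then obtain f' where f': "\<And>x. (f has_derivative f' x) (at x)" "\<And>v. smooth_fun (\<lambda>x. f' x v)" by blast
  obtain g' where g': "smooth_real g'" "\<And>t. (g has_real_derivative g' t) (at t)"
    using smooth_real_has_derivative[OF compose.hyps(1)] by blast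
  have "((\<lambda>x. g (f x)) has_derivative (\<lambda>v. g' (f x) * f' x v)) (at x)" for x
    using has_derivative_compose[OF f'(1) g'(2)[unfolded has_field_derivative_def]] .
  moreover have "smooth_fun (\<lambda>x. g' (f x) * f' x v)" for v
    using smooth_fun.mult[OF smooth_fun.compose[OF g'(1) compose.hyps(2)] f'(2)] .
  ultimately show ?case by (intro exI[of _ "\<lambda>x v. g' (f x) * f' x v"]) blast
qed

lemma smooth_fun_Ck:
  assumes "smooth_fun f"
  shows "Ck k f"
  using assms
proof (induction k arbitrary: f)
  case 0
  then obtain f' where "\<And>x. (f has_derivative f' x) (at x)"
    using smooth_fun_has_derivative by blast
  then have "continuous (at x) f" for x by (rule has_derivative_continuous)
  then show ?case by (simp add: continuous_at_imp_continuous_on)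
next
  case (Suc k)
  then obtain f' where f': "\<And>x. (f has_derivative f' x) (at x)" "\<And>v. smooth_fun (\<lambda>x. f' x v)"
    using smooth_fun_has_derivative by blast
  have "frechet_derivative f (at x) = f' x" for x
    by (rule frechet_derivative_at[symmetric]) (rule f')
  then show ?case using f' Suc.IH by (auto simp: differentiable_def)
qed

lemma smooth_fun_dist2: "smooth_fun (\<lambda>x::'a::euclidean_space. dist x c ^ 2)"
proof -
  have sum: "smooth_fun (\<lambda>x::'a. \<Sum>b\<in>B. ((x - c) \<bullet> b) * ((x - c) \<bullet> b))" if "finite B" for B
    using that
  proof induction
    case empty
    show ?case using smooth_fun.const[of 0] by simp
  next
    case (insert b B)
    show ?case
      unfolding sum.insert[OF insert.hyps]
      by (rule smooth_fun.add[OF smooth_fun.mult[OF smooth_fun.inner smooth_fun.inner] insert.IH])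
  qed
  have eq: "dist x c ^ 2 = (\<Sum>b\<in>Basis. ((x - c) \<bullet> b) * ((x - c) \<bullet> b))" for x :: 'a
    unfolding dist_norm power2_norm_eq_inner by (rule euclidean_inner)
  show ?thesis unfolding eq by (rule sum) simp
qed

text \<open>
  A smooth version of \<open>ln (\<rho> / sqrt q)\<close> between \<open>a ^ 2\<close> and \<open>\<rho> ^ 2\<close>, as a function of the squared radius
  \<open>q\<close>, so that composing it with \<open>dist x c ^ 2\<close> is smooth at the centre as well.  Its slope never exceeds
  that of the logarithm; the price is the factor \<open>exp (- 3 * \<eta>)\<close> and the constant \<open>ln 2\<close> in the height.
\<close>

lemma moser_profile:
  fixes a \<rho> \<eta> :: real
  assumes a: "0 < a" "2 * a \<le> \<rho>" and \<eta>: "0 < \<eta>"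
  obtains F where "smooth_real F" "\<And>q. q \<le> a ^ 2 \<Longrightarrow> F q = F 0" "\<And>q. \<rho> ^ 2 \<le> q \<Longrightarrow> F q = 0"
    "\<And>q r. q \<le> r \<Longrightarrow> F r \<le> F q"
    "\<And>q r. 0 < q \<Longrightarrow> q \<le> r \<Longrightarrow> F q - F r \<le> ln (r / q) / 2"
    "exp (- 3 * \<eta>) * (ln (\<rho> / a) - ln 2) \<le> F 0"
proof -
  \<comment> \<open>\<open>F\<close> will have the derivative \<open>- B q / (2 * q)\<close>; the cut-off \<open>B\<close> has values in \<open>[0, 1]\<close>, vanishes outside \<open>[a ^ 2, \<rho> ^ 2]\<close> and is at least \<open>exp (- 3 * \<eta>)\<close> on \<open>[2 * a ^ 2, \<rho> ^ 2 / 2]\<close>\<close>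
  define B where "B q = flat 0 (1 / (\<eta> * a ^ 2) * q + - (1 / \<eta>)) * flat 0 (- (1 / (\<eta> * \<rho> ^ 2)) * q + 1 / \<eta>)" for q
  define g where "g q = (- 1 / 2) * (B q / q)" for q
  have \<rho>: "0 < \<rho>" using a by simp
  have flat01: "0 \<le> flat 0 t" "flat 0 t \<le> 1" for t by (auto simp: flat_def)
  have B01: "0 \<le> B q" "B q \<le> 1" for q
    unfolding B_def using flat01 by (auto intro: mult_le_one)
  have B0: "B q = 0" if "q \<le> a ^ 2" for q
  proof -
    have "1 / (\<eta> * a ^ 2) * q + - (1 / \<eta>) \<le> 0" using that a \<eta> by (simp add: field_simps)
    then show ?thesis by (simp add: B_def flat_def)
  qed
  have B1: "B q = 0" if "\<rho> ^ 2 \<le> q" for q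
  proof -
    have "- (1 / (\<eta> * \<rho> ^ 2)) * q + 1 / \<eta> \<le> 0" using that \<rho> \<eta> by (simp add: field_simps)
    then show ?thesis by (simp add: B_def flat_def)
  qed
  have Blow: "exp (- 3 * \<eta>) \<le> B q" if q: "2 * a ^ 2 \<le> q" "q \<le> \<rho> ^ 2 / 2" for q
  proof -
    have flat_ge: "exp (- s) \<le> flat 0 t" if "0 < s" "1 / s \<le> t" for s t
    proof -
      have "0 < 1 / s" using that by simp
      then have t: "0 < t" using that by linarith
      have "1 \<le> t * s" using that by (simp add: field_simps)
      then show ?thesis using t by (simp add: flat_def field_simps)
    qed
    have "1 / \<eta> \<le> 1 / (\<eta> * a ^ 2) * q + - (1 / \<eta>)"
      using q a \<eta> by (simp add: field_simps)
    moreover have "1 / (2 * \<eta>) \<le> - (1 / (\<eta> * \<rho> ^ 2)) * q + 1 / \<eta>"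
      using q \<rho> \<eta> by (simp add: field_simps)
    ultimately have "exp (- \<eta>) * exp (- (2 * \<eta>)) \<le> B q"
      unfolding B_def using \<eta> by (intro mult_mono flat_ge flat01) auto
    then show ?thesis by (simp flip: exp_add)
  qed
  have smB: "smooth_real B"
    unfolding B_def by (intro smooth_real.mult smooth_real.flat_affine)
  have smg: "smooth_real g"
    unfolding g_def using a B0
    by (intro smooth_real.mult smooth_real.const smooth_real.divide[where c="a ^ 2"] smB) auto
  have contg: "continuous_on S g" for S
  proof -
    obtain g' where "\<And>t. (g has_real_derivative g' t) (at t)"
      using smooth_real_has_derivative[OF smg] by blast
    then show ?thesis by (intro continuous_at_imp_continuous_on) (auto intro: DERIV_isCont)
  qed
  define G where "G q = integral {0..q} g" for q
  have Gd: "(G has_real_derivative g q) (at q)" for q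
  proof (cases "q < a ^ 2")
    case True
    have "((\<lambda>_. 0) has_real_derivative 0) (at q)" by simp
    moreover have "G r = 0" if "r < a ^ 2" for r
    proof -
      have "integral {0..r} g = integral {0..r} (\<lambda>_. 0)"
        by (intro integral_cong) (use that B0 in \<open>auto simp: g_def\<close>)
      then show ?thesis by (simp add: G_def)
    qed
    ultimately have "(G has_real_derivative 0) (at q)"
      by (intro has_field_derivative_transform_within_open[where S="{..<a ^ 2}" and f="\<lambda>_. 0" and g=G]) (use True in auto)
    then show ?thesis using True B0 by (simp add: g_def)
  next
    case False
    then have q: "0 < q" using a by (meson less_le_trans not_le_imp_less zero_less_power linorder_not_less)
    have "(G has_real_derivative g q) (at q within {0..q + 1})"
      unfolding G_def using q by (intro integral_has_real_derivative contg) auto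
    then show ?thesis using q by (simp add: at_within_Icc_at)
  qed
  define F where "F q = G q + - G (\<rho> ^ 2)" for q
  have Fd: "(F has_real_derivative g q) (at q)" for q
    unfolding F_def by (rule DERIV_add[OF Gd DERIV_const, THEN DERIV_cong]) simp
  have gneg: "g q \<le> 0" for q
  proof (cases "0 < q")
    case False
    then have "q \<le> a ^ 2" using zero_le_power2[of a] by linarith
    then show ?thesis by (simp add: g_def B0)
  qed (use B01 in \<open>auto simp: g_def\<close>)
  have anti: "F r \<le> F q" if "q \<le> r" for q r
    using that by (rule DERIV_nonpos_imp_nonincreasing) (use Fd gneg in blast)
  have conv: "F q = F r" if "q \<le> r" "\<And>t. q \<le> t \<Longrightarrow> t \<le> r \<Longrightarrow> g t = 0" for q r
  proof -
    have "F q \<le> F r" using that(1)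
      by (rule DERIV_nonneg_imp_nondecreasing) (use Fd that in force)
    then show ?thesis using anti[OF that(1)] by simp
  qed
  have F\<rho>: "F (\<rho> ^ 2) = 0" by (simp add: F_def)
  have g0: "g t = 0" if "t \<le> a ^ 2 \<or> \<rho> ^ 2 \<le> t" for t using that B0 B1 by (auto simp: g_def)
  show ?thesis
  proof
    show "smooth_real F" by (rule smooth_real.antiderivative[OF smg Fd])
    show "F q = F 0" if "q \<le> a ^ 2" for q
    proof (cases "q \<le> 0")
      case True
      show ?thesis
      proof (rule conv[OF True])
        show "g t = 0" if "t \<le> 0" for t
          by (rule g0) (use that zero_le_power2[of a] in linarith)
      qed
    next
      case False
      then show ?thesis using that by (intro conv[symmetric] g0) auto
    qed
    show "F q = 0" if "\<rho> ^ 2 \<le> q" for q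
      using conv[OF that] g0 F\<rho> by auto
    show "F r \<le> F q" if "q \<le> r" for q r using anti that .
    show "F q - F r \<le> ln (r / q) / 2" if "0 < q" "q \<le> r" for q r
    proof -
      have "F q + ln q / 2 \<le> F r + ln r / 2"
      proof (rule DERIV_nonneg_imp_nondecreasing[OF that(2)])
        fix t assume t: "q \<le> t" "t \<le> r"
        have "((\<lambda>t. F t + ln t / 2) has_real_derivative (g t + 1 / t / 2)) (at t)"
          using t that by (intro DERIV_add Fd DERIV_cdivide DERIV_ln_divide) auto
        moreover have "g t + 1 / t / 2 = (1 - B t) / (2 * t)"
          using t that by (simp add: g_def field_simps)
        moreover have "0 \<le> (1 - B t) / (2 * t)" using t that B01 by auto
        ultimately show "\<exists>y. ((\<lambda>t. F t + ln t / 2) has_real_derivative y) (at t) \<and> 0 \<le> y" by auto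
      qed
      then show ?thesis using that by (simp add: ln_div field_simps)
    qed
    define E where "E = exp (- 3 * \<eta>)"
    have le: "2 * a ^ 2 \<le> \<rho> ^ 2 / 2"
    proof -
      have "(2 * a) ^ 2 \<le> \<rho> ^ 2" by (rule power_mono) (use a in auto)
      then show ?thesis by (simp add: power_mult_distrib)
    qed
    have "F (2 * a ^ 2) + E * ln (2 * a ^ 2) / 2 \<ge> F (\<rho> ^ 2 / 2) + E * ln (\<rho> ^ 2 / 2) / 2"
    proof (rule DERIV_nonpos_imp_nonincreasing[OF le, where f="\<lambda>t. F t + E * ln t / 2"])
      fix t assume t: "2 * a ^ 2 \<le> t" "t \<le> \<rho> ^ 2 / 2"
      have "0 < 2 * a ^ 2" using a by simp
      then have t0: "0 < t" using t by linarith
      have "((\<lambda>t. F t + E * ln t / 2) has_real_derivative (g t + E * (1 / t) / 2)) (at t)"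
        using t0 by (intro DERIV_add Fd DERIV_cdivide DERIV_cmult DERIV_ln_divide)
      moreover have e: "g t + E * (1 / t) / 2 = (E - B t) / (2 * t)"
        using t0 by (simp add: g_def field_simps)
      moreover have "(E - B t) / (2 * t) \<le> 0"
        using t0 Blow[OF t] unfolding E_def[symmetric] by (intro divide_nonpos_nonneg) simp_all
      ultimately show "\<exists>y. ((\<lambda>t. F t + E * ln t / 2) has_real_derivative y) (at t) \<and> y \<le> 0"
        by (intro exI[of _ "g t + E * (1 / t) / 2"]) simp
    qed
    moreover have "0 \<le> F (\<rho> ^ 2 / 2)"
    proof -
      have "F (\<rho> ^ 2) \<le> F (\<rho> ^ 2 / 2)" by (rule anti) simp
      then show ?thesis by (simp only: F\<rho>)
    qed
    moreover have "F (2 * a ^ 2) \<le> F 0" by (rule anti) simp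
    moreover have "E * ln (\<rho> ^ 2 / 2) / 2 - E * ln (2 * a ^ 2) / 2 = E * (ln (\<rho> / a) - ln 2)"
    proof -
      have "ln (\<rho> ^ 2 / 2) = 2 * ln \<rho> - ln 2" using \<rho> by (simp add: ln_div ln_realpow)
      moreover have "ln (2 * a ^ 2) = ln 2 + 2 * ln a" using a by (simp add: ln_mult ln_realpow)
      moreover have "ln (\<rho> / a) = ln \<rho> - ln a" using a \<rho> by (simp add: ln_div)
      moreover have "E * (2 * x - l) / 2 - E * (l + 2 * y) / 2 = E * (x - y - l)" for x y l :: real
        by (simp add: field_simps)
      ultimately show ?thesis by (simp only:)
    qed
    moreover have "z \<le> F 0" if "y + B \<ge> x + A" "0 \<le> x" "y \<le> F 0" "A - B = z" for x y z A B :: real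
      using that by linarith
    ultimately show "exp (- 3 * \<eta>) * (ln (\<rho> / a) - ln 2) \<le> F 0"
      unfolding E_def[symmetric] by blast
  qed
qed

section \<open>Function spaces, test functions and the distance to the boundary\<close>

lemma nn_integral_lebesgue_on:
  assumes "\<Omega> \<in> sets borel"
  shows "(\<integral>\<^sup>+x. f x \<partial>lebesgue_on \<Omega>) = (\<integral>\<^sup>+x. f x * indicator \<Omega> x \<partial>lborel)"
  using assms by (subst nn_integral_restrict_space) (auto simp: nn_integral_completion)

text \<open>
  The diagonal \<open>x = y\<close> is consistent as well: there both numerators vanish.
\<close>

lemma gagliardo_eq_energy:
  fixes u :: "'a::euclidean_space \<Rightarrow> real" and s p :: real
  assumes "\<Omega> \<in> sets borel" "s * p = real DIM('a)"
  shows "gagliardo \<Omega> s p u = ennpowr (energy \<Omega> p u) (1 / p)"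
proof -
  have "norm z powr (real DIM('a) + s * p) = norm z ^ (2 * DIM('a))" for z :: 'a
  proof -
    have e: "real DIM('a) + s * p = real (2 * DIM('a))" using assms(2) by simp
    show ?thesis
    proof (cases "z = 0")
      case False
      then show ?thesis unfolding e by (intro powr_realpow) simp
    qed simp
  qed
  then show ?thesis
    unfolding gagliardo_def energy_def
    by (simp add: nn_integral_lebesgue_on[OF assms(1)] dist_norm)
qed

lemma gagliardo_le_iff_energy:
  fixes u :: "'a::euclidean_space \<Rightarrow> real" and s p :: real
  assumes "\<Omega> \<in> sets borel" "s * p = real DIM('a)" "0 < p" "0 \<le> B"
  shows "gagliardo \<Omega> s p u \<le> ennreal B \<longleftrightarrow> energy \<Omega> p u \<le> ennreal (B powr p)"
  unfolding gagliardo_eq_energy[OF assms(1,2)] by (rule ennpowr_inverse_le_iff) fact+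

lemma energy_mono: "A \<subseteq> B \<Longrightarrow> energy A p u \<le> energy B p u"
  unfolding energy_def
  by (intro nn_integral_mono mult_mono) (auto split: split_indicator)

lemma energy_cmult:
  fixes u :: "'a::euclidean_space \<Rightarrow> real"
  assumes [measurable]: "u \<in> borel_measurable borel" "\<Omega> \<in> sets borel" and "0 < p"
  shows "energy \<Omega> p (\<lambda>x. k * u x) = ennreal (\<bar>k\<bar> powr p) * energy \<Omega> p u"
proof -
  have e: "ennreal (\<bar>k * u x - k * u y\<bar> powr p / dist x y ^ (2 * DIM('a))) =
     ennreal (\<bar>k\<bar> powr p) * ennreal (\<bar>u x - u y\<bar> powr p / dist x y ^ (2 * DIM('a)))" for x y
    by (simp add: abs_mult powr_mult right_diff_distrib[symmetric] flip: ennreal_mult)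
  show ?thesis unfolding energy_def e
    by (simp add: mult.assoc nn_integral_cmult)
qed

text \<open>
  The tail of the exponential series, which makes the nonnegativity and monotonicity of
  \<^const>\<open>trunc_exp\<close> visible.
\<close>

lemma trunc_exp_sums: "(\<lambda>n. t ^ (n + n0) / fact (n + n0)) sums trunc_exp n0 t"
proof -
  have "(\<lambda>n. t ^ n / fact n) sums exp t"
    using exp_converges[of t] by (simp add: scaleR_conv_of_real divide_inverse mult.commute)
  then show ?thesis
    unfolding trunc_exp_def by (subst sums_iff_shift) simp
qed

lemma trunc_exp_nonneg: "0 \<le> t \<Longrightarrow> 0 \<le> trunc_exp n t"
  by (rule sums_le[OF _ sums_zero trunc_exp_sums]) simp

lemma trunc_exp_mono: "0 \<le> t \<Longrightarrow> t \<le> r \<Longrightarrow> trunc_exp n t \<le> trunc_exp n r"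
  by (rule sums_le[OF _ trunc_exp_sums trunc_exp_sums]) (intro divide_right_mono power_mono, auto)

lemma continuous_on_bdist: "continuous_on S (bdist \<Omega>)"
  unfolding bdist_def by (intro continuous_intros)

lemma borel_measurable_bdist [measurable]: "bdist \<Omega> \<in> borel_measurable borel"
  by (intro borel_measurable_continuous_onI continuous_on_bdist)

lemma bdist_nonneg [simp]: "0 \<le> bdist \<Omega> x"
  by (simp add: bdist_def infdist_nonneg)

lemma bdist_lipschitz: "bdist \<Omega> x \<le> bdist \<Omega> y + dist x y"
  unfolding bdist_def by (rule infdist_triangle)

lemma bdist_le_inradius: "bounded_lipschitz_domain \<Omega> \<Longrightarrow> x \<in> \<Omega> \<Longrightarrow> bdist \<Omega> x \<le> inradius \<Omega>"
  unfolding inradius_def by (intro cSUP_upper bdd_above_bdist)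

lemma emeasure_bounded_less_top: "bounded A \<Longrightarrow> emeasure lborel A < \<infinity>"
  by (rule emeasure_bounded_finite)

lemma test_function_continuous: "u \<in> test_functions \<Omega> \<Longrightarrow> continuous_on S u"
  using Ck.simps(1)[of u] continuous_on_subset unfolding test_functions_def by blast

lemma test_function_measurable: "u \<in> test_functions \<Omega> \<Longrightarrow> u \<in> borel_measurable borel"
  by (intro borel_measurable_continuous_onI test_function_continuous)

lemma test_function_bounded:
  assumes "u \<in> test_functions \<Omega>"
  obtains B where "0 \<le> B" "\<And>x. \<bar>u x\<bar> \<le> B"
proof -
  let ?K = "closure {x. u x \<noteq> 0}"
  have "compact (u ` ?K)"
    using assms by (intro compact_continuous_image test_function_continuous) (auto simp: test_functions_def)
  then obtain B where B: "\<And>x. x \<in> ?K \<Longrightarrow> \<bar>u x\<bar> \<le> B"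
    using compact_imp_bounded by (fastforce simp: bounded_iff)
  have "\<bar>u x\<bar> \<le> max B 0" for x
    using B[of x] closure_subset[of "{x. u x \<noteq> 0}"] by (cases "u x = 0") auto
  then show ?thesis using that[of "max B 0"] by simp
qed

lemma test_function_in_wsp0:
  fixes u :: "'a::euclidean_space \<Rightarrow> real"
  assumes u: "u \<in> test_functions \<Omega>" and \<Omega>: "open \<Omega>" "bounded \<Omega>" and p: "0 < p"
    and fin: "gagliardo \<Omega> s p u < \<infinity>"
  shows "u \<in> wsp0 \<Omega> s p"
proof -
  have [measurable]: "u \<in> borel_measurable borel" "\<Omega> \<in> sets borel"
    using u \<Omega> by (auto intro: test_function_measurable)
  obtain B where B: "0 \<le> B" "\<And>x. \<bar>u x\<bar> \<le> B" using test_function_bounded[OF u] by blast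
  have "(\<integral>\<^sup>+x. ennreal (\<bar>u x\<bar> powr p) \<partial>lebesgue_on \<Omega>) \<le> (\<integral>\<^sup>+x. ennreal (B powr p) * indicator \<Omega> x \<partial>lborel)"
    unfolding nn_integral_lebesgue_on[OF \<open>\<Omega> \<in> sets borel\<close>]
    using B p by (intro nn_integral_mono mult_right_mono ennreal_leI powr_mono2) auto
  also have "\<dots> = ennreal (B powr p) * emeasure lborel \<Omega>"
    by (subst nn_integral_cmult_indicator) auto
  also have "\<dots> < \<infinity>"
    using emeasure_bounded_less_top[OF \<Omega>(2)] by (simp add: ennreal_mult_less_top)
  finally have "lp_norm \<Omega> p u < \<infinity>"
    unfolding lp_norm_def ennpowr_less_top_iff .
  then have "u \<in> wsp \<Omega> s p"
    using fin by (auto simp: wsp_def intro!: measurable_restrict_space1 measurable_completion)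
  moreover have "wsp_norm \<Omega> s p (\<lambda>x. u x - u x) = 0"
    by (simp add: wsp_norm_def gagliardo_def lp_norm_def)
  ultimately show ?thesis
    using u unfolding wsp0_def by (auto intro!: exI[of _ "\<lambda>_. u"])
qed

section \<open>Moser functions and unboundedness above the critical exponent\<close>

text \<open>
  The energy of the cut-off logarithm per unit of its height.
\<close>

definition moser_energy :: "nat \<Rightarrow> real \<Rightarrow> real" where
  "moser_energy d p = 2 * log_kernel_const d p * (real d * unit_ball_vol d)"

text \<open>
  Rewriting the factorials as binomial coefficients turns the critical exponent into the value at which
  the growth of the Moser functions balances the volume \<open>exp (- d * L)\<close> of their plateaus.
\<close>

lemma alpha_star_eq:
  assumes d: "0 < d" and s: "0 < s" "s < 1" "s * p = real d" and p: "real d < p"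
  shows "alpha_star d s p = real d * moser_energy d p powr (1 / (p - 1))"
proof -
  have c: "fact (d + n - 1) / fact n = fact (d - 1) * real ((d + n - 1) choose n)" for n
  proof -
    have "real ((d + n - 1) choose n) = fact (d + n - 1) / (fact n * fact (d - 1))"
      using d by (subst binomial_fact) auto
    then show ?thesis by (simp add: field_simps)
  qed
  have sm: "summable (\<lambda>n. real ((d + n - 1) choose n) / real (d + 2 * n) powr p)"
    using summable_log_kernel[OF d p] .
  define S where "S = (\<Sum>n. real ((d + n - 1) choose n) / real (d + 2 * n) powr p)"
  have 1: "(\<Sum>n. fact (d + n - 1) / fact n * (1 / real (d + 2 * n) powr p)) = fact (d - 1) * S"
    unfolding S_def c using suminf_mult[OF sm, of "fact (d - 1)"] by (simp add: mult.assoc)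
  have 2: "log_kernel_const d p = unit_ball_vol d * (Gamma (p + 1) * S)"
    unfolding log_kernel_const_def S_def using suminf_mult[OF sm, of "Gamma (p + 1)"]
    by (simp add: mult_ac)
  have 3: "(fact d :: real) = real d * fact (d - 1)"
    using d by (simp add: fact_reduce)
  have "2 * (real d * unit_ball_vol (real d))\<^sup>2 * Gamma (p + 1) / fact d * (fact (d - 1) * S) = moser_energy d p"
    unfolding moser_energy_def 2 3 using d by (simp add: power2_eq_square)
  moreover have "s / (real d - s) = 1 / (p - 1)"
    using s d p by (simp add: field_simps)
  ultimately show ?thesis
    unfolding alpha_star_def 1 by simp
qed

lemma trunc_exp_growth:
  fixes b k :: real
  assumes "0 < k" "k < b"
  shows "filterlim (\<lambda>L. exp (- k * L) * trunc_exp n (b * L)) at_top at_top"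
proof -
  have "((\<lambda>L. exp (- k * L) * (b * L) ^ i) \<longlongrightarrow> 0) at_top" for i
    using assms by real_asymp
  then have "((\<lambda>L. \<Sum>i<n. (exp (- k * L) * (b * L) ^ i) * (1 / fact i)) \<longlongrightarrow> (\<Sum>i<n. 0 * (1 / fact i))) at_top"
    by (intro tendsto_sum tendsto_mult_right)
  then have "((\<lambda>L. - (\<Sum>i<n. (exp (- k * L) * (b * L) ^ i) * (1 / fact i))) \<longlongrightarrow> - 0) at_top"
    by (intro tendsto_minus) simp
  moreover have "filterlim (\<lambda>L. exp ((b - k) * L)) at_top at_top"
    using assms by (intro filterlim_compose[OF exp_at_top] filterlim_tendsto_pos_mult_at_top[OF tendsto_const] filterlim_ident) auto
  ultimately have "filterlim (\<lambda>L. - (\<Sum>i<n. (exp (- k * L) * (b * L) ^ i) * (1 / fact i)) + exp ((b - k) * L)) at_top at_top"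
    by (rule filterlim_tendsto_add_at_top)
  moreover have "- (\<Sum>i<n. (exp (- k * L) * (b * L) ^ i) * (1 / fact i)) + exp ((b - k) * L) = exp (- k * L) * trunc_exp n (b * L)" for L
    by (simp add: trunc_exp_def right_diff_distrib sum_distrib_left left_diff_distrib flip: exp_add)
  ultimately show ?thesis by simp
qed

text \<open>
  The plateau radius is \<open>\<rho> * exp (- L)\<close>.  Dividing the smooth cut-off logarithm by the \<open>p\<close>-th root of the
  bound for its energy normalises the seminorm to at most \<open>1\<close>.
\<close>

lemma moser_function_exists:
  fixes \<Omega> :: "'a::euclidean_space set" and p s L \<rho> \<theta> :: real
  assumes \<Omega>: "open \<Omega>" "bounded \<Omega>" and p: "real DIM('a) < p" "s * p = real DIM('a)"
    and L: "ln 2 \<le> L" and \<rho>: "0 < \<rho>" "cball c \<rho> \<subseteq> \<Omega>" and \<theta>: "0 < \<theta>"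
  obtains u where "u \<in> wsp0 \<Omega> s p" "u \<in> borel_measurable borel" "gagliardo \<Omega> s p u \<le> 1"
    "\<And>x. 0 \<le> u x" "\<And>x. u x \<le> u c" "\<And>x. x \<notin> cball c \<rho> \<Longrightarrow> u x = 0"
    "\<And>x. dist x c \<le> \<rho> * exp (- L) \<Longrightarrow> u x = u c"
    "exp (- 3 * \<theta>) * (L - ln 2) / (moser_energy DIM('a) p * (L + 1 / DIM('a))) powr (1 / p) \<le> u c"
proof -
  let ?d = "DIM('a)"
  define a where "a = \<rho> * exp (- L)"
  have p0: "0 < p" by (rule le_less_trans[OF of_nat_0_le_iff p(1)])
  have L0: "0 < L" using L ln_gt_zero[of "2::real"] by linarith
  have "exp (- L) \<le> exp (- ln 2)" using L by simp
  then have "exp (- L) \<le> 1 / 2" by (simp add: exp_minus)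
  then have a: "0 < a" "2 * a \<le> \<rho>" "a < \<rho>" using \<rho> L0 by (simp_all add: a_def)
  have "\<rho> / a = exp L" using \<rho> by (simp add: a_def exp_minus divide_inverse)
  then have lna: "ln (\<rho> / a) = L" by simp
  obtain F where F: "smooth_real F" "\<And>q. q \<le> a ^ 2 \<Longrightarrow> F q = F 0" "\<And>q. \<rho> ^ 2 \<le> q \<Longrightarrow> F q = 0"
    "\<And>q r. q \<le> r \<Longrightarrow> F r \<le> F q" "\<And>q r. 0 < q \<Longrightarrow> q \<le> r \<Longrightarrow> F q - F r \<le> ln (r / q) / 2"
    "exp (- 3 * \<theta>) * (ln (\<rho> / a) - ln 2) \<le> F 0"
    by (rule moser_profile[OF a(1,2) \<theta>], rule that)
  define v where "v x = F (dist x c ^ 2)" for x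
  define N where "N = (moser_energy ?d p * (L + 1 / ?d)) powr (1 / p)"
  define u where "u x = (1 / N) * v x" for x
  have E0: "0 < moser_energy ?d p * (L + 1 / ?d)"
    unfolding moser_energy_def using log_kernel_const_pos[OF _ p(1)] L0
    by (intro mult_pos_pos add_pos_pos) auto
  then have N: "0 < N" by (metis N_def less_irrefl powr_gt_zero)
  have smv: "smooth_fun v"
    unfolding v_def by (rule smooth_fun.compose[OF F(1) smooth_fun_dist2])
  have smu: "smooth_fun u"
    unfolding u_def by (rule smooth_fun.mult[OF smooth_fun.const smv])
  have [measurable]: "v \<in> borel_measurable borel"
    using smooth_fun_Ck[OF smv, of 0] by (intro borel_measurable_continuous_onI) simp
  have F0: "0 \<le> F q" for q using F(3)[of "max q (\<rho> ^ 2)"] F(4)[of q "max q (\<rho> ^ 2)"] by simp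
  have out: "v x = 0" if "\<rho> \<le> dist x c" for x
    unfolding v_def using that \<rho> by (intro F(3) power_mono) auto
  have en: "energy UNIV p v \<le> ennreal (moser_energy ?d p * (L + 1 / ?d))"
    unfolding moser_energy_def lna[symmetric]
  proof (rule energy_radial_le[OF p(1) a(1,3)])
    show "v x = v y" if "dist x c = dist y c" for x y using that by (simp add: v_def)
    show "v x = v y" if "dist x c \<le> a" "dist y c \<le> a" for x y
      using F(2)[of "dist x c ^ 2"] F(2)[of "dist y c ^ 2"] that by (simp add: v_def power_mono)
    show "\<bar>v x - v y\<bar> \<le> ln (dist x c / dist y c)"
      if "0 < dist y c" "dist y c < dist x c" "dist x c \<le> \<rho>" for x y
    proof -
      have le: "dist y c ^ 2 \<le> dist x c ^ 2" using that by (intro power_mono) auto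
      have "v y - v x \<le> ln (dist x c ^ 2 / dist y c ^ 2) / 2"
        unfolding v_def using that le by (intro F(5)) auto
      also have "\<dots> = ln (dist x c / dist y c)"
        using that by (simp add: power_divide[symmetric] ln_realpow)
      finally show ?thesis using F(4)[OF le] by (simp add: v_def)
    qed
  qed (use out in auto)
  have Nu: "N powr p = moser_energy ?d p * (L + 1 / ?d)"
    using p0 E0 by (simp add: N_def powr_powr)
  have "energy \<Omega> p u \<le> energy UNIV p u" by (rule energy_mono) simp
  also have "\<dots> = ennreal (\<bar>1 / N\<bar> powr p) * energy UNIV p v"
    unfolding u_def using p0 by (intro energy_cmult) auto
  also have "\<dots> \<le> ennreal (\<bar>1 / N\<bar> powr p) * ennreal (moser_energy ?d p * (L + 1 / ?d))"
    by (intro mult_left_mono en) auto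
  also have "\<dots> = ennreal 1"
    unfolding Nu[symmetric] using N by (simp add: powr_divide flip: ennreal_mult)
  finally have "energy \<Omega> p u \<le> ennreal (1 powr p)" by simp
  then have gag: "gagliardo \<Omega> s p u \<le> 1"
    using gagliardo_le_iff_energy[of \<Omega> s p 1 u] \<Omega> p p0 by simp
  have supp: "{x. u x \<noteq> 0} \<subseteq> cball c \<rho>"
    using out by (force simp: u_def dist_commute)
  then have cl: "closure {x. u x \<noteq> 0} \<subseteq> cball c \<rho>"
    by (rule closure_minimal) simp
  have tf: "u \<in> test_functions \<Omega>"
    unfolding test_functions_def using smooth_fun_Ck[OF smu] \<rho>(2)
    using bounded_subset[OF bounded_cball cl] by (simp add: compact_eq_bounded_closed order_trans[OF cl])
  show ?thesis
  proof
    show "u \<in> wsp0 \<Omega> s p"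
      by (intro test_function_in_wsp0 tf \<Omega> p0 le_less_trans[OF gag]) simp
    show "u \<in> borel_measurable borel" by (rule test_function_measurable[OF tf])
    show "gagliardo \<Omega> s p u \<le> 1" by fact
    show "0 \<le> u x" for x using N F0 by (simp add: u_def v_def)
    show "u x \<le> u c" for x using N F(4)[of 0 "dist x c ^ 2"] by (simp add: u_def v_def divide_right_mono)
    show "u x = 0" if "x \<notin> cball c \<rho>" for x using supp that by blast
    show "u x = u c" if "dist x c \<le> \<rho> * exp (- L)" for x
      using F(2)[of "dist x c ^ 2"] that by (simp add: u_def v_def a_def power_mono)
    show "exp (- 3 * \<theta>) * (L - ln 2) / (moser_energy DIM('a) p * (L + 1 / DIM('a))) powr (1 / p) \<le> u c"
      using F(6) N unfolding N_def[symmetric] lna by (simp add: u_def v_def divide_right_mono)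
  qed
qed

text \<open>
  On the plateau the functional \<^const>\<open>mt_X\<close> loses only a factor \<open>1 - \<theta>\<close>.  In dimension one the mean of
  \<open>u\<close> is at most \<open>\<theta> * m\<close>, because the support is small, and the logarithmic weight is at most \<open>1\<close>, because the
  point is far from the boundary.
\<close>

lemma mt_X_ge_near_center:
  fixes u :: "'a::euclidean_space \<Rightarrow> real"
  assumes dom: "bounded_lipschitz_domain \<Omega>" and [measurable]: "u \<in> borel_measurable borel"
    and u: "\<And>x. 0 \<le> u x" "\<And>x. u x \<le> m" "\<And>x. x \<notin> cball c \<rho> \<Longrightarrow> u x = 0"
    and \<rho>: "0 < \<rho>" "\<rho> \<le> inradius \<Omega> / 10" "unit_ball_vol DIM('a) * \<rho> ^ DIM('a) \<le> \<theta> * measure lebesgue \<Omega>"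
    and c: "9 / 10 * inradius \<Omega> < bdist \<Omega> c" and x: "x \<in> \<Omega>" "dist x c \<le> \<rho>" "u x = m"
    and vol: "0 < measure lebesgue \<Omega>" and \<theta>: "0 < \<theta>" "\<theta> < 1"
  shows "(1 - \<theta>) * m \<le> mt_X \<Omega> u x"
proof -
  let ?R = "inradius \<Omega>" and ?w = "unit_ball_vol (real DIM('a))"
  have [measurable]: "\<Omega> \<in> sets borel" using dom by (auto simp: bounded_lipschitz_domain_def)
  have m: "0 \<le> m" using u(1)[of x] x by simp
  have avg: "0 \<le> average \<Omega> u \<and> average \<Omega> u \<le> \<theta> * m"
  proof -
    have "(\<integral>\<^sup>+y. ennreal (u y) \<partial>lebesgue_on \<Omega>) \<le> (\<integral>\<^sup>+y. ennreal m * indicator (cball c \<rho>) y \<partial>lborel)"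
      unfolding nn_integral_lebesgue_on[OF \<open>\<Omega> \<in> sets borel\<close>]
      by (intro nn_integral_mono) (use u in \<open>auto split: split_indicator intro: ennreal_leI\<close>)
    also have "\<dots> = ennreal m * ennreal (?w * \<rho> ^ DIM('a))"
      using \<rho>(1) by (subst nn_integral_cmult_indicator) (auto simp: emeasure_cball)
    also have "\<dots> = ennreal (m * (?w * \<rho> ^ DIM('a)))"
      using m \<rho>(1) by (intro ennreal_mult[symmetric]) auto
    finally have le: "(\<integral>\<^sup>+y. ennreal (u y) \<partial>lebesgue_on \<Omega>) \<le> ennreal (m * (?w * \<rho> ^ DIM('a)))" .
    have "(LINT y|lebesgue_on \<Omega>. u y) = enn2real (\<integral>\<^sup>+y. ennreal (u y) \<partial>lebesgue_on \<Omega>)"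
      using u(1) by (intro integral_eq_nn_integral measurable_restrict_space1 measurable_completion) auto
    then have "0 \<le> (LINT y|lebesgue_on \<Omega>. u y)" "(LINT y|lebesgue_on \<Omega>. u y) \<le> m * (?w * \<rho> ^ DIM('a))"
      using enn2real_leI[OF _ le] m \<rho>(1) by auto
    moreover have "m * (?w * \<rho> ^ DIM('a)) \<le> m * (\<theta> * measure lebesgue \<Omega>)"
      using m \<rho>(3) by (intro mult_left_mono)
    ultimately have "0 \<le> (LINT y|lebesgue_on \<Omega>. u y)" "(LINT y|lebesgue_on \<Omega>. u y) \<le> \<theta> * m * measure lebesgue \<Omega>"
      by (auto simp: mult_ac)
    then show ?thesis
      using vol by (simp add: average_def divide_le_eq)
  qed
  show ?thesis
  proof (cases "DIM('a) = 1")
    case False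
    then show ?thesis using m \<theta> x by (simp add: mt_X_def mult_left_le_one_le)
  next
    case True
    have R: "0 < ?R" by (rule inradius_pos[OF dom])
    have "bdist \<Omega> c \<le> bdist \<Omega> x + dist c x" by (rule bdist_lipschitz)
    then have lo: "8 / 10 * ?R \<le> bdist \<Omega> x" using c \<rho> x by (simp add: dist_commute)
    have up: "bdist \<Omega> x \<le> ?R" by (rule bdist_le_inradius[OF dom x(1)])
    have bp: "0 < bdist \<Omega> x" using lo R by linarith
    have "1 < 2 * ?R / bdist \<Omega> x" using up R bp by (simp add: field_simps)
    then have l0: "0 < ln (2 * ?R / bdist \<Omega> x)" by simp
    have "2 * ?R / bdist \<Omega> x \<le> 5 / 2" using lo bp by (simp add: field_simps)
    \<comment> \<open>the point of the factors \<open>9 / 10\<close> and \<open>1 / 10\<close>: \<open>2 * R / bdist \<Omega> x\<close> stays below \<open>exp 1\<close>\<close>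
    also have "5 / 2 \<le> exp (1::real)" using exp_lower_Taylor_quadratic[of 1] by simp
    finally have "ln (2 * ?R / bdist \<Omega> x) \<le> ln (exp 1)"
      using bp R by (intro ln_mono) auto
    then have l1: "ln (2 * ?R / bdist \<Omega> x) \<le> 1" by simp
    have "(1 - \<theta>) * m \<le> \<bar>u x - average \<Omega> u\<bar>"
    proof -
      have "(1 - \<theta>) * m = m - \<theta> * m" by (simp add: algebra_simps)
      then show ?thesis using avg x by linarith
    qed
    also have "\<dots> \<le> \<bar>u x - average \<Omega> u\<bar> / ln (2 * ?R / bdist \<Omega> x)"
      using l0 l1 by (simp add: le_divide_eq mult_left_le)
    also have "\<dots> = mt_X \<Omega> u x" using True by (simp add: mt_X_def)
    finally show ?thesis .
  qed
qed

lemma mt_integral_ge: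
  fixes u :: "'a::euclidean_space \<Rightarrow> real"
  assumes dom: "bounded_lipschitz_domain \<Omega>" and B: "ball c a \<subseteq> \<Omega>" and a: "0 < a"
    and X: "\<And>x. x \<in> ball c a \<Longrightarrow> k \<le> mt_X \<Omega> u x" and k: "0 \<le> k" and \<alpha>: "0 \<le> \<alpha>"
    and s: "s < 1"
  shows "ennreal (unit_ball_vol DIM('a) * (a / inradius \<Omega>) ^ DIM('a) * trunc_exp n0 (\<alpha> * k powr (real DIM('a) / (real DIM('a) - s))))
    \<le> mt_integral \<Omega> s n0 \<alpha> u"
proof -
  let ?R = "inradius \<Omega>" and ?w = "unit_ball_vol (real DIM('a))" and ?q = "real DIM('a) / (real DIM('a) - s)"
  have R: "0 < ?R" by (rule inradius_pos[OF dom])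
  have "1 \<le> real DIM('a)" by (simp add: Suc_le_eq)
  then have "0 \<le> real DIM('a) - s" using s by linarith
  then have q: "0 \<le> ?q" by (intro divide_nonneg_nonneg) auto
  define T where "T = trunc_exp n0 (\<alpha> * k powr ?q)"
  have T: "0 \<le> T" unfolding T_def using \<alpha> by (intro trunc_exp_nonneg) auto
  have \<Omega>: "\<Omega> \<in> sets borel" using dom by (auto simp: bounded_lipschitz_domain_def)
  have "ennreal (?w * (a / ?R) ^ DIM('a) * T) = ennreal (T / ?R ^ DIM('a)) * ennreal (?w * a ^ DIM('a))"
    using R T a by (subst ennreal_mult[symmetric]) (auto simp: power_divide)
  also have "\<dots> = (\<integral>\<^sup>+x. ennreal (T / ?R ^ DIM('a)) * indicator (ball c a) x \<partial>lborel)"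
    using a by (subst nn_integral_cmult_indicator) (auto simp: emeasure_ball)
  also have "\<dots> \<le> mt_integral \<Omega> s n0 \<alpha> u"
    unfolding mt_integral_def nn_integral_lebesgue_on[OF \<Omega>]
  proof (rule nn_integral_mono)
    fix x
    show "ennreal (T / ?R ^ DIM('a)) * indicator (ball c a) x \<le>
      ennreal (trunc_exp n0 (\<alpha> * mt_X \<Omega> u x powr ?q) / bdist \<Omega> x ^ DIM('a)) * indicator \<Omega> x"
    proof (cases "x \<in> ball c a")
      case True
      then have x: "x \<in> \<Omega>" using B by blast
      have "T \<le> trunc_exp n0 (\<alpha> * mt_X \<Omega> u x powr ?q)"
        unfolding T_def using X[OF True] k \<alpha> q
        by (intro trunc_exp_mono mult_left_mono powr_mono2) auto
      moreover have "bdist \<Omega> x ^ DIM('a) \<le> ?R ^ DIM('a)"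
        by (intro power_mono bdist_le_inradius[OF dom x]) simp
      ultimately have "T / ?R ^ DIM('a) \<le> trunc_exp n0 (\<alpha> * mt_X \<Omega> u x powr ?q) / bdist \<Omega> x ^ DIM('a)"
        using T bdist_pos[OF dom x] by (intro frac_le) auto
      then show ?thesis using True x by (simp add: ennreal_leI del: mem_ball)
    qed simp
  qed
  finally show ?thesis unfolding T_def .
qed

text \<open>
  Up to factors tending to \<open>1\<close> the functional of the Moser function of height parameter \<open>L\<close> is at least
  \<open>exp (- d * L) * trunc_exp n0 (\<sigma>' * L)\<close> with a number \<open>\<sigma>' > d\<close>, and this tends to infinity with \<open>L\<close>.
\<close>

theorem moser_trudinger_supercritical:
  fixes \<Omega> :: "'a::euclidean_space set" and p s :: real
  assumes dom: "bounded_lipschitz_domain \<Omega>" and s: "0 < s" "s < 1" and p: "1 < p" and sp: "s * p = real DIM('a)"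
    and \<alpha>: "alpha_star DIM('a) s p < \<alpha>"
  shows "(SUP u\<in>{u \<in> wsp0 \<Omega> s p. gagliardo \<Omega> s p u \<le> 1}. mt_integral \<Omega> s n0 \<alpha> u) = \<infinity>"
proof -
  let ?d = "DIM('a)" and ?R = "inradius \<Omega>" and ?w = "unit_ball_vol (real DIM('a))"
  define d where "d = real ?d"
  define \<gamma> where "\<gamma> = moser_energy ?d p"
  define e where "e = 1 / (p - 1)"
  define q where "q = real ?d / (real ?d - s)"
  have d: "1 \<le> d" using DIM_positive[where 'a='a] unfolding d_def by linarith
  have dp: "d < p" unfolding d_def sp[symmetric] using s p by simp
  have dp': "real ?d < p" using dp by (simp add: d_def)
  have \<gamma>: "0 < \<gamma>"
    unfolding \<gamma>_def moser_energy_def using log_kernel_const_pos[OF _ dp'] by simp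
  have s_eq: "s = d / p" using sp p by (simp add: d_def field_simps)
  have q_eq: "q = 1 + e"
    unfolding q_def e_def d_def[symmetric] s_eq using d p by (simp add: field_simps)
  have qp: "q / p = e"
    unfolding q_eq e_def using p by (simp add: field_simps)
  have e: "0 < e" using p by (simp add: e_def)
  have \<alpha>1: "d < \<alpha> * 1 powr q / \<gamma> powr e"
    using \<alpha> alpha_star_eq[OF DIM_positive[where 'a='a] s sp dp'] \<gamma>
    by (simp add: d_def \<gamma>_def[symmetric] e_def[symmetric] less_divide_eq)
  have \<alpha>0: "0 < \<alpha>"
  proof -
    have "0 < \<alpha> / \<gamma> powr e" using \<alpha>1 d by simp
    then show ?thesis using \<gamma> by (simp add: zero_less_divide_iff)
  qed
  have "((\<lambda>\<theta>. \<alpha> * ((1 - \<theta>) * exp (- 3 * \<theta>)) powr q / \<gamma> powr e) \<longlongrightarrow> \<alpha> * ((1 - 0) * exp (- 3 * 0)) powr q / \<gamma> powr e) (at_right 0)"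
    using \<gamma> by (intro tendsto_intros) auto
  then have "eventually (\<lambda>\<theta>. d < \<alpha> * ((1 - \<theta>) * exp (- 3 * \<theta>)) powr q / \<gamma> powr e) (at_right 0)"
    using \<alpha>1 by (intro order_tendstoD(1)) simp_all
  moreover have "eventually (\<lambda>\<theta>::real. 0 < \<theta> \<and> \<theta> < 1) (at_right 0)"
    by (rule eventually_at_rightI[of 0 1]) auto
  ultimately have "eventually (\<lambda>\<theta>. 0 < \<theta> \<and> \<theta> < 1 \<and> d < \<alpha> * ((1 - \<theta>) * exp (- 3 * \<theta>)) powr q / \<gamma> powr e) (at_right 0)"
    by eventually_elim simp
  then obtain \<theta> where \<theta>: "0 < \<theta>" "\<theta> < 1" "d < \<alpha> * ((1 - \<theta>) * exp (- 3 * \<theta>)) powr q / \<gamma> powr e"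
    using eventually_happens'[OF trivial_limit_at_right_real] by blast
  \<comment> \<open>\<open>\<sigma>\<close> is the growth rate in \<open>L\<close> left after the losses by \<open>\<theta>\<close>; the gap down to \<open>\<sigma>'\<close> absorbs the lower order terms in \<open>L\<close>\<close>
  define \<sigma> where "\<sigma> = \<alpha> * ((1 - \<theta>) * exp (- 3 * \<theta>)) powr q / \<gamma> powr e"
  obtain \<sigma>' where \<sigma>': "d < \<sigma>'" "\<sigma>' < \<sigma>" using \<theta>(3) dense unfolding \<sigma>_def by blast
  have R: "0 < ?R" by (rule inradius_pos[OF dom])
  have op: "open \<Omega>" "bounded \<Omega>" using dom by (auto simp: bounded_lipschitz_domain_def)
  have "9 / 10 * ?R < (SUP x\<in>\<Omega>. bdist \<Omega> x)" using R unfolding inradius_def[symmetric] by simp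
  then obtain c where c: "c \<in> \<Omega>" "9 / 10 * ?R < bdist \<Omega> c"
    using dom bdd_above_bdist[OF dom] by (subst (asm) less_cSUP_iff) (auto simp: bounded_lipschitz_domain_def)
  obtain \<rho>1 where \<rho>1: "0 < \<rho>1" "cball c \<rho>1 \<subseteq> \<Omega>" using op c open_contains_cball by blast
  have vol: "0 < measure lebesgue \<Omega>"
  proof -
    have "0 < measure lebesgue (ball c \<rho>1)" using \<rho>1 by simp
    also have "\<dots> \<le> measure lebesgue \<Omega>"
      using \<rho>1 op by (intro measure_mono_fmeasurable lmeasurable_open)
        (auto simp: subset_iff dest: less_imp_le)
    finally show ?thesis .
  qed
  have w: "0 < ?w" by simp
  define \<rho> where "\<rho> = min \<rho>1 (min (?R / 10) (min 1 (\<theta> * measure lebesgue \<Omega> / ?w)))"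
  have \<rho>: "0 < \<rho>" "\<rho> \<le> \<rho>1" "\<rho> \<le> ?R / 10" "\<rho> \<le> 1" "\<rho> \<le> \<theta> * measure lebesgue \<Omega> / ?w"
  proof -
    have "0 < \<theta> * measure lebesgue \<Omega> / ?w" using \<theta> vol w by simp
    then show "0 < \<rho>" "\<rho> \<le> \<rho>1" "\<rho> \<le> ?R / 10" "\<rho> \<le> 1" "\<rho> \<le> \<theta> * measure lebesgue \<Omega> / ?w"
      unfolding \<rho>_def using \<rho>1(1) R by linarith+
  qed
  have \<rho>sub: "cball c \<rho> \<subseteq> \<Omega>" using \<rho>1 \<rho>(2) by (meson order_trans subset_cball)
  have \<rho>vol: "?w * \<rho> ^ ?d \<le> \<theta> * measure lebesgue \<Omega>"
  proof -
    have "\<rho> ^ ?d \<le> \<rho> ^ 1" using \<rho> by (intro power_decreasing) (auto simp: Suc_le_eq)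
    also have "\<dots> \<le> \<theta> * measure lebesgue \<Omega> / ?w" using \<rho> by simp
    finally show ?thesis using w by (simp add: field_simps)
  qed
  define K where "K = ?w * (\<rho> / ?R) ^ ?d"
  have K: "0 < K" using w \<rho>(1) R by (simp add: K_def)
  define S where "S = (SUP u\<in>{u \<in> wsp0 \<Omega> s p. gagliardo \<Omega> s p u \<le> 1}. mt_integral \<Omega> s n0 \<alpha> u)"
  have bound: "ennreal (K * (exp (- d * L) * trunc_exp n0 (\<sigma>' * L))) \<le> S"
    if L: "ln 2 < L" "\<sigma>' * L \<le> \<sigma> * ((L - ln 2) * ((L - ln 2) / (L + 1 / d)) powr e)" for L
  proof -
    have L0: "0 < L" using L(1) ln_gt_zero[of "2::real"] by linarith
    define N where "N = \<gamma> * (L + 1 / d)"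
    have N: "0 < N" using \<gamma> L0 d by (auto simp: N_def intro!: mult_pos_pos add_pos_pos)
    obtain u where u: "u \<in> wsp0 \<Omega> s p" "u \<in> borel_measurable borel" "gagliardo \<Omega> s p u \<le> 1"
      "\<And>x. 0 \<le> u x" "\<And>x. u x \<le> u c" "\<And>x. x \<notin> cball c \<rho> \<Longrightarrow> u x = 0"
      "\<And>x. dist x c \<le> \<rho> * exp (- L) \<Longrightarrow> u x = u c"
      "exp (- 3 * \<theta>) * (L - ln 2) / N powr (1 / p) \<le> u c"
      using moser_function_exists[OF op dp' sp _ \<rho>(1) \<rho>sub \<theta>(1), of L] L(1)
      unfolding N_def \<gamma>_def d_def by (metis less_imp_le)
    define k where "k = (1 - \<theta>) * (exp (- 3 * \<theta>) * (L - ln 2) / N powr (1 / p))"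
    have k: "0 \<le> k" using \<theta> L N by (simp add: k_def)
    have aL: "\<rho> * exp (- L) \<le> \<rho>" using \<rho>(1) L0 by (simp add: mult_le_cancel_left1)
    have "ennreal (?w * (\<rho> * exp (- L) / ?R) ^ ?d * trunc_exp n0 (\<alpha> * k powr (real ?d / (real ?d - s)))) \<le> mt_integral \<Omega> s n0 \<alpha> u"
    proof (rule mt_integral_ge[OF dom])
      show "ball c (\<rho> * exp (- L)) \<subseteq> \<Omega>"
        using \<rho>sub aL by (auto simp: subset_iff dest!: less_imp_le)
      show "k \<le> mt_X \<Omega> u x" if "x \<in> ball c (\<rho> * exp (- L))" for x
      proof -
        have x: "dist x c \<le> \<rho> * exp (- L)" using that by (simp add: dist_commute)
        have "k \<le> (1 - \<theta>) * u c" unfolding k_def using \<theta> u(8) by (intro mult_left_mono) auto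
        also have "\<dots> \<le> mt_X \<Omega> u x"
          by (rule mt_X_ge_near_center[OF dom u(2,4,5,6) \<rho>(1,3) \<rho>vol c(2) _ _ u(7)[OF x] vol \<theta>(1,2)])
            (use x aL \<rho>sub in \<open>auto simp: subset_iff dist_commute\<close>)
        finally show ?thesis .
      qed
    qed (use \<rho>(1) k \<alpha>0 s in auto)
    moreover have "mt_integral \<Omega> s n0 \<alpha> u \<le> S"
      unfolding S_def using u by (intro SUP_upper) simp
    moreover have "K * (exp (- d * L) * trunc_exp n0 (\<sigma>' * L)) \<le> ?w * (\<rho> * exp (- L) / ?R) ^ ?d * trunc_exp n0 (\<alpha> * k powr (real ?d / (real ?d - s)))"
    proof -
      have ex: "exp (- d * L) = exp (- L) ^ ?d"
        using exp_of_nat_mult[of ?d "- L"] by (simp add: d_def)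
      have tk: "\<alpha> * k powr q = \<sigma> * ((L - ln 2) * ((L - ln 2) / (L + 1 / d)) powr e)"
      proof -
        have ba: "0 < L - ln 2" "0 < L + 1 / d" using L L0 d by (auto intro: add_pos_pos)
        have "k powr q = ((1 - \<theta>) * exp (- 3 * \<theta>)) powr q * ((L - ln 2) powr q / (N powr (1 / p)) powr q)"
          unfolding k_def using ba \<theta> N
          by (simp only: powr_mult powr_divide mult.assoc[symmetric] times_divide_eq_right)
        also have "(N powr (1 / p)) powr q = N powr e"
          using qp by (simp add: powr_powr)
        also have "\<dots> = \<gamma> powr e * (L + 1 / d) powr e"
          unfolding N_def by (simp only: powr_mult)
        also have "(L - ln 2) powr q = (L - ln 2) * (L - ln 2) powr e"
          unfolding q_eq using ba by (simp add: powr_add)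
        finally show ?thesis
          by (simp add: \<sigma>_def powr_divide)
      qed
      have "trunc_exp n0 (\<sigma>' * L) \<le> trunc_exp n0 (\<alpha> * k powr q)"
        unfolding tk using \<sigma>' d L0 L by (intro trunc_exp_mono) auto
      then have "K * (exp (- d * L) * trunc_exp n0 (\<sigma>' * L)) \<le> K * (exp (- d * L) * trunc_exp n0 (\<alpha> * k powr q))"
        using K by (intro mult_left_mono) auto
      also have "\<dots> = ?w * (\<rho> * exp (- L) / ?R) ^ ?d * trunc_exp n0 (\<alpha> * k powr q)"
        unfolding K_def ex by (simp add: power_mult_distrib power_divide)
      finally show ?thesis by (simp only: q_def)
    qed
    ultimately show ?thesis by (meson ennreal_leI order_trans)
  qed
  have lim: "((\<lambda>L. \<sigma> * ((L - ln 2) / L * ((L - ln 2) / (L + 1 / d)) powr e)) \<longlongrightarrow> \<sigma> * (1 * 1 powr e)) at_top"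
  proof (intro tendsto_mult tendsto_powr tendsto_const)
    show "((\<lambda>L. (L - ln 2) / L) \<longlongrightarrow> (1::real)) at_top" by real_asymp
    show "((\<lambda>L. (L - ln 2) / (L + 1 / d)) \<longlongrightarrow> 1) at_top" using d by real_asymp
  qed simp
  have ev1: "eventually (\<lambda>L. \<sigma>' < \<sigma> * ((L - ln 2) / L * ((L - ln 2) / (L + 1 / d)) powr e)) at_top"
    using \<sigma>'(2) by (intro order_tendstoD(1)[OF lim]) simp
  have "S = top"
    unfolding S_def
  proof (rule ennreal_SUP_eq_top)
    fix n :: nat
    show "\<exists>u\<in>{u \<in> wsp0 \<Omega> s p. gagliardo \<Omega> s p u \<le> 1}. of_nat n \<le> mt_integral \<Omega> s n0 \<alpha> u"
    proof -
      have "filterlim (\<lambda>L. exp (- d * L) * trunc_exp n0 (\<sigma>' * L)) at_top at_top"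
        using \<sigma>' d by (intro trunc_exp_growth) auto
      then have "eventually (\<lambda>L. (real n + 1) / K \<le> exp (- d * L) * trunc_exp n0 (\<sigma>' * L)) at_top"
        by (simp add: filterlim_at_top)
      then have "eventually (\<lambda>L. (real n + 1) / K \<le> exp (- d * L) * trunc_exp n0 (\<sigma>' * L) \<and> ln 2 < L \<and>
          \<sigma>' < \<sigma> * ((L - ln 2) / L * ((L - ln 2) / (L + 1 / d)) powr e)) at_top"
        using ev1 eventually_gt_at_top[of "ln 2"] by eventually_elim simp
      then obtain L where L: "(real n + 1) / K \<le> exp (- d * L) * trunc_exp n0 (\<sigma>' * L)" "ln 2 < L"
          "\<sigma>' < \<sigma> * ((L - ln 2) / L * ((L - ln 2) / (L + 1 / d)) powr e)"
        using eventually_happens'[OF trivial_limit_at_top_linorder] by blast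
      have L0: "0 < L" using L(2) ln_gt_zero[of "2::real"] by linarith
      have "\<sigma>' * L \<le> \<sigma> * ((L - ln 2) / L * ((L - ln 2) / (L + 1 / d)) powr e) * L"
        using L L0 by (intro mult_right_mono) auto
      also have "\<dots> = \<sigma> * ((L - ln 2) * ((L - ln 2) / (L + 1 / d)) powr e)"
        using L0 by simp
      finally have "ennreal (K * (exp (- d * L) * trunc_exp n0 (\<sigma>' * L))) \<le> S"
        using L by (intro bound) auto
      moreover have "real n + 1 \<le> K * (exp (- d * L) * trunc_exp n0 (\<sigma>' * L))"
        using L(1) K by (simp add: divide_le_eq mult.commute)
      ultimately have "ennreal (real n + 1) \<le> S" by (meson ennreal_leI order_trans)
      then have "of_nat n < S"
        by (metis ennreal_less_iff ennreal_of_nat_eq_real_of_nat less_add_one less_le_trans of_nat_0_le_iff)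
      then show ?thesis unfolding S_def less_SUP_iff by (auto intro: less_imp_le)
    qed
  qed
  then show ?thesis unfolding S_def by simp
qed

section \<open>Means and the energy\<close>

definition mean :: "'a::euclidean_space set \<Rightarrow> ('a \<Rightarrow> real) \<Rightarrow> real" where
  "mean A u = (LINT y|lborel. indicator A y * u y) / measure lborel A"

text \<open>
  Jensen's inequality for the normalised restriction of Lebesgue measure to \<open>A\<close>.
\<close>

lemma mean_powr_le:
  fixes u :: "'a::euclidean_space \<Rightarrow> real"
  assumes [measurable]: "u \<in> borel_measurable borel" "A \<in> sets borel"
    and A: "emeasure lborel A = ennreal a" "0 < a" and bdd: "\<And>y. y \<in> A \<Longrightarrow> \<bar>u y\<bar> \<le> b" and p: "1 \<le> p"
  shows "ennreal a * ennreal (\<bar>mean A u - c\<bar> powr p) \<le> (\<integral>\<^sup>+y. indicator A y * ennreal (\<bar>u y - c\<bar> powr p) \<partial>lborel)"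
proof -
  have mA: "measure lborel A = a" using A by (simp add: measure_def)
  have fin: "emeasure lborel A < \<infinity>" using A by simp
  have int: "integrable lborel (\<lambda>y. indicator A y * (u y))"
    by (rule integrableI_bounded_set[where A=A and B=b]) (use fin bdd in \<open>auto split: split_indicator\<close>)
  have int1: "integrable lborel (\<lambda>y. indicator A y * c)"
    using integrable_real_indicator[of A lborel] fin by (intro integrable_mult_left) simp
  have e: "(LINT y|lborel. indicator A y * (u y - c)) = a * (mean A u - c)"
  proof -
    have "(LINT y|lborel. indicator A y * (u y - c)) = (LINT y|lborel. indicator A y * u y) - (LINT y|lborel. indicator A y * c)"
      using int int1 by (simp add: right_diff_distrib)
    also have "(LINT y|lborel. indicator A y * c) = a * c"
      using mA by simp
    finally show ?thesis using A(2) mA by (simp add: mean_def right_diff_distrib)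
  qed
  have int2: "integrable lborel (\<lambda>y. indicator A y * (u y - c))"
    using int int1 by (simp add: right_diff_distrib)
  have "ennreal (a * \<bar>mean A u - c\<bar>) = ennreal (norm (LINT y|lborel. indicator A y * (u y - c)))"
    using A(2) by (simp add: e abs_mult)
  also have "\<dots> \<le> (\<integral>\<^sup>+y. norm (indicator A y * (u y - c)) \<partial>lborel)"
    using int2 by (rule integral_norm_bound_ennreal)
  also have "\<dots> = (\<integral>\<^sup>+y. indicator A y * ennreal \<bar>u y - c\<bar> \<partial>lborel)"
    by (intro nn_integral_cong) (auto split: split_indicator)
  finally have "ennpowr (ennreal (a * \<bar>mean A u - c\<bar>)) p \<le> ennpowr (\<integral>\<^sup>+y. indicator A y * ennreal \<bar>u y - c\<bar> \<partial>lborel) p"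
    using p by (intro ennpowr_mono) auto
  also have "\<dots> \<le> ennreal (a powr (p - 1)) * (\<integral>\<^sup>+y. indicator A y * ennpowr (ennreal \<bar>u y - c\<bar>) p \<partial>lborel)"
    using A p by (intro jensen_ennpowr_weighted) auto
  also have "ennpowr (ennreal (a * \<bar>mean A u - c\<bar>)) p = ennreal (a powr (p - 1)) * (ennreal a * ennreal (\<bar>mean A u - c\<bar> powr p))"
  proof -
    have "a powr p = a powr (p - 1) * a" using A(2) by (simp add: powr_diff)
    then show ?thesis using A(2)
      by (simp add: ennpowr_ennreal powr_mult flip: ennreal_mult)
  qed
  finally show ?thesis
    using A(2) by (subst (asm) ennreal_mult_le_mult_iff) (auto simp: ennpowr_ennreal)
qed

lemma mean_diff_powr_le:
  fixes u :: "'a::euclidean_space \<Rightarrow> real"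
  assumes [measurable]: "u \<in> borel_measurable borel" "A \<in> sets borel" "B \<in> sets borel"
    and A: "emeasure lborel A = ennreal a" "0 < a" and B: "emeasure lborel B = ennreal b" "0 < b"
    and bdd: "\<And>y. \<bar>u y\<bar> \<le> C" and p: "1 \<le> p"
  shows "ennreal (a * b) * ennreal (\<bar>mean A u - mean B u\<bar> powr p) \<le>
    (\<integral>\<^sup>+y. indicator A y * (\<integral>\<^sup>+z. indicator B z * ennreal (\<bar>u z - u y\<bar> powr p) \<partial>lborel) \<partial>lborel)"
proof -
  have "ennreal (a * b) * ennreal (\<bar>mean A u - mean B u\<bar> powr p) = ennreal b * (ennreal a * ennreal (\<bar>mean A u - mean B u\<bar> powr p))"
    using A B by (simp add: ennreal_mult mult_ac)
  also have "\<dots> \<le> ennreal b * (\<integral>\<^sup>+y. indicator A y * ennreal (\<bar>u y - mean B u\<bar> powr p) \<partial>lborel)"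
    using A bdd p by (intro mult_left_mono mean_powr_le) auto
  also have "\<dots> = (\<integral>\<^sup>+y. indicator A y * (ennreal b * ennreal (\<bar>mean B u - u y\<bar> powr p)) \<partial>lborel)"
    by (subst nn_integral_cmult[symmetric]) (auto intro!: nn_integral_cong simp: mult.left_commute abs_minus_commute)
  also have "\<dots> \<le> (\<integral>\<^sup>+y. indicator A y * (\<integral>\<^sup>+z. indicator B z * ennreal (\<bar>u z - u y\<bar> powr p) \<partial>lborel) \<partial>lborel)"
    using B bdd p by (intro nn_integral_mono mult_left_mono mean_powr_le) auto
  finally show ?thesis .
qed

text \<open>
  The inner integral of the energy; it is the mass distribution that the local estimates use.
\<close>

definition energy_density :: "'a::euclidean_space set \<Rightarrow> real \<Rightarrow> ('a \<Rightarrow> real) \<Rightarrow> 'a \<Rightarrow> ennreal" where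
  "energy_density \<Omega> p u y = (\<integral>\<^sup>+x. ennreal (\<bar>u x - u y\<bar> powr p / dist x y ^ (2 * DIM('a)))
     * indicator \<Omega> x \<partial>lborel) * indicator \<Omega> y"

lemma energy_eq_density: "energy \<Omega> p u = (\<integral>\<^sup>+y. energy_density \<Omega> p u y \<partial>lborel)"
  by (simp add: energy_def energy_density_def)

lemma borel_measurable_energy_density [measurable]:
  fixes u :: "'a::euclidean_space \<Rightarrow> real"
  assumes [measurable]: "u \<in> borel_measurable borel" "\<Omega> \<in> sets borel"
  shows "energy_density \<Omega> p u \<in> borel_measurable borel"
  unfolding energy_density_def by measurable

text \<open>
  Two means differ by at most the averaged difference of the values, and the kernel is at least
  \<open>1 / D ^ (2 * d)\<close> on pairs at distance at most \<open>D\<close>.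
\<close>

lemma mean_diff_powr_le_energy:
  fixes u :: "'a::euclidean_space \<Rightarrow> real"
  assumes [measurable]: "u \<in> borel_measurable borel" "A \<in> sets borel" "B \<in> sets borel" "\<Omega> \<in> sets borel"
    and sub: "A \<subseteq> \<Omega>" "B \<subseteq> \<Omega>"
    and A: "emeasure lborel A = ennreal a" "0 < a" and B: "emeasure lborel B = ennreal b" "0 < b"
    and D: "\<And>y z. y \<in> A \<Longrightarrow> z \<in> B \<Longrightarrow> dist z y \<le> D" "0 < D"
    and bdd: "\<And>y. \<bar>u y\<bar> \<le> C" and p: "1 \<le> p"
  shows "ennreal (\<bar>mean A u - mean B u\<bar> powr p) \<le>
    ennreal (D ^ (2 * DIM('a)) / (a * b)) * (\<integral>\<^sup>+y. indicator A y * energy_density \<Omega> p u y \<partial>lborel)"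
proof -
  let ?E = "D ^ (2 * DIM('a))"
  have pt: "ennreal (\<bar>u z - u y\<bar> powr p) \<le> ennreal ?E * ennreal (\<bar>u z - u y\<bar> powr p / dist z y ^ (2 * DIM('a)))"
    if "y \<in> A" "z \<in> B" for y z
  proof (cases "z = y")
    case False
    have "dist z y ^ (2 * DIM('a)) \<le> ?E" using D(1)[OF that] by (intro power_mono) auto
    then have "\<bar>u z - u y\<bar> powr p * (dist z y ^ (2 * DIM('a)) / dist z y ^ (2 * DIM('a))) \<le> \<bar>u z - u y\<bar> powr p * (?E / dist z y ^ (2 * DIM('a)))"
      by (intro mult_left_mono divide_right_mono) auto
    then have "\<bar>u z - u y\<bar> powr p \<le> ?E * (\<bar>u z - u y\<bar> powr p / dist z y ^ (2 * DIM('a)))"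
      using False by (simp add: mult.commute)
    then show ?thesis using D(2) by (simp add: ennreal_leI flip: ennreal_mult)
  qed simp
  have "ennreal (a * b) * ennreal (\<bar>mean A u - mean B u\<bar> powr p) \<le>
    (\<integral>\<^sup>+y. indicator A y * (\<integral>\<^sup>+z. indicator B z * ennreal (\<bar>u z - u y\<bar> powr p) \<partial>lborel) \<partial>lborel)"
    by (rule mean_diff_powr_le) fact+
  also have "\<dots> \<le> (\<integral>\<^sup>+y. ennreal ?E * (indicator A y * energy_density \<Omega> p u y) \<partial>lborel)"
  proof (rule nn_integral_mono)
    fix y
    show "indicator A y * (\<integral>\<^sup>+z. indicator B z * ennreal (\<bar>u z - u y\<bar> powr p) \<partial>lborel) \<le> ennreal ?E * (indicator A y * energy_density \<Omega> p u y)"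
    proof (cases "y \<in> A")
      case True
      have "(\<integral>\<^sup>+z. indicator B z * ennreal (\<bar>u z - u y\<bar> powr p) \<partial>lborel) \<le>
        (\<integral>\<^sup>+z. ennreal ?E * (ennreal (\<bar>u z - u y\<bar> powr p / dist z y ^ (2 * DIM('a))) * indicator \<Omega> z) \<partial>lborel)"
        using sub pt[OF True] by (intro nn_integral_mono) (auto split: split_indicator)
      also have "\<dots> = ennreal ?E * energy_density \<Omega> p u y"
        using True sub by (subst nn_integral_cmult) (auto simp: energy_density_def)
      finally show ?thesis using True by simp
    qed simp
  qed
  also have "\<dots> = ennreal ?E * (\<integral>\<^sup>+y. indicator A y * energy_density \<Omega> p u y \<partial>lborel)"
    by (rule nn_integral_cmult) measurable
  finally have "ennreal (1 / (a * b)) * (ennreal (a * b) * ennreal (\<bar>mean A u - mean B u\<bar> powr p)) \<le>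
     ennreal (1 / (a * b)) * (ennreal ?E * (\<integral>\<^sup>+y. indicator A y * energy_density \<Omega> p u y \<partial>lborel))"
    by (intro mult_left_mono) auto
  moreover have "ennreal (1 / (a * b)) * (ennreal (a * b) * X) = X" for X
    using A B by (simp add: mult.assoc[symmetric] flip: ennreal_mult)
  moreover have "ennreal (1 / (a * b)) * (ennreal ?E * X) = ennreal (?E / (a * b)) * X" for X
    using A B D by (simp add: mult.assoc[symmetric] flip: ennreal_mult)
  ultimately show ?thesis by simp
qed

definition annulus :: "'a::euclidean_space \<Rightarrow> real \<Rightarrow> 'a set" where
  "annulus x r = ball x r - ball x (r / 2)"

lemma annulus_sets [measurable]: "annulus x r \<in> sets borel"
  by (simp add: annulus_def)

lemma emeasure_annulus:
  fixes x :: "'a::euclidean_space"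
  assumes "0 < r"
  shows "emeasure lborel (annulus x r) = ennreal (unit_ball_vol DIM('a) * (1 - 1 / 2 ^ DIM('a)) * r ^ DIM('a))"
proof -
  have "emeasure lborel (annulus x r) = emeasure lborel (ball x r) - emeasure lborel (ball x (r / 2))"
    unfolding annulus_def using assms by (intro emeasure_Diff) (auto simp: emeasure_ball intro: subset_ball[THEN subsetD])
  also have "\<dots> = ennreal (unit_ball_vol DIM('a) * r ^ DIM('a) - unit_ball_vol DIM('a) * (r / 2) ^ DIM('a))"
    using assms by (simp add: emeasure_ball ennreal_minus)
  finally show ?thesis by (simp add: power_divide algebra_simps)
qed

text \<open>
  The constant does not depend on the radius, by scale invariance.
\<close>

lemma mean_annuli_diff_le:
  fixes u :: "'a::euclidean_space \<Rightarrow> real"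
  assumes [measurable]: "u \<in> borel_measurable borel" "\<Omega> \<in> sets borel"
    and r: "0 < r" and sub: "ball x r \<subseteq> \<Omega>"
    and bdd: "\<And>y. \<bar>u y\<bar> \<le> C" and p: "1 \<le> p"
  shows "ennreal (\<bar>mean (annulus x r) u - mean (annulus x (r / 2)) u\<bar> powr p) \<le>
    ennreal (4 * 8 ^ DIM('a) / unit_ball_vol DIM('a) ^ 2) * (\<integral>\<^sup>+y. indicator (annulus x r) y * energy_density \<Omega> p u y \<partial>lborel)"
proof -
  let ?d = "DIM('a)" and ?w = "unit_ball_vol (real DIM('a))"
  define c where "c = 1 - 1 / (2::real) ^ ?d"
  have c: "1 / 2 \<le> c"
  proof -
    have "(2::real) ^ 1 \<le> 2 ^ ?d" by (intro power_increasing) (auto simp: Suc_le_eq)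
    then show ?thesis by (simp add: c_def field_simps)
  qed
  have s: "annulus x r \<subseteq> ball x r" "annulus x (r / 2) \<subseteq> ball x r"
    using r subset_ball[of "r / 2" r x] by (auto simp: annulus_def)
  have "ennreal (\<bar>mean (annulus x r) u - mean (annulus x (r / 2)) u\<bar> powr p) \<le>
    ennreal ((2 * r) ^ (2 * ?d) / ((?w * c * r ^ ?d) * (?w * c * (r / 2) ^ ?d))) * (\<integral>\<^sup>+y. indicator (annulus x r) y * energy_density \<Omega> p u y \<partial>lborel)"
  proof (rule mean_diff_powr_le_energy)
    show "dist z y \<le> 2 * r" if "y \<in> annulus x r" "z \<in> annulus x (r / 2)" for y z
    proof -
      have "dist x y < r" "dist x z < r" using that s by auto
      then show ?thesis using dist_triangle[of z y x] by (simp add: dist_commute)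
    qed
    show "emeasure lborel (annulus x r) = ennreal (?w * c * r ^ ?d)"
      "emeasure lborel (annulus x (r / 2)) = ennreal (?w * c * (r / 2) ^ ?d)"
      using r by (simp_all add: emeasure_annulus c_def)
  qed (use r c s sub bdd p in auto)
  also have "\<dots> \<le> ennreal (4 * 8 ^ ?d / ?w ^ 2) * (\<integral>\<^sup>+y. indicator (annulus x r) y * energy_density \<Omega> p u y \<partial>lborel)"
  proof (intro mult_right_mono ennreal_leI)
    have "(2 * r) ^ (2 * ?d) / ((?w * c * r ^ ?d) * (?w * c * (r / 2) ^ ?d)) = 8 ^ ?d / ?w ^ 2 * (1 / c ^ 2)"
    proof -
      have "(2 * r) ^ (2 * ?d) = ((2 * r) * (2 * r)) ^ ?d"
        by (simp only: power_mult power2_eq_square)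
      also have "(2 * r) * (2 * r) = 8 * (r * (r / 2))" by simp
      also have "(8 * (r * (r / 2))) ^ ?d = 8 ^ ?d * (r ^ ?d * (r / 2) ^ ?d)"
        by (simp only: power_mult_distrib)
      finally have e: "(2 * r) ^ (2 * ?d) = 8 ^ ?d * (r ^ ?d * (r / 2) ^ ?d)" .
      define X Y where "X = r ^ ?d" and "Y = (r / 2) ^ ?d"
      have "0 < X" "0 < Y" using r by (auto simp: X_def Y_def)
      then show ?thesis unfolding e X_def[symmetric] Y_def[symmetric]
        using c by (simp add: power2_eq_square)
    qed
    also have "\<dots> \<le> 8 ^ ?d / ?w ^ 2 * 4"
    proof (intro mult_left_mono)
      have "(1 / 2) ^ 2 \<le> c ^ 2" using c by (intro power_mono) auto
      then show "1 / c ^ 2 \<le> 4" using c by (simp add: field_simps power2_eq_square)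
    qed auto
    also have "8 ^ ?d / ?w ^ 2 * 4 = 4 * 8 ^ ?d / ?w ^ 2" by simp
    finally show "(2 * r) ^ (2 * ?d) / ((?w * c * r ^ ?d) * (?w * c * (r / 2) ^ ?d)) \<le> 4 * 8 ^ ?d / ?w ^ 2" .
  qed auto
  finally show ?thesis .
qed

section \<open>Local estimate by a potential of the energy density\<close>

lemma mean_dist_le:
  fixes u :: "'a::euclidean_space \<Rightarrow> real"
  assumes [measurable]: "u \<in> borel_measurable borel" "A \<in> sets borel"
    and A: "emeasure lborel A = ennreal a" "0 < a"
    and bdd: "\<And>y. \<bar>u y\<bar> \<le> C" and near: "\<And>y. y \<in> A \<Longrightarrow> \<bar>u y - c\<bar> \<le> e" and e: "0 \<le> e"
  shows "\<bar>mean A u - c\<bar> \<le> e"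
proof -
  have "ennreal a * ennreal (\<bar>mean A u - c\<bar> powr 1) \<le> (\<integral>\<^sup>+y. indicator A y * ennreal (\<bar>u y - c\<bar> powr 1) \<partial>lborel)"
    using A bdd by (intro mean_powr_le) auto
  also have "\<dots> \<le> (\<integral>\<^sup>+y. ennreal e * indicator A y \<partial>lborel)"
    using near by (intro nn_integral_mono) (auto split: split_indicator intro!: ennreal_leI)
  also have "\<dots> = ennreal e * ennreal a"
    using A by (subst nn_integral_cmult_indicator) auto
  finally have "ennreal (a * \<bar>mean A u - c\<bar>) \<le> ennreal (a * e)"
    using A e by (simp add: mult.commute flip: ennreal_mult)
  then show ?thesis using A e by (simp add: ennreal_le_iff mult_le_cancel_left_pos)
qed

text \<open>
  The ratio \<open>\<theta>\<close> is chosen so that \<open>\<theta> powr (1 - p) = 2 powr (p / (2 * q))\<close>.  It tends to \<open>1\<close> as \<open>q\<close> grows,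
  but the sum of the geometric series grows only linearly in \<open>q\<close>.
\<close>

lemma geometric_weight_le:
  fixes p q :: real
  assumes p: "1 < p" and q: "1 \<le> q"
  defines "\<theta> \<equiv> 2 powr (- (p / (2 * q * (p - 1))))"
  shows "0 < \<theta>" "\<theta> < 1" "1 / (1 - \<theta>) \<le> q * (1 + 2 * (p - 1) / ln 2)"
proof -
  define t where "t = p / (2 * q * (p - 1))"
  define x where "x = t * ln 2"
  have t: "0 < t" using p q by (simp add: t_def)
  have x: "0 < x" using t by (simp add: x_def)
  have \<theta>: "\<theta> = exp (- x)" by (simp add: \<theta>_def t_def x_def powr_def)
  show 1: "0 < \<theta>" "\<theta> < 1" using x by (auto simp: \<theta>)
  have "x / (1 + x) \<le> 1 - \<theta>"
  proof -
    have "\<theta> \<le> inverse (1 + x)"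
      unfolding \<theta> exp_minus using x exp_ge_add_one_self[of x] by (intro le_imp_inverse_le) auto
    also have "\<dots> = 1 - x / (1 + x)" using x by (simp add: field_simps)
    finally show ?thesis by simp
  qed
  then have "1 / (1 - \<theta>) \<le> 1 / (x / (1 + x))"
    using x by (intro divide_left_mono mult_pos_pos) (auto simp: \<theta>)
  also have "\<dots> = 1 + 1 / x" using x by (simp add: field_simps)
  also have "1 / x = q * (2 * (p - 1) / ln 2) * (1 / p)"
  proof -
    have "1 / (p / (2 * q * v) * l) = q * (2 * v / l) * (1 / p)" for v l :: real by (simp add: mult_ac)
    then show ?thesis unfolding x_def t_def .
  qed
  also have "\<dots> \<le> q * (2 * (p - 1) / ln 2) * 1"
    using p q by (intro mult_left_mono) auto
  also have "1 + q * (2 * (p - 1) / ln 2) * 1 \<le> q * (1 + 2 * (p - 1) / ln 2)"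
    using q by (simp add: distrib_left)
  finally show "1 / (1 - \<theta>) \<le> q * (1 + 2 * (p - 1) / ln 2)" by simp
qed

definition trudinger_const :: "nat \<Rightarrow> real \<Rightarrow> real" where
  "trudinger_const d p = 4 * 8 ^ d / unit_ball_vol d ^ 2 * (1 + 2 * (p - 1) / ln 2) powr (p - 1)"

text \<open>
  By continuity, \<open>u x\<close> is the limit of the means over the dyadic annuli.  Jensen's inequality with
  weights \<open>\<theta> ^ k\<close> bounds the \<open>p\<close>-th power of the telescoping sum; the factor \<open>(\<theta> ^ k) powr (1 - p)\<close> that it puts
  on the \<open>k\<close>-th annulus is comparable with a power of \<open>r / dist x y\<close> there.
\<close>

lemma mean_deviation_le_potential:
  fixes u :: "'a::euclidean_space \<Rightarrow> real" and p q :: real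
  assumes [measurable]: "u \<in> borel_measurable borel" "\<Omega> \<in> sets borel" and cont: "isCont u x"
    and r: "0 < r" and sub: "ball x r \<subseteq> \<Omega>"
    and bdd: "\<And>y. \<bar>u y\<bar> \<le> C" and p: "1 < p" and q: "1 \<le> q"
  shows "ennreal (\<bar>u x - mean (annulus x r) u\<bar> powr p) \<le>
    ennreal (trudinger_const DIM('a) p * q powr (p - 1)) *
      (\<integral>\<^sup>+y. indicator (ball x r) y * (ennreal ((r / dist x y) powr (p / (2 * q))) * energy_density \<Omega> p u y) \<partial>lborel)"
proof -
  let ?G = "energy_density \<Omega> p u" and ?B = "1 + 2 * (p - 1) / ln 2"
  define \<theta> where "\<theta> = 2 powr (- (p / (2 * q * (p - 1))))"
  define K where "K = 1 / (1 - \<theta>)"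
  have \<theta>: "0 < \<theta>" "\<theta> < 1" and Kle: "K \<le> q * ?B"
    unfolding K_def \<theta>_def using geometric_weight_le[OF p q] by auto
  have K: "0 < K" using \<theta> by (simp add: K_def)
  define C1 where "C1 = 4 * 8 ^ DIM('a) / unit_ball_vol DIM('a) ^ 2"
  have C1: "0 \<le> C1" by (simp add: C1_def)
  define m where "m k = mean (annulus x (r / 2 ^ k)) u" for k
  define a where "a k = \<bar>m k - m (Suc k)\<bar>" for k
  define F where "F y = ennreal ((r / dist x y) powr (p / (2 * q))) * ?G y" for y
  have [measurable]: "F \<in> borel_measurable borel" unfolding F_def by measurable
  define J where "J = (\<integral>\<^sup>+y. indicator (ball x r) y * F y \<partial>lborel)"
  have rk: "0 < r / 2 ^ k" "ball x (r / 2 ^ k) \<subseteq> ball x r" for k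
    using r by (auto simp: field_simps intro!: subset_ball)
  have step: "ennreal (a k powr p) \<le> ennreal C1 * (\<integral>\<^sup>+y. indicator (annulus x (r / 2 ^ k)) y * ?G y \<partial>lborel)" for k
  proof -
    have "r / 2 ^ Suc k = (r / 2 ^ k) / 2" by simp
    then show ?thesis
      unfolding a_def m_def C1_def using rk[of k] sub bdd p
      by (simp only:) (intro mean_annuli_diff_le, auto)
  qed
  \<comment> \<open>the choice of \<open>\<theta>\<close> gives \<open>(\<theta> ^ k) powr (1 - p) = (2 ^ k) powr (p / (2 * q))\<close>, and \<open>2 ^ k \<le> r / dist x y\<close> on the annulus\<close>
  have weighted: "ennreal (\<theta> ^ k) * ennpowr (ennreal (a k / \<theta> ^ k)) p \<le>
      ennreal C1 * (\<integral>\<^sup>+y. indicator (annulus x (r / 2 ^ k)) y * F y \<partial>lborel)" for k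
  proof -
    have \<theta>k: "\<theta> ^ k = 2 powr (- (p / (2 * q * (p - 1))) * k)"
      unfolding \<theta>_def by (simp add: powr_powr flip: powr_realpow)
    have "\<theta> ^ k * (a k / \<theta> ^ k) powr p = (\<theta> ^ k) powr (1 - p) * a k powr p"
      using \<theta> by (simp add: powr_divide powr_diff a_def)
    also have "(\<theta> ^ k) powr (1 - p) = (2 ^ k) powr (p / (2 * q))"
    proof -
      have e: "- (p / (2 * q * v)) * k * (- v) = real k * (p / (2 * q))" if "v \<noteq> 0" for v
        using that by simp
      have "- (p / (2 * q * (p - 1))) * k * (1 - p) = real k * (p / (2 * q))"
        using e[of "p - 1"] p by simp
      then have "(\<theta> ^ k) powr (1 - p) = 2 powr (real k * (p / (2 * q)))"
        unfolding \<theta>k powr_powr by simp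
      then show ?thesis
        unfolding powr_powr[symmetric] by (simp add: powr_realpow)
    qed
    finally have "ennreal (\<theta> ^ k) * ennpowr (ennreal (a k / \<theta> ^ k)) p = ennreal ((2 ^ k) powr (p / (2 * q))) * ennreal (a k powr p)"
      using \<theta> by (simp add: ennpowr_ennreal a_def flip: ennreal_mult)
    also have "\<dots> \<le> ennreal ((2 ^ k) powr (p / (2 * q))) * (ennreal C1 * (\<integral>\<^sup>+y. indicator (annulus x (r / 2 ^ k)) y * ?G y \<partial>lborel))"
      by (intro mult_left_mono step) auto
    also have "\<dots> = ennreal C1 * (\<integral>\<^sup>+y. indicator (annulus x (r / 2 ^ k)) y * (ennreal ((2 ^ k) powr (p / (2 * q))) * ?G y) \<partial>lborel)"
      by (subst mult.left_commute, subst nn_integral_cmult[symmetric]) (auto simp: mult.left_commute)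
    also have "\<dots> \<le> ennreal C1 * (\<integral>\<^sup>+y. indicator (annulus x (r / 2 ^ k)) y * F y \<partial>lborel)"
    proof (rule mult_left_mono[OF nn_integral_mono])
      fix y
      show "indicator (annulus x (r / 2 ^ k)) y * (ennreal ((2 ^ k) powr (p / (2 * q))) * ?G y) \<le> indicator (annulus x (r / 2 ^ k)) y * F y"
      proof (cases "y \<in> annulus x (r / 2 ^ k)")
        case True
        then have "dist x y < r / 2 ^ k" "r / 2 ^ k / 2 \<le> dist x y" by (auto simp: annulus_def)
        moreover have "0 < dist x y"
          by (rule less_le_trans[OF half_gt_zero[OF rk(1)[of k]] calculation(2)])
        ultimately have "2 ^ k \<le> r / dist x y" by (simp add: field_simps)
        then have "(2 ^ k) powr (p / (2 * q)) \<le> (r / dist x y) powr (p / (2 * q))"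
          using p q by (intro powr_mono2) auto
        then show ?thesis
          unfolding F_def by (intro mult_left_mono mult_right_mono ennreal_leI) auto
      qed simp
    qed simp
    finally show ?thesis .
  qed
  have disj: "disjoint_family (\<lambda>k. annulus x (r / 2 ^ k))"
  proof -
    have "annulus x (r / 2 ^ k) \<inter> annulus x (r / 2 ^ j) = {}" if "k < j" for k j
    proof -
      have "(2::real) ^ Suc k \<le> 2 ^ j" using that by (intro power_increasing) auto
      then have "r / 2 ^ j \<le> r / 2 ^ Suc k" using r by (intro divide_left_mono) auto
      then show ?thesis by (auto simp: annulus_def)
    qed
    then show ?thesis
      unfolding disjoint_family_on_def by (metis Int_commute nat_neq_iff)
  qed
  have bound: "ennreal (\<bar>m 0 - m N\<bar> powr p) \<le> ennreal (K powr (p - 1)) * (ennreal C1 * J)" for N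
  proof -
    have "\<bar>m 0 - m N\<bar> \<le> (\<Sum>k<N. a k)"
      by (induction N) (auto simp: a_def)
    then have "ennreal (\<bar>m 0 - m N\<bar> powr p) \<le> ennpowr (\<Sum>k<N. ennreal (a k)) p"
      using p by (subst sum_ennreal) (auto simp: a_def ennpowr_ennreal sum_nonneg intro!: ennreal_leI powr_mono2)
    also have "(\<Sum>k<N. ennreal (a k)) = (\<integral>\<^sup>+k. ennreal (\<theta> ^ k) * ennreal (a k / \<theta> ^ k) \<partial>count_space {..<N})"
      using \<theta> by (simp add: nn_integral_count_space_finite a_def flip: ennreal_mult)
    also have "ennpowr \<dots> p \<le> ennreal (K powr (p - 1)) * (\<integral>\<^sup>+k. ennreal (\<theta> ^ k) * ennpowr (ennreal (a k / \<theta> ^ k)) p \<partial>count_space {..<N})"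
    proof (rule jensen_ennpowr_weighted)
      have "(\<Sum>k<N. \<theta> ^ k) \<le> K"
      proof -
        have "(\<Sum>k<N. \<theta> ^ k) * (1 - \<theta>) = 1 - \<theta> ^ N"
          by (simp add: one_diff_power_eq mult.commute)
        then have "(\<Sum>k<N. \<theta> ^ k) * (1 - \<theta>) \<le> 1" using \<theta> by simp
        then show ?thesis using \<theta> by (simp add: K_def le_divide_eq)
      qed
      then show "(\<integral>\<^sup>+k. ennreal (\<theta> ^ k) \<partial>count_space {..<N}) \<le> ennreal K"
        using \<theta> by (simp add: nn_integral_count_space_finite sum_ennreal ennreal_leI)
    qed (use K p in auto)
    also have "(\<integral>\<^sup>+k. ennreal (\<theta> ^ k) * ennpowr (ennreal (a k / \<theta> ^ k)) p \<partial>count_space {..<N}) =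
      (\<Sum>k<N. ennreal (\<theta> ^ k) * ennpowr (ennreal (a k / \<theta> ^ k)) p)"
      by (simp add: nn_integral_count_space_finite)
    also have "\<dots> \<le> (\<Sum>k<N. ennreal C1 * (\<integral>\<^sup>+y. indicator (annulus x (r / 2 ^ k)) y * F y \<partial>lborel))"
      by (intro sum_mono weighted)
    also have "\<dots> = ennreal C1 * (\<Sum>k<N. (\<integral>\<^sup>+y. indicator (annulus x (r / 2 ^ k)) y * F y \<partial>lborel))"
      by (simp add: sum_distrib_left)
    also have "(\<Sum>k<N. (\<integral>\<^sup>+y. indicator (annulus x (r / 2 ^ k)) y * F y \<partial>lborel)) =
       (\<integral>\<^sup>+y. (\<Sum>k<N. indicator (annulus x (r / 2 ^ k)) y) * F y \<partial>lborel)"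
      by (subst nn_integral_sum[symmetric]) (auto simp: sum_distrib_right)
    also have "\<dots> \<le> J"
      unfolding J_def
    proof (intro nn_integral_mono mult_right_mono)
      fix y
      have "(\<Sum>k<N. indicator (annulus x (r / 2 ^ k)) y :: ennreal) = indicator (\<Union>k<N. annulus x (r / 2 ^ k)) y"
        using disj by (intro indicator_UN_disjoint[symmetric]) (auto simp: disjoint_family_on_def)
      also have "\<dots> \<le> indicator (ball x r) y"
      proof -
        have "(\<Union>k<N. annulus x (r / 2 ^ k)) \<subseteq> ball x r"
          using rk(2) unfolding annulus_def by blast
        then show ?thesis by (simp add: indicator_def subset_iff del: mem_ball UN_iff)
      qed
      finally show "(\<Sum>k<N. indicator (annulus x (r / 2 ^ k)) y :: ennreal) \<le> indicator (ball x r) y" .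
    qed auto
    finally show ?thesis by (simp add: mult_left_mono)
  qed
  have "m \<longlonglongrightarrow> u x"
  proof (rule LIMSEQ_I)
    fix e :: real assume "0 < e"
    then obtain d where d: "0 < d" "\<And>y. dist y x < d \<Longrightarrow> dist (u y) (u x) < e / 2"
      using cont unfolding continuous_at_eps_delta by (metis half_gt_zero)
    obtain N where N: "r / d < 2 ^ N" using real_arch_pow[of 2 "r / d"] by auto
    have "norm (m n - u x) < e" if "N \<le> n" for n
    proof -
      have "(2::real) ^ N \<le> 2 ^ n" using that by (intro power_increasing) auto
      then have "r / d < 2 ^ n" using N by linarith
      then have rd: "r / 2 ^ n < d" using d by (simp add: field_simps)
      have "\<bar>m n - u x\<bar> \<le> e / 2"
        unfolding m_def
      proof (rule mean_dist_le[OF _ _ emeasure_annulus])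
        show "\<bar>u y - u x\<bar> \<le> e / 2" if "y \<in> annulus x (r / 2 ^ n)" for y
          using d(2)[of y] that rd by (auto simp: annulus_def dist_commute dist_real_def abs_minus_commute)
        have "(2::real) ^ 0 < 2 ^ DIM('a)" by (intro power_strict_increasing) auto
        then show "0 < unit_ball_vol DIM('a) * (1 - 1 / 2 ^ DIM('a)) * (r / 2 ^ n) ^ DIM('a)"
          using r by (intro mult_pos_pos) auto
      qed (use r \<open>0 < e\<close> bdd in auto)
      then show ?thesis using \<open>0 < e\<close> by simp
    qed
    then show "\<exists>N. \<forall>n\<ge>N. norm (m n - u x) < e" by blast
  qed
  then have "(\<lambda>N. ennreal (\<bar>m 0 - m N\<bar> powr p)) \<longlonglongrightarrow> ennreal (\<bar>m 0 - u x\<bar> powr p)"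
    using p by (intro tendsto_ennrealI tendsto_powr' tendsto_intros) auto
  then have "ennreal (\<bar>m 0 - u x\<bar> powr p) \<le> ennreal (K powr (p - 1)) * (ennreal C1 * J)"
    by (rule LIMSEQ_le_const2) (use bound in auto)
  also have "\<dots> = ennreal (C1 * K powr (p - 1)) * J"
    using C1 by (simp add: ennreal_mult mult_ac)
  also have "\<dots> \<le> ennreal (trudinger_const DIM('a) p * q powr (p - 1)) * J"
  proof (intro mult_right_mono ennreal_leI)
    have "K powr (p - 1) \<le> (q * ?B) powr (p - 1)"
      using K Kle p by (intro powr_mono2) auto
    also have "\<dots> = q powr (p - 1) * ?B powr (p - 1)"
      using p q by (simp add: powr_mult)
    finally have "C1 * K powr (p - 1) \<le> C1 * (q powr (p - 1) * ?B powr (p - 1))"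
      using C1 by (rule mult_left_mono)
    then show "C1 * K powr (p - 1) \<le> trudinger_const DIM('a) p * q powr (p - 1)"
      by (simp add: trudinger_const_def C1_def mult_ac)
  qed auto
  finally show ?thesis
    by (simp add: m_def J_def F_def abs_minus_commute)
qed

section \<open>Potentials with respect to the scale-invariant measure\<close>

lemma ball_bdist_subset:
  fixes \<Omega> :: "'a::euclidean_space set"
  assumes "x \<in> \<Omega>"
  shows "ball x (bdist \<Omega> x) \<subseteq> \<Omega>"
proof (rule ccontr)
  assume "\<not> ball x (bdist \<Omega> x) \<subseteq> \<Omega>"
  moreover from this have "x \<in> ball x (bdist \<Omega> x)"
    by (metis ball_empty centre_in_ball empty_subsetI linorder_not_le)
  ultimately have "ball x (bdist \<Omega> x) \<inter> \<Omega> \<noteq> {}" "ball x (bdist \<Omega> x) - \<Omega> \<noteq> {}"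
    using assms by blast+
  then have "ball x (bdist \<Omega> x) \<inter> frontier \<Omega> \<noteq> {}"
    by (rule connected_Int_frontier[OF connected_ball])
  then obtain z where "z \<in> frontier \<Omega>" "dist x z < bdist \<Omega> x" by auto
  then show False using infdist_le[of z "frontier \<Omega>" x] by (simp add: bdist_def)
qed

text \<open>
  Inside half the distance to the boundary, all distances to the boundary are comparable.
\<close>

lemma bdist_comparable:
  assumes "dist x y < bdist \<Omega> x / 2"
  shows "bdist \<Omega> x < 2 * bdist \<Omega> y" "bdist \<Omega> y < 2 * bdist \<Omega> x" "dist x y < bdist \<Omega> y"
  using bdist_lipschitz[of \<Omega> x y] bdist_lipschitz[of \<Omega> y x] assms bdist_nonneg[of \<Omega> x]
  by (auto simp: dist_commute)

lemma nn_integral_inverse_sqrt_ball_le: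
  fixes y :: "'a::euclidean_space"
  assumes \<rho>: "0 < \<rho>"
  shows "(\<integral>\<^sup>+x. (if dist x y < \<rho> then ennreal ((\<rho> / dist x y) powr (1 / 2)) else 0) \<partial>lborel)
    \<le> ennreal (2 * DIM('a) * unit_ball_vol DIM('a) * \<rho> ^ DIM('a))"
proof -
  let ?d = "DIM('a)" and ?w = "unit_ball_vol (real DIM('a))"
  define c where "c = ?d * ?w * \<rho> ^ (?d - 1)"
  have c: "0 \<le> c" using \<rho> by (simp add: c_def)
  have "(\<integral>\<^sup>+x. (if dist x y < \<rho> then ennreal ((\<rho> / dist x y) powr (1 / 2)) else 0) \<partial>lborel) =
    (\<integral>\<^sup>+r. (if r < \<rho> then ennreal ((\<rho> / r) powr (1 / 2)) else 0) * ennreal (?d * ?w * r ^ (?d - 1)) * indicator {0..} r \<partial>lborel)"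
    by (rule nn_integral_radial) measurable
  also have "\<dots> \<le> (\<integral>\<^sup>+r. ennreal (indicator {0..\<rho>} r * (\<rho> powr (1 / 2) * r powr (- (1 / 2)) * c)) \<partial>lborel)"
  proof (rule nn_integral_mono)
    fix r :: real
    show "(if r < \<rho> then ennreal ((\<rho> / r) powr (1 / 2)) else 0) * ennreal (?d * ?w * r ^ (?d - 1)) * indicator {0..} r
      \<le> ennreal (indicator {0..\<rho>} r * (\<rho> powr (1 / 2) * r powr (- (1 / 2)) * c))"
    proof (cases "0 \<le> r \<and> r < \<rho>")
      case True
      have "ennreal ((\<rho> / r) powr (1 / 2)) * ennreal (?d * ?w * r ^ (?d - 1)) = ennreal ((\<rho> / r) powr (1 / 2) * (?d * ?w * r ^ (?d - 1)))"
        using True by (intro ennreal_mult[symmetric]) auto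
      also have "\<dots> \<le> ennreal ((\<rho> / r) powr (1 / 2) * c)"
        unfolding c_def using True by (intro ennreal_leI mult_left_mono power_mono) auto
      also have "ennreal ((\<rho> / r) powr (1 / 2) * c) = ennreal (\<rho> powr (1 / 2) * r powr (- (1 / 2)) * c)"
        unfolding powr_divide powr_minus_divide by simp
      finally show ?thesis using True by simp
    next
      case False
      then show ?thesis by (cases "r < \<rho>") simp_all
    qed
  qed
  also have "\<dots> = ennreal (\<rho> powr (1 / 2) * (\<rho> powr (- (1 / 2) + 1) / (- (1 / 2) + 1)) * c)"
  proof (rule nn_integral_has_integral_lebesgue)
    show "((\<lambda>r. \<rho> powr (1 / 2) * r powr (- (1 / 2)) * c) has_integral
      \<rho> powr (1 / 2) * (\<rho> powr (- (1 / 2) + 1) / (- (1 / 2) + 1)) * c) {0..\<rho>}"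
      using \<rho> by (intro has_integral_mult_left has_integral_mult_right has_integral_powr_from_0) auto
  qed (use c in simp)
  also have "\<rho> powr (1 / 2) * (\<rho> powr (- (1 / 2) + 1) / (- (1 / 2) + 1)) * c = 2 * ?d * ?w * \<rho> ^ ?d"
  proof -
    have e: "- (1 / 2) + 1 = (1 / 2 :: real)" by simp
    have "\<rho> powr (1 / 2) * \<rho> powr (1 / 2) = \<rho>" using \<rho> by (simp flip: powr_add)
    then have "\<rho> powr (1 / 2) * (\<rho> powr (- (1 / 2) + 1) / (- (1 / 2) + 1)) = 2 * \<rho>" unfolding e by simp
    moreover have "\<rho> * \<rho> ^ (?d - 1) = \<rho> ^ ?d" by (metis DIM_positive power_eq_if less_numeral_extra(3))
    then have "2 * \<rho> * c = 2 * ?d * ?w * \<rho> ^ ?d" by (simp add: c_def mult.left_commute)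
    ultimately show ?thesis by (simp only:)
  qed
  finally show ?thesis .
qed

text \<open>
  The weakly singular kernel restricted to pairs on which \<^const>\<open>bdist\<close> is comparable.
\<close>

definition local_kernel :: "'a::euclidean_space set \<Rightarrow> real \<Rightarrow> 'a \<Rightarrow> 'a \<Rightarrow> ennreal" where
  "local_kernel \<Omega> e x y = (if dist x y < bdist \<Omega> x / 2 then ennreal ((bdist \<Omega> x / 2 / dist x y) powr e) else 0)"

lemma measurable_local_kernel [measurable (raw)]:
  assumes [measurable]: "f \<in> borel_measurable M" "g \<in> borel_measurable M"
  shows "(\<lambda>z. local_kernel \<Omega> e (f z) (g z)) \<in> borel_measurable M"
  unfolding local_kernel_def by measurable

text \<open>
  The integral over \<open>x\<close> is confined to a ball around \<open>y\<close> of radius comparable with \<open>bdist \<Omega> y\<close>, whose volume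
  cancels the weight; so the bound is uniform in \<open>y\<close>.
\<close>

lemma nn_integral_local_kernel_le:
  fixes \<Omega> :: "'a::euclidean_space set"
  assumes y: "0 < bdist \<Omega> y"
  shows "(\<integral>\<^sup>+x. indicator \<Omega> x * (ennreal (1 / bdist \<Omega> x ^ DIM('a)) * local_kernel \<Omega> (1 / 2) x y) \<partial>lborel)
    \<le> ennreal (2 ^ DIM('a) * (2 * DIM('a) * unit_ball_vol DIM('a)))"
proof -
  let ?d = "DIM('a)" and ?w = "unit_ball_vol (real DIM('a))" and ?D = "bdist \<Omega> y"
  have "(\<integral>\<^sup>+x. indicator \<Omega> x * (ennreal (1 / bdist \<Omega> x ^ ?d) * local_kernel \<Omega> (1 / 2) x y) \<partial>lborel) \<le>
    (\<integral>\<^sup>+x. ennreal (2 ^ ?d / ?D ^ ?d) * (if dist x y < ?D then ennreal ((?D / dist x y) powr (1 / 2)) else 0) \<partial>lborel)"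
  proof (rule nn_integral_mono)
    fix x
    show "indicator \<Omega> x * (ennreal (1 / bdist \<Omega> x ^ ?d) * local_kernel \<Omega> (1 / 2) x y) \<le>
      ennreal (2 ^ ?d / ?D ^ ?d) * (if dist x y < ?D then ennreal ((?D / dist x y) powr (1 / 2)) else 0)"
    proof (cases "dist x y < bdist \<Omega> x / 2")
      case True
      note c = bdist_comparable[OF True]
      have "?D ^ ?d \<le> (2 * bdist \<Omega> x) ^ ?d" using c y by (intro power_mono) auto
      then have "1 / bdist \<Omega> x ^ ?d \<le> 2 ^ ?d / ?D ^ ?d"
        using y c by (simp add: power_mult_distrib field_simps)
      moreover have "(bdist \<Omega> x / 2 / dist x y) powr (1 / 2) \<le> (?D / dist x y) powr (1 / 2)"
        using c by (intro powr_mono2 divide_right_mono) auto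
      ultimately have "ennreal (1 / bdist \<Omega> x ^ ?d) * ennreal ((bdist \<Omega> x / 2 / dist x y) powr (1 / 2)) \<le>
        ennreal (2 ^ ?d / ?D ^ ?d) * ennreal ((?D / dist x y) powr (1 / 2))"
        by (intro mult_mono ennreal_leI) auto
      then show ?thesis using True c by (auto simp: local_kernel_def split: split_indicator)
    qed (simp add: local_kernel_def)
  qed
  also have "\<dots> = ennreal (2 ^ ?d / ?D ^ ?d) * (\<integral>\<^sup>+x. (if dist x y < ?D then ennreal ((?D / dist x y) powr (1 / 2)) else 0) \<partial>lborel)"
    by (rule nn_integral_cmult) measurable
  also have "\<dots> \<le> ennreal (2 ^ ?d / ?D ^ ?d) * ennreal (2 * ?d * ?w * ?D ^ ?d)"
    by (intro mult_left_mono nn_integral_inverse_sqrt_ball_le y) auto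
  also have "\<dots> = ennreal (2 ^ ?d * (2 * ?d * ?w))"
    using y by (simp flip: ennreal_mult)
  finally show ?thesis .
qed

text \<open>
  Jensen's inequality with respect to the measure with density \<open>G\<close> moves the power \<open>q / p\<close> onto the
  kernel, and Fubini's theorem integrates the kernel in \<open>x\<close> first.
\<close>

lemma local_potential_estimate:
  fixes \<Omega> :: "'a::euclidean_space set" and G :: "'a \<Rightarrow> ennreal"
  assumes [measurable]: "G \<in> borel_measurable borel" "\<Omega> \<in> sets borel"
    and G: "(\<integral>\<^sup>+y. G y \<partial>lborel) \<le> ennreal M" and M: "0 < M"
    and supp: "\<And>y. y \<notin> \<Omega> \<Longrightarrow> G y = 0" and pos: "\<And>y. y \<in> \<Omega> \<Longrightarrow> 0 < bdist \<Omega> y"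
    and p: "0 < p" "p \<le> q"
  shows "(\<integral>\<^sup>+x. indicator \<Omega> x * (ennreal (1 / bdist \<Omega> x ^ DIM('a)) *
      ennpowr (\<integral>\<^sup>+y. G y * local_kernel \<Omega> (p / (2 * q)) x y \<partial>lborel) (q / p)) \<partial>lborel)
    \<le> ennreal (M powr (q / p) * (2 ^ DIM('a) * (2 * DIM('a) * unit_ball_vol DIM('a))))"
proof -
  let ?C = "2 ^ DIM('a) * (2 * DIM('a) * unit_ball_vol DIM('a))"
  let ?k = "\<lambda>x y. local_kernel \<Omega> (1 / 2) x y"
  let ?h = "\<lambda>x. ennreal (1 / bdist \<Omega> x ^ DIM('a))"
  have q: "0 < q" "1 \<le> q / p" using p by auto
  \<comment> \<open>the exponent \<open>p / (2 * q)\<close> was chosen such that this power does not depend on \<open>q\<close>\<close>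
  have pw: "ennpowr (local_kernel \<Omega> (p / (2 * q)) x y) (q / p) = ?k x y" for x y
    using p q by (simp add: local_kernel_def ennpowr_ennreal powr_powr)
  have "(\<integral>\<^sup>+x. indicator \<Omega> x * (?h x * ennpowr (\<integral>\<^sup>+y. G y * local_kernel \<Omega> (p / (2 * q)) x y \<partial>lborel) (q / p)) \<partial>lborel)
    \<le> (\<integral>\<^sup>+x. indicator \<Omega> x * (?h x * (ennreal (M powr (q / p - 1)) * (\<integral>\<^sup>+y. G y * ?k x y \<partial>lborel))) \<partial>lborel)"
  proof (intro nn_integral_mono mult_left_mono)
    fix x
    show "ennpowr (\<integral>\<^sup>+y. G y * local_kernel \<Omega> (p / (2 * q)) x y \<partial>lborel) (q / p) \<le> ennreal (M powr (q / p - 1)) * (\<integral>\<^sup>+y. G y * ?k x y \<partial>lborel)"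
      unfolding pw[symmetric] using G M q by (intro jensen_ennpowr_weighted) measurable
  qed auto
  also have "\<dots> = ennreal (M powr (q / p - 1)) * (\<integral>\<^sup>+x. (\<integral>\<^sup>+y. G y * (indicator \<Omega> x * (?h x * ?k x y)) \<partial>lborel) \<partial>lborel)"
  proof -
    have "indicator \<Omega> x * (?h x * (ennreal (M powr (q / p - 1)) * (\<integral>\<^sup>+y. G y * ?k x y \<partial>lborel))) =
      ennreal (M powr (q / p - 1)) * (\<integral>\<^sup>+y. G y * (indicator \<Omega> x * (?h x * ?k x y)) \<partial>lborel)" for x
    proof -
      have "(\<integral>\<^sup>+y. G y * (indicator \<Omega> x * (?h x * ?k x y)) \<partial>lborel) = (\<integral>\<^sup>+y. (indicator \<Omega> x * ?h x) * (G y * ?k x y) \<partial>lborel)"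
        by (intro nn_integral_cong) (simp add: mult_ac)
      also have "\<dots> = (indicator \<Omega> x * ?h x) * (\<integral>\<^sup>+y. G y * ?k x y \<partial>lborel)"
        by (rule nn_integral_cmult) measurable
      finally show ?thesis by (simp add: mult_ac)
    qed
    then show ?thesis by (simp only:) (rule nn_integral_cmult, measurable)
  qed
  also have "(\<integral>\<^sup>+x. (\<integral>\<^sup>+y. G y * (indicator \<Omega> x * (?h x * ?k x y)) \<partial>lborel) \<partial>lborel) =
    (\<integral>\<^sup>+y. (\<integral>\<^sup>+x. G y * (indicator \<Omega> x * (?h x * ?k x y)) \<partial>lborel) \<partial>lborel)"
    by (rule lborel_pair.Fubini') measurable
  also have "\<dots> \<le> (\<integral>\<^sup>+y. ennreal ?C * G y \<partial>lborel)"
  proof (rule nn_integral_mono)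
    fix y
    show "(\<integral>\<^sup>+x. G y * (indicator \<Omega> x * (?h x * ?k x y)) \<partial>lborel) \<le> ennreal ?C * G y"
    proof (cases "y \<in> \<Omega>")
      case True
      have "(\<integral>\<^sup>+x. G y * (indicator \<Omega> x * (?h x * ?k x y)) \<partial>lborel) = G y * (\<integral>\<^sup>+x. indicator \<Omega> x * (?h x * ?k x y) \<partial>lborel)"
        by (rule nn_integral_cmult) measurable
      also have "\<dots> \<le> G y * ennreal ?C"
        by (intro mult_left_mono nn_integral_local_kernel_le pos True) auto
      finally show ?thesis by (simp add: mult.commute)
    qed (simp add: supp)
  qed
  also have "\<dots> = ennreal ?C * (\<integral>\<^sup>+y. G y \<partial>lborel)"
    by (rule nn_integral_cmult) measurable
  also have "\<dots> \<le> ennreal ?C * ennreal M"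
    by (intro mult_left_mono G) auto
  also have "ennreal (M powr (q / p - 1)) * (ennreal ?C * ennreal M) = ennreal (M powr (q / p) * ?C)"
    using M by (simp add: powr_diff mult_ac flip: ennreal_mult)
  finally show ?thesis by (simp add: mult_left_mono)
qed

section \<open>Moments\<close>

definition weighted_const :: "nat \<Rightarrow> real \<Rightarrow> real \<Rightarrow> real \<Rightarrow> real" where
  "weighted_const d p c \<Lambda> = 2 powr p * (trudinger_const d p / c powr p + 2 * 4 ^ d * \<Lambda> powr p / unit_ball_vol d)"

definition kernel_const :: "nat \<Rightarrow> real" where
  "kernel_const d = 2 ^ d * (2 * real d * unit_ball_vol d)"

lemma trudinger_const_nonneg: "1 < p \<Longrightarrow> 0 \<le> trudinger_const d p"
  by (simp add: trudinger_const_def)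

lemma weighted_const_nonneg: "1 < p \<Longrightarrow> 0 \<le> weighted_const d p c \<Lambda>"
  by (simp add: weighted_const_def trudinger_const_nonneg)

text \<open>
  The integrand of a Hardy inequality for \<open>u - m\<close> with weight \<open>l\<close>.  In dimension at least two \<open>l = 1\<close> and
  \<open>m = 0\<close>; in dimension one \<open>l\<close> is the logarithmic weight and \<open>m\<close> is the mean of \<open>u\<close>.
\<close>

definition hardy_density :: "'a::euclidean_space set \<Rightarrow> real \<Rightarrow> ('a \<Rightarrow> real) \<Rightarrow> ('a \<Rightarrow> real) \<Rightarrow> real \<Rightarrow> 'a \<Rightarrow> ennreal" where
  "hardy_density \<Omega> p l u m y = indicator \<Omega> y * ennreal (\<bar>u y - m\<bar> powr p / (l y powr p * bdist \<Omega> y ^ DIM('a)))"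

lemma borel_measurable_hardy_density [measurable]:
  assumes [measurable]: "u \<in> borel_measurable borel" "l \<in> borel_measurable borel" "\<Omega> \<in> sets borel"
  shows "hardy_density \<Omega> p l u m \<in> borel_measurable borel"
  unfolding hardy_density_def by measurable

text \<open>
  Split \<open>u x - m\<close> at the mean over the annulus of radius \<open>bdist \<Omega> x / 2\<close>.  The first part is the local
  potential of the energy density.  For the second part, the annulus is a set of volume comparable with
  \<open>bdist \<Omega> x ^ d\<close> on which \<open>l\<close> is at most \<open>\<Lambda> * l x\<close>, so the mean of \<open>u - m\<close> is bounded by the Hardy
  density; the kernel is at least \<open>1\<close> there and may be inserted.
\<close>

lemma weighted_pointwise_bound:
  fixes u l :: "'a::euclidean_space \<Rightarrow> real" and p q :: real
  assumes [measurable]: "u \<in> borel_measurable borel" "\<Omega> \<in> sets borel" "l \<in> borel_measurable borel" and cont: "isCont u x"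
    and bdd: "\<And>y. \<bar>u y\<bar> \<le> C" and p: "1 < p" "1 \<le> q"
    and x: "x \<in> \<Omega>" and pos: "\<And>y. y \<in> \<Omega> \<Longrightarrow> 0 < bdist \<Omega> y"
    and l: "\<And>y. y \<in> \<Omega> \<Longrightarrow> c \<le> l y" "0 < c"
    and \<Lambda>: "\<And>y. y \<in> \<Omega> \<Longrightarrow> dist x y < bdist \<Omega> x / 2 \<Longrightarrow> l y \<le> \<Lambda> * l x" "0 \<le> \<Lambda>"
  shows "ennreal ((\<bar>u x - m\<bar> / l x) powr p) \<le> ennreal (weighted_const DIM('a) p c \<Lambda> * q powr (p - 1)) *
    (\<integral>\<^sup>+y. (energy_density \<Omega> p u y + hardy_density \<Omega> p l u m y) * local_kernel \<Omega> (p / (2 * q)) x y \<partial>lborel)"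
proof -
  let ?d = "DIM('a)" and ?w = "unit_ball_vol (real DIM('a))"
  let ?k = "\<lambda>y. local_kernel \<Omega> (p / (2 * q)) x y"
  define r where "r = bdist \<Omega> x / 2"
  have r: "0 < r" using pos[OF x] by (simp add: r_def)
  have sub: "ball x r \<subseteq> \<Omega>"
    using ball_bdist_subset[OF x] r by (auto simp: r_def subset_iff)
  have lx: "0 < l x" "c \<le> l x" using l x by (auto intro: less_le_trans)
  define A where "A = annulus x r"
  have [measurable]: "A \<in> sets borel" by (simp add: A_def)
  have As: "A \<subseteq> ball x r" by (auto simp: A_def annulus_def)
  define a where "a = ?w * (1 - 1 / 2 ^ ?d) * r ^ ?d"
  have half: "(1::real) / 2 ^ ?d \<le> 1 / 2"
    using power_increasing[of 1 ?d "2::real"] by (simp add: Suc_le_eq field_simps)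
  have a: "0 < a" "?w / 2 * r ^ ?d \<le> a"
  proof -
    have "0 < 1 - (1::real) / 2 ^ ?d" using half by linarith
    then show "0 < a" unfolding a_def using r by (intro mult_pos_pos) auto
    have "?w * (1 / 2) * r ^ ?d \<le> a" unfolding a_def using half r by (intro mult_right_mono mult_left_mono) auto
    then show "?w / 2 * r ^ ?d \<le> a" by simp
  qed
  have eA: "emeasure lborel A = ennreal a" unfolding A_def a_def by (rule emeasure_annulus[OF r])
  define \<mu> where "\<mu> = mean A u"
  have 1: "ennreal ((\<bar>u x - \<mu>\<bar> / l x) powr p) \<le> ennreal (trudinger_const ?d p / c powr p * q powr (p - 1)) * (\<integral>\<^sup>+y. energy_density \<Omega> p u y * ?k y \<partial>lborel)"
  proof -
    have "(\<bar>u x - \<mu>\<bar> / l x) powr p \<le> (\<bar>u x - \<mu>\<bar> / c) powr p"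
      using lx l p by (intro powr_mono2 divide_left_mono) auto
    also have "\<dots> = 1 / c powr p * \<bar>u x - \<mu>\<bar> powr p" by (simp add: powr_divide)
    finally have "ennreal ((\<bar>u x - \<mu>\<bar> / l x) powr p) \<le> ennreal (1 / c powr p) * ennreal (\<bar>u x - \<mu>\<bar> powr p)"
      by (simp add: ennreal_leI flip: ennreal_mult)
    also have "\<dots> \<le> ennreal (1 / c powr p) * (ennreal (trudinger_const ?d p * q powr (p - 1)) *
      (\<integral>\<^sup>+y. indicator (ball x r) y * (ennreal ((r / dist x y) powr (p / (2 * q))) * energy_density \<Omega> p u y) \<partial>lborel))"
      unfolding \<mu>_def A_def using cont r sub bdd p by (intro mult_left_mono mean_deviation_le_potential) auto
    also have "(\<integral>\<^sup>+y. indicator (ball x r) y * (ennreal ((r / dist x y) powr (p / (2 * q))) * energy_density \<Omega> p u y) \<partial>lborel)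
      = (\<integral>\<^sup>+y. energy_density \<Omega> p u y * ?k y \<partial>lborel)"
      by (intro nn_integral_cong) (auto simp: local_kernel_def r_def mult.commute split: split_indicator)
    also have "ennreal (1 / c powr p) * (ennreal (trudinger_const ?d p * q powr (p - 1)) * X) = ennreal (trudinger_const ?d p / c powr p * q powr (p - 1)) * X" for X
      using trudinger_const_nonneg[OF p(1)] by (simp add: mult.assoc[symmetric] flip: ennreal_mult)
    finally show ?thesis .
  qed
  have 2: "ennreal ((\<bar>\<mu> - m\<bar> / l x) powr p) \<le> ennreal (2 * 4 ^ ?d * \<Lambda> powr p / ?w) * (\<integral>\<^sup>+y. hardy_density \<Omega> p l u m y * ?k y \<partial>lborel)"
  proof -
    define b where "b = \<Lambda> powr p * l x powr p * (4 ^ ?d * r ^ ?d)"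
    have b: "0 \<le> b" using r by (simp add: b_def)
    have pt: "indicator A y * ennreal (\<bar>u y - m\<bar> powr p) \<le> ennreal b * (hardy_density \<Omega> p l u m y * ?k y)" for y
    proof (cases "y \<in> A")
      case True
      then have y: "y \<in> \<Omega>" "dist x y < bdist \<Omega> x / 2" "0 < dist x y" using As sub r
        by (auto simp: r_def A_def annulus_def not_less intro: less_le_trans[of _ "bdist \<Omega> x / 2 / 2"])
      have ly: "0 < l y" using l y by (auto intro: less_le_trans)
      have dy: "0 < bdist \<Omega> y" by (rule pos) fact
      have "l y powr p \<le> (\<Lambda> * l x) powr p"
        using \<Lambda>(1)[OF y(1,2)] ly p by (intro powr_mono2) auto
      then have "l y powr p \<le> \<Lambda> powr p * l x powr p" by (simp add: powr_mult)
      moreover have "bdist \<Omega> y ^ ?d \<le> (4 * r) ^ ?d"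
        using bdist_comparable(2)[OF y(2)] by (intro power_mono) (auto simp: r_def)
      ultimately have "l y powr p * bdist \<Omega> y ^ ?d \<le> \<Lambda> powr p * l x powr p * (4 ^ ?d * r ^ ?d)"
        unfolding power_mult_distrib by (intro mult_mono) auto
      then have "\<bar>u y - m\<bar> powr p * (l y powr p * bdist \<Omega> y ^ ?d) \<le> \<bar>u y - m\<bar> powr p * b"
        unfolding b_def by (rule mult_left_mono) simp
      then have "\<bar>u y - m\<bar> powr p \<le> b * (\<bar>u y - m\<bar> powr p / (l y powr p * bdist \<Omega> y ^ ?d))"
        using ly dy by (simp add: pos_le_divide_eq mult.commute)
      then have "ennreal (\<bar>u y - m\<bar> powr p) \<le> ennreal b * (hardy_density \<Omega> p l u m y * 1)"
        using y b by (simp add: hardy_density_def ennreal_leI flip: ennreal_mult)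
      also have "\<dots> \<le> ennreal b * (hardy_density \<Omega> p l u m y * ?k y)"
      proof (intro mult_left_mono)
        have "1 \<le> bdist \<Omega> x / 2 / dist x y" using y by simp
        then have "1 \<le> (bdist \<Omega> x / 2 / dist x y) powr (p / (2 * q))"
          using p by (intro ge_one_powr_ge_zero) auto
        then show "1 \<le> ?k y" using y by (simp add: local_kernel_def)
      qed auto
      finally show ?thesis using True by simp
    qed simp
    have "ennreal a * ennreal (\<bar>\<mu> - m\<bar> powr p) \<le> (\<integral>\<^sup>+y. indicator A y * ennreal (\<bar>u y - m\<bar> powr p) \<partial>lborel)"
      unfolding \<mu>_def using eA a bdd p by (intro mean_powr_le) auto
    also have "\<dots> \<le> (\<integral>\<^sup>+y. ennreal b * (hardy_density \<Omega> p l u m y * ?k y) \<partial>lborel)"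
      by (intro nn_integral_mono pt)
    also have "\<dots> = ennreal b * (\<integral>\<^sup>+y. hardy_density \<Omega> p l u m y * ?k y \<partial>lborel)"
      by (rule nn_integral_cmult) measurable
    finally have "ennreal (1 / (a * l x powr p)) * (ennreal a * ennreal (\<bar>\<mu> - m\<bar> powr p)) \<le>
      ennreal (1 / (a * l x powr p)) * (ennreal b * (\<integral>\<^sup>+y. hardy_density \<Omega> p l u m y * ?k y \<partial>lborel))"
      by (intro mult_left_mono) auto
    also have "ennreal (1 / (a * l x powr p)) * (ennreal a * ennreal (\<bar>\<mu> - m\<bar> powr p)) = ennreal ((\<bar>\<mu> - m\<bar> / l x) powr p)"
      using a lx by (simp add: powr_divide flip: ennreal_mult)
    also have "ennreal (1 / (a * l x powr p)) * (ennreal b * X) = ennreal (b / (a * l x powr p)) * X" for X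
      using a b by (simp add: mult.assoc[symmetric] flip: ennreal_mult)
    also have "ennreal (b / (a * l x powr p)) * X \<le> ennreal (2 * 4 ^ ?d * \<Lambda> powr p / ?w) * X" for X
    proof (intro mult_right_mono ennreal_leI)
      have "b / (a * l x powr p) = \<Lambda> powr p * 4 ^ ?d * r ^ ?d / a"
        using lx by (simp add: b_def)
      also have "\<dots> \<le> \<Lambda> powr p * 4 ^ ?d * r ^ ?d / (?w / 2 * r ^ ?d)"
        using a r by (intro divide_left_mono) auto
      also have "\<dots> = 2 * 4 ^ ?d * \<Lambda> powr p / ?w" using r by simp
      finally show "b / (a * l x powr p) \<le> 2 * 4 ^ ?d * \<Lambda> powr p / ?w" .
    qed auto
    finally show ?thesis .
  qed
  define X where "X = (\<integral>\<^sup>+y. energy_density \<Omega> p u y * ?k y \<partial>lborel)"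
  define Y where "Y = (\<integral>\<^sup>+y. hardy_density \<Omega> p l u m y * ?k y \<partial>lborel)"
  define K1 where "K1 = trudinger_const ?d p / c powr p"
  define K2 where "K2 = 2 * 4 ^ ?d * \<Lambda> powr p / ?w"
  have K: "0 \<le> K1" "0 \<le> K2" using trudinger_const_nonneg[OF p(1)] by (auto simp: K1_def K2_def)
  have q1: "1 \<le> q powr (p - 1)" using p by (intro ge_one_powr_ge_zero) auto
  have "(\<bar>u x - m\<bar> / l x) powr p \<le> (\<bar>u x - \<mu>\<bar> / l x + \<bar>\<mu> - m\<bar> / l x) powr p"
    using lx p by (intro powr_mono2) (auto simp: add_divide_distrib[symmetric] intro!: divide_right_mono)
  also have "\<dots> \<le> 2 powr p * ((\<bar>u x - \<mu>\<bar> / l x) powr p + (\<bar>\<mu> - m\<bar> / l x) powr p)"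
    using lx p by (intro powr_add_le) auto
  finally have "ennreal ((\<bar>u x - m\<bar> / l x) powr p) \<le> ennreal (2 powr p) * (ennreal ((\<bar>u x - \<mu>\<bar> / l x) powr p) + ennreal ((\<bar>\<mu> - m\<bar> / l x) powr p))"
    by (simp add: ennreal_leI flip: ennreal_plus ennreal_mult)
  also have "\<dots> \<le> ennreal (2 powr p) * (ennreal (K1 * q powr (p - 1)) * X + ennreal K2 * Y)"
    using 1 2 unfolding X_def Y_def K1_def K2_def by (intro mult_left_mono add_mono) auto
  also have "\<dots> \<le> ennreal (2 powr p) * (ennreal ((K1 + K2) * q powr (p - 1)) * X + ennreal ((K1 + K2) * q powr (p - 1)) * Y)"
  proof (intro mult_left_mono add_mono mult_right_mono ennreal_leI)
    have "K2 * 1 \<le> (K1 + K2) * q powr (p - 1)" using K q1 by (intro mult_mono) auto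
    then show "K2 \<le> (K1 + K2) * q powr (p - 1)" by simp
  qed (use K in auto)
  also have "\<dots> = ennreal (2 powr p) * ennreal ((K1 + K2) * q powr (p - 1)) * (X + Y)"
    by (simp add: distrib_left mult.assoc)
  also have "ennreal (2 powr p) * ennreal ((K1 + K2) * q powr (p - 1)) = ennreal (weighted_const ?d p c \<Lambda> * q powr (p - 1))"
    using K by (simp add: weighted_const_def K1_def K2_def mult.assoc flip: ennreal_mult)
  also have "X + Y = (\<integral>\<^sup>+y. (energy_density \<Omega> p u y + hardy_density \<Omega> p l u m y) * ?k y \<partial>lborel)"
    unfolding X_def Y_def by (subst nn_integral_add[symmetric]) (auto simp: distrib_right)
  finally show ?thesis .
qed

text \<open>
  The dependence on \<open>q\<close> is explicit: it is what decides that the exponential of the power \<open>p / (p - 1)\<close>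
  is integrable.
\<close>

lemma weighted_moment_bound:
  fixes u l :: "'a::euclidean_space \<Rightarrow> real" and p q :: real
  assumes meas [measurable]: "u \<in> borel_measurable borel" "\<Omega> \<in> sets borel" "l \<in> borel_measurable borel" and cont: "\<And>x. isCont u x"
    and bdd: "\<And>y. \<bar>u y\<bar> \<le> C" and p: "1 < p" "p \<le> q"
    and pos: "\<And>y. y \<in> \<Omega> \<Longrightarrow> 0 < bdist \<Omega> y"
    and l: "\<And>y. y \<in> \<Omega> \<Longrightarrow> c \<le> l y" "0 < c"
    and \<Lambda>: "\<And>x y. x \<in> \<Omega> \<Longrightarrow> y \<in> \<Omega> \<Longrightarrow> dist x y < bdist \<Omega> x / 2 \<Longrightarrow> l y \<le> \<Lambda> * l x" "0 \<le> \<Lambda>"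
    and E: "energy \<Omega> p u \<le> ennreal M" and M: "0 < M"
    and H: "(\<integral>\<^sup>+y. hardy_density \<Omega> p l u m y \<partial>lborel) \<le> ennreal H" "0 \<le> H"
  shows "(\<integral>\<^sup>+x. indicator \<Omega> x * ennreal ((\<bar>u x - m\<bar> / l x) powr q / bdist \<Omega> x ^ DIM('a)) \<partial>lborel)
    \<le> ennreal ((weighted_const DIM('a) p c \<Lambda> * (M + H) * q powr (p - 1)) powr (q / p) * kernel_const DIM('a))"
proof -
  let ?d = "DIM('a)"
  define G where "G y = energy_density \<Omega> p u y + hardy_density \<Omega> p l u m y" for y
  define K where "K = weighted_const ?d p c \<Lambda> * q powr (p - 1)"
  have K: "0 \<le> K" using weighted_const_nonneg[OF p(1)] by (simp add: K_def)
  define J where "J x = (\<integral>\<^sup>+y. G y * local_kernel \<Omega> (p / (2 * q)) x y \<partial>lborel)" for x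
  have [measurable]: "G \<in> borel_measurable borel" unfolding G_def by measurable
  have [measurable]: "J \<in> borel_measurable borel" unfolding J_def by measurable
  have q: "0 < q / p" using p by simp
  have "(\<integral>\<^sup>+x. indicator \<Omega> x * ennreal ((\<bar>u x - m\<bar> / l x) powr q / bdist \<Omega> x ^ ?d) \<partial>lborel) \<le>
    (\<integral>\<^sup>+x. ennreal (K powr (q / p)) * (indicator \<Omega> x * (ennreal (1 / bdist \<Omega> x ^ ?d) * ennpowr (J x) (q / p))) \<partial>lborel)"
  proof (rule nn_integral_mono)
    fix x
    show "indicator \<Omega> x * ennreal ((\<bar>u x - m\<bar> / l x) powr q / bdist \<Omega> x ^ ?d) \<le>
      ennreal (K powr (q / p)) * (indicator \<Omega> x * (ennreal (1 / bdist \<Omega> x ^ ?d) * ennpowr (J x) (q / p)))"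
    proof (cases "x \<in> \<Omega>")
      case True
      have "ennreal ((\<bar>u x - m\<bar> / l x) powr p) \<le> ennreal K * J x"
        unfolding K_def J_def G_def using True cont bdd p pos l \<Lambda> by (intro weighted_pointwise_bound meas) auto
      then have "ennpowr (ennreal ((\<bar>u x - m\<bar> / l x) powr p)) (q / p) \<le> ennpowr (ennreal K * J x) (q / p)"
        using q by (intro ennpowr_mono) auto
      also have "\<dots> = ennreal (K powr (q / p)) * ennpowr (J x) (q / p)"
        using q K by (simp add: ennpowr_mult ennpowr_ennreal)
      also have "ennpowr (ennreal ((\<bar>u x - m\<bar> / l x) powr p)) (q / p) = ennreal ((\<bar>u x - m\<bar> / l x) powr q)"
        using p by (simp add: ennpowr_ennreal powr_powr)
      finally have "ennreal (1 / bdist \<Omega> x ^ ?d) * ennreal ((\<bar>u x - m\<bar> / l x) powr q) \<le> ennreal (1 / bdist \<Omega> x ^ ?d) * (ennreal (K powr (q / p)) * ennpowr (J x) (q / p))"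
        by (rule mult_left_mono) simp
      then show ?thesis using True by (simp add: mult.left_commute flip: ennreal_mult)
    qed simp
  qed
  also have "\<dots> = ennreal (K powr (q / p)) * (\<integral>\<^sup>+x. indicator \<Omega> x * (ennreal (1 / bdist \<Omega> x ^ ?d) * ennpowr (J x) (q / p)) \<partial>lborel)"
    by (rule nn_integral_cmult) measurable
  also have "\<dots> \<le> ennreal (K powr (q / p)) * ennreal ((M + H) powr (q / p) * (2 ^ ?d * (2 * ?d * unit_ball_vol ?d)))"
    unfolding J_def
  proof (rule mult_left_mono[OF local_potential_estimate])
    have "(\<integral>\<^sup>+y. G y \<partial>lborel) = energy \<Omega> p u + (\<integral>\<^sup>+y. hardy_density \<Omega> p l u m y \<partial>lborel)"
      unfolding G_def energy_eq_density by (rule nn_integral_add) measurable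
    also have "\<dots> \<le> ennreal M + ennreal H" by (intro add_mono E H)
    finally show "(\<integral>\<^sup>+y. G y \<partial>lborel) \<le> ennreal (M + H)" using M H by simp
    show "G y = 0" if "y \<notin> \<Omega>" for y using that by (simp add: G_def energy_density_def hardy_density_def)
  qed (use M H p pos in auto)
  also have "\<dots> = ennreal ((K * (M + H)) powr (q / p) * kernel_const ?d)"
    using K M H by (simp add: kernel_const_def powr_mult mult.assoc flip: ennreal_mult)
  also have "K * (M + H) = weighted_const ?d p c \<Lambda> * (M + H) * q powr (p - 1)"
    by (simp add: K_def)
  finally show ?thesis .
qed

section \<open>From moments to the exponential\<close>

text \<open>
  The left-hand side is one term of the exponential series at \<open>n\<close>.
\<close>

lemma power_self_div_fact_le: "real n ^ n / fact n \<le> exp 1 ^ n"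
proof -
  have s: "(\<lambda>k. real n ^ k / fact k) sums exp (real n)"
    using exp_converges[of "real n"] by (simp add: scaleR_conv_of_real divide_inverse mult.commute)
  have "(\<Sum>k\<in>{n}. real n ^ k / fact k) \<le> (\<Sum>k. real n ^ k / fact k)"
    using s by (intro sum_le_suminf) (auto simp: sums_iff)
  then show ?thesis
    using s exp_of_nat_mult[of n "1::real"] by (simp add: sums_iff)
qed

text \<open>
  Expand the exponential and integrate term by term.  The \<open>n\<close>-th term is the moment of order
  \<open>q = n * p / (p - 1)\<close>, and \<open>n \<ge> n0 \<ge> p - 1\<close> gives \<open>q \<ge> p\<close>.
\<close>

lemma exponential_moment_sum:
  fixes X w :: "'a::euclidean_space \<Rightarrow> real" and p \<alpha> B K :: real
  assumes [measurable]: "X \<in> borel_measurable borel" "w \<in> borel_measurable borel" "\<Omega> \<in> sets borel"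
    and X: "\<And>x. 0 \<le> X x" and w: "\<And>x. x \<in> \<Omega> \<Longrightarrow> 0 < w x" and p: "1 < p" and n0: "p - 1 \<le> real n0"
    and \<alpha>: "0 \<le> \<alpha>" and B: "0 < B" and K: "0 \<le> K"
    and mom: "\<And>q. p \<le> q \<Longrightarrow> (\<integral>\<^sup>+x. indicator \<Omega> x * ennreal (X x powr q / w x) \<partial>lborel) \<le> ennreal ((B * q powr (p - 1)) powr (q / p) * K)"
    and small: "\<alpha> * (p / (p - 1) * B powr (1 / (p - 1)) * exp 1) \<le> 1 / 2"
  shows "(\<integral>\<^sup>+x. indicator \<Omega> x * ennreal (trunc_exp n0 (\<alpha> * X x powr (p / (p - 1))) / w x) \<partial>lborel) \<le> ennreal (2 * K)"
proof -
  let ?p' = "p / (p - 1)"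
  have p': "0 < ?p'" using p by simp
  define c where "c n = \<alpha> ^ n / fact n" for n :: nat
  have c: "0 \<le> c n" for n using \<alpha> by (simp add: c_def)
  have ser: "indicator \<Omega> x * ennreal (trunc_exp n0 (\<alpha> * X x powr ?p') / w x) =
    (\<Sum>k. ennreal (c (k + n0)) * (indicator \<Omega> x * ennreal (X x powr (real (k + n0) * ?p') / w x)))" for x
  proof (cases "x \<in> \<Omega>")
    case True
    have t: "(\<alpha> * X x powr ?p') ^ n / fact n / w x = c n * (X x powr (real n * ?p') / w x)" if "1 \<le> n" for n
    proof -
      have "(X x powr ?p') ^ n = X x powr (real n * ?p')"
      proof (cases "X x = 0")
        case True
        then show ?thesis using p' that by (cases n) auto
      next
        case False
        then have "0 < X x powr ?p'" by simp
        then show ?thesis by (simp only: powr_realpow[symmetric] powr_powr mult.commute)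
      qed
      then show ?thesis by (simp add: c_def power_mult_distrib)
    qed
    have "(\<lambda>k. c (k + n0) * (X x powr (real (k + n0) * ?p') / w x)) sums (trunc_exp n0 (\<alpha> * X x powr ?p') / w x)"
    proof -
      have "1 \<le> n0" using n0 p by (cases n0) auto
      then have "c (k + n0) * (X x powr (real (k + n0) * ?p') / w x) = (\<alpha> * X x powr ?p') ^ (k + n0) / fact (k + n0) / w x" for k
        by (intro t[symmetric]) simp
      then show ?thesis by (simp only:) (rule sums_divide[OF trunc_exp_sums])
    qed
    then have "(\<lambda>k. ennreal (c (k + n0) * (X x powr (real (k + n0) * ?p') / w x))) sums ennreal (trunc_exp n0 (\<alpha> * X x powr ?p') / w x)"
      using c w[OF True] by (subst sums_ennreal) (auto intro!: trunc_exp_nonneg divide_nonneg_nonneg mult_nonneg_nonneg \<alpha>)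
    then have "ennreal (trunc_exp n0 (\<alpha> * X x powr ?p') / w x) = (\<Sum>k. ennreal (c (k + n0) * (X x powr (real (k + n0) * ?p') / w x)))"
      by (rule sums_unique)
    also have "\<dots> = (\<Sum>k. ennreal (c (k + n0)) * ennreal (X x powr (real (k + n0) * ?p') / w x))"
      using c w[OF True] by (intro suminf_cong ennreal_mult) auto
    finally show ?thesis using True by simp
  qed simp
  have bnd: "ennreal (c n) * (\<integral>\<^sup>+x. indicator \<Omega> x * ennreal (X x powr (real n * ?p') / w x) \<partial>lborel) \<le> ennreal (K * (1 / 2) ^ n)"
    if n: "n0 \<le> n" for n
  proof -
    define q where "q = real n * ?p'"
    have n1: "p - 1 \<le> real n" using n n0 by linarith
    have "(p - 1) * p \<le> real n * p" using n1 p by (intro mult_right_mono) auto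
    then have q: "p \<le> q" using p by (simp add: q_def field_simps)
    have qp: "q / p = real n / (p - 1)" using p by (simp add: q_def)
    have q0: "0 < q" using q p by linarith
    have "(B * q powr (p - 1)) powr (q / p) = (B powr (1 / (p - 1))) ^ n * q ^ n"
    proof -
      have "(q powr (p - 1)) powr (q / p) = q ^ n"
        unfolding powr_powr qp using p q0 by (simp add: powr_realpow)
      moreover have "B powr (q / p) = (B powr (1 / (p - 1))) ^ n"
        using B by (simp add: qp powr_powr flip: powr_realpow)
      ultimately show ?thesis using B by (simp add: powr_mult)
    qed
    also have "q ^ n = ?p' ^ n * real n ^ n" by (simp only: q_def power_mult_distrib mult.commute)
    finally have e: "(B * q powr (p - 1)) powr (q / p) = (B powr (1 / (p - 1))) ^ n * (?p' ^ n * real n ^ n)" .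
    have "ennreal (c n) * (\<integral>\<^sup>+x. indicator \<Omega> x * ennreal (X x powr q / w x) \<partial>lborel) \<le> ennreal (c n) * ennreal ((B * q powr (p - 1)) powr (q / p) * K)"
      by (intro mult_left_mono mom q) auto
    also have "\<dots> = ennreal (c n * ((B * q powr (p - 1)) powr (q / p) * K))"
      using c K by (intro ennreal_mult[symmetric]) auto
    also have "\<dots> \<le> ennreal (K * (1 / 2) ^ n)"
    proof (rule ennreal_leI)
      define b where "b = \<alpha> * (?p' * B powr (1 / (p - 1)))"
      have b: "0 \<le> b" unfolding b_def by (intro mult_nonneg_nonneg less_imp_le[OF p'] \<alpha> powr_ge_zero)
      have "c n * ((B * q powr (p - 1)) powr (q / p) * K) = K * (b ^ n * (real n ^ n / fact n))"
      proof -
        have "\<alpha> ^ n / fact n * (Q ^ n * (P ^ n * N) * K) = K * ((\<alpha> * (P * Q)) ^ n * (N / fact n))" for P Q N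
          by (simp add: power_mult_distrib)
        then show ?thesis unfolding e c_def b_def .
      qed
      also have "\<dots> \<le> K * (b ^ n * exp 1 ^ n)"
        using b K by (intro mult_left_mono power_self_div_fact_le) auto
      also have "\<dots> = K * (b * exp 1) ^ n" by (simp add: power_mult_distrib)
      also have "\<dots> \<le> K * (1 / 2) ^ n"
      proof (intro mult_left_mono power_mono K)
        show "b * exp 1 \<le> 1 / 2" using small by (simp only: b_def mult.assoc)
        show "0 \<le> b * exp 1" using b by (intro mult_nonneg_nonneg) auto
      qed
      finally show "c n * ((B * q powr (p - 1)) powr (q / p) * K) \<le> K * (1 / 2) ^ n" .
    qed
    finally show ?thesis by (simp only: q_def)
  qed
  have "(\<integral>\<^sup>+x. indicator \<Omega> x * ennreal (trunc_exp n0 (\<alpha> * X x powr ?p') / w x) \<partial>lborel) =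
    (\<Sum>k. ennreal (c (k + n0)) * (\<integral>\<^sup>+x. indicator \<Omega> x * ennreal (X x powr (real (k + n0) * ?p') / w x) \<partial>lborel))"
    unfolding ser by (subst nn_integral_suminf) (auto intro!: suminf_cong nn_integral_cmult)
  also have "\<dots> \<le> (\<Sum>k. ennreal (K * (1 / 2) ^ k))"
  proof (intro suminf_le summableI)
    fix k
    have "(1 / 2 :: real) ^ (k + n0) \<le> (1 / 2) ^ k" by (intro power_decreasing) auto
    then have "ennreal (K * (1 / 2) ^ (k + n0)) \<le> ennreal (K * (1 / 2) ^ k)"
      using K by (intro ennreal_leI mult_left_mono)
    then show "ennreal (c (k + n0)) * (\<integral>\<^sup>+x. indicator \<Omega> x * ennreal (X x powr (real (k + n0) * ?p') / w x) \<partial>lborel) \<le> ennreal (K * (1 / 2) ^ k)"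
      using bnd[of "k + n0"] by (meson le_add2 order_trans)
  qed
  also have "\<dots> = ennreal (2 * K)"
  proof -
    have "(\<lambda>k. K * (1 / 2) ^ k) sums (K * (1 / (1 - 1 / 2)))"
      by (intro sums_mult geometric_sums) simp
    then have "(\<lambda>k. ennreal (K * (1 / 2) ^ k)) sums ennreal (2 * K)"
      using K by (subst sums_ennreal) (auto simp: mult.commute)
    then show ?thesis by (rule sums_unique[symmetric])
  qed
  finally show ?thesis .
qed

section \<open>Cones at a Lipschitz boundary\<close>

definition horizontal :: "'a::euclidean_space \<Rightarrow> 'a \<Rightarrow> 'a" where
  "horizontal e v = v - (v \<bullet> e) *\<^sub>R e"

lemma horizontal_add: "horizontal e (v + w) = horizontal e v + horizontal e w"
  by (simp add: horizontal_def inner_add_left scaleR_add_left)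

lemma horizontal_diff: "horizontal e (v - w) = horizontal e v - horizontal e w"
  by (simp add: horizontal_def inner_diff_left scaleR_diff_left)

lemma horizontal_scale: "norm e = 1 \<Longrightarrow> horizontal e (t *\<^sub>R e) = 0"
  by (simp add: horizontal_def norm_eq_1)

lemma norm_horizontal_le:
  assumes "norm e = 1"
  shows "norm (horizontal e v) \<le> norm v"
proof -
  have "horizontal e v \<bullet> horizontal e v = v \<bullet> v - (v \<bullet> e) ^ 2"
    using assms by (simp add: horizontal_def norm_eq_1 inner_diff_left inner_diff_right inner_commute power2_eq_square)
  then have "horizontal e v \<bullet> horizontal e v \<le> v \<bullet> v" by simp
  then show ?thesis by (simp add: norm_le)
qed

lemma horizontal_orthogonal: "norm e = 1 \<Longrightarrow> horizontal e v \<bullet> e = 0"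
  by (simp add: horizontal_def norm_eq_1 inner_diff_left)

text \<open>
  Points \<open>w\<close> that are nearer to the boundary than \<open>x\<close> by a factor of order \<open>t\<close>, lie within distance
  \<open>A * bdist \<Omega> x\<close> of \<open>x\<close>, and are horizontally within \<open>bdist \<Omega> x / t\<close> of \<open>x\<close>.  The conditions are stated through \<^const>\<open>bdist\<close> only, and not through a
  chart, so that the same set makes sense near every boundary point.
\<close>

definition cone_set :: "'a::euclidean_space set \<Rightarrow> real \<Rightarrow> 'a \<Rightarrow> real \<Rightarrow> 'a \<Rightarrow> 'a set" where
  "cone_set \<Omega> A e t x = {w \<in> \<Omega>. bdist \<Omega> x \<le> A * t * bdist \<Omega> w \<and> t * bdist \<Omega> w \<le> A * bdist \<Omega> x \<and>
     dist x w \<le> A * bdist \<Omega> x \<and> t * norm (horizontal e (x - w)) \<le> bdist \<Omega> x}"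

lemma cone_set_mono: "A \<le> B \<Longrightarrow> 0 \<le> t \<Longrightarrow> cone_set \<Omega> A e t x \<subseteq> cone_set \<Omega> B e t x"
proof
  fix w assume AB: "A \<le> B" "0 \<le> t" and w: "w \<in> cone_set \<Omega> A e t x"
  have "A * t * bdist \<Omega> w \<le> B * t * bdist \<Omega> w" "A * bdist \<Omega> x \<le> B * bdist \<Omega> x"
    using AB by (auto intro!: mult_right_mono)
  then show "w \<in> cone_set \<Omega> B e t x"
    using w unfolding cone_set_def by auto
qed

text \<open>
  In a Lipschitz chart the height above the graph and the distance to the boundary are comparable up
  to the factor \<open>k = 1 + L\<close>.  Moving \<open>x\<close> down until its height is divided by \<open>t\<close> gives the centre of the
  ball.
\<close>

lemma lipschitz_chart_cone:
  fixes \<Omega> :: "'a::euclidean_space set"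
  assumes op: "open \<Omega>" and lip: "lipschitz_boundary \<Omega>" and z: "z \<in> frontier \<Omega>"
  obtains \<rho> e A where "0 < \<rho>" "norm e = 1" "1 \<le> A"
    "\<And>x t. x \<in> \<Omega> \<Longrightarrow> x \<in> ball z \<rho> \<Longrightarrow> 1 \<le> t \<Longrightarrow> \<exists>y. ball y (bdist \<Omega> x / (A * t)) \<subseteq> cone_set \<Omega> A e t x"
proof -
  obtain e r L g where e: "norm e = 1" and r: "0 < r" and g: "L-lipschitz_on {y. y \<bullet> e = 0} g"
    and graph: "\<Omega> \<inter> ball z r = {x \<in> ball z r. g ((x - z) - ((x - z) \<bullet> e) *\<^sub>R e) < (x - z) \<bullet> e}"
    using lip[unfolded lipschitz_boundary_def, rule_format, OF z] by (elim exE conjE) (rule that)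
  have L: "0 \<le> L" using g by (rule lipschitz_on_nonneg)
  define k where "k = 1 + L"
  have k: "1 \<le> k" using L by (simp add: k_def)
  \<comment> \<open>the height above the graph\<close>
  define h where "h x = (x - z) \<bullet> e - g (horizontal e (x - z))" for x
  have h_lip: "\<bar>h x - h y\<bar> \<le> k * dist x y" for x y
  proof -
    have "\<bar>(x - y) \<bullet> e\<bar> \<le> dist x y"
      using Cauchy_Schwarz_ineq2[of "x - y" e] e by (simp add: dist_norm)
    moreover have "\<bar>g (horizontal e (x - z)) - g (horizontal e (y - z))\<bar> \<le> L * dist x y"
    proof -
      have "dist (g (horizontal e (x - z))) (g (horizontal e (y - z))) \<le> L * dist (horizontal e (x - z)) (horizontal e (y - z))"
        using g by (rule lipschitz_onD) (simp_all add: horizontal_orthogonal e)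
      also have "dist (horizontal e (x - z)) (horizontal e (y - z)) = norm (horizontal e (x - y))"
        by (simp add: dist_norm horizontal_diff)
      also have "L * \<dots> \<le> L * dist x y"
        using norm_horizontal_le[OF e] L by (intro mult_left_mono) (auto simp: dist_norm)
      finally show ?thesis by (simp add: dist_real_def)
    qed
    moreover have "h x - h y = (x - y) \<bullet> e - (g (horizontal e (x - z)) - g (horizontal e (y - z)))"
      by (simp add: h_def inner_diff_left)
    ultimately show ?thesis unfolding k_def distrib_right mult_1 by linarith
  qed
  have h_shift: "h (x + s *\<^sub>R e) = h x + s" for x s
  proof -
    have eq: "x + s *\<^sub>R e - z = (x - z) + s *\<^sub>R e" by simp
    have "e \<bullet> e = 1" using e by (simp add: norm_eq_1)
    then show ?thesis
      unfolding h_def eq horizontal_add horizontal_scale[OF e] inner_add_left by simp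
  qed
  have graph': "x \<in> \<Omega> \<longleftrightarrow> 0 < h x" if "x \<in> ball z r" for x
  proof -
    have "x \<in> \<Omega> \<longleftrightarrow> x \<in> \<Omega> \<inter> ball z r" using that by blast
    also have "\<dots> \<longleftrightarrow> g (horizontal e (x - z)) < (x - z) \<bullet> e"
      unfolding graph mem_Collect_eq horizontal_def using that by blast
    finally show ?thesis by (simp add: h_def)
  qed
  have front1: "y \<in> frontier \<Omega>" if y: "y \<in> ball z r" "h y = 0" for y
  proof -
    have "y \<in> closure \<Omega>"
      unfolding closure_approachable
    proof (intro allI impI)
      fix \<epsilon> :: real assume "0 < \<epsilon>"
      obtain s where s: "0 < s" "ball y s \<subseteq> ball z r" using y(1) open_ball openE by meson
      define m where "m = min s \<epsilon> / 2"
      have m: "0 < m" "m < s" "m < \<epsilon>" using s(1) \<open>0 < \<epsilon>\<close> unfolding m_def by linarith+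
      have d: "dist (y + m *\<^sub>R e) y = m" using m e by (simp add: dist_norm)
      then have "y + m *\<^sub>R e \<in> ball z r" using m by (intro subsetD[OF s(2)]) (simp add: dist_commute)
      then have "y + m *\<^sub>R e \<in> \<Omega>" using graph' h_shift y m by simp
      then show "\<exists>x\<in>\<Omega>. dist x y < \<epsilon>" using d m by (intro bexI[of _ "y + m *\<^sub>R e"]) auto
    qed
    moreover have "y \<notin> interior \<Omega>" using graph'[OF y(1)] y(2) interior_subset by auto
    ultimately show ?thesis by (simp add: frontier_def)
  qed
  have front2: "h y = 0" if y: "y \<in> ball z r" "y \<in> frontier \<Omega>" for y
  proof -
    have "y \<notin> \<Omega>" using y(2) op by (simp add: frontier_def interior_open)
    then have "h y \<le> 0" using graph'[OF y(1)] by simp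
    moreover have "\<not> h y < 0"
    proof
      assume neg: "h y < 0"
      obtain s where s: "0 < s" "ball y s \<subseteq> ball z r" using y(1) open_ball openE by meson
      have "0 < - h y / k" using neg k by (intro divide_pos_pos) auto
      then have "0 < min s (- h y / k)" using s by simp
      moreover have "y \<in> closure \<Omega>" using y(2) by (simp add: frontier_def)
      ultimately obtain x where x: "x \<in> \<Omega>" "dist x y < min s (- h y / k)"
        unfolding closure_approachable by blast
      have "x \<in> ball z r" using x(2) by (intro subsetD[OF s(2)]) (simp add: dist_commute)
      then have "0 < h x" using graph' x(1) by blast
      moreover have "k * dist x y < - h y"
      proof -
        have "dist x y < - h y / k" using x(2) unfolding min_less_iff_conj by (rule conjunct2)
        moreover have "0 < k" using k by simp
        ultimately have "k * dist x y < k * (- h y / k)" by (rule mult_strict_left_mono)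
        also have "\<dots> = - h y" using k by simp
        finally show ?thesis .
      qed
      ultimately show False using h_lip[of x y] by linarith
    qed
    ultimately show ?thesis by simp
  qed
  have hz: "h z = 0" using front2[OF _ z] r by simp
  have up: "bdist \<Omega> x \<le> h x" if x: "dist z x < r / 4" "0 \<le> h x" "h x < r / 4" for x
  proof -
    define y where "y = x + (- h x) *\<^sub>R e"
    have d: "dist x y = h x" using x e by (simp add: y_def dist_norm)
    have "dist z y < r" using dist_triangle[of z y x] d x r by linarith
    then have "y \<in> frontier \<Omega>" using h_shift[of x "- h x"] by (intro front1) (auto simp: y_def)
    then show ?thesis unfolding bdist_def d[symmetric] by (rule infdist_le)
  qed
  have lo: "h x \<le> k * bdist \<Omega> x" if x: "dist z x < r / 4" for x
  proof -
    obtain y where y: "y \<in> frontier \<Omega>" "infdist x (frontier \<Omega>) = dist x y"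
      using infdist_attains_inf[of "frontier \<Omega>" x] z frontier_closed by blast
    have "dist x y \<le> dist x z" unfolding y(2)[symmetric] by (rule infdist_le[OF z])
    then have "dist z y < r" using dist_triangle[of z y x] x r by (simp add: dist_commute)
    then have "h y = 0" using y(1) by (intro front2) auto
    then show ?thesis using h_lip[of x y] by (simp add: bdist_def y(2))
  qed
  have main: "\<exists>y. ball y (bdist \<Omega> x / (2 * k * t)) \<subseteq> cone_set \<Omega> (2 * k) e t x"
    if x: "x \<in> \<Omega>" "x \<in> ball z (r / (16 * k))" and t: "1 \<le> t" for x t
  proof -
    have rk: "r / (16 * k) \<le> r / 16" using r k by (intro divide_left_mono) auto
    have xz: "dist z x < r / (16 * k)" using x by simp
    then have xz': "dist z x < r / 16" using rk by linarith
    have hx0: "0 < h x" using x xz' r graph'[of x] by simp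
    have "k * dist z x < r / 16" using xz k by (simp add: field_simps)
    then have hx1: "h x < r / 16" using h_lip[of x z] hz by (simp add: dist_commute)
    have dx: "bdist \<Omega> x \<le> h x" "h x \<le> k * bdist \<Omega> x"
      using up[of x] lo[of x] xz' hx0 hx1 r by auto
    \<comment> \<open>descending by \<open>s\<close> divides the height by \<open>t\<close>\<close>
    define s where "s = (1 - 1 / t) * h x"
    have s: "0 \<le> s" "s \<le> h x" using t hx0 by (auto simp: s_def mult_left_le_one_le)
    define y where "y = x + (- s) *\<^sub>R e"
    have hy: "h y = h x / t" unfolding y_def h_shift s_def by (simp add: algebra_simps)
    have dxy: "dist x y = s" using s e by (simp add: y_def dist_norm)
    have hor: "horizontal e (x - y) = 0"
    proof -
      have "x - y = s *\<^sub>R e" by (simp add: y_def)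
      then show ?thesis by (simp only: horizontal_scale[OF e])
    qed
    have "w \<in> cone_set \<Omega> (2 * k) e t x" if w: "w \<in> ball y (bdist \<Omega> x / (2 * k * t))" for w
    proof -
      have "bdist \<Omega> x / (2 * k * t) \<le> h x / (2 * k * t)" using dx k t by (intro divide_right_mono) auto
      then have w1: "dist y w < h x / (2 * k * t)" using w by simp
      have kd: "k * dist y w < h x / (2 * t)" using w1 k t by (simp add: field_simps)
      have hw: "\<bar>h w - h x / t\<bar> < h x / (2 * t)"
        using h_lip[of w y] kd hy by (simp add: dist_commute)
      have e2: "h x / t = 2 * (h x / (2 * t))" by simp
      have ht: "h x / (2 * t) \<le> h x / 2" using hx0 t by (intro divide_left_mono) auto
      have hwlo: "h x / (2 * t) < h w" and hwup: "h w < 3 * (h x / (2 * t))"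
        using hw e2 by linarith+
      have yw: "dist y w \<le> h x / 2"
      proof -
        have "1 * dist y w \<le> k * dist y w" using k by (intro mult_right_mono) auto
        then show ?thesis using kd ht by linarith
      qed
      have xw: "dist x w \<le> 3 / 2 * h x" using dist_triangle[of x w y] dxy s yw by linarith
      have zw: "dist z w < r / 4" using dist_triangle[of z w x] xw xz' hx1 r by linarith
      have pos: "0 < h x / (2 * t)" using hx0 t by simp
      have "h w < r / 4" using hwup ht hx1 hx0 by linarith
      then have dw: "bdist \<Omega> w \<le> h w" "h w \<le> k * bdist \<Omega> w"
        using up[OF zw] lo[OF zw] hwlo pos by linarith+
      have "w \<in> \<Omega>" using graph'[of w] zw r hwlo pos by simp
      moreover have "bdist \<Omega> x \<le> 2 * k * t * bdist \<Omega> w"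
      proof -
        have "h x / (2 * t) \<le> k * bdist \<Omega> w" using hwlo dw by linarith
        then have "h x \<le> k * bdist \<Omega> w * (2 * t)" using t by (simp add: pos_divide_le_eq)
        then show ?thesis using dx(1) by (simp add: mult_ac)
      qed
      moreover have "t * bdist \<Omega> w \<le> 2 * k * bdist \<Omega> x"
      proof -
        have "t * bdist \<Omega> w \<le> t * (3 * (h x / (2 * t)))" using dw hwup t by (intro mult_left_mono) auto
        also have "\<dots> = 3 / 2 * h x" using t by simp
        also have "\<dots> \<le> 2 * h x" using hx0 by simp
        finally show ?thesis using dx(2) by linarith
      qed
      moreover have "dist x w \<le> 2 * k * bdist \<Omega> x" using xw dx(2) hx0 by linarith
      moreover have "t * norm (horizontal e (x - w)) \<le> bdist \<Omega> x"
      proof -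
        have "horizontal e (x - w) = horizontal e (x - y) + horizontal e (y - w)"
          unfolding horizontal_add[symmetric] by simp
        then have "norm (horizontal e (x - w)) \<le> dist y w"
          using hor norm_horizontal_le[OF e, of "y - w"] by (simp add: dist_norm)
        also have "\<dots> \<le> bdist \<Omega> x / (2 * k * t)" using w by simp
        also have "\<dots> \<le> bdist \<Omega> x / t"
        proof (rule divide_left_mono)
          have "1 * t \<le> (2 * k) * t" using k t by (intro mult_right_mono) auto
          then show "t \<le> 2 * k * t" by simp
        qed (use k t in auto)
        finally show ?thesis using t by (simp add: pos_le_divide_eq mult.commute)
      qed
      ultimately show ?thesis by (simp add: cone_set_def)
    qed
    then show ?thesis by blast
  qed
  show ?thesis
  proof (rule that[of "r / (16 * k)" e "2 * k"])
    show "0 < r / (16 * k)" using r k by simp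
    show "1 \<le> 2 * k" using k by simp
  qed (fact e, rule main)
qed

text \<open>
  Compactness of the boundary leaves finitely many directions and one constant.
\<close>

lemma boundary_cone_cover:
  fixes \<Omega> :: "'a::euclidean_space set"
  assumes dom: "bounded_lipschitz_domain \<Omega>"
  obtains \<eta> E A where "0 < \<eta>" "finite E" "E \<noteq> {}" "\<And>e. e \<in> E \<Longrightarrow> norm e = 1" "1 \<le> A"
    "\<And>x t. x \<in> \<Omega> \<Longrightarrow> bdist \<Omega> x < \<eta> \<Longrightarrow> 1 \<le> t \<Longrightarrow> \<exists>e\<in>E. \<exists>y. ball y (bdist \<Omega> x / (A * t)) \<subseteq> cone_set \<Omega> A e t x"
proof -
  have op: "open \<Omega>" "lipschitz_boundary \<Omega>" "bounded \<Omega>" using dom by (auto simp: bounded_lipschitz_domain_def)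
  define good where "good z \<rho> e A \<longleftrightarrow> 0 < \<rho> \<and> norm e = 1 \<and> 1 \<le> A \<and> (\<forall>x t. x \<in> \<Omega> \<longrightarrow> x \<in> ball z \<rho> \<longrightarrow> 1 \<le> t \<longrightarrow> (\<exists>y. ball y (bdist \<Omega> x / (A * t)) \<subseteq> cone_set \<Omega> A e t x))" for z \<rho> e A
  have "\<exists>\<rho> e A. good z \<rho> e A" if "z \<in> frontier \<Omega>" for z
    using lipschitz_chart_cone[OF op(1,2) that] unfolding good_def by metis
  then obtain \<rho> e A where g: "\<And>z. z \<in> frontier \<Omega> \<Longrightarrow> good z (\<rho> z) (e z) (A z)" by metis
  have comp: "compact (frontier \<Omega>)" using op(3) by (rule compact_frontier_bounded)
  obtain T where T: "T \<subseteq> frontier \<Omega>" "finite T" "frontier \<Omega> \<subseteq> (\<Union>z\<in>T. ball z (\<rho> z / 2))"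
  proof (rule compactE_image[OF comp, of "frontier \<Omega>" "\<lambda>z. ball z (\<rho> z / 2)"])
    show "frontier \<Omega> \<subseteq> (\<Union>z\<in>frontier \<Omega>. ball z (\<rho> z / 2))" using g by (force simp: good_def)
  qed auto
  have ne: "T \<noteq> {}" using T(3) frontier_nonempty[OF dom] by auto
  define \<eta> where "\<eta> = Min ((\<lambda>z. \<rho> z / 2) ` T)"
  define B where "B = Max (A ` T)"
  have \<eta>: "0 < \<eta>" unfolding \<eta>_def using T ne g by (subst Min_gr_iff) (auto simp: good_def)
  have \<eta>le: "\<eta> \<le> \<rho> z / 2" if "z \<in> T" for z unfolding \<eta>_def using T that by (intro Min_le) auto
  have Ble: "A z \<le> B" if "z \<in> T" for z unfolding B_def using T that by (intro Max_ge) auto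
  have B1: "1 \<le> B"
  proof -
    obtain z where "z \<in> T" using ne by blast
    then show ?thesis using Ble[of z] g[of z] T by (auto simp: good_def)
  qed
  have "\<exists>e'\<in>e ` T. \<exists>y. ball y (bdist \<Omega> x / (B * t)) \<subseteq> cone_set \<Omega> B e' t x"
    if x: "x \<in> \<Omega>" "bdist \<Omega> x < \<eta>" "1 \<le> t" for x t
  proof -
    obtain w where w: "w \<in> frontier \<Omega>" "infdist x (frontier \<Omega>) = dist x w"
      using infdist_attains_inf[of "frontier \<Omega>" x] frontier_nonempty[OF dom] frontier_closed by blast
    obtain z where z: "z \<in> T" "dist z w < \<rho> z / 2" using T(3) w(1) by auto
    have "dist w x < \<rho> z / 2" using x(2) \<eta>le[OF z(1)] w(2) by (simp add: bdist_def dist_commute)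
    then have "x \<in> ball z (\<rho> z)" using dist_triangle[of z x w] z(2) by simp
    then obtain y where y: "ball y (bdist \<Omega> x / (A z * t)) \<subseteq> cone_set \<Omega> (A z) (e z) t x"
      using g[of z] T(1) z(1) x unfolding good_def by blast
    have A1: "1 \<le> A z" using g[of z] T(1) z(1) by (auto simp: good_def)
    have "bdist \<Omega> x / (B * t) \<le> bdist \<Omega> x / (A z * t)"
      using A1 B1 x(3) Ble[OF z(1)] by (intro divide_left_mono mult_right_mono mult_pos_pos) auto
    then have "ball y (bdist \<Omega> x / (B * t)) \<subseteq> cone_set \<Omega> (A z) (e z) t x"
      using y by (meson order_trans subset_ball)
    also have "\<dots> \<subseteq> cone_set \<Omega> B (e z) t x" using Ble[OF z(1)] x(3) by (intro cone_set_mono) auto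
    finally show ?thesis using z(1) by blast
  qed
  then show ?thesis
    using T g ne \<eta> B1 by (intro that[of \<eta> "e ` T" B]) (auto simp: good_def)
qed

text \<open>
  Cover the tube by balls of radius \<open>2 * s\<close> with centres spaced by \<open>s\<close> along its axis.
\<close>

lemma emeasure_tube_le:
  fixes w :: "'a::euclidean_space"
  assumes e: "norm e = 1" and s: "0 < s" "0 \<le> T"
  shows "emeasure lborel {x. \<bar>(x - w) \<bullet> e\<bar> \<le> T \<and> norm (horizontal e (x - w)) \<le> s}
    \<le> ennreal ((2 * T / s + 3) * (unit_ball_vol DIM('a) * (2 * s) ^ DIM('a)))"
proof -
  define N where "N = \<lfloor>T / s\<rfloor> + 1"
  have N: "T / s < of_int N" "of_int N \<le> T / s + 1" unfolding N_def by linarith+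
  have N0: "0 \<le> N" unfolding N_def using s by (simp add: zero_le_floor le_add_same_cancel2)
  let ?C = "\<lambda>j::int. cball (w + (of_int j * s) *\<^sub>R e) (2 * s)"
  have sub: "{x. \<bar>(x - w) \<bullet> e\<bar> \<le> T \<and> norm (horizontal e (x - w)) \<le> s} \<subseteq> (\<Union>j\<in>{-N..N}. ?C j)"
  proof (safe)
    fix x assume x: "\<bar>(x - w) \<bullet> e\<bar> \<le> T" "norm (horizontal e (x - w)) \<le> s"
    define a where "a = (x - w) \<bullet> e"
    define j where "j = \<lfloor>a / s\<rfloor>"
    have "\<bar>a / s\<bar> \<le> T / s" using x(1) s by (simp add: a_def divide_right_mono)
    then have as: "- (T / s) \<le> a / s" "a / s \<le> T / s" by linarith+
    have j: "of_int j \<le> a / s" "a / s < of_int j + 1" unfolding j_def by linarith+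
    have "real_of_int (- N) < of_int j + 1" using as j N by simp
    then have "- N \<le> j" by linarith
    moreover have "real_of_int j \<le> of_int N" using as j N by linarith
    then have "j \<le> N" by linarith
    moreover have "x \<in> ?C j"
    proof -
      have "x - (w + (of_int j * s) *\<^sub>R e) = horizontal e (x - w) + (a - of_int j * s) *\<^sub>R e"
        by (simp add: horizontal_def a_def algebra_simps)
      then have "norm (x - (w + (of_int j * s) *\<^sub>R e)) \<le> norm (horizontal e (x - w)) + \<bar>a - of_int j * s\<bar>"
        using norm_triangle_ineq[of "horizontal e (x - w)" "(a - of_int j * s) *\<^sub>R e"] e by simp
      moreover have "\<bar>a - of_int j * s\<bar> \<le> s" using j s by (simp add: field_simps abs_le_iff)
      ultimately show ?thesis using x(2) by (simp add: dist_norm norm_minus_commute)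
    qed
    ultimately show "x \<in> (\<Union>j\<in>{-N..N}. ?C j)" by auto
  qed
  have "emeasure lborel {x. \<bar>(x - w) \<bullet> e\<bar> \<le> T \<and> norm (horizontal e (x - w)) \<le> s} \<le> emeasure lborel (\<Union>j\<in>{-N..N}. ?C j)"
    using sub by (rule emeasure_mono) auto
  also have "\<dots> \<le> (\<Sum>j\<in>{-N..N}. emeasure lborel (?C j))"
    by (rule emeasure_subadditive_finite) auto
  also have "\<dots> = (\<Sum>j\<in>{-N..N}. ennreal (unit_ball_vol DIM('a) * (2 * s) ^ DIM('a)))"
    using s by (intro sum.cong refl) (simp add: emeasure_cball)
  also have "\<dots> = ennreal (real (card {-N..N}) * (unit_ball_vol DIM('a) * (2 * s) ^ DIM('a)))"
    using s by (subst ennreal_mult) (auto simp: ennreal_of_nat_eq_real_of_nat)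
  also have "real (card {-N..N}) = 2 * of_int N + 1" using N0 by simp
  also have "ennreal ((2 * of_int N + 1) * (unit_ball_vol DIM('a) * (2 * s) ^ DIM('a))) \<le>
    ennreal ((2 * T / s + 3) * (unit_ball_vol DIM('a) * (2 * s) ^ DIM('a)))"
    using N s by (intro ennreal_leI mult_right_mono) auto
  finally show ?thesis .
qed

section \<open>Hardy inequality in dimension at least two\<close>

text \<open>
  A test function vanishes near the boundary.  Finiteness is needed for the absorption argument below.
\<close>

lemma test_function_hardy_finite:
  fixes u :: "'a::euclidean_space \<Rightarrow> real"
  assumes dom: "bounded_lipschitz_domain \<Omega>" and u: "u \<in> test_functions \<Omega>" and p: "0 \<le> p"
  shows "(\<integral>\<^sup>+x. indicator \<Omega> x * ennreal (\<bar>u x\<bar> powr p / bdist \<Omega> x ^ DIM('a)) \<partial>lborel) < \<infinity>"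
proof -
  let ?K = "closure {x. u x \<noteq> 0}"
  have K: "compact ?K" "?K \<subseteq> \<Omega>" using u by (auto simp: test_functions_def)
  obtain B where B: "0 \<le> B" "\<And>x. \<bar>u x\<bar> \<le> B" using test_function_bounded[OF u] by blast
  obtain \<delta> where \<delta>: "0 < \<delta>" "\<And>x. x \<in> ?K \<Longrightarrow> \<delta> \<le> bdist \<Omega> x"
  proof (cases "?K = {}")
    case True
    then show ?thesis using that[of 1] by simp
  next
    case False
    obtain y where y: "y \<in> ?K" "\<And>x. x \<in> ?K \<Longrightarrow> bdist \<Omega> y \<le> bdist \<Omega> x"
      using continuous_attains_inf[OF K(1) False continuous_on_bdist] by blast
    then show ?thesis using that[of "bdist \<Omega> y"] bdist_pos[OF dom, of y] K(2) by blast
  qed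
  have \<Omega>: "\<Omega> \<in> sets borel" "bounded \<Omega>" using dom by (auto simp: bounded_lipschitz_domain_def)
  have "(\<integral>\<^sup>+x. indicator \<Omega> x * ennreal (\<bar>u x\<bar> powr p / bdist \<Omega> x ^ DIM('a)) \<partial>lborel) \<le> (\<integral>\<^sup>+x. ennreal (B powr p / \<delta> ^ DIM('a)) * indicator \<Omega> x \<partial>lborel)"
  proof (rule nn_integral_mono)
    fix x
    have "\<bar>u x\<bar> powr p / bdist \<Omega> x ^ DIM('a) \<le> B powr p / \<delta> ^ DIM('a)"
    proof (cases "u x = 0")
      case False
      then have "x \<in> ?K" by (intro subsetD[OF closure_subset]) simp
      then have "\<delta> \<le> bdist \<Omega> x" by (rule \<delta>(2))
      moreover have "\<bar>u x\<bar> powr p \<le> B powr p" using B(2)[of x] p by (intro powr_mono2) auto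
      ultimately show ?thesis using \<delta>(1) by (intro frac_le power_mono) auto
    next
      case True
      then show ?thesis using \<delta>(1) by simp
    qed
    then show "indicator \<Omega> x * ennreal (\<bar>u x\<bar> powr p / bdist \<Omega> x ^ DIM('a)) \<le> ennreal (B powr p / \<delta> ^ DIM('a)) * indicator \<Omega> x"
      by (cases "x \<in> \<Omega>") (simp_all add: ennreal_leI)
  qed
  also have "\<dots> = ennreal (B powr p / \<delta> ^ DIM('a)) * emeasure lborel \<Omega>"
    using \<Omega>(1) by (intro nn_integral_cmult_indicator) simp
  also have "\<dots> < \<infinity>"
    using emeasure_bounded_less_top[OF \<Omega>(2)] unfolding infinity_ennreal_def
    by (intro ennreal_mult_less_top[THEN iffD2] disjI2 conjI ennreal_less_top)
  finally show ?thesis .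
qed

text \<open>
  For fixed \<open>w\<close>, the points \<open>x\<close> with \<open>w\<close> in their cone set lie in a tube around \<open>w\<close> of length of order
  \<open>t * bdist \<Omega> w\<close> and width of order \<open>bdist \<Omega> w\<close>, and there \<open>bdist \<Omega> x\<close> is of order \<open>t * bdist \<Omega> w\<close>.  The
  integral is therefore of order \<open>t / t ^ (2 * d)\<close> times \<open>1 / bdist \<Omega> w ^ d\<close>.  For \<open>d \<ge> 2\<close> the exponent
  \<open>2 * d - 1\<close> is at least \<open>d + 1\<close>; this is the gain that dimension one does not have.
\<close>

lemma cone_kernel_integral_le:
  fixes \<Omega> :: "'a::euclidean_space set"
  assumes w: "0 < bdist \<Omega> w" and e: "norm e = 1" and A: "1 \<le> A" and t: "A \<le> t" and d: "2 \<le> DIM('a)"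
  shows "(\<integral>\<^sup>+x. (if w \<in> cone_set \<Omega> A e t x then ennreal (1 / bdist \<Omega> x ^ (2 * DIM('a))) else 0) \<partial>lborel)
    \<le> ennreal (5 * 2 ^ DIM('a) * unit_ball_vol DIM('a) * A ^ (3 * DIM('a) + 1) / (t ^ (DIM('a) + 1) * bdist \<Omega> w ^ DIM('a)))"
proof -
  let ?d = "DIM('a)" and ?D = "bdist \<Omega> w" and ?w = "unit_ball_vol (real DIM('a))"
  have t1: "1 \<le> t" using A t by simp
  define S where "S = {x. \<bar>(x - w) \<bullet> e\<bar> \<le> A * (A * t * ?D) \<and> norm (horizontal e (x - w)) \<le> A * ?D}"
  have [measurable]: "S \<in> sets borel"
    unfolding S_def horizontal_def by measurable
  have "(\<integral>\<^sup>+x. (if w \<in> cone_set \<Omega> A e t x then ennreal (1 / bdist \<Omega> x ^ (2 * ?d)) else 0) \<partial>lborel) \<le>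
    (\<integral>\<^sup>+x. ennreal (A ^ (2 * ?d) / (t * ?D) ^ (2 * ?d)) * indicator S x \<partial>lborel)"
  proof (rule nn_integral_mono)
    fix x
    show "(if w \<in> cone_set \<Omega> A e t x then ennreal (1 / bdist \<Omega> x ^ (2 * ?d)) else 0) \<le> ennreal (A ^ (2 * ?d) / (t * ?D) ^ (2 * ?d)) * indicator S x"
    proof (cases "w \<in> cone_set \<Omega> A e t x")
      case True
      then have c: "bdist \<Omega> x \<le> A * t * ?D" "t * ?D \<le> A * bdist \<Omega> x" "dist x w \<le> A * bdist \<Omega> x"
        "t * norm (horizontal e (x - w)) \<le> bdist \<Omega> x" by (auto simp: cone_set_def)
      have tD: "0 < t * ?D" using t1 w by simp
      have "0 < A * bdist \<Omega> x" using c(2) tD by linarith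
      then have dx: "0 < bdist \<Omega> x" using A by (simp add: zero_less_mult_iff)
      have "(t * ?D) ^ (2 * ?d) \<le> (A * bdist \<Omega> x) ^ (2 * ?d)" using c(2) tD by (intro power_mono) auto
      then have le: "1 / bdist \<Omega> x ^ (2 * ?d) \<le> A ^ (2 * ?d) / (t * ?D) ^ (2 * ?d)"
        using dx tD A unfolding power_mult_distrib[of A] by (simp add: pos_le_divide_eq pos_divide_le_eq)
      have "\<bar>(x - w) \<bullet> e\<bar> \<le> dist x w"
        using Cauchy_Schwarz_ineq2[of "x - w" e] e by (simp add: dist_norm)
      also have "\<dots> \<le> A * (A * t * ?D)" using c A by (intro order_trans[OF c(3)] mult_left_mono) auto
      finally have s1: "\<bar>(x - w) \<bullet> e\<bar> \<le> A * (A * t * ?D)" .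
      have "t * norm (horizontal e (x - w)) \<le> t * (A * ?D)" using c(1,4) by (simp add: mult_ac)
      then have "norm (horizontal e (x - w)) \<le> A * ?D" using t1 by simp
      then have "x \<in> S" using s1 by (simp add: S_def)
      then show ?thesis using True le by (simp add: ennreal_leI)
    qed simp
  qed
  also have "\<dots> = ennreal (A ^ (2 * ?d) / (t * ?D) ^ (2 * ?d)) * emeasure lborel S"
    by (rule nn_integral_cmult_indicator) simp
  also have "\<dots> \<le> ennreal (A ^ (2 * ?d) / (t * ?D) ^ (2 * ?d)) * ennreal ((2 * (A * (A * t * ?D)) / (A * ?D) + 3) * (?w * (2 * (A * ?D)) ^ ?d))"
    unfolding S_def using A w t1 e by (intro mult_left_mono emeasure_tube_le) auto
  also have "\<dots> \<le> ennreal (A ^ (2 * ?d) / (t * ?D) ^ (2 * ?d)) * ennreal (5 * A * t * (?w * (2 * (A * ?D)) ^ ?d))"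
  proof (intro mult_left_mono ennreal_leI mult_right_mono)
    have "1 * 1 \<le> A * t" using A t1 by (intro mult_mono) auto
    then show "2 * (A * (A * t * ?D)) / (A * ?D) + 3 \<le> 5 * A * t" using A w by simp
  qed (use A w in auto)
  also have "\<dots> = ennreal (A ^ (2 * ?d) / (t * ?D) ^ (2 * ?d) * (5 * A * t * (?w * (2 * (A * ?D)) ^ ?d)))"
    using A w t1 by (intro ennreal_mult[symmetric]) auto
  also have "A ^ (2 * ?d) / (t * ?D) ^ (2 * ?d) * (5 * A * t * (?w * (2 * (A * ?D)) ^ ?d)) =
    5 * 2 ^ ?d * ?w * A ^ (3 * ?d + 1) / (t ^ (?d + 1) * ?D ^ ?d) * (t * t / t ^ ?d)"
  proof -
    have p3: "A ^ (3 * ?d + 1) = A ^ (2 * ?d) * A ^ ?d * A" by (simp add: power_add[symmetric])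
    have p1: "t ^ (?d + 1) = t ^ ?d * t" by simp
    have t2: "t ^ (2 * ?d) = t ^ ?d * t ^ ?d" "?D ^ (2 * ?d) = ?D ^ ?d * ?D ^ ?d" by (simp_all add: mult_2 power_add)
    have gen: "g / ((a * a) * (b * b)) * (5 * A * t * (v * (k * (c * b)))) = 5 * k * v * (g * c * A) / (a * t * b) * (t * t / a)"
      if "0 < a" "0 < b" for a b c g k v :: real
      using that t1 by (simp add: field_simps)
    have "0 < t ^ ?d" "0 < ?D ^ ?d" using t1 w by auto
    then show ?thesis
      unfolding p3 p1 power_mult_distrib t2 by (rule gen)
  qed
  also have "\<dots> \<le> 5 * 2 ^ ?d * ?w * A ^ (3 * ?d + 1) / (t ^ (?d + 1) * ?D ^ ?d) * 1"
  proof (rule mult_left_mono)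
    have "t ^ 2 \<le> t ^ ?d" using t1 d by (intro power_increasing) auto
    then show "t * t / t ^ ?d \<le> 1" using t1 by (simp add: power2_eq_square)
  qed (use A t1 w in auto)
  finally show ?thesis by (simp add: ennreal_leI)
qed

text \<open>
  Average \<open>\<bar>u x\<bar> powr p \<le> 2 powr p * (\<bar>u x - u w\<bar> powr p + \<bar>u w\<bar> powr p)\<close> over the ball of points \<open>w\<close>
  below \<open>x\<close>, and integrate against \<open>1 / bdist \<Omega> x ^ d\<close>.  The differences are controlled by the energy,
  since \<open>dist x w\<close> is at most of order \<open>bdist \<Omega> x\<close>.  In the other term, Fubini's theorem and the tube estimate
  return the Hardy integral itself with the factor \<open>C0 / t\<close>: the normalisation of the average costs
  \<open>t ^ d\<close> and the tube gains \<open>1 / t ^ (d + 1)\<close>.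
\<close>

lemma hardy_near_boundary:
  fixes \<Omega> :: "'a::euclidean_space set" and p :: real
  assumes dom: "bounded_lipschitz_domain \<Omega>" and d: "2 \<le> DIM('a)" and p: "0 \<le> p"
  obtains \<eta> K where "0 < \<eta>" "0 \<le> K"
    "\<And>u. u \<in> test_functions \<Omega> \<Longrightarrow> (\<integral>\<^sup>+x. indicator {x \<in> \<Omega>. bdist \<Omega> x < \<eta>} x * ennreal (\<bar>u x\<bar> powr p / bdist \<Omega> x ^ DIM('a)) \<partial>lborel)
      \<le> ennreal K * energy \<Omega> p u"
proof -
  let ?d = "DIM('a)" and ?w = "unit_ball_vol (real DIM('a))"
  obtain \<eta> E A where E: "0 < \<eta>" "finite E" "E \<noteq> {}" "\<And>e. e \<in> E \<Longrightarrow> norm e = 1" "1 \<le> A"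
    "\<And>x t. x \<in> \<Omega> \<Longrightarrow> bdist \<Omega> x < \<eta> \<Longrightarrow> 1 \<le> t \<Longrightarrow> \<exists>e\<in>E. \<exists>y. ball y (bdist \<Omega> x / (A * t)) \<subseteq> cone_set \<Omega> A e t x"
    using boundary_cone_cover[OF dom] by metis
  have [measurable]: "\<Omega> \<in> sets borel" using dom by (auto simp: bounded_lipschitz_domain_def)
  define S where "S = {x \<in> \<Omega>. bdist \<Omega> x < \<eta>}"
  have [measurable]: "S \<in> sets borel" unfolding S_def by measurable
  define n where "n = real (card E)"
  have n: "1 \<le> n" using E(2,3) by (simp add: n_def Suc_le_eq card_gt_0_iff)
  define C0 where "C0 = 2 powr p * (5 * 2 ^ ?d * A ^ (4 * ?d + 1))"
  \<comment> \<open>so large that the returning terms of all \<open>n\<close> directions add up to at most half of the Hardy integral\<close>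
  define t where "t = max A (2 * n * C0)"
  have t: "A \<le> t" "1 \<le> t" "2 * n * C0 \<le> t" using E(5) by (auto simp: t_def)
  define c where "c = (A * t) ^ ?d / ?w"
  have c: "0 < c" using E(5) t by (simp add: c_def)
  define K where "K = 2 * n * (c * 2 powr p * A ^ (2 * ?d))"
  have K: "0 \<le> K" using n c E(5) by (simp add: K_def)
  have main: "(\<integral>\<^sup>+x. indicator S x * ennreal (\<bar>u x\<bar> powr p / bdist \<Omega> x ^ ?d) \<partial>lborel) \<le> ennreal K * energy \<Omega> p u"
    if u: "u \<in> test_functions \<Omega>" for u
  proof -
    have [measurable]: "u \<in> borel_measurable borel" by (rule test_function_measurable[OF u])
    define I where "I = (\<integral>\<^sup>+x. indicator S x * ennreal (\<bar>u x\<bar> powr p / bdist \<Omega> x ^ ?d) \<partial>lborel)"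
    have "I \<le> (\<integral>\<^sup>+x. indicator \<Omega> x * ennreal (\<bar>u x\<bar> powr p / bdist \<Omega> x ^ ?d) \<partial>lborel)"
      unfolding I_def by (intro nn_integral_mono mult_right_mono) (auto simp: S_def split: split_indicator)
    also have "\<dots> < \<infinity>" by (rule test_function_hardy_finite[OF dom u p])
    finally have Ifin: "I < \<infinity>" .
    define P where "P e x w = (if x \<in> S \<and> w \<in> cone_set \<Omega> A e t x then 1 else 0 :: ennreal)" for e x w
    have [measurable (raw)]: "(\<lambda>z. P e (f z) (g z)) \<in> borel_measurable M"
      if [measurable]: "f \<in> borel_measurable M" "g \<in> borel_measurable M" for f g e and M :: "'c measure"
      unfolding P_def cone_set_def horizontal_def mem_Collect_eq by measurable
    define k where "k x = ennreal (c * 2 powr p / bdist \<Omega> x ^ (2 * ?d))" for x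
    have [measurable]: "k \<in> borel_measurable borel" unfolding k_def by measurable
    define T1 where "T1 e = (\<integral>\<^sup>+x. \<integral>\<^sup>+w. P e x w * (k x * ennreal (\<bar>u x - u w\<bar> powr p)) \<partial>lborel \<partial>lborel)" for e
    define T2 where "T2 e = (\<integral>\<^sup>+x. \<integral>\<^sup>+w. P e x w * (k x * ennreal (\<bar>u w\<bar> powr p)) \<partial>lborel \<partial>lborel)" for e
    have pt: "indicator S x * ennreal (\<bar>u x\<bar> powr p / bdist \<Omega> x ^ ?d) \<le>
      (\<Sum>e\<in>E. \<integral>\<^sup>+w. P e x w * (k x * ennreal (\<bar>u x - u w\<bar> powr p)) + P e x w * (k x * ennreal (\<bar>u w\<bar> powr p)) \<partial>lborel)" for x
    proof (cases "x \<in> S")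
      case True
      then have x: "x \<in> \<Omega>" "bdist \<Omega> x < \<eta>" by (auto simp: S_def)
      have dx: "0 < bdist \<Omega> x" by (rule bdist_pos[OF dom x(1)])
      obtain e y where ey: "e \<in> E" "ball y (bdist \<Omega> x / (A * t)) \<subseteq> cone_set \<Omega> A e t x"
        using E(6)[OF x t(2)] by blast
      let ?r = "bdist \<Omega> x / (A * t)"
      have "ennreal (\<bar>u x\<bar> powr p / bdist \<Omega> x ^ ?d) = ennreal (c / bdist \<Omega> x ^ (2 * ?d) * \<bar>u x\<bar> powr p) * ennreal (?w * ?r ^ ?d)"
      proof -
        have "c / bdist \<Omega> x ^ (2 * ?d) * \<bar>u x\<bar> powr p * (?w * ?r ^ ?d) = \<bar>u x\<bar> powr p / bdist \<Omega> x ^ ?d"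
        proof -
          define X Y where "X = (A * t) ^ ?d" and "Y = bdist \<Omega> x ^ ?d"
          have XY: "0 < X" "0 < Y" using E(5) t dx by (auto simp: X_def Y_def)
          have w0: "0 < ?w" by simp
          have Y2: "bdist \<Omega> x ^ (2 * ?d) = Y * Y" by (simp add: Y_def mult_2 power_add)
          have "X / v / (Y * Y) * U * (v * (Y / X)) = U / Y" if "0 < v" for U v :: real
            using XY that by (simp add: field_simps)
          from this[OF w0] show ?thesis
            unfolding c_def power_divide Y2 X_def[symmetric] Y_def[symmetric] .
        qed
        then show ?thesis
          using c dx t E(5) by (subst ennreal_mult[symmetric]) (simp_all del: times_divide_eq_left times_divide_eq_right)
      qed
      also have "\<dots> = (\<integral>\<^sup>+w. ennreal (c / bdist \<Omega> x ^ (2 * ?d) * \<bar>u x\<bar> powr p) * indicator (ball y ?r) w \<partial>lborel)"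
        using dx t E(5) by (subst nn_integral_cmult_indicator) (auto simp: emeasure_ball)
      also have "\<dots> \<le> (\<integral>\<^sup>+w. P e x w * (k x * ennreal (\<bar>u x - u w\<bar> powr p)) + P e x w * (k x * ennreal (\<bar>u w\<bar> powr p)) \<partial>lborel)"
      proof (rule nn_integral_mono)
        fix w
        show "ennreal (c / bdist \<Omega> x ^ (2 * ?d) * \<bar>u x\<bar> powr p) * indicator (ball y ?r) w \<le>
          P e x w * (k x * ennreal (\<bar>u x - u w\<bar> powr p)) + P e x w * (k x * ennreal (\<bar>u w\<bar> powr p))"
        proof (cases "w \<in> ball y ?r")
          case w: True
          then have P: "P e x w = 1" using ey True by (auto simp: P_def)
          have "\<bar>u x\<bar> powr p \<le> (\<bar>u x - u w\<bar> + \<bar>u w\<bar>) powr p" using p by (intro powr_mono2) auto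
          also have "\<dots> \<le> 2 powr p * (\<bar>u x - u w\<bar> powr p + \<bar>u w\<bar> powr p)" using p by (intro powr_add_le) auto
          finally have "c / bdist \<Omega> x ^ (2 * ?d) * \<bar>u x\<bar> powr p \<le> c / bdist \<Omega> x ^ (2 * ?d) * (2 powr p * (\<bar>u x - u w\<bar> powr p + \<bar>u w\<bar> powr p))"
            using c dx by (intro mult_left_mono) auto
          also have "\<dots> = c * 2 powr p / bdist \<Omega> x ^ (2 * ?d) * \<bar>u x - u w\<bar> powr p + c * 2 powr p / bdist \<Omega> x ^ (2 * ?d) * \<bar>u w\<bar> powr p"
            by (simp add: distrib_left)
          finally have "ennreal (c / bdist \<Omega> x ^ (2 * ?d) * \<bar>u x\<bar> powr p) \<le> ennreal (c * 2 powr p / bdist \<Omega> x ^ (2 * ?d) * \<bar>u x - u w\<bar> powr p + c * 2 powr p / bdist \<Omega> x ^ (2 * ?d) * \<bar>u w\<bar> powr p)"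
            by (rule ennreal_leI)
          also have "\<dots> = k x * ennreal (\<bar>u x - u w\<bar> powr p) + k x * ennreal (\<bar>u w\<bar> powr p)"
          proof -
            have "ennreal (a * U + a * V) = ennreal a * ennreal U + ennreal a * ennreal V"
              if "0 \<le> a" "0 \<le> U" "0 \<le> V" for a U V :: real
              using that by (simp add: ennreal_mult)
            then show ?thesis unfolding k_def using c dx by (simp del: times_divide_eq_left times_divide_eq_right)
          qed
          finally show ?thesis using w P by simp
        qed simp
      qed
      also have "\<dots> \<le> (\<Sum>e\<in>E. \<integral>\<^sup>+w. P e x w * (k x * ennreal (\<bar>u x - u w\<bar> powr p)) + P e x w * (k x * ennreal (\<bar>u w\<bar> powr p)) \<partial>lborel)"
        by (rule member_le_sum[OF ey(1) _ E(2)]) simp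
      finally show ?thesis using True by simp
    qed simp
    have "I \<le> (\<integral>\<^sup>+x. (\<Sum>e\<in>E. \<integral>\<^sup>+w. P e x w * (k x * ennreal (\<bar>u x - u w\<bar> powr p)) + P e x w * (k x * ennreal (\<bar>u w\<bar> powr p)) \<partial>lborel) \<partial>lborel)"
      unfolding I_def by (intro nn_integral_mono pt)
    also have "\<dots> = (\<Sum>e\<in>E. \<integral>\<^sup>+x. (\<integral>\<^sup>+w. P e x w * (k x * ennreal (\<bar>u x - u w\<bar> powr p)) + P e x w * (k x * ennreal (\<bar>u w\<bar> powr p)) \<partial>lborel) \<partial>lborel)"
      by (rule nn_integral_sum) measurable
    also have "\<dots> = (\<Sum>e\<in>E. T1 e + T2 e)"
    proof (rule sum.cong[OF refl])
      fix e
      have "(\<integral>\<^sup>+x. (\<integral>\<^sup>+w. P e x w * (k x * ennreal (\<bar>u x - u w\<bar> powr p)) + P e x w * (k x * ennreal (\<bar>u w\<bar> powr p)) \<partial>lborel) \<partial>lborel) =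
        (\<integral>\<^sup>+x. (\<integral>\<^sup>+w. P e x w * (k x * ennreal (\<bar>u x - u w\<bar> powr p)) \<partial>lborel) + (\<integral>\<^sup>+w. P e x w * (k x * ennreal (\<bar>u w\<bar> powr p)) \<partial>lborel) \<partial>lborel)"
        by (intro nn_integral_cong nn_integral_add) measurable
      also have "\<dots> = T1 e + T2 e" unfolding T1_def T2_def by (rule nn_integral_add) measurable
      finally show "(\<integral>\<^sup>+x. (\<integral>\<^sup>+w. P e x w * (k x * ennreal (\<bar>u x - u w\<bar> powr p)) + P e x w * (k x * ennreal (\<bar>u w\<bar> powr p)) \<partial>lborel) \<partial>lborel) = T1 e + T2 e" .
    qed
    also have "\<dots> \<le> (\<Sum>e\<in>E. ennreal (c * 2 powr p * A ^ (2 * ?d)) * energy \<Omega> p u + ennreal (C0 / t) * I)"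
    proof (intro sum_mono add_mono)
      fix e assume e: "e \<in> E"
      have "T1 e \<le> (\<integral>\<^sup>+x. ennreal (c * 2 powr p * A ^ (2 * ?d)) * energy_density \<Omega> p u x \<partial>lborel)"
        unfolding T1_def
      proof (rule nn_integral_mono)
        fix x
        have "P e x w * (k x * ennreal (\<bar>u x - u w\<bar> powr p)) \<le>
          ennreal (c * 2 powr p * A ^ (2 * ?d)) * (ennreal (\<bar>u w - u x\<bar> powr p / dist w x ^ (2 * ?d)) * indicator \<Omega> w * indicator \<Omega> x)" for w
        proof (cases "P e x w = 0 \<or> w = x")
          case False
          then have xw: "x \<in> S" "w \<in> cone_set \<Omega> A e t x" "w \<noteq> x" by (auto simp: P_def split: if_splits)
          then have x: "x \<in> \<Omega>" "w \<in> \<Omega>" "dist w x \<le> A * bdist \<Omega> x" by (auto simp: S_def cone_set_def dist_commute)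
          have dx: "0 < bdist \<Omega> x" by (rule bdist_pos[OF dom x(1)])
          have "dist w x ^ (2 * ?d) \<le> A ^ (2 * ?d) * bdist \<Omega> x ^ (2 * ?d)"
            unfolding power_mult_distrib[symmetric] using x(3) by (intro power_mono) auto
          then have "1 / bdist \<Omega> x ^ (2 * ?d) \<le> A ^ (2 * ?d) / dist w x ^ (2 * ?d)"
            using dx xw(3) by (simp add: pos_le_divide_eq pos_divide_le_eq)
          then have "(c * 2 powr p * \<bar>u w - u x\<bar> powr p) * (1 / bdist \<Omega> x ^ (2 * ?d)) \<le> (c * 2 powr p * \<bar>u w - u x\<bar> powr p) * (A ^ (2 * ?d) / dist w x ^ (2 * ?d))"
            using c by (intro mult_left_mono) auto
          then have "c * 2 powr p / bdist \<Omega> x ^ (2 * ?d) * \<bar>u x - u w\<bar> powr p \<le> c * 2 powr p * A ^ (2 * ?d) * (\<bar>u w - u x\<bar> powr p / dist w x ^ (2 * ?d))"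
            by (simp add: mult_ac abs_minus_commute)
          then have "ennreal (c * 2 powr p / bdist \<Omega> x ^ (2 * ?d)) * ennreal (\<bar>u x - u w\<bar> powr p) \<le> ennreal (c * 2 powr p * A ^ (2 * ?d)) * ennreal (\<bar>u w - u x\<bar> powr p / dist w x ^ (2 * ?d))"
            using c dx E(5) by (subst (1 2) ennreal_mult[symmetric]) (auto intro: ennreal_leI)
          then show ?thesis using xw x by (simp add: P_def k_def)
        qed auto
        then have "(\<integral>\<^sup>+w. P e x w * (k x * ennreal (\<bar>u x - u w\<bar> powr p)) \<partial>lborel) \<le>
          (\<integral>\<^sup>+w. ennreal (c * 2 powr p * A ^ (2 * ?d)) * (ennreal (\<bar>u w - u x\<bar> powr p / dist w x ^ (2 * ?d)) * indicator \<Omega> w * indicator \<Omega> x) \<partial>lborel)"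
          by (intro nn_integral_mono)
        also have "\<dots> = ennreal (c * 2 powr p * A ^ (2 * ?d)) * (\<integral>\<^sup>+w. (ennreal (\<bar>u w - u x\<bar> powr p / dist w x ^ (2 * ?d)) * indicator \<Omega> w * indicator \<Omega> x) \<partial>lborel)"
          by (rule nn_integral_cmult) measurable
        also have "(\<integral>\<^sup>+w. (ennreal (\<bar>u w - u x\<bar> powr p / dist w x ^ (2 * ?d)) * indicator \<Omega> w * indicator \<Omega> x) \<partial>lborel) = energy_density \<Omega> p u x"
          unfolding energy_density_def by (rule nn_integral_multc) measurable
        finally show "(\<integral>\<^sup>+w. P e x w * (k x * ennreal (\<bar>u x - u w\<bar> powr p)) \<partial>lborel) \<le> ennreal (c * 2 powr p * A ^ (2 * ?d)) * energy_density \<Omega> p u x" .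
      qed
      also have "\<dots> = ennreal (c * 2 powr p * A ^ (2 * ?d)) * energy \<Omega> p u"
        unfolding energy_eq_density by (rule nn_integral_cmult) measurable
      finally show "T1 e \<le> ennreal (c * 2 powr p * A ^ (2 * ?d)) * energy \<Omega> p u" .
      have "T2 e = (\<integral>\<^sup>+w. \<integral>\<^sup>+x. P e x w * (k x * ennreal (\<bar>u w\<bar> powr p)) \<partial>lborel \<partial>lborel)"
        unfolding T2_def by (rule lborel_pair.Fubini') measurable
      also have "\<dots> \<le> (\<integral>\<^sup>+w. ennreal (C0 / t) * (indicator S w * ennreal (\<bar>u w\<bar> powr p / bdist \<Omega> w ^ ?d)) \<partial>lborel)"
      proof (rule nn_integral_mono)
        fix w
        show "(\<integral>\<^sup>+x. P e x w * (k x * ennreal (\<bar>u w\<bar> powr p)) \<partial>lborel) \<le> ennreal (C0 / t) * (indicator S w * ennreal (\<bar>u w\<bar> powr p / bdist \<Omega> w ^ ?d))"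
        proof (cases "w \<in> S")
          case False
          have "P e x w = 0" for x
          proof (rule ccontr)
            assume "P e x w \<noteq> 0"
            then have xw: "x \<in> S" "w \<in> cone_set \<Omega> A e t x" by (auto simp: P_def split: if_splits)
            then have "w \<in> \<Omega>" "t * bdist \<Omega> w \<le> A * bdist \<Omega> x" "bdist \<Omega> x < \<eta>" by (auto simp: S_def cone_set_def)
            moreover have "A * bdist \<Omega> x \<le> t * bdist \<Omega> x" using t by (intro mult_right_mono) auto
            ultimately have "t * bdist \<Omega> w \<le> t * bdist \<Omega> x" by linarith
            then have "bdist \<Omega> w \<le> bdist \<Omega> x" using t by simp
            then show False using \<open>w \<in> \<Omega>\<close> \<open>bdist \<Omega> x < \<eta>\<close> False by (simp add: S_def)
          qed
          then show ?thesis by simp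
        next
          case True
          then have dw: "0 < bdist \<Omega> w" using bdist_pos[OF dom] by (auto simp: S_def)
          let ?J = "5 * 2 ^ ?d * ?w * A ^ (3 * ?d + 1) / (t ^ (?d + 1) * bdist \<Omega> w ^ ?d)"
          have "(\<integral>\<^sup>+x. P e x w * (k x * ennreal (\<bar>u w\<bar> powr p)) \<partial>lborel) \<le>
            (\<integral>\<^sup>+x. ennreal (c * 2 powr p * \<bar>u w\<bar> powr p) * (if w \<in> cone_set \<Omega> A e t x then ennreal (1 / bdist \<Omega> x ^ (2 * ?d)) else 0) \<partial>lborel)"
            using c by (intro nn_integral_mono) (auto simp: P_def k_def simp flip: ennreal_mult)
          also have "\<dots> = ennreal (c * 2 powr p * \<bar>u w\<bar> powr p) * (\<integral>\<^sup>+x. (if w \<in> cone_set \<Omega> A e t x then ennreal (1 / bdist \<Omega> x ^ (2 * ?d)) else 0) \<partial>lborel)"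
            unfolding cone_set_def horizontal_def mem_Collect_eq by (rule nn_integral_cmult) measurable
          also have "\<dots> \<le> ennreal (c * 2 powr p * \<bar>u w\<bar> powr p) * ennreal ?J"
            using dw E(4)[OF e] E(5) t d by (intro mult_left_mono cone_kernel_integral_le) auto
          also have "\<dots> = ennreal (c * 2 powr p * \<bar>u w\<bar> powr p * ?J)"
            using c E(5) t dw by (intro ennreal_mult[symmetric]) auto
          also have "c * 2 powr p * \<bar>u w\<bar> powr p * ?J = C0 / t * (\<bar>u w\<bar> powr p / bdist \<Omega> w ^ ?d)"
          proof -
            have p4: "A ^ (4 * ?d + 1) = A ^ ?d * A ^ (3 * ?d + 1)" by (simp add: power_add[symmetric])
            define v where "v = ?w"
            define T where "T = t ^ ?d"
            have vT: "0 < T" "0 < v" "0 < t" using t by (auto simp: v_def T_def)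
            have t1: "t ^ (?d + 1) = T * t" by (simp add: T_def)
            show ?thesis
              unfolding c_def C0_def p4 power_mult_distrib[of A] t1 v_def[symmetric] T_def[symmetric]
              using vT by (simp add: mult_ac)
          qed
          also have "ennreal \<dots> = ennreal (C0 / t) * ennreal (\<bar>u w\<bar> powr p / bdist \<Omega> w ^ ?d)"
            using t E(5) by (intro ennreal_mult) (auto simp: C0_def)
          finally show ?thesis using True by simp
        qed
      qed
      also have "\<dots> = ennreal (C0 / t) * I"
        unfolding I_def by (rule nn_integral_cmult) measurable
      finally show "T2 e \<le> ennreal (C0 / t) * I" .
    qed
    also have "\<dots> = ennreal n * (ennreal (c * 2 powr p * A ^ (2 * ?d)) * energy \<Omega> p u + ennreal (C0 / t) * I)"
      by (simp add: n_def ennreal_of_nat_eq_real_of_nat)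
    finally have fin: "I \<le> ennreal n * (ennreal (c * 2 powr p * A ^ (2 * ?d)) * energy \<Omega> p u + ennreal (C0 / t) * I)" .
    show ?thesis
    \<comment> \<open>absorption of \<open>n * (C0 / t) * I \<le> I / 2\<close>, which requires \<open>I\<close> to be finite\<close>
    proof (cases "energy \<Omega> p u")
      case (real E')
      obtain i where i: "I = ennreal i" "0 \<le> i" using Ifin by (cases I) auto
      define b where "b = c * 2 powr p * A ^ (2 * ?d)"
      have b: "0 \<le> b" using c E(5) by (simp add: b_def)
      define f where "f = C0 / t"
      have f: "0 \<le> f" using t E(5) by (simp add: f_def C0_def)
      have "ennreal n * (ennreal b * ennreal E' + ennreal f * ennreal i) = ennreal (n * (b * E' + f * i))"
        using n b f real i by (simp add: ennreal_mult)
      then have "ennreal i \<le> ennreal (n * (b * E' + f * i))"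
        using fin unfolding b_def[symmetric] f_def[symmetric] i(1) real(2) by simp
      then have "i \<le> n * (b * E' + f * i)"
        using n b f real i by (subst (asm) ennreal_le_iff) auto
      moreover have "n * f \<le> 1 / 2" using t n by (simp add: f_def field_simps)
      then have "n * f * i \<le> 1 / 2 * i" using i by (intro mult_right_mono)
      ultimately have "i \<le> 2 * n * b * E'" by (simp add: distrib_left mult.assoc)
      then have "I \<le> ennreal (K * E')" using i by (simp add: K_def b_def ennreal_leI)
      also have "\<dots> = ennreal K * energy \<Omega> p u" using K real by (simp add: ennreal_mult)
      finally show ?thesis by (simp only: I_def)
    next
      case top
      have "0 < K" using n c E(5) by (simp add: K_def)
      then show ?thesis using top by (simp add: ennreal_mult_top)
    qed
  qed
  show ?thesis
    by (rule that[OF E(1) K]) (use main in \<open>simp only: S_def\<close>)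
qed

text \<open>
  Away from the boundary the weight is bounded, and the \<open>L^p\<close> norm over \<open>\<Omega>\<close> is bounded by the energy
  and the \<open>L^p\<close> norm over the boundary layer \<open>S\<close>, because any two points of \<open>\<Omega>\<close> are at bounded distance.
\<close>

theorem hardy_higher_dimension:
  fixes \<Omega> :: "'a::euclidean_space set" and p :: real
  assumes dom: "bounded_lipschitz_domain \<Omega>" and d: "2 \<le> DIM('a)" and p: "0 < p"
  obtains H where "0 \<le> H"
    "\<And>u. u \<in> test_functions \<Omega> \<Longrightarrow> (\<integral>\<^sup>+x. indicator \<Omega> x * ennreal (\<bar>u x\<bar> powr p / bdist \<Omega> x ^ DIM('a)) \<partial>lborel)
      \<le> ennreal H * energy \<Omega> p u"
proof -
  let ?d = "DIM('a)"
  have [measurable]: "\<Omega> \<in> sets borel" and op: "open \<Omega>" "bounded \<Omega>"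
    using dom by (auto simp: bounded_lipschitz_domain_def)
  obtain \<eta> K where \<eta>: "0 < \<eta>" and K: "0 \<le> K"
    and near: "\<And>u. u \<in> test_functions \<Omega> \<Longrightarrow> (\<integral>\<^sup>+x. indicator {x \<in> \<Omega>. bdist \<Omega> x < \<eta>} x * ennreal (\<bar>u x\<bar> powr p / bdist \<Omega> x ^ ?d) \<partial>lborel)
      \<le> ennreal K * energy \<Omega> p u"
    by (rule hardy_near_boundary[OF dom d less_imp_le[OF p]], rule that)
  define S where "S = {x \<in> \<Omega>. bdist \<Omega> x < \<eta>}"
  have Seq: "S = \<Omega> \<inter> bdist \<Omega> -` {..<\<eta>}" by (auto simp: S_def)
  have "open S" unfolding Seq using op
    by (intro continuous_open_preimage continuous_on_bdist) auto
  have "S \<noteq> {}"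
  proof -
    obtain z where z: "z \<in> frontier \<Omega>" using frontier_nonempty[OF dom] by blast
    then have "z \<in> closure \<Omega>" by (simp add: frontier_def)
    then obtain x where x: "x \<in> \<Omega>" "dist x z < \<eta>" using \<eta> unfolding closure_approachable by blast
    then have "bdist \<Omega> x < \<eta>" using infdist_le[OF z, of x] by (simp add: bdist_def)
    then show ?thesis using x(1) by (auto simp: S_def)
  qed
  then obtain c where "c \<in> S" by blast
  then obtain r where cr: "0 < r" "ball c r \<subseteq> S" using \<open>open S\<close> unfolding open_contains_ball by blast
  have Sm [measurable]: "S \<in> sets borel" using \<open>open S\<close> by simp
  have vfin: "emeasure lborel \<Omega> < \<infinity>" using op(2) by (rule emeasure_bounded_less_top)
  obtain v where v: "emeasure lborel \<Omega> = ennreal v" "0 \<le> v" using vfin by (cases "emeasure lborel \<Omega>") auto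
  define \<sigma> where "\<sigma> = unit_ball_vol ?d * r ^ ?d"
  have \<sigma>: "0 < \<sigma>" "ennreal \<sigma> \<le> emeasure lborel S"
    using cr emeasure_mono[OF cr(2), of lborel] by (auto simp: \<sigma>_def emeasure_ball)
  obtain D where D: "0 < D" "\<And>x y. x \<in> \<Omega> \<Longrightarrow> y \<in> \<Omega> \<Longrightarrow> dist x y \<le> D"
  proof -
    obtain D where D: "\<And>x y. x \<in> \<Omega> \<Longrightarrow> y \<in> \<Omega> \<Longrightarrow> dist x y \<le> D"
      using op(2) unfolding bounded_two_points by blast
    show ?thesis
    proof (rule that[of "max D 1"])
      show "dist x y \<le> max D 1" if "x \<in> \<Omega>" "y \<in> \<Omega>" for x y
        using D[OF that] by (rule max.coboundedI1)
    qed simp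
  qed
  define L where "L = 2 powr p * (D ^ (2 * ?d) + v * (\<eta> ^ ?d * K)) / \<sigma>"
  have L: "0 \<le> L" using D \<eta> K v \<sigma> by (simp add: L_def)
  define H where "H = K + L / \<eta> ^ ?d"
  show ?thesis
  proof (rule that[of H])
    show "0 \<le> H" using K L \<eta> by (simp add: H_def)
    fix u :: "'a \<Rightarrow> real" assume u: "u \<in> test_functions \<Omega>"
    have [measurable]: "u \<in> borel_measurable borel" by (rule test_function_measurable[OF u])
    define I where "I = (\<integral>\<^sup>+x. indicator S x * ennreal (\<bar>u x\<bar> powr p / bdist \<Omega> x ^ ?d) \<partial>lborel)"
    have I: "I \<le> ennreal K * energy \<Omega> p u" unfolding I_def S_def by (rule near[OF u])
    define W where "W = (\<integral>\<^sup>+x. indicator \<Omega> x * ennreal (\<bar>u x\<bar> powr p) \<partial>lborel)"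
    have S1: "(\<integral>\<^sup>+x. indicator S x * ennreal (\<bar>u x\<bar> powr p) \<partial>lborel) \<le> ennreal (\<eta> ^ ?d) * I"
    proof -
      have "(\<integral>\<^sup>+x. indicator S x * ennreal (\<bar>u x\<bar> powr p) \<partial>lborel) \<le> (\<integral>\<^sup>+x. ennreal (\<eta> ^ ?d) * (indicator S x * ennreal (\<bar>u x\<bar> powr p / bdist \<Omega> x ^ ?d)) \<partial>lborel)"
      proof (rule nn_integral_mono)
        fix x
        show "indicator S x * ennreal (\<bar>u x\<bar> powr p) \<le> ennreal (\<eta> ^ ?d) * (indicator S x * ennreal (\<bar>u x\<bar> powr p / bdist \<Omega> x ^ ?d))"
        proof (cases "x \<in> S")
          case True
          then have dx: "0 < bdist \<Omega> x" "bdist \<Omega> x \<le> \<eta>" using bdist_pos[OF dom] by (auto simp: S_def)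
          have "\<bar>u x\<bar> powr p * bdist \<Omega> x ^ ?d \<le> \<bar>u x\<bar> powr p * \<eta> ^ ?d"
            using dx by (intro mult_left_mono power_mono) auto
          then have "\<bar>u x\<bar> powr p \<le> \<eta> ^ ?d * (\<bar>u x\<bar> powr p / bdist \<Omega> x ^ ?d)"
            using dx by (simp add: pos_le_divide_eq mult.commute)
          then have "ennreal (\<bar>u x\<bar> powr p) \<le> ennreal (\<eta> ^ ?d) * ennreal (\<bar>u x\<bar> powr p / bdist \<Omega> x ^ ?d)"
            using \<eta> by (subst ennreal_mult[symmetric]) (auto intro: ennreal_leI)
          then show ?thesis using True by simp
        qed simp
      qed
      also have "\<dots> = ennreal (\<eta> ^ ?d) * I" unfolding I_def by (rule nn_integral_cmult) measurable
      finally show ?thesis .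
    qed
    have "ennreal \<sigma> * W \<le> emeasure lborel S * W" by (intro mult_right_mono \<sigma>) simp
    also have "\<dots> = (\<integral>\<^sup>+x. indicator \<Omega> x * ennreal (\<bar>u x\<bar> powr p) * (\<integral>\<^sup>+z. indicator S z \<partial>lborel) \<partial>lborel)"
      unfolding W_def by (simp add: nn_integral_cmult mult.commute)
    also have "\<dots> \<le> (\<integral>\<^sup>+x. ennreal (2 powr p) * (ennreal (D ^ (2 * ?d)) * energy_density \<Omega> p u x + indicator \<Omega> x * (\<integral>\<^sup>+z. indicator S z * ennreal (\<bar>u z\<bar> powr p) \<partial>lborel)) \<partial>lborel)"
    proof (rule nn_integral_mono)
      fix x
      show "indicator \<Omega> x * ennreal (\<bar>u x\<bar> powr p) * (\<integral>\<^sup>+z. indicator S z \<partial>lborel) \<le>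
        ennreal (2 powr p) * (ennreal (D ^ (2 * ?d)) * energy_density \<Omega> p u x + indicator \<Omega> x * (\<integral>\<^sup>+z. indicator S z * ennreal (\<bar>u z\<bar> powr p) \<partial>lborel))"
      proof (cases "x \<in> \<Omega>")
        case True
        have "ennreal (\<bar>u x\<bar> powr p) * (\<integral>\<^sup>+z. indicator S z \<partial>lborel) = (\<integral>\<^sup>+z. ennreal (\<bar>u x\<bar> powr p) * indicator S z \<partial>lborel)"
          by (rule nn_integral_cmult[symmetric]) measurable
        also have "\<dots> \<le> (\<integral>\<^sup>+z. ennreal (2 powr p) * (ennreal (D ^ (2 * ?d)) * (ennreal (\<bar>u z - u x\<bar> powr p / dist z x ^ (2 * ?d)) * indicator \<Omega> z) + indicator S z * ennreal (\<bar>u z\<bar> powr p)) \<partial>lborel)"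
        proof (rule nn_integral_mono)
          fix z
          show "ennreal (\<bar>u x\<bar> powr p) * indicator S z \<le> ennreal (2 powr p) * (ennreal (D ^ (2 * ?d)) * (ennreal (\<bar>u z - u x\<bar> powr p / dist z x ^ (2 * ?d)) * indicator \<Omega> z) + indicator S z * ennreal (\<bar>u z\<bar> powr p))"
          proof (cases "z \<in> S")
            case zS: True
            then have z: "z \<in> \<Omega>" by (simp add: S_def)
            have "\<bar>u x\<bar> powr p \<le> (\<bar>u z - u x\<bar> + \<bar>u z\<bar>) powr p" using p by (intro powr_mono2) auto
            also have "\<dots> \<le> 2 powr p * (\<bar>u z - u x\<bar> powr p + \<bar>u z\<bar> powr p)" using p by (intro powr_add_le) auto
            also have "\<dots> \<le> 2 powr p * (D ^ (2 * ?d) * (\<bar>u z - u x\<bar> powr p / dist z x ^ (2 * ?d)) + \<bar>u z\<bar> powr p)"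
            proof (intro mult_left_mono add_right_mono)
              show "\<bar>u z - u x\<bar> powr p \<le> D ^ (2 * ?d) * (\<bar>u z - u x\<bar> powr p / dist z x ^ (2 * ?d))"
              proof (cases "z = x")
                case False
                have "\<bar>u z - u x\<bar> powr p * dist z x ^ (2 * ?d) \<le> \<bar>u z - u x\<bar> powr p * D ^ (2 * ?d)"
                  using D(2)[OF z True] by (intro mult_left_mono power_mono) auto
                then show ?thesis using False by (simp add: pos_le_divide_eq mult.commute)
              qed simp
            qed auto
            finally have "ennreal (\<bar>u x\<bar> powr p) \<le> ennreal (2 powr p * (D ^ (2 * ?d) * (\<bar>u z - u x\<bar> powr p / dist z x ^ (2 * ?d)) + \<bar>u z\<bar> powr p))"
              by (rule ennreal_leI)
            also have "\<dots> = ennreal (2 powr p) * (ennreal (D ^ (2 * ?d)) * ennreal (\<bar>u z - u x\<bar> powr p / dist z x ^ (2 * ?d)) + ennreal (\<bar>u z\<bar> powr p))"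
            proof -
              have "ennreal (a * (b * e + f)) = ennreal a * (ennreal b * ennreal e + ennreal f)"
                if "0 \<le> a" "0 \<le> b" "0 \<le> e" "0 \<le> f" for a b e f :: real
                using that by (simp add: ennreal_mult)
              then show ?thesis using D(1) by (simp del: times_divide_eq_left times_divide_eq_right)
            qed
            finally show ?thesis using zS z by simp
          qed simp
        qed
        also have "\<dots> = ennreal (2 powr p) * (\<integral>\<^sup>+z. ennreal (D ^ (2 * ?d)) * (ennreal (\<bar>u z - u x\<bar> powr p / dist z x ^ (2 * ?d)) * indicator \<Omega> z) + indicator S z * ennreal (\<bar>u z\<bar> powr p) \<partial>lborel)"
          by (rule nn_integral_cmult) measurable
        also have "(\<integral>\<^sup>+z. ennreal (D ^ (2 * ?d)) * (ennreal (\<bar>u z - u x\<bar> powr p / dist z x ^ (2 * ?d)) * indicator \<Omega> z) + indicator S z * ennreal (\<bar>u z\<bar> powr p) \<partial>lborel) =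
          (\<integral>\<^sup>+z. ennreal (D ^ (2 * ?d)) * (ennreal (\<bar>u z - u x\<bar> powr p / dist z x ^ (2 * ?d)) * indicator \<Omega> z) \<partial>lborel) + (\<integral>\<^sup>+z. indicator S z * ennreal (\<bar>u z\<bar> powr p) \<partial>lborel)"
          by (rule nn_integral_add) measurable
        also have "(\<integral>\<^sup>+z. ennreal (D ^ (2 * ?d)) * (ennreal (\<bar>u z - u x\<bar> powr p / dist z x ^ (2 * ?d)) * indicator \<Omega> z) \<partial>lborel) = ennreal (D ^ (2 * ?d)) * energy_density \<Omega> p u x"
          using True by (subst nn_integral_cmult) (auto simp: energy_density_def)
        finally show ?thesis using True by simp
      qed simp
    qed
    also have "\<dots> = ennreal (2 powr p) * (\<integral>\<^sup>+x. ennreal (D ^ (2 * ?d)) * energy_density \<Omega> p u x + indicator \<Omega> x * (\<integral>\<^sup>+z. indicator S z * ennreal (\<bar>u z\<bar> powr p) \<partial>lborel) \<partial>lborel)"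
      by (rule nn_integral_cmult) measurable
    also have "(\<integral>\<^sup>+x. ennreal (D ^ (2 * ?d)) * energy_density \<Omega> p u x + indicator \<Omega> x * (\<integral>\<^sup>+z. indicator S z * ennreal (\<bar>u z\<bar> powr p) \<partial>lborel) \<partial>lborel) =
      (\<integral>\<^sup>+x. ennreal (D ^ (2 * ?d)) * energy_density \<Omega> p u x \<partial>lborel) + (\<integral>\<^sup>+x. indicator \<Omega> x * (\<integral>\<^sup>+z. indicator S z * ennreal (\<bar>u z\<bar> powr p) \<partial>lborel) \<partial>lborel)"
      by (rule nn_integral_add) measurable
    also have "(\<integral>\<^sup>+x. ennreal (D ^ (2 * ?d)) * energy_density \<Omega> p u x \<partial>lborel) = ennreal (D ^ (2 * ?d)) * energy \<Omega> p u"
      unfolding energy_eq_density by (rule nn_integral_cmult) measurable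
    also have "(\<integral>\<^sup>+x. indicator \<Omega> x * (\<integral>\<^sup>+z. indicator S z * ennreal (\<bar>u z\<bar> powr p) \<partial>lborel) \<partial>lborel) = ennreal v * (\<integral>\<^sup>+z. indicator S z * ennreal (\<bar>u z\<bar> powr p) \<partial>lborel)"
      by (simp add: nn_integral_multc v)
    also have "ennreal (2 powr p) * (ennreal (D ^ (2 * ?d)) * energy \<Omega> p u + ennreal v * (\<integral>\<^sup>+z. indicator S z * ennreal (\<bar>u z\<bar> powr p) \<partial>lborel))
      \<le> ennreal (2 powr p) * (ennreal (D ^ (2 * ?d)) * energy \<Omega> p u + ennreal v * (ennreal (\<eta> ^ ?d) * (ennreal K * energy \<Omega> p u)))"
      by (intro mult_left_mono add_left_mono order_trans[OF S1] I) auto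
    also have "\<dots> = ennreal (\<sigma> * L) * energy \<Omega> p u"
    proof -
      have "ennreal a * (ennreal b * X + ennreal v * (ennreal e * (ennreal K * X))) = ennreal (a * (b + v * (e * K))) * X"
        if "0 \<le> a" "0 \<le> b" "0 \<le> e" for a b e and X :: ennreal
        using that v K by (simp add: ennreal_mult distrib_left distrib_right mult.assoc)
      then show ?thesis using D \<eta> \<sigma> by (simp add: L_def)
    qed
    finally have "ennreal (1 / \<sigma>) * (ennreal \<sigma> * W) \<le> ennreal (1 / \<sigma>) * (ennreal (\<sigma> * L) * energy \<Omega> p u)"
      by (rule mult_left_mono) simp
    then have W: "W \<le> ennreal L * energy \<Omega> p u"
      using \<sigma>(1) L by (simp add: mult.assoc[symmetric] flip: ennreal_mult)
    have "(\<integral>\<^sup>+x. indicator \<Omega> x * ennreal (\<bar>u x\<bar> powr p / bdist \<Omega> x ^ ?d) \<partial>lborel) \<le>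
      (\<integral>\<^sup>+x. indicator S x * ennreal (\<bar>u x\<bar> powr p / bdist \<Omega> x ^ ?d) + ennreal (1 / \<eta> ^ ?d) * (indicator \<Omega> x * ennreal (\<bar>u x\<bar> powr p)) \<partial>lborel)"
    proof (rule nn_integral_mono)
      fix x
      show "indicator \<Omega> x * ennreal (\<bar>u x\<bar> powr p / bdist \<Omega> x ^ ?d) \<le> indicator S x * ennreal (\<bar>u x\<bar> powr p / bdist \<Omega> x ^ ?d) + ennreal (1 / \<eta> ^ ?d) * (indicator \<Omega> x * ennreal (\<bar>u x\<bar> powr p))"
      proof (cases "x \<in> \<Omega> - S")
        case True
        then have "\<eta> \<le> bdist \<Omega> x" "x \<in> \<Omega>" by (auto simp: S_def)
        then have "\<bar>u x\<bar> powr p / bdist \<Omega> x ^ ?d \<le> \<bar>u x\<bar> powr p / \<eta> ^ ?d"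
          using \<eta> by (intro divide_left_mono power_mono mult_pos_pos) auto
        then have "ennreal (\<bar>u x\<bar> powr p / bdist \<Omega> x ^ ?d) \<le> ennreal (1 / \<eta> ^ ?d) * ennreal (\<bar>u x\<bar> powr p)"
          using \<eta> by (subst ennreal_mult[symmetric]) (auto intro: ennreal_leI)
        then show ?thesis using True by simp
      qed (auto simp: S_def split: split_indicator)
    qed
    also have "\<dots> = I + ennreal (1 / \<eta> ^ ?d) * W"
      unfolding I_def W_def by (subst nn_integral_add) (auto simp: nn_integral_cmult)
    also have "\<dots> \<le> ennreal K * energy \<Omega> p u + ennreal (1 / \<eta> ^ ?d) * (ennreal L * energy \<Omega> p u)"
      by (intro add_mono I mult_left_mono W) auto
    also have "\<dots> = ennreal H * energy \<Omega> p u"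
      using K L \<eta> by (simp add: H_def distrib_right mult.assoc[symmetric] flip: ennreal_mult)
    finally show "(\<integral>\<^sup>+x. indicator \<Omega> x * ennreal (\<bar>u x\<bar> powr p / bdist \<Omega> x ^ ?d) \<partial>lborel) \<le> ennreal H * energy \<Omega> p u" .
  qed
qed

section \<open>Logarithmic Hardy inequality in dimension one\<close>

text \<open>
  Convexity with the weights \<open>1 / (1 + h)\<close> and \<open>h / (1 + h)\<close>: the value \<open>a\<close> is kept with a factor close to
  \<open>1\<close>, at the expense of a large factor on the increment.
\<close>

lemma powr_le_weighted:
  fixes a b p h :: real
  assumes p: "1 < p" and h: "0 < h"
  shows "\<bar>b\<bar> powr p \<le> (1 + h) powr (p - 1) * \<bar>a\<bar> powr p + (1 + 1 / h) powr (p - 1) * \<bar>b - a\<bar> powr p"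
proof -
  define m where "m = \<bar>a\<bar> + \<bar>b - a\<bar>"
  define s where "s = 1 / (1 + h)"
  define r where "r = h / (1 + h)"
  have sr: "0 < s" "0 < r" "s + r = 1" using h by (auto simp: s_def r_def field_simps)
  have s': "1 + h = 1 / s" "1 + 1 / h = 1 / r" using h by (auto simp: s_def r_def field_simps)
  have mono: "\<bar>b\<bar> powr p \<le> m powr p" unfolding m_def using p by (intro powr_mono2) auto
  have scale: "v * (x / v) powr p = (1 / v) powr (p - 1) * x powr p" if "0 < v" for v x :: real
    using that by (simp add: powr_divide powr_diff)
  show ?thesis
  proof (cases "m = 0")
    case True
    then show ?thesis using mono p by (auto simp: s'[symmetric])
  next
    case False
    then have m: "0 < m" unfolding m_def by linarith
    have "s * (p * m powr (p - 1) * (\<bar>a\<bar> / s)) \<le> s * ((\<bar>a\<bar> / s) powr p + (p - 1) * m powr p)"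
      using sr p m by (intro mult_left_mono powr_ge_tangent) auto
    moreover have "r * (p * m powr (p - 1) * (\<bar>b - a\<bar> / r)) \<le> r * ((\<bar>b - a\<bar> / r) powr p + (p - 1) * m powr p)"
      using sr p m by (intro mult_left_mono powr_ge_tangent) auto
    moreover have "s * (p * m powr (p - 1) * (\<bar>a\<bar> / s)) = p * m powr (p - 1) * \<bar>a\<bar>"
      "r * (p * m powr (p - 1) * (\<bar>b - a\<bar> / r)) = p * m powr (p - 1) * \<bar>b - a\<bar>" using sr by auto
    ultimately have "p * m powr (p - 1) * \<bar>a\<bar> + p * m powr (p - 1) * \<bar>b - a\<bar> \<le>
      s * (\<bar>a\<bar> / s) powr p + r * (\<bar>b - a\<bar> / r) powr p + (s + r) * ((p - 1) * m powr p)"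
      by (simp add: distrib_left distrib_right)
    moreover have "p * m powr (p - 1) * \<bar>a\<bar> + p * m powr (p - 1) * \<bar>b - a\<bar> = p * m powr p"
    proof -
      have "p * m powr (p - 1) * \<bar>a\<bar> + p * m powr (p - 1) * \<bar>b - a\<bar> = p * (m powr (p - 1) * m)"
        by (simp add: m_def distrib_left)
      also have "m powr (p - 1) * m = m powr p" using m by (simp add: powr_diff)
      finally show ?thesis .
    qed
    ultimately have "m powr p \<le> s * (\<bar>a\<bar> / s) powr p + r * (\<bar>b - a\<bar> / r) powr p"
      by (simp add: sr(3) left_diff_distrib)
    then show ?thesis unfolding s' scale[OF sr(1)] scale[OF sr(2)] using mono by linarith
  qed
qed

text \<open>
  The mean value theorem; the decrement over a half step is what the discrete Hardy inequality sums up.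
\<close>

lemma powr_negative_decrement:
  fixes y p :: real
  assumes y: "1 \<le> y" and p: "1 < p"
  shows "(y + 1 / 2) powr (1 - p) + (p - 1) / 2 * 2 powr (- p) * y powr (- p) \<le> y powr (1 - p)"
proof -
  have "\<exists>z>y. z < y + 1 / 2 \<and> (y + 1 / 2) powr (1 - p) - y powr (1 - p) = (y + 1 / 2 - y) * ((1 - p) * z powr (- p))"
  proof (rule MVT2)
    show "DERIV (\<lambda>x. x powr (1 - p)) x :> (1 - p) * x powr (- p)" if "y \<le> x" "x \<le> y + 1 / 2" for x
      using DERIV_powr[of "\<lambda>x. x" 1 x "\<lambda>_. 1 - p" 0] has_real_derivative_powr[of x "1 - p"] that y by (simp add: diff_diff_eq)
  qed simp
  then obtain z where z: "y < z" "z < y + 1 / 2" "(y + 1 / 2) powr (1 - p) - y powr (1 - p) = 1 / 2 * ((1 - p) * z powr (- p))"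
    by auto
  have "(2 * y) powr (- p) \<le> z powr (- p)" using z y p by (intro powr_mono2') auto
  then have "2 powr (- p) * y powr (- p) \<le> z powr (- p)" by (simp add: powr_mult)
  then have "(p - 1) / 2 * (2 powr (- p) * y powr (- p)) \<le> (p - 1) / 2 * z powr (- p)"
    using p by (intro mult_left_mono) auto
  moreover have "1 / 2 * ((1 - p) * z powr (- p)) = - ((p - 1) / 2 * z powr (- p))"
    by (simp add: field_simps)
  ultimately show ?thesis using z(3) by (simp add: mult.assoc)
qed

text \<open>
  Telescope \<open>(k + 1) powr (1 - p) * \<bar>b k\<bar> powr p\<close>.  From \<open>k\<close> to \<open>k + 1\<close> the weight decreases by about
  \<open>(k + 1) powr (- p)\<close>; half of the decrease pays for replacing \<open>b (k + 1)\<close> by \<open>b k\<close>, and the other half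
  is the sum on the left.
\<close>

lemma discrete_hardy:
  fixes b :: "nat \<Rightarrow> real" and p :: real
  assumes p: "1 < p"
  shows "(p - 1) / 2 * 2 powr (- p) * (\<Sum>k<N. \<bar>b k\<bar> powr p * (real k + 1) powr (- p)) \<le>
    \<bar>b 0\<bar> powr p + 3 powr (p - 1) * (\<Sum>k<N. \<bar>b (Suc k) - b k\<bar> powr p)"
proof -
  define c where "c = (p - 1) / 2 * 2 powr (- p)"
  have step: "(real k + 2) powr (1 - p) * \<bar>b (Suc k)\<bar> powr p + c * (\<bar>b k\<bar> powr p * (real k + 1) powr (- p)) \<le>
    (real k + 1) powr (1 - p) * \<bar>b k\<bar> powr p + 3 powr (p - 1) * \<bar>b (Suc k) - b k\<bar> powr p" for k
  proof -
    define n where "n = real k + 2"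
    \<comment> \<open>this \<open>h\<close> makes \<open>(1 + h) / n\<close> at most \<open>1 / (k + 3 / 2)\<close>, half a step on the way from \<open>1 / (k + 2)\<close> to \<open>1 / (k + 1)\<close>\<close>
    define h where "h = 1 / (2 * n)"
    have n: "2 \<le> n" and h: "0 < h" by (auto simp: n_def h_def)
    have w: "n powr (1 - p) = 1 / n powr (p - 1)" using n by (simp add: powr_diff)
    have e1: "n powr (1 - p) * (1 + h) powr (p - 1) \<le> (real k + 1 + 1 / 2) powr (1 - p)"
    proof -
      have "(1 + h) / n \<le> 1 / (real k + 1 + 1 / 2)"
      proof -
        have "(1 + h) * (real k + 1 + 1 / 2) = (1 + 1 / (2 * n)) * (n - 1 / 2)" by (simp add: h_def n_def)
        also have "\<dots> = n - 1 / (4 * n)" using n by (simp add: field_simps)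
        also have "\<dots> \<le> n" using n by simp
        finally show ?thesis using n by (simp add: divide_le_eq le_divide_eq n_def mult.commute)
      qed
      then have "((1 + h) / n) powr (p - 1) \<le> (1 / (real k + 1 + 1 / 2)) powr (p - 1)"
        using p h n by (intro powr_mono2) auto
      also have "\<dots> = (real k + 1 + 1 / 2) powr (1 - p)"
        using powr_minus_divide[of "real k + 1 + 1 / 2" "p - 1"] by (simp add: powr_divide)
      also have "((1 + h) / n) powr (p - 1) = n powr (1 - p) * (1 + h) powr (p - 1)"
        unfolding w powr_divide by simp
      finally show ?thesis .
    qed
    have e2: "n powr (1 - p) * (1 + 1 / h) powr (p - 1) \<le> 3 powr (p - 1)"
    proof -
      have "(1 + 1 / h) / n \<le> 3" using n by (simp add: h_def divide_le_eq)
      then have "((1 + 1 / h) / n) powr (p - 1) \<le> 3 powr (p - 1)"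
        using p h n by (intro powr_mono2) auto
      also have "((1 + 1 / h) / n) powr (p - 1) = n powr (1 - p) * (1 + 1 / h) powr (p - 1)"
        unfolding w powr_divide by simp
      finally show ?thesis .
    qed
    have "n powr (1 - p) * \<bar>b (Suc k)\<bar> powr p \<le> n powr (1 - p) * ((1 + h) powr (p - 1) * \<bar>b k\<bar> powr p + (1 + 1 / h) powr (p - 1) * \<bar>b (Suc k) - b k\<bar> powr p)"
      by (intro mult_left_mono powr_le_weighted p h) auto
    also have "\<dots> = (n powr (1 - p) * (1 + h) powr (p - 1)) * \<bar>b k\<bar> powr p + (n powr (1 - p) * (1 + 1 / h) powr (p - 1)) * \<bar>b (Suc k) - b k\<bar> powr p"
      by (simp add: distrib_left)
    also have "\<dots> \<le> (real k + 1 + 1 / 2) powr (1 - p) * \<bar>b k\<bar> powr p + 3 powr (p - 1) * \<bar>b (Suc k) - b k\<bar> powr p"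
      using e1 e2 by (intro add_mono mult_right_mono) auto
    finally have A: "n powr (1 - p) * \<bar>b (Suc k)\<bar> powr p \<le> (real k + 1 + 1 / 2) powr (1 - p) * \<bar>b k\<bar> powr p + 3 powr (p - 1) * \<bar>b (Suc k) - b k\<bar> powr p" .
    have "((real k + 1 + 1 / 2) powr (1 - p) + c * (real k + 1) powr (- p)) * \<bar>b k\<bar> powr p \<le> (real k + 1) powr (1 - p) * \<bar>b k\<bar> powr p"
      unfolding c_def by (intro mult_right_mono powr_negative_decrement p) auto
    then have "(real k + 1 + 1 / 2) powr (1 - p) * \<bar>b k\<bar> powr p + c * (\<bar>b k\<bar> powr p * (real k + 1) powr (- p)) \<le> (real k + 1) powr (1 - p) * \<bar>b k\<bar> powr p"
      by (simp only: distrib_right mult.assoc mult.commute[of "(real k + 1) powr (- p)"])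
    then show ?thesis using A unfolding n_def by linarith
  qed
  have "(real N + 1) powr (1 - p) * \<bar>b N\<bar> powr p + c * (\<Sum>k<N. \<bar>b k\<bar> powr p * (real k + 1) powr (- p)) \<le>
    \<bar>b 0\<bar> powr p + 3 powr (p - 1) * (\<Sum>k<N. \<bar>b (Suc k) - b k\<bar> powr p)"
  proof (induction N)
    case (Suc N)
    have "real (Suc N) + 1 = real N + 2" by simp
    then show ?case using Suc step[of N] by (simp only: sum.lessThan_Suc distrib_left)
  qed simp
  moreover have "0 \<le> (real N + 1) powr (1 - p) * \<bar>b N\<bar> powr p" by simp
  ultimately show ?thesis unfolding c_def by linarith
qed

text \<open>
  Cut the interval of length \<open>R\<close> next to the end point \<open>z\<close> into the dyadic intervals \<open>I k\<close>.  On \<open>I k\<close> the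
  logarithm is at least \<open>(k + 1) * ln 2\<close> and the distance to the end point is comparable with the length of
  \<open>I k\<close>.  The deviation of \<open>u\<close> from its mean over \<open>I k\<close> is controlled by the energy density on \<open>I k\<close>, and
  the means are handled by the discrete Hardy inequality.
\<close>

lemma half_interval_hardy:
  fixes u :: "'a::euclidean_space \<Rightarrow> real" and e z :: 'a and p R m C :: real
  assumes d: "DIM('a) = 1" and e: "norm e = 1" and R: "0 < R" and p: "1 < p"
    and [measurable]: "u \<in> borel_measurable borel" "\<Omega> \<in> sets borel" and bdd: "\<And>y. \<bar>u y\<bar> \<le> C"
    and sub: "\<And>x. 0 < (x - z) \<bullet> e \<Longrightarrow> (x - z) \<bullet> e < R \<Longrightarrow> x \<in> \<Omega>"
  defines "c \<equiv> (p - 1) / 2 * 2 powr (- p)"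
  shows "(\<integral>\<^sup>+x. (if 0 < (x - z) \<bullet> e \<and> (x - z) \<bullet> e < R then
      ennreal (\<bar>u x - m\<bar> powr p / (ln (2 * R / ((x - z) \<bullet> e)) powr p * ((x - z) \<bullet> e))) else 0) \<partial>lborel)
    \<le> ennreal (2 powr p / ln 2 powr p * (8 / unit_ball_vol 1 + unit_ball_vol 1 / (2 * c) * (3 powr (p - 1) * (32 / unit_ball_vol 1 ^ 2)))) * energy \<Omega> p u
      + ennreal (2 powr p / ln 2 powr p * (unit_ball_vol 1 / (2 * c)) * \<bar>mean (ball (z + (3 / 4 * R) *\<^sub>R e) (R / 4)) u - m\<bar> powr p)"
proof -
  let ?w = "unit_ball_vol 1" and ?G = "energy_density \<Omega> p u"
  define t where "t x = (x - z) \<bullet> e" for x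
  have [measurable]: "t \<in> borel_measurable borel" unfolding t_def by measurable
  have w: "0 < ?w" by simp
  have c: "0 < c" using p by (simp add: c_def)
  have l2: "0 < ln (2::real)" by simp
  have dist: "dist x y = \<bar>t x - t y\<bar>" for x y
  proof -
    obtain b :: 'a where b: "Basis = {b}" using d by (metis card_1_singletonE)
    have rep: "v = (v \<bullet> b) *\<^sub>R b" for v using euclidean_representation[of v] unfolding b by simp
    have "b \<in> Basis" unfolding b by (rule singletonI)
    then have bb: "b \<bullet> b = 1" by (rule inner_same_Basis)
    have n: "norm v = \<bar>v \<bullet> b\<bar>" for v using rep[of v] bb by (metis norm_scaleR mult.right_neutral norm_eq_1)
    have "(x - y) \<bullet> e = ((x - y) \<bullet> b) * (e \<bullet> b)"
      by (metis rep inner_commute inner_scaleR_right)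
    then have "\<bar>(x - y) \<bullet> e\<bar> = norm (x - y) * norm e" by (simp only: n abs_mult)
    moreover have "t x - t y = (x - y) \<bullet> e" by (simp add: t_def inner_diff_left)
    ultimately show ?thesis using e by (simp add: dist_norm)
  qed
  define r where "r k = R / 2 ^ k" for k :: nat
  have r: "0 < r k" "r (Suc k) = r k / 2" for k using R by (auto simp: r_def)
  \<comment> \<open>the interval \<open>r k / 2 < t x < r k\<close>, as a ball\<close>
  define I where "I k = ball (z + (3 / 4 * r k) *\<^sub>R e) (r k / 4)" for k
  have tc: "t (z + s *\<^sub>R e) = s" for s using e by (simp add: t_def norm_eq_1)
  have I: "x \<in> I k \<longleftrightarrow> r k / 2 < t x \<and> t x < r k" for x k
    unfolding I_def mem_ball dist tc by (auto simp: abs_less_iff field_simps)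
  have Im [measurable]: "I k \<in> sets borel" for k by (simp add: I_def)
  have eI: "emeasure lborel (I k) = ennreal (?w * (r k / 4))" for k
    unfolding I_def using r(1)[of k] d by (subst emeasure_ball) auto
  have rR: "r k \<le> R" for k using R by (simp add: r_def divide_le_eq mult_le_cancel_left1)
  have Isub: "I k \<subseteq> \<Omega>" for k
  proof
    fix x assume "x \<in> I k"
    then have "0 < t x" "t x < R" using I r(1)[of k] rR[of k] by (auto intro: less_trans[of _ "r k / 2"])
    then show "x \<in> \<Omega>" using sub by (simp add: t_def)
  qed
  have disj: "disjoint_family I"
  proof -
    have "I k \<inter> I j = {}" if "k < j" for k j
    proof -
      have "(2::real) ^ Suc k \<le> 2 ^ j" using that by (intro power_increasing) auto
      then have "r j \<le> r k / 2" using R by (simp add: r_def field_simps)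
      then show ?thesis using I by fastforce
    qed
    then show ?thesis unfolding disjoint_family_on_def by (metis Int_commute nat_neq_iff)
  qed
  define a where "a k = mean (I k) u" for k
  define S where "S k = (\<integral>\<^sup>+y. indicator (I k) y * ?G y \<partial>lborel)" for k
  have Ssum: "(\<Sum>k<N. S k) \<le> energy \<Omega> p u" for N
  proof -
    have "(\<Sum>k<N. S k) = (\<integral>\<^sup>+y. (\<Sum>k<N. indicator (I k) y) * ?G y \<partial>lborel)"
      unfolding S_def by (subst nn_integral_sum[symmetric]) (auto simp: sum_distrib_right)
    also have "\<dots> \<le> (\<integral>\<^sup>+y. 1 * ?G y \<partial>lborel)"
    proof (intro nn_integral_mono mult_right_mono)
      fix y
      have "(\<Sum>k<N. indicator (I k) y :: ennreal) = indicator (\<Union>k<N. I k) y"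
        using disj by (intro indicator_UN_disjoint[symmetric]) (auto simp: disjoint_family_on_def)
      then show "(\<Sum>k<N. indicator (I k) y :: ennreal) \<le> 1" by (simp split: split_indicator)
    qed auto
    finally show ?thesis by (simp add: energy_eq_density)
  qed
  have diff: "ennreal (\<bar>a (Suc k) - a k\<bar> powr p) \<le> ennreal (32 / ?w ^ 2) * S (Suc k)" for k
  proof -
    have "ennreal (\<bar>a (Suc k) - a k\<bar> powr p) \<le> ennreal (r k ^ (2 * DIM('a)) / ((?w * (r (Suc k) / 4)) * (?w * (r k / 4)))) * S (Suc k)"
      unfolding a_def S_def
    proof (rule mean_diff_powr_le_energy)
      show "dist x y \<le> r k" if "y \<in> I (Suc k)" "x \<in> I k" for x y
        using that r[of k] unfolding I dist by auto
    qed (use eI Isub r(1) w bdd p in auto)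
    also have "r k ^ (2 * DIM('a)) / ((?w * (r (Suc k) / 4)) * (?w * (r k / 4))) = 32 / ?w ^ 2"
      unfolding r(2) d using r(1)[of k] w by (simp add: power2_eq_square)
    finally show ?thesis .
  qed
  have hardy: "(\<Sum>k<N. ennreal (\<bar>a k - m\<bar> powr p * (real k + 1) powr (- p))) \<le>
    ennreal (1 / c) * (ennreal (\<bar>a 0 - m\<bar> powr p) + ennreal (3 powr (p - 1) * (32 / ?w ^ 2)) * energy \<Omega> p u)" for N
  proof -
    have "c * (\<Sum>k<N. \<bar>a k - m\<bar> powr p * (real k + 1) powr (- p)) \<le>
      \<bar>a 0 - m\<bar> powr p + 3 powr (p - 1) * (\<Sum>k<N. \<bar>a (Suc k) - a k\<bar> powr p)"
      using discrete_hardy[OF p, of "\<lambda>k. a k - m" N] by (simp add: c_def)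
    then have "(\<Sum>k<N. \<bar>a k - m\<bar> powr p * (real k + 1) powr (- p)) \<le>
      1 / c * (\<bar>a 0 - m\<bar> powr p + 3 powr (p - 1) * (\<Sum>k<N. \<bar>a (Suc k) - a k\<bar> powr p))"
      using c by (simp add: le_divide_eq mult.commute)
    then have "ennreal (\<Sum>k<N. \<bar>a k - m\<bar> powr p * (real k + 1) powr (- p)) \<le>
      ennreal (1 / c * (\<bar>a 0 - m\<bar> powr p + 3 powr (p - 1) * (\<Sum>k<N. \<bar>a (Suc k) - a k\<bar> powr p)))"
      by (rule ennreal_leI)
    also have "\<dots> = ennreal (1 / c) * (ennreal (\<bar>a 0 - m\<bar> powr p) + ennreal (3 powr (p - 1)) * (\<Sum>k<N. ennreal (\<bar>a (Suc k) - a k\<bar> powr p)))"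
    proof -
      have "ennreal (x * (y + v * q)) = ennreal x * (ennreal y + ennreal v * ennreal q)"
        if "0 \<le> x" "0 \<le> y" "0 \<le> v" "0 \<le> q" for x y v q :: real
        using that by (simp add: ennreal_mult)
      from this[of "1 / c" "\<bar>a 0 - m\<bar> powr p" "3 powr (p - 1)" "\<Sum>k<N. \<bar>a (Suc k) - a k\<bar> powr p"]
      show ?thesis using c by (simp del: times_divide_eq_left times_divide_eq_right mult_1 add: sum_nonneg)
    qed
    also have "\<dots> \<le> ennreal (1 / c) * (ennreal (\<bar>a 0 - m\<bar> powr p) + ennreal (3 powr (p - 1)) * (ennreal (32 / ?w ^ 2) * energy \<Omega> p u))"
    proof (intro mult_left_mono add_left_mono)
      have "(\<Sum>k<N. ennreal (\<bar>a (Suc k) - a k\<bar> powr p)) \<le> (\<Sum>k<N. ennreal (32 / ?w ^ 2) * S (Suc k))"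
        by (intro sum_mono diff)
      also have "\<dots> = ennreal (32 / ?w ^ 2) * (\<Sum>k<N. S (Suc k))" by (simp add: sum_distrib_left)
      also have "(\<Sum>k<N. S (Suc k)) \<le> (\<Sum>k<Suc N. S k)"
        by (subst sum.lessThan_Suc_shift) simp
      also have "\<dots> \<le> energy \<Omega> p u" by (rule Ssum)
      finally show "(\<Sum>k<N. ennreal (\<bar>a (Suc k) - a k\<bar> powr p)) \<le> ennreal (32 / ?w ^ 2) * energy \<Omega> p u"
        by (simp add: mult_left_mono)
    qed auto
    also have "ennreal (3 powr (p - 1)) * (ennreal (32 / ?w ^ 2) * energy \<Omega> p u) = ennreal (3 powr (p - 1) * (32 / ?w ^ 2)) * energy \<Omega> p u"
      by (subst ennreal_mult) (auto simp: mult.assoc)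
    finally show ?thesis by (simp add: sum_ennreal)
  qed
  have inside: "ennreal (\<bar>u x - a k\<bar> powr p) \<le> ennreal (4 * r k / ?w) * ?G x" if x: "x \<in> I k" for x k
  proof -
    have "ennreal (?w * (r k / 4)) * ennreal (\<bar>a k - u x\<bar> powr p) \<le> (\<integral>\<^sup>+y. indicator (I k) y * ennreal (\<bar>u y - u x\<bar> powr p) \<partial>lborel)"
      unfolding a_def using eI r(1) w bdd p by (intro mean_powr_le) auto
    also have "\<dots> \<le> (\<integral>\<^sup>+y. ennreal (r k ^ 2) * (ennreal (\<bar>u y - u x\<bar> powr p / dist y x ^ (2 * DIM('a))) * indicator \<Omega> y) \<partial>lborel)"
    proof (rule nn_integral_mono)
      fix y
      show "indicator (I k) y * ennreal (\<bar>u y - u x\<bar> powr p) \<le> ennreal (r k ^ 2) * (ennreal (\<bar>u y - u x\<bar> powr p / dist y x ^ (2 * DIM('a))) * indicator \<Omega> y)"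
      proof (cases "y \<in> I k \<and> y \<noteq> x")
        case True
        have "dist y x \<le> r k" using True x r(1)[of k] unfolding I dist by auto
        then have "\<bar>u y - u x\<bar> powr p * dist y x ^ 2 \<le> \<bar>u y - u x\<bar> powr p * r k ^ 2"
          by (intro mult_left_mono power_mono) auto
        then have "\<bar>u y - u x\<bar> powr p \<le> r k ^ 2 * (\<bar>u y - u x\<bar> powr p / dist y x ^ 2)"
          using True by (simp add: pos_le_divide_eq mult.commute)
        then have "ennreal (\<bar>u y - u x\<bar> powr p) \<le> ennreal (r k ^ 2) * ennreal (\<bar>u y - u x\<bar> powr p / dist y x ^ 2)"
          by (subst ennreal_mult[symmetric]) (auto intro: ennreal_leI)
        moreover have "y \<in> \<Omega>" using True Isub by blast
        ultimately show ?thesis using True by (simp add: d)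
      qed auto
    qed
    also have "\<dots> = ennreal (r k ^ 2) * ?G x"
    proof -
      have "x \<in> \<Omega>" using x Isub by blast
      then show ?thesis by (subst nn_integral_cmult) (auto simp: energy_density_def)
    qed
    finally have "ennreal (4 / (?w * r k)) * (ennreal (?w * (r k / 4)) * ennreal (\<bar>a k - u x\<bar> powr p)) \<le> ennreal (4 / (?w * r k)) * (ennreal (r k ^ 2) * ?G x)"
      by (intro mult_left_mono) auto
    also have "ennreal (4 / (?w * r k)) * (ennreal (?w * (r k / 4)) * ennreal (\<bar>a k - u x\<bar> powr p)) = ennreal (\<bar>u x - a k\<bar> powr p)"
      using w r(1)[of k] by (simp add: mult.assoc[symmetric] abs_minus_commute flip: ennreal_mult)
    also have "ennreal (4 / (?w * r k)) * (ennreal (r k ^ 2) * ?G x) = ennreal (4 * r k / ?w) * ?G x"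
      using w r(1)[of k] by (simp add: mult.assoc[symmetric] power2_eq_square flip: ennreal_mult)
    finally show ?thesis .
  qed
  define Q where "Q = 2 powr p / ln 2 powr p"
  have Q: "0 \<le> Q" by (simp add: Q_def)
  define F where "F x = (if 0 < t x \<and> t x < R then ennreal (\<bar>u x - m\<bar> powr p / (ln (2 * R / t x) powr p * t x)) else 0)" for x
  define B where "B k = ennreal (\<bar>a k - m\<bar> powr p * (real k + 1) powr (- p))" for k
  have pt: "F x \<le> ennreal Q * (ennreal (8 / ?w) * ?G x + ennreal (2 / r k) * B k)" if x: "x \<in> I k" for x k
  proof -
    have tx: "r k / 2 < t x" "t x < r k" using x I by auto
    have t0: "0 < t x" using tx r(1)[of k] by linarith
    have tR: "t x < R" using tx rR[of k] by linarith
    have "2 * R / r k \<le> 2 * R / t x" using tx t0 R by (intro divide_left_mono mult_pos_pos) auto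
    moreover have "2 * R / r k = 2 ^ Suc k" using R by (simp add: r_def)
    ultimately have "ln (2 ^ Suc k) \<le> ln (2 * R / t x)" by (intro ln_mono) (auto intro: less_le_trans[of _ "2 ^ Suc k"])
    then have lnx: "(real k + 1) * ln 2 \<le> ln (2 * R / t x)" by (simp add: ln_realpow del: power_Suc) (simp add: add.commute)
    have k1: "0 < (real k + 1) * ln 2" using l2 by (intro mult_pos_pos) auto
    have "((real k + 1) * ln 2) powr p * (r k / 2) \<le> ln (2 * R / t x) powr p * t x"
      using lnx k1 tx p r(1)[of k] by (intro mult_mono powr_mono2) auto
    then have "\<bar>u x - m\<bar> powr p / (ln (2 * R / t x) powr p * t x) \<le> \<bar>u x - m\<bar> powr p / (((real k + 1) * ln 2) powr p * (r k / 2))"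
    proof (intro divide_left_mono mult_pos_pos)
      show "0 < ((real k + 1) * ln 2) powr p" "0 < ln (2 * R / t x) powr p"
        using k1 lnx by (simp_all only: powr_gt_zero)
    qed (use r(1)[of k] t0 in auto)
    also have "\<dots> = \<bar>u x - m\<bar> powr p * ((1 / ln 2 powr p) * (2 / r k) * (real k + 1) powr (- p))"
      by (simp add: powr_mult powr_minus_divide)
    also have "\<dots> \<le> 2 powr p * (\<bar>u x - a k\<bar> powr p + \<bar>a k - m\<bar> powr p) * ((1 / ln 2 powr p) * (2 / r k) * (real k + 1) powr (- p))"
    proof (rule mult_right_mono)
      have "\<bar>u x - m\<bar> powr p \<le> (\<bar>u x - a k\<bar> + \<bar>a k - m\<bar>) powr p" using p by (intro powr_mono2) auto
      also have "\<dots> \<le> 2 powr p * (\<bar>u x - a k\<bar> powr p + \<bar>a k - m\<bar> powr p)" using p by (intro powr_add_le) auto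
      finally show "\<bar>u x - m\<bar> powr p \<le> 2 powr p * (\<bar>u x - a k\<bar> powr p + \<bar>a k - m\<bar> powr p)" .
    qed (use r(1)[of k] in auto)
    also have "\<dots> = Q * (2 / r k * (real k + 1) powr (- p) * \<bar>u x - a k\<bar> powr p + 2 / r k * (\<bar>a k - m\<bar> powr p * (real k + 1) powr (- p)))"
      by (simp add: Q_def algebra_simps)
    also have "\<dots> \<le> Q * (2 / r k * 1 * \<bar>u x - a k\<bar> powr p + 2 / r k * (\<bar>a k - m\<bar> powr p * (real k + 1) powr (- p)))"
    proof (intro mult_left_mono add_right_mono mult_right_mono)
      have "(real k + 1) powr (- p) \<le> 1 powr (- p)" using p by (intro powr_mono2') auto
      then show "(real k + 1) powr (- p) \<le> 1" by simp
    qed (use r(1)[of k] Q in auto)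
    finally have le: "\<bar>u x - m\<bar> powr p / (ln (2 * R / t x) powr p * t x) \<le> Q * (2 / r k * \<bar>u x - a k\<bar> powr p + 2 / r k * (\<bar>a k - m\<bar> powr p * (real k + 1) powr (- p)))"
      by simp
    have "F x \<le> ennreal (Q * (2 / r k * \<bar>u x - a k\<bar> powr p + 2 / r k * (\<bar>a k - m\<bar> powr p * (real k + 1) powr (- p))))"
      unfolding F_def using t0 tR le by (simp add: ennreal_leI)
    also have "\<dots> = ennreal Q * (ennreal (2 / r k) * ennreal (\<bar>u x - a k\<bar> powr p) + ennreal (2 / r k) * B k)"
    proof -
      have "ennreal (x * (y * v + y * q)) = ennreal x * (ennreal y * ennreal v + ennreal y * ennreal q)"
        if "0 \<le> x" "0 \<le> y" "0 \<le> v" "0 \<le> q" for x y v q :: real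
        using that by (simp add: ennreal_mult)
      then show ?thesis unfolding B_def using Q r(1)[of k] by (simp del: times_divide_eq_left times_divide_eq_right)
    qed
    also have "\<dots> \<le> ennreal Q * (ennreal (2 / r k) * (ennreal (4 * r k / ?w) * ?G x) + ennreal (2 / r k) * B k)"
      by (intro mult_left_mono add_right_mono inside x) auto
    also have "ennreal (2 / r k) * (ennreal (4 * r k / ?w) * ?G x) = ennreal (8 / ?w) * ?G x"
      using w r(1)[of k] by (simp add: mult.assoc[symmetric] flip: ennreal_mult)
    finally show ?thesis .
  qed
  have Fm [measurable]: "F \<in> borel_measurable borel" unfolding F_def by measurable
  have Ik: "(\<integral>\<^sup>+x. indicator (I k) x * F x \<partial>lborel) \<le> ennreal Q * (ennreal (8 / ?w) * S k + ennreal (?w / 2) * B k)" for k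
  proof -
    have "(\<integral>\<^sup>+x. indicator (I k) x * F x \<partial>lborel) \<le> (\<integral>\<^sup>+x. ennreal Q * (ennreal (8 / ?w) * (indicator (I k) x * ?G x) + (ennreal (2 / r k) * B k) * indicator (I k) x) \<partial>lborel)"
      using pt by (intro nn_integral_mono) (auto split: split_indicator)
    also have "\<dots> = ennreal Q * (\<integral>\<^sup>+x. ennreal (8 / ?w) * (indicator (I k) x * ?G x) + (ennreal (2 / r k) * B k) * indicator (I k) x \<partial>lborel)"
      by (rule nn_integral_cmult) measurable
    also have "(\<integral>\<^sup>+x. ennreal (8 / ?w) * (indicator (I k) x * ?G x) + (ennreal (2 / r k) * B k) * indicator (I k) x \<partial>lborel) =
      (\<integral>\<^sup>+x. ennreal (8 / ?w) * (indicator (I k) x * ?G x) \<partial>lborel) + (\<integral>\<^sup>+x. (ennreal (2 / r k) * B k) * indicator (I k) x \<partial>lborel)"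
      by (rule nn_integral_add) measurable
    also have "(\<integral>\<^sup>+x. ennreal (8 / ?w) * (indicator (I k) x * ?G x) \<partial>lborel) = ennreal (8 / ?w) * S k"
      unfolding S_def by (rule nn_integral_cmult) measurable
    also have "(\<integral>\<^sup>+x. (ennreal (2 / r k) * B k) * indicator (I k) x \<partial>lborel) = ennreal (2 / r k) * B k * ennreal (?w * (r k / 4))"
      by (subst nn_integral_cmult_indicator) (auto simp: eI)
    also have "ennreal (2 / r k) * B k * ennreal (?w * (r k / 4)) = ennreal (?w / 2) * B k"
    proof -
      have "ennreal (2 / r k) * ennreal (?w * (r k / 4)) = ennreal (?w / 2)"
        using w r(1)[of k] by (subst ennreal_mult[symmetric]) auto
      then show ?thesis by (metis mult.assoc mult.commute)
    qed
    finally show ?thesis .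
  qed
  have cover: "AE x in lborel. F x \<le> (\<Sum>k. indicator (I k) x * F x)"
  proof -
    have null: "AE x in lborel. t x \<noteq> r k" for k
    proof -
      have "{x. t x = r k} \<subseteq> {z + r k *\<^sub>R e}"
      proof
        fix x assume "x \<in> {x. t x = r k}"
        then have "dist x (z + r k *\<^sub>R e) = 0" unfolding dist tc by simp
        then show "x \<in> {z + r k *\<^sub>R e}" by simp
      qed
      then show ?thesis
        using AE_lborel_singleton[of "z + r k *\<^sub>R e"] by (elim eventually_mono) auto
    qed
    then have "AE x in lborel. \<forall>k. t x \<noteq> r k" by (simp add: AE_all_countable)
    then show ?thesis
    proof (elim eventually_mono)
      fix x assume nr: "\<forall>k. t x \<noteq> r k"
      show "F x \<le> (\<Sum>k. indicator (I k) x * F x)"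
      proof (cases "0 < t x \<and> t x < R")
        case True
        have "\<exists>k. r (Suc k) < t x \<and> t x < r k"
        proof -
          obtain n where n: "R / t x < 2 ^ n" using real_arch_pow[of 2 "R / t x"] by auto
          then have "r n < t x" using True R by (simp add: r_def field_simps)
          moreover have "\<not> r 0 < t x" using True by (simp add: r_def)
          ultimately obtain k where "r (Suc k) < t x" "\<not> r k < t x"
            using ex_least_nat_less[of "\<lambda>n. r n < t x" n] by blast
          then show ?thesis using nr by (metis linorder_neqE_linordered_idom)
        qed
        then obtain k where k: "x \<in> I k" using I r(2) by auto
        have "F x = (\<Sum>i\<in>{k}. indicator (I i) x * F x)" using k by simp
        also have "\<dots> \<le> (\<Sum>i. indicator (I i) x * F x)" by (rule sum_le_suminf[OF summableI]) auto
        finally show ?thesis .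
      next
        case False
        then have "F x = 0" unfolding F_def by (rule if_not_P)
        then show ?thesis by simp
      qed
    qed
  qed
  have "(\<integral>\<^sup>+x. F x \<partial>lborel) \<le> (\<integral>\<^sup>+x. (\<Sum>k. indicator (I k) x * F x) \<partial>lborel)"
    by (rule nn_integral_mono_AE[OF cover])
  also have "\<dots> = (\<Sum>k. \<integral>\<^sup>+x. indicator (I k) x * F x \<partial>lborel)"
    by (rule nn_integral_suminf) measurable
  also have "\<dots> \<le> (\<Sum>k. ennreal Q * (ennreal (8 / ?w) * S k + ennreal (?w / 2) * B k))"
    by (intro suminf_le summableI Ik)
  also have "\<dots> \<le> ennreal Q * (ennreal (8 / ?w) * energy \<Omega> p u + ennreal (?w / 2) * (ennreal (1 / c) * (ennreal (\<bar>a 0 - m\<bar> powr p) + ennreal (3 powr (p - 1) * (32 / ?w ^ 2)) * energy \<Omega> p u)))"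
  proof (rule suminf_le_const[OF summableI])
    fix N
    have "(\<Sum>k<N. ennreal Q * (ennreal (8 / ?w) * S k + ennreal (?w / 2) * B k)) = ennreal Q * (ennreal (8 / ?w) * (\<Sum>k<N. S k) + ennreal (?w / 2) * (\<Sum>k<N. B k))"
      by (simp add: sum_distrib_left sum.distrib distrib_left)
    also have "\<dots> \<le> ennreal Q * (ennreal (8 / ?w) * energy \<Omega> p u + ennreal (?w / 2) * (ennreal (1 / c) * (ennreal (\<bar>a 0 - m\<bar> powr p) + ennreal (3 powr (p - 1) * (32 / ?w ^ 2)) * energy \<Omega> p u)))"
      using hardy[of N] Ssum[of N] unfolding B_def by (intro mult_left_mono add_mono) auto
    finally show "(\<Sum>k<N. ennreal Q * (ennreal (8 / ?w) * S k + ennreal (?w / 2) * B k)) \<le> ennreal Q * (ennreal (8 / ?w) * energy \<Omega> p u + ennreal (?w / 2) * (ennreal (1 / c) * (ennreal (\<bar>a 0 - m\<bar> powr p) + ennreal (3 powr (p - 1) * (32 / ?w ^ 2)) * energy \<Omega> p u)))" .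
  qed
  also have "\<dots> = ennreal (Q * (8 / ?w + ?w / (2 * c) * (3 powr (p - 1) * (32 / ?w ^ 2)))) * energy \<Omega> p u + ennreal (Q * (?w / (2 * c)) * \<bar>a 0 - m\<bar> powr p)"
  proof -
    have gen: "ennreal q * (ennreal x * X + ennreal y * (ennreal v * (ennreal f + ennreal g * X))) = ennreal (q * (x + y * v * g)) * X + ennreal (q * (y * v) * f)"
      if "0 \<le> q" "0 \<le> x" "0 \<le> y" "0 \<le> v" "0 \<le> f" "0 \<le> g" for q x y v f g and X :: ennreal
      using that by (simp add: ennreal_mult distrib_left distrib_right mult.assoc ac_simps)
    have yv: "?w / 2 * (1 / c) = ?w / (2 * c)" by simp
    show ?thesis
      using gen[of Q "8 / ?w" "?w / 2" "1 / c" "\<bar>a 0 - m\<bar> powr p" "3 powr (p - 1) * (32 / ?w ^ 2)" "energy \<Omega> p u"] Q w c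
      unfolding yv by simp
  qed
  finally have "(\<integral>\<^sup>+x. F x \<partial>lborel) \<le> ennreal (Q * (8 / ?w + ?w / (2 * c) * (3 powr (p - 1) * (32 / ?w ^ 2)))) * energy \<Omega> p u + ennreal (Q * (?w / (2 * c)) * \<bar>a 0 - m\<bar> powr p)" .
  moreover have "a 0 = mean (ball (z + (3 / 4 * R) *\<^sub>R e) (R / 4)) u"
    by (simp add: a_def I_def r_def)
  ultimately show ?thesis unfolding F_def t_def Q_def by simp
qed

text \<open>
  A bounded domain in dimension one is an interval; apply the estimate to the two halves.  The means over
  the first dyadic intervals are compared with the mean over \<open>\<Omega>\<close> by the energy.
\<close>

theorem hardy_dimension_one:
  fixes \<Omega> :: "'a::euclidean_space set" and p :: real
  assumes dom: "bounded_lipschitz_domain \<Omega>" and d: "DIM('a) = 1" and p: "1 < p"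
  obtains H where "0 \<le> H"
    "\<And>u. u \<in> test_functions \<Omega> \<Longrightarrow>
      (\<integral>\<^sup>+x. hardy_density \<Omega> p (\<lambda>x. ln (2 * inradius \<Omega> / bdist \<Omega> x)) u (mean \<Omega> u) x \<partial>lborel) \<le> ennreal H * energy \<Omega> p u"
proof -
  let ?R = "inradius \<Omega>" and ?w = "unit_ball_vol (1::real)"
  have op: "open \<Omega>" "bounded \<Omega>" "connected \<Omega>" "\<Omega> \<noteq> {}" using dom by (auto simp: bounded_lipschitz_domain_def)
  have [measurable]: "\<Omega> \<in> sets borel" using op by simp
  obtain b :: 'a where b: "Basis = {b}" using d by (metis card_1_singletonE)
  have rep: "v = (v \<bullet> b) *\<^sub>R b" for v using euclidean_representation[of v] unfolding b by simp
  have bB: "b \<in> Basis" unfolding b by (rule singletonI)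
  have bb: "b \<bullet> b = 1" using bB by (rule inner_same_Basis)
  have nb: "norm b = 1" using bB by (rule norm_Basis)
  have nrm: "norm v = \<bar>v \<bullet> b\<bar>" for v using rep[of v] nb by (metis norm_scaleR mult.right_neutral)
  have dist: "dist x y = \<bar>x \<bullet> b - y \<bullet> b\<bar>" for x y by (simp add: dist_norm nrm inner_diff_left)
  define J where "J = (\<lambda>x. x \<bullet> b) ` \<Omega>"
  have Jc: "connected J" unfolding J_def using op(3) by (intro connected_continuous_image continuous_intros)
  have Jb: "bdd_above J" "bdd_below J"
  proof -
    have "bounded J" unfolding J_def using op(2) bounded_linear_image[OF _ bounded_linear_inner_left] by blast
    then show "bdd_above J" "bdd_below J" by (rule bounded_imp_bdd_above, rule bounded_imp_bdd_below)
  qed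
  have Jne: "J \<noteq> {}" using op(4) by (simp add: J_def)
  define lo where "lo = Inf J"
  define hi where "hi = Sup J"
  have \<Omega>iff: "x \<in> \<Omega> \<longleftrightarrow> lo < x \<bullet> b \<and> x \<bullet> b < hi" for x
  proof
    assume x: "x \<in> \<Omega>"
    obtain e where e: "0 < e" "cball x e \<subseteq> \<Omega>" using op(1) x open_contains_cball by blast
    have "x - e *\<^sub>R b \<in> \<Omega>" "x + e *\<^sub>R b \<in> \<Omega>" using e nb by (auto intro!: subsetD[OF e(2)] simp: dist_norm)
    then have "x \<bullet> b - e \<in> J" "x \<bullet> b + e \<in> J"
      unfolding J_def using image_eqI[of "x \<bullet> b - e" "\<lambda>x. x \<bullet> b" "x - e *\<^sub>R b" \<Omega>]
        image_eqI[of "x \<bullet> b + e" "\<lambda>x. x \<bullet> b" "x + e *\<^sub>R b" \<Omega>]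
      by (simp_all add: inner_diff_left inner_add_left bb)
    then have "lo \<le> x \<bullet> b - e" "x \<bullet> b + e \<le> hi"
      unfolding lo_def hi_def using Jb by (auto intro: cInf_lower cSup_upper)
    then show "lo < x \<bullet> b \<and> x \<bullet> b < hi" using e(1) by linarith
  next
    assume x: "lo < x \<bullet> b \<and> x \<bullet> b < hi"
    obtain s where s: "s \<in> J" "s < x \<bullet> b" using x cInf_lessD[OF Jne] unfolding lo_def by blast
    obtain t where t: "t \<in> J" "x \<bullet> b < t" using x less_cSupD[OF Jne] unfolding hi_def by blast
    have "x \<bullet> b \<in> J" using connected_contains_Icc[OF Jc s(1) t(1)] s t by auto
    then obtain y where "y \<in> \<Omega>" "x \<bullet> b = y \<bullet> b" unfolding J_def by blast
    then show "x \<in> \<Omega>" using rep[of x] rep[of y] by simp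
  qed
  obtain x0 where "x0 \<in> \<Omega>" using op(4) by blast
  then have lohi: "lo < hi" using \<Omega>iff by (meson less_trans)
  define zl where "zl = lo *\<^sub>R b"
  define zh where "zh = hi *\<^sub>R b"
  have zb: "zl \<bullet> b = lo" "zh \<bullet> b = hi" by (simp_all add: zl_def zh_def bb)
  have front: "zl \<in> frontier \<Omega>" "zh \<in> frontier \<Omega>"
  proof -
    have cl: "z \<in> closure \<Omega>" if "lo \<le> z \<bullet> b" "z \<bullet> b \<le> hi" for z
      unfolding closure_approachable
    proof (intro allI impI)
      fix e :: real assume e: "0 < e"
      define mid where "mid = (lo + hi) / 2"
      define v where "v = min 1 (e / (2 * (hi - lo)))"
      have v: "0 < v" "v \<le> 1" "v * (hi - lo) \<le> e / 2"
      proof -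
        show "0 < v" "v \<le> 1" using e lohi by (auto simp: v_def)
        have "v \<le> e / (2 * (hi - lo))" by (simp add: v_def)
        then show "v * (hi - lo) \<le> e / 2" using lohi by (simp add: field_simps)
      qed
      define y where "y = (z \<bullet> b + v * (mid - z \<bullet> b)) *\<^sub>R b"
      have yb: "y \<bullet> b = z \<bullet> b + v * (mid - z \<bullet> b)" by (simp add: y_def bb)
      have conv: "y \<bullet> b = (1 - v) * (z \<bullet> b) + v * mid" by (simp add: yb algebra_simps)
      have "lo = (1 - v) * lo + v * lo" "hi = (1 - v) * hi + v * hi" by (simp_all add: algebra_simps)
      moreover have "(1 - v) * lo \<le> (1 - v) * (z \<bullet> b)" "(1 - v) * (z \<bullet> b) \<le> (1 - v) * hi" using v that by (auto intro: mult_left_mono)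
      moreover have "v * lo < v * mid" "v * mid < v * hi" using v lohi by (auto simp: mid_def)
      ultimately have "y \<in> \<Omega>" unfolding \<Omega>iff conv by linarith
      moreover have "dist y z < e"
      proof -
        have half: "mid - lo = (hi - lo) / 2" "hi - mid = (hi - lo) / 2" "(hi - lo) / 2 \<le> hi - lo"
          using lohi by (simp_all add: mid_def field_simps)
        have "mid - z \<bullet> b \<le> mid - lo" using that(1) by (rule diff_left_mono)
        moreover have "z \<bullet> b - mid \<le> hi - mid" using that(2) by (rule diff_right_mono)
        ultimately have "mid - z \<bullet> b \<le> hi - lo" "- (mid - z \<bullet> b) \<le> hi - lo"
          unfolding minus_diff_eq half(1,2) using half(3) by (blast intro: order_trans)+
        then have "\<bar>mid - z \<bullet> b\<bar> \<le> hi - lo" by (rule abs_leI)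
        then have "v * \<bar>mid - z \<bullet> b\<bar> \<le> v * (hi - lo)" using v by (intro mult_left_mono) auto
        then have le: "v * \<bar>mid - z \<bullet> b\<bar> \<le> e / 2" using v(3) by (rule order_trans)
        have "e / 2 < e" using e by simp
        with le have "v * \<bar>mid - z \<bullet> b\<bar> < e" by (rule le_less_trans)
        moreover have "\<bar>y \<bullet> b - z \<bullet> b\<bar> = v * \<bar>mid - z \<bullet> b\<bar>" using v(1) unfolding yb by (simp add: abs_mult)
        ultimately show ?thesis unfolding dist by (simp only:)
      qed
      ultimately show "\<exists>y\<in>\<Omega>. dist y z < e" by blast
    qed
    have "zl \<notin> \<Omega>" "zh \<notin> \<Omega>" using \<Omega>iff zb by auto
    then show "zl \<in> frontier \<Omega>" "zh \<in> frontier \<Omega>"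
      using cl[of zl] cl[of zh] zb lohi op(1) by (auto simp: frontier_def interior_open)
  qed
  have bd: "bdist \<Omega> x = min (x \<bullet> b - lo) (hi - x \<bullet> b)" if x: "x \<in> \<Omega>" for x
  proof (rule antisym)
    have "bdist \<Omega> x \<le> dist x zl" "bdist \<Omega> x \<le> dist x zh"
      unfolding bdist_def using front by (auto intro: infdist_le)
    then show "bdist \<Omega> x \<le> min (x \<bullet> b - lo) (hi - x \<bullet> b)"
      using x unfolding \<Omega>iff dist zb by auto
    obtain y where y: "y \<in> frontier \<Omega>" "infdist x (frontier \<Omega>) = dist x y"
      using infdist_attains_inf[of "frontier \<Omega>" x] front frontier_closed by blast
    have "y \<notin> \<Omega>" using y(1) op(1) by (simp add: frontier_def interior_open)
    then have "y \<bullet> b \<le> lo \<or> hi \<le> y \<bullet> b" using \<Omega>iff by (meson not_le)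
    then show "min (x \<bullet> b - lo) (hi - x \<bullet> b) \<le> bdist \<Omega> x"
      using x unfolding \<Omega>iff bdist_def y(2) dist by auto
  qed
  have R: "?R = (hi - lo) / 2"
  proof (rule antisym)
    show "?R \<le> (hi - lo) / 2"
      unfolding inradius_def by (rule cSUP_least[OF op(4)]) (auto simp: bd min_def)
    define y where "y = ((lo + hi) / 2) *\<^sub>R b"
    have yb: "y \<bullet> b = (lo + hi) / 2" by (simp add: y_def bb)
    have "y \<in> \<Omega>" unfolding \<Omega>iff yb using lohi by simp
    then show "(hi - lo) / 2 \<le> ?R"
      using bdist_le_inradius[OF dom, of y] bd[of y] yb by (simp add: min_def field_simps)
  qed
  have R0: "0 < ?R" using R lohi by simp
  have R2: "2 * ?R = hi - lo" using R by simp
  define c where "c = (p - 1) / 2 * 2 powr (- p)"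
  have c: "0 < c" using p by (simp add: c_def)
  define K1 where "K1 = 2 powr p / ln 2 powr p * (8 / ?w + ?w / (2 * c) * (3 powr (p - 1) * (32 / ?w ^ 2)))"
  define K2 where "K2 = 2 powr p / ln 2 powr p * (?w / (2 * c))"
  have w: "0 < ?w" by simp
  have K: "0 \<le> K1" "0 \<le> K2" using w c by (auto simp: K1_def K2_def intro!: mult_nonneg_nonneg add_nonneg_nonneg divide_nonneg_nonneg)
  have vol0: "emeasure lborel \<Omega> < \<infinity>" by (rule emeasure_bounded_less_top[OF op(2)])
  obtain V where V: "emeasure lborel \<Omega> = ennreal V" "0 \<le> V" using vol0 by (cases "emeasure lborel \<Omega>") auto
  have Vpos: "0 < V"
  proof -
    obtain r where r: "0 < r" "ball x0 r \<subseteq> \<Omega>" using op(1) \<open>x0 \<in> \<Omega>\<close> openE by blast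
    have "emeasure lborel (ball x0 r) \<le> ennreal V" unfolding V(1)[symmetric] using r(2) by (intro emeasure_mono) auto
    then have "ennreal (unit_ball_vol (real DIM('a)) * r ^ DIM('a)) \<le> ennreal V" using r by (simp add: emeasure_ball)
    then have "unit_ball_vol (real DIM('a)) * r ^ DIM('a) \<le> V" using V by simp
    moreover have "0 < unit_ball_vol (real DIM('a)) * r ^ DIM('a)" using r by simp
    ultimately show ?thesis by linarith
  qed
  \<comment> \<open>the cost of comparing the mean over a first dyadic interval with the mean over \<open>\<Omega>\<close>\<close>
  define K3 where "K3 = (hi - lo) ^ (2 * DIM('a)) / (?w * (?R / 4) * V)"
  have K3: "0 \<le> K3" using lohi w R0 V by (simp add: K3_def)
  define H where "H = 2 * (K1 + K2 * K3)"
  show ?thesis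
  proof (rule that[of H])
    show "0 \<le> H" using K K3 by (simp add: H_def)
    fix u :: "'a \<Rightarrow> real" assume u: "u \<in> test_functions \<Omega>"
    have [measurable]: "u \<in> borel_measurable borel" by (rule test_function_measurable[OF u])
    obtain C where C: "0 \<le> C" "\<And>x. \<bar>u x\<bar> \<le> C" using test_function_bounded[OF u] by blast
    define m where "m = mean \<Omega> u"
    define F where "F z e x = (if 0 < (x - z) \<bullet> e \<and> (x - z) \<bullet> e < ?R then
      ennreal (\<bar>u x - m\<bar> powr p / (ln (2 * ?R / ((x - z) \<bullet> e)) powr p * ((x - z) \<bullet> e))) else 0)" for z e x
    have [measurable]: "F z e \<in> borel_measurable borel" for z e unfolding F_def by measurable
    have half: "(\<integral>\<^sup>+x. F z e x \<partial>lborel) \<le> ennreal (K1 + K2 * K3) * energy \<Omega> p u"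
      if e: "norm e = 1" and sub: "\<And>x. 0 < (x - z) \<bullet> e \<Longrightarrow> (x - z) \<bullet> e < ?R \<Longrightarrow> x \<in> \<Omega>" for z e
    proof -
      let ?A = "ball (z + (3 / 4 * ?R) *\<^sub>R e) (?R / 4)"
      have As: "?A \<subseteq> \<Omega>"
      proof
        fix x assume "x \<in> ?A"
        then have n: "norm (x - (z + (3 / 4 * ?R) *\<^sub>R e)) < ?R / 4" by (simp add: dist_norm norm_minus_commute)
        have ee: "e \<bullet> e = 1" using e by (simp add: norm_eq_1)
        have "(x - z) \<bullet> e = (x - (z + (3 / 4 * ?R) *\<^sub>R e)) \<bullet> e + 3 / 4 * ?R"
          by (simp add: inner_diff_left inner_add_left ee)
        moreover have "\<bar>(x - (z + (3 / 4 * ?R) *\<^sub>R e)) \<bullet> e\<bar> < ?R / 4"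
          using Cauchy_Schwarz_ineq2[of "x - (z + (3 / 4 * ?R) *\<^sub>R e)" e] e n by simp
        ultimately have "0 < (x - z) \<bullet> e" "(x - z) \<bullet> e < ?R" using R0 by linarith+
        then show "x \<in> \<Omega>" by (rule sub)
      qed
      have "(\<integral>\<^sup>+x. F z e x \<partial>lborel) \<le> ennreal K1 * energy \<Omega> p u + ennreal (K2 * \<bar>mean ?A u - m\<bar> powr p)"
        unfolding F_def K1_def K2_def c_def 
        by (rule half_interval_hardy[OF d e R0 p _ _ C(2) sub]) measurable
      also have "\<dots> = ennreal K1 * energy \<Omega> p u + ennreal K2 * ennreal (\<bar>mean ?A u - m\<bar> powr p)"
        using K by (simp add: ennreal_mult)
      also have "ennreal (\<bar>mean ?A u - m\<bar> powr p) \<le> ennreal K3 * (\<integral>\<^sup>+y. indicator ?A y * energy_density \<Omega> p u y \<partial>lborel)"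
        unfolding m_def K3_def
      proof (rule mean_diff_powr_le_energy)
        show "emeasure lborel ?A = ennreal (?w * (?R / 4))" using R0 d by (subst emeasure_ball) auto
        show "dist x y \<le> hi - lo" if "y \<in> ?A" "x \<in> \<Omega>" for x y
        proof -
          have "y \<in> \<Omega>" using that(1) by (rule subsetD[OF As])
          then have "lo < y \<bullet> b" "y \<bullet> b < hi" "lo < x \<bullet> b" "x \<bullet> b < hi" using that(2) \<Omega>iff by blast+
          then show ?thesis unfolding dist by linarith
        qed
      qed (use As V Vpos R0 w lohi C p in auto)
      also have "(\<integral>\<^sup>+y. indicator ?A y * energy_density \<Omega> p u y \<partial>lborel) \<le> energy \<Omega> p u"
        unfolding energy_eq_density by (intro nn_integral_mono) (simp add: indicator_def)
      also have "ennreal K1 * energy \<Omega> p u + ennreal K2 * (ennreal K3 * energy \<Omega> p u) = ennreal (K1 + K2 * K3) * energy \<Omega> p u"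
        using K K3 by (simp add: ennreal_mult distrib_right mult.assoc)
      finally show ?thesis by (simp add: mult_left_mono)
    qed
    have "(\<integral>\<^sup>+x. hardy_density \<Omega> p (\<lambda>x. ln (2 * ?R / bdist \<Omega> x)) u m x \<partial>lborel) \<le> (\<integral>\<^sup>+x. F zl b x + F zh (- b) x \<partial>lborel)"
    proof (rule nn_integral_mono_AE)
      define mid where "mid = ((lo + hi) / 2) *\<^sub>R b"
      show "AE x in lborel. hardy_density \<Omega> p (\<lambda>x. ln (2 * ?R / bdist \<Omega> x)) u m x \<le> F zl b x + F zh (- b) x"
      proof (rule AE_mp[OF AE_lborel_singleton[of mid]], rule AE_I2, rule impI)
        fix x assume "x \<noteq> mid"
        have ne: "2 * (x \<bullet> b) \<noteq> lo + hi"
        proof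
          assume "2 * (x \<bullet> b) = lo + hi"
          then have h: "x \<bullet> b = (lo + hi) / 2" by simp
          have "x = (x \<bullet> b) *\<^sub>R b" by (rule rep)
          also have "\<dots> = mid" unfolding mid_def h by (rule refl)
          finally show False using \<open>x \<noteq> mid\<close> by contradiction
        qed
        show "hardy_density \<Omega> p (\<lambda>x. ln (2 * ?R / bdist \<Omega> x)) u m x \<le> F zl b x + F zh (- b) x"
        proof (cases "x \<in> \<Omega>")
          case True
          then have xb: "lo < x \<bullet> b" "x \<bullet> b < hi" using \<Omega>iff by auto
          have t: "(x - zl) \<bullet> b = x \<bullet> b - lo" "(x - zh) \<bullet> (- b) = hi - x \<bullet> b"
            by (simp_all only: inner_diff_left inner_minus_right zb minus_diff_eq)
          consider "2 * (x \<bullet> b) < lo + hi" | "lo + hi < 2 * (x \<bullet> b)" using ne by (rule linorder_neqE)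
          then show ?thesis
          proof cases
            case 1
            then have le: "x \<bullet> b - lo \<le> hi - x \<bullet> b" "2 * (x \<bullet> b - lo) < 2 * ?R"
              unfolding R2 by (simp_all add: algebra_simps)
            then have B: "bdist \<Omega> x = (x - zl) \<bullet> b" "0 < (x - zl) \<bullet> b" "(x - zl) \<bullet> b < ?R"
              unfolding bd[OF True] t using xb by (simp_all only: min_absorb1 mult_less_cancel_left_pos zero_less_numeral diff_gt_0_iff_gt)
            have "hardy_density \<Omega> p (\<lambda>x. ln (2 * ?R / bdist \<Omega> x)) u m x = F zl b x"
              unfolding hardy_density_def F_def d B(1) power_one_right using True B(2,3) by (simp only: indicator_simps if_True mult_1 simp_thms)
            then show ?thesis by simp
          next
            case 2
            then have le: "hi - x \<bullet> b \<le> x \<bullet> b - lo" "2 * (hi - x \<bullet> b) < 2 * ?R"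
              unfolding R2 by (simp_all add: algebra_simps)
            then have B: "bdist \<Omega> x = (x - zh) \<bullet> (- b)" "0 < (x - zh) \<bullet> (- b)" "(x - zh) \<bullet> (- b) < ?R"
              unfolding bd[OF True] t using xb by (simp_all only: min_absorb2 mult_less_cancel_left_pos zero_less_numeral diff_gt_0_iff_gt)
            have "hardy_density \<Omega> p (\<lambda>x. ln (2 * ?R / bdist \<Omega> x)) u m x = F zh (- b) x"
              unfolding hardy_density_def F_def d B(1) power_one_right using True B(2,3) by (simp only: indicator_simps if_True mult_1 simp_thms)
            then show ?thesis by simp
          qed
        qed (simp add: hardy_density_def)
      qed
    qed
    also have "\<dots> = (\<integral>\<^sup>+x. F zl b x \<partial>lborel) + (\<integral>\<^sup>+x. F zh (- b) x \<partial>lborel)"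
      by (rule nn_integral_add) measurable
    also have "\<dots> \<le> ennreal (K1 + K2 * K3) * energy \<Omega> p u + ennreal (K1 + K2 * K3) * energy \<Omega> p u"
    proof (intro add_mono half)
      show "x \<in> \<Omega>" if "0 < (x - zl) \<bullet> b" "(x - zl) \<bullet> b < ?R" for x
      proof -
        have t: "(x - zl) \<bullet> b = x \<bullet> b - lo" by (simp only: inner_diff_left zb)
        have "lo < \<xi> \<and> \<xi> < hi" if "0 < \<xi> - lo" "\<xi> - lo < ?R" for \<xi> using that R2 lohi by linarith
        then show ?thesis using that unfolding \<Omega>iff t by blast
      qed
      show "x \<in> \<Omega>" if "0 < (x - zh) \<bullet> - b" "(x - zh) \<bullet> - b < ?R" for x
      proof -
        have t: "(x - zh) \<bullet> - b = hi - x \<bullet> b" by (simp only: inner_diff_left inner_minus_right zb minus_diff_eq)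
        have "lo < \<xi> \<and> \<xi> < hi" if "0 < hi - \<xi>" "hi - \<xi> < ?R" for \<xi> using that R2 lohi by linarith
        then show ?thesis using that unfolding \<Omega>iff t by blast
      qed
    qed (use nb in auto)
    also have "\<dots> = ennreal H * energy \<Omega> p u"
    proof -
      have "ennreal x * X + ennreal x * X = ennreal (2 * x) * X" if "0 \<le> x" for x and X :: ennreal
        using that by (simp only: mult_2 ennreal_plus[OF that that] distrib_right)
      from this[OF add_nonneg_nonneg[OF K(1) mult_nonneg_nonneg[OF K(2) K3]]]
      show ?thesis unfolding H_def .
    qed
    finally show "(\<integral>\<^sup>+x. hardy_density \<Omega> p (\<lambda>x. ln (2 * ?R / bdist \<Omega> x)) u (mean \<Omega> u) x \<partial>lborel) \<le> ennreal H * energy \<Omega> p u"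
      unfolding m_def .
  qed
qed

section \<open>Approximation by test functions\<close>

lemma energy_cong_AE:
  assumes "AE x in lborel. x \<in> \<Omega> \<longrightarrow> u x = v x"
  shows "energy \<Omega> p u = energy \<Omega> p v"
  unfolding energy_def
proof (rule nn_integral_cong_AE, use assms in eventually_elim)
  fix y assume y: "y \<in> \<Omega> \<longrightarrow> u y = v y"
  show "(\<integral>\<^sup>+x. ennreal (\<bar>u x - u y\<bar> powr p / dist x y ^ (2 * DIM('a))) * indicator \<Omega> x \<partial>lborel) * indicator \<Omega> y =
    (\<integral>\<^sup>+x. ennreal (\<bar>v x - v y\<bar> powr p / dist x y ^ (2 * DIM('a))) * indicator \<Omega> x \<partial>lborel) * indicator \<Omega> y"
  proof (cases "y \<in> \<Omega>")
    case True
    have "(\<integral>\<^sup>+x. ennreal (\<bar>u x - u y\<bar> powr p / dist x y ^ (2 * DIM('a))) * indicator \<Omega> x \<partial>lborel) =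
      (\<integral>\<^sup>+x. ennreal (\<bar>v x - v y\<bar> powr p / dist x y ^ (2 * DIM('a))) * indicator \<Omega> x \<partial>lborel)"
      by (rule nn_integral_cong_AE, use assms in eventually_elim) (use y True in \<open>auto split: split_indicator\<close>)
    then show ?thesis by simp
  qed simp
qed

lemma energy_add_le:
  fixes u v :: "'a::euclidean_space \<Rightarrow> real"
  assumes [measurable]: "u \<in> borel_measurable borel" "v \<in> borel_measurable borel" "\<Omega> \<in> sets borel" and p: "0 \<le> p"
  shows "energy \<Omega> p (\<lambda>x. u x + v x) \<le> ennreal (2 powr p) * (energy \<Omega> p u + energy \<Omega> p v)"
proof -
  let ?k = "\<lambda>w x y. ennreal (\<bar>w x - w y\<bar> powr p / dist x y ^ (2 * DIM('a))) * indicator \<Omega> x"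
  have pt: "?k (\<lambda>x. u x + v x) x y \<le> ennreal (2 powr p) * (?k u x y + ?k v x y)" for x y
  proof -
    have "\<bar>u x + v x - (u y + v y)\<bar> powr p \<le> (\<bar>u x - u y\<bar> + \<bar>v x - v y\<bar>) powr p" using p by (intro powr_mono2) auto
    also have "\<dots> \<le> 2 powr p * (\<bar>u x - u y\<bar> powr p + \<bar>v x - v y\<bar> powr p)" using p by (intro powr_add_le) auto
    finally have "\<bar>u x + v x - (u y + v y)\<bar> powr p / dist x y ^ (2 * DIM('a)) \<le> 2 powr p * (\<bar>u x - u y\<bar> powr p + \<bar>v x - v y\<bar> powr p) / dist x y ^ (2 * DIM('a))"
      by (intro divide_right_mono) auto
    also have "\<dots> = 2 powr p * (\<bar>u x - u y\<bar> powr p / dist x y ^ (2 * DIM('a)) + \<bar>v x - v y\<bar> powr p / dist x y ^ (2 * DIM('a)))"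
      by (simp only: distrib_left add_divide_distrib times_divide_eq_right)
    finally have "ennreal (\<bar>u x + v x - (u y + v y)\<bar> powr p / dist x y ^ (2 * DIM('a))) \<le> ennreal (2 powr p * (\<bar>u x - u y\<bar> powr p / dist x y ^ (2 * DIM('a)) + \<bar>v x - v y\<bar> powr p / dist x y ^ (2 * DIM('a))))"
      by (rule ennreal_leI)
    also have "\<dots> = ennreal (2 powr p) * (ennreal (\<bar>u x - u y\<bar> powr p / dist x y ^ (2 * DIM('a))) + ennreal (\<bar>v x - v y\<bar> powr p / dist x y ^ (2 * DIM('a))))"
      by (subst ennreal_mult) auto
    finally show ?thesis by (simp split: split_indicator)
  qed
  have "energy \<Omega> p (\<lambda>x. u x + v x) \<le> (\<integral>\<^sup>+y. (\<integral>\<^sup>+x. ennreal (2 powr p) * (?k u x y + ?k v x y) \<partial>lborel) * indicator \<Omega> y \<partial>lborel)"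
    unfolding energy_def by (intro nn_integral_mono mult_right_mono pt) auto
  also have "\<dots> = (\<integral>\<^sup>+y. ennreal (2 powr p) * ((\<integral>\<^sup>+x. ?k u x y \<partial>lborel) * indicator \<Omega> y + (\<integral>\<^sup>+x. ?k v x y \<partial>lborel) * indicator \<Omega> y) \<partial>lborel)"
    by (intro nn_integral_cong) (simp add: nn_integral_cmult nn_integral_add distrib_right mult.assoc)
  also have "\<dots> = ennreal (2 powr p) * (energy \<Omega> p u + energy \<Omega> p v)"
    unfolding energy_def by (simp add: nn_integral_cmult nn_integral_add)
  finally show ?thesis .
qed

text \<open>
  Members of the function space are only Lebesgue measurable, whereas Fubini's theorem is applied
  for \<^const>\<open>lborel\<close>.
\<close>

lemma borel_representative:
  fixes u :: "'a::euclidean_space \<Rightarrow> real"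
  assumes u: "u \<in> borel_measurable (lebesgue_on \<Omega>)" and \<Omega>: "\<Omega> \<in> sets borel"
  obtains v where "v \<in> borel_measurable borel" "AE x in lborel. x \<in> \<Omega> \<longrightarrow> u x = v x"
proof -
  have "(\<lambda>x. indicator \<Omega> x *\<^sub>R u x) \<in> borel_measurable lebesgue"
    using u \<Omega> by (subst (asm) borel_measurable_restrict_space_iff) auto
  from completion_ex_borel_measurable_real[OF this]
  obtain v where "v \<in> borel_measurable lborel" "AE x in lborel. indicator \<Omega> x *\<^sub>R u x = v x" by blast
  then show ?thesis
    by (intro that[of v]) (auto elim!: eventually_mono split: split_indicator_asm)
qed

lemma AE_lebesgue_onI:
  assumes \<Omega>: "\<Omega> \<in> sets borel" and P: "AE x in lborel. x \<in> \<Omega> \<longrightarrow> P x"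
  shows "AE x in lebesgue_on \<Omega>. P x"
  using assms by (subst AE_restrict_space_iff) (auto intro!: AE_completion)

lemma average_eq_lborel:
  fixes u v :: "'a::euclidean_space \<Rightarrow> real"
  assumes \<Omega> [measurable]: "\<Omega> \<in> sets borel" and u: "u \<in> borel_measurable (lebesgue_on \<Omega>)" and v [measurable]: "v \<in> borel_measurable borel"
    and AE: "AE x in lborel. x \<in> \<Omega> \<longrightarrow> u x = v x"
  shows "average \<Omega> u = mean \<Omega> v"
proof -
  have "(LINT y|lebesgue_on \<Omega>. u y) = (LINT y|lebesgue_on \<Omega>. v y)"
    using u by (intro integral_cong_AE AE_lebesgue_onI[OF \<Omega> AE]) (auto intro!: measurable_restrict_space1 measurable_completion)
  also have "\<dots> = (LINT y|lebesgue. indicator \<Omega> y *\<^sub>R v y)"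
    using \<Omega> by (subst integral_restrict_space) auto
  also have "\<dots> = (LINT y|lborel. indicator \<Omega> y *\<^sub>R v y)"
    by (rule integral_completion) measurable
  finally show ?thesis
    using \<Omega> by (simp add: average_def mean_def measure_completion)
qed

text \<open>
  The averages converge because \<open>\<Omega>\<close> has finite measure, so that convergence in \<open>L^p\<close> implies convergence
  in \<open>L^1\<close>; almost everywhere convergence holds along a subsequence.  The energies stay bounded by the
  quasi-triangle inequality.
\<close>

lemma wsp0_approximation:
  fixes \<Omega> :: "'a::euclidean_space set" and s p :: real
  assumes op: "open \<Omega>" "bounded \<Omega>" and p: "1 < p" "s * p = real DIM('a)"
    and u: "u \<in> wsp0 \<Omega> s p" and g: "gagliardo \<Omega> s p u \<le> 1"
  obtains \<psi> where "\<And>n. \<psi> n \<in> test_functions \<Omega>" "\<And>n. energy \<Omega> p (\<psi> n) \<le> ennreal (2 powr p * 2)"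
    "AE x in lborel. x \<in> \<Omega> \<longrightarrow> (\<lambda>n. \<psi> n x) \<longlonglongrightarrow> u x"
    "(\<lambda>n. average \<Omega> (\<psi> n)) \<longlonglongrightarrow> average \<Omega> u"
proof -
  have \<Omega> [measurable]: "\<Omega> \<in> sets borel" using op by simp
  have um: "u \<in> borel_measurable (lebesgue_on \<Omega>)" using u by (simp add: wsp0_def wsp_def)
  obtain v where v [measurable]: "v \<in> borel_measurable borel" and uv: "AE x in lborel. x \<in> \<Omega> \<longrightarrow> u x = v x"
    using borel_representative[OF um \<Omega>] by blast
  obtain \<phi> where \<phi>: "\<And>n. \<phi> n \<in> test_functions \<Omega>" "(\<lambda>n. wsp_norm \<Omega> s p (\<lambda>x. \<phi> n x - u x)) \<longlonglongrightarrow> 0"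
    using u unfolding wsp0_def by blast
  have \<phi>m: "\<phi> n \<in> borel_measurable borel" for n by (rule test_function_measurable[OF \<phi>(1)])
  define w where "w n x = \<phi> n x - v x" for n x
  have wm [measurable]: "w n \<in> borel_measurable borel" for n unfolding w_def using \<phi>m[of n] by measurable
  have wu: "AE x in lborel. x \<in> \<Omega> \<longrightarrow> \<phi> n x - u x = w n x" for n
    using uv by (auto elim!: eventually_mono simp: w_def)
  have norm_eq: "wsp_norm \<Omega> s p (\<lambda>x. \<phi> n x - u x) = ennpowr (energy \<Omega> p (w n) + (\<integral>\<^sup>+x. indicator \<Omega> x * ennreal (\<bar>w n x\<bar> powr p) \<partial>lborel)) (1 / p)" for n
  proof -
    have "(\<integral>\<^sup>+x. ennreal (\<bar>\<phi> n x - u x\<bar> powr p) \<partial>lebesgue_on \<Omega>) = (\<integral>\<^sup>+x. indicator \<Omega> x * ennreal (\<bar>w n x\<bar> powr p) \<partial>lborel)"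
      unfolding nn_integral_lebesgue_on[OF \<Omega>]
      by (rule nn_integral_cong_AE, use wu[of n] in eventually_elim) (auto split: split_indicator)
    then show ?thesis
      using p unfolding wsp_norm_def lp_norm_def gagliardo_eq_energy[OF \<Omega> p(2)] energy_cong_AE[OF wu[of n]]
      by (simp add: ennpowr_ennpowr)
  qed
  have "\<exists>n. energy \<Omega> p (w n) + (\<integral>\<^sup>+x. indicator \<Omega> x * ennreal (\<bar>w n x\<bar> powr p) \<partial>lborel) \<le> ennreal (1 / (real k + 1))" for k
  proof -
    define \<epsilon> where "\<epsilon> = (1 / (real k + 1)) powr (1 / p)"
    have \<epsilon>: "0 < \<epsilon>" by (simp add: \<epsilon>_def)
    have "eventually (\<lambda>n. wsp_norm \<Omega> s p (\<lambda>x. \<phi> n x - u x) < ennreal \<epsilon>) sequentially"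
      using \<phi>(2) \<epsilon> by (intro order_tendstoD(2)) auto
    then obtain n where "wsp_norm \<Omega> s p (\<lambda>x. \<phi> n x - u x) < ennreal \<epsilon>"
      using eventually_happens'[OF sequentially_bot] by blast
    then have "energy \<Omega> p (w n) + (\<integral>\<^sup>+x. indicator \<Omega> x * ennreal (\<bar>w n x\<bar> powr p) \<partial>lborel) \<le> ennreal (\<epsilon> powr p)"
      unfolding norm_eq using p \<epsilon> by (intro ennpowr_inverse_le_iff[THEN iffD1]) auto
    also have "\<epsilon> powr p = 1 / (real k + 1)" using p by (simp add: \<epsilon>_def powr_powr)
    finally show ?thesis by blast
  qed
  then obtain N where N: "\<And>k. energy \<Omega> p (w (N k)) + (\<integral>\<^sup>+x. indicator \<Omega> x * ennreal (\<bar>w (N k) x\<bar> powr p) \<partial>lborel) \<le> ennreal (1 / (real k + 1))"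
    by metis
  have NE: "energy \<Omega> p (w (N k)) \<le> 1" for k
  proof -
    have "energy \<Omega> p (w (N k)) \<le> ennreal (1 / (real k + 1))" using N[of k] by (rule order_trans[rotated]) simp
    also have "\<dots> \<le> ennreal 1" by (intro ennreal_leI) simp
    finally show ?thesis by simp
  qed
  have NL: "(\<integral>\<^sup>+x. indicator \<Omega> x * ennreal (\<bar>w (N k) x\<bar> powr p) \<partial>lborel) \<le> ennreal (1 / (real k + 1))" for k
    using N[of k] by (rule order_trans[rotated]) simp
  have Ev: "energy \<Omega> p v \<le> 1"
  proof -
    have "energy \<Omega> p u \<le> ennreal (1 powr p)" using g gagliardo_le_iff_energy[OF \<Omega> p(2), of 1 u] p by simp
    then show ?thesis using energy_cong_AE[OF uv, of p] by simp
  qed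
  have E\<phi>: "energy \<Omega> p (\<phi> (N k)) \<le> ennreal (2 powr p * 2)" for k
  proof -
    have "energy \<Omega> p (\<phi> (N k)) = energy \<Omega> p (\<lambda>x. w (N k) x + v x)" by (simp add: w_def)
    also have "\<dots> \<le> ennreal (2 powr p) * (energy \<Omega> p (w (N k)) + energy \<Omega> p v)" using p by (intro energy_add_le) auto
    also have "\<dots> \<le> ennreal (2 powr p) * (1 + 1)" by (intro mult_left_mono add_mono NE Ev) auto
    also have "\<dots> = ennreal (2 powr p * 2)" by (simp add: ennreal_mult)
    finally show ?thesis .
  qed
  define h where "h k x = indicator \<Omega> x * \<bar>w (N k) x\<bar> powr p" for k x
  have h_nn: "(\<integral>\<^sup>+x. ennreal (norm (h k x)) \<partial>lborel) = (\<integral>\<^sup>+x. indicator \<Omega> x * ennreal (\<bar>w (N k) x\<bar> powr p) \<partial>lborel)" for k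
    by (intro nn_integral_cong) (auto simp: h_def split: split_indicator)
  have h_int: "integrable lborel (h k)" for k
  proof (rule integrableI_bounded)
    show "(\<integral>\<^sup>+x. ennreal (norm (h k x)) \<partial>lborel) < \<infinity>"
      unfolding h_nn by (rule le_less_trans[OF NL]) simp
  qed (simp add: h_def[abs_def])
  have h_lim: "(\<lambda>k. \<integral>x. norm (h k x) \<partial>lborel) \<longlonglongrightarrow> 0"
  proof (rule tendsto_sandwich[OF _ _ tendsto_const])
    show "eventually (\<lambda>k. 0 \<le> (\<integral>x. norm (h k x) \<partial>lborel)) sequentially" by simp
    show "eventually (\<lambda>k. (\<integral>x. norm (h k x) \<partial>lborel) \<le> 1 / (real k + 1)) sequentially"
    proof (intro always_eventually allI)
      fix k
      have "(\<integral>x. norm (h k x) \<partial>lborel) = enn2real (\<integral>\<^sup>+x. ennreal (norm (h k x)) \<partial>lborel)"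
        by (intro integral_eq_nn_integral) (auto simp: h_def)
      also have "\<dots> \<le> 1 / (real k + 1)" unfolding h_nn by (rule enn2real_leI[OF _ NL]) simp
      finally show "(\<integral>x. norm (h k x) \<partial>lborel) \<le> 1 / (real k + 1)" .
    qed
    show "(\<lambda>k. 1 / (real k + 1)) \<longlonglongrightarrow> 0"
      using LIMSEQ_inverse_real_of_nat by (simp add: inverse_eq_divide add.commute)
  qed
  obtain r where r: "strict_mono r" "AE x in lborel. (\<lambda>n. h (r n) x) \<longlonglongrightarrow> 0"
    using tendsto_L1_AE_subseq[OF h_int h_lim] by blast
  define \<psi> where "\<psi> n = \<phi> (N (r n))" for n
  have vol: "emeasure lborel \<Omega> < \<infinity>" by (rule emeasure_bounded_less_top[OF op(2)])
  have wint: "integrable lborel (\<lambda>x. indicator \<Omega> x * f x)"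
    if [measurable]: "f \<in> borel_measurable borel" and fin: "(\<integral>\<^sup>+x. indicator \<Omega> x * ennreal (\<bar>f x\<bar> powr p) \<partial>lborel) < \<infinity>" for f :: "'a \<Rightarrow> real"
  proof (rule integrableI_bounded)
    have "(\<integral>\<^sup>+x. ennreal (norm (indicator \<Omega> x * f x)) \<partial>lborel) \<le> (\<integral>\<^sup>+x. indicator \<Omega> x + indicator \<Omega> x * ennreal (\<bar>f x\<bar> powr p) \<partial>lborel)"
    proof (rule nn_integral_mono)
      fix x
      have "\<bar>f x\<bar> \<le> 1 + \<bar>f x\<bar> powr p"
      proof (cases "\<bar>f x\<bar> \<le> 1")
        case False
        then have "\<bar>f x\<bar> powr 1 \<le> \<bar>f x\<bar> powr p" using p by (intro powr_mono) auto
        then show ?thesis by simp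
      qed (simp add: add_increasing2)
      then have "ennreal \<bar>f x\<bar> \<le> ennreal (1 + \<bar>f x\<bar> powr p)" by (rule ennreal_leI)
      also have "\<dots> = 1 + ennreal (\<bar>f x\<bar> powr p)" by (simp add: ennreal_plus)
      finally show "ennreal (norm (indicator \<Omega> x * f x)) \<le> indicator \<Omega> x + indicator \<Omega> x * ennreal (\<bar>f x\<bar> powr p)"
        by (auto split: split_indicator)
    qed
    also have "\<dots> = emeasure lborel \<Omega> + (\<integral>\<^sup>+x. indicator \<Omega> x * ennreal (\<bar>f x\<bar> powr p) \<partial>lborel)"
      by (subst nn_integral_add) auto
    also have "\<dots> < \<infinity>" using vol fin by simp
    finally show "(\<integral>\<^sup>+x. ennreal (norm (indicator \<Omega> x * f x)) \<partial>lborel) < \<infinity>" .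
  qed measurable
  have intv: "integrable lborel (\<lambda>x. indicator \<Omega> x * v x)"
  proof (rule wint[OF v])
    have "lp_norm \<Omega> p u < \<infinity>" using u by (simp add: wsp0_def wsp_def)
    then have "(\<integral>\<^sup>+x. ennreal (\<bar>u x\<bar> powr p) \<partial>lebesgue_on \<Omega>) < \<infinity>" unfolding lp_norm_def ennpowr_less_top_iff .
    also have "(\<integral>\<^sup>+x. ennreal (\<bar>u x\<bar> powr p) \<partial>lebesgue_on \<Omega>) = (\<integral>\<^sup>+x. indicator \<Omega> x * ennreal (\<bar>v x\<bar> powr p) \<partial>lborel)"
      unfolding nn_integral_lebesgue_on[OF \<Omega>]
      by (rule nn_integral_cong_AE, use uv in eventually_elim) (auto split: split_indicator)
    finally show "(\<integral>\<^sup>+x. indicator \<Omega> x * ennreal (\<bar>v x\<bar> powr p) \<partial>lborel) < \<infinity>" .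
  qed
  have intw: "integrable lborel (\<lambda>x. indicator \<Omega> x * w (N k) x)" for k
    by (rule wint[OF wm]) (rule le_less_trans[OF NL], simp)
  obtain V where V: "emeasure lborel \<Omega> = ennreal V" "0 \<le> V" using vol by (cases "emeasure lborel \<Omega>") auto
  have small: "\<bar>LINT x|lborel. indicator \<Omega> x * w (N k) x\<bar> \<le> ((V + 1) powr (p - 1) * (1 / (real k + 1))) powr (1 / p)" for k
  proof -
    have "ennreal \<bar>LINT x|lborel. indicator \<Omega> x * w (N k) x\<bar> \<le> (\<integral>\<^sup>+x. ennreal (norm (indicator \<Omega> x * w (N k) x)) \<partial>lborel)"
      using integral_norm_bound_ennreal[OF intw[of k]] by simp
    also have "\<dots> = (\<integral>\<^sup>+x. indicator \<Omega> x * ennreal \<bar>w (N k) x\<bar> \<partial>lborel)"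
      by (intro nn_integral_cong) (auto split: split_indicator)
    finally have "ennpowr (ennreal \<bar>LINT x|lborel. indicator \<Omega> x * w (N k) x\<bar>) p \<le> ennpowr (\<integral>\<^sup>+x. indicator \<Omega> x * ennreal \<bar>w (N k) x\<bar> \<partial>lborel) p"
      using p by (intro ennpowr_mono) auto
    also have "\<dots> \<le> ennreal ((V + 1) powr (p - 1)) * (\<integral>\<^sup>+x. indicator \<Omega> x * ennpowr (ennreal \<bar>w (N k) x\<bar>) p \<partial>lborel)"
    proof (rule jensen_ennpowr_weighted)
      show "(\<integral>\<^sup>+x. indicator \<Omega> x \<partial>lborel) \<le> ennreal (V + 1)" using V by (simp add: ennreal_leI)
    qed (use V p in auto)
    also have "\<dots> \<le> ennreal ((V + 1) powr (p - 1)) * ennreal (1 / (real k + 1))"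
      using NL[of k] by (intro mult_left_mono) (auto simp: ennpowr_ennreal)
    also have "\<dots> = ennreal ((V + 1) powr (p - 1) * (1 / (real k + 1)))" by (rule ennreal_mult[symmetric]) auto
    finally have "\<bar>LINT x|lborel. indicator \<Omega> x * w (N k) x\<bar> powr p \<le> (V + 1) powr (p - 1) * (1 / (real k + 1))"
      by (simp add: ennpowr_ennreal)
    then have "(\<bar>LINT x|lborel. indicator \<Omega> x * w (N k) x\<bar> powr p) powr (1 / p) \<le> ((V + 1) powr (p - 1) * (1 / (real k + 1))) powr (1 / p)"
      using p by (intro powr_mono2) auto
    then show ?thesis using p by (simp add: powr_powr)
  qed
  have lim0: "(\<lambda>k. LINT x|lborel. indicator \<Omega> x * w (N k) x) \<longlonglongrightarrow> 0"
  proof (rule Lim_null_comparison)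
    show "eventually (\<lambda>k. norm (LINT x|lborel. indicator \<Omega> x * w (N k) x) \<le> ((V + 1) powr (p - 1) * (1 / (real k + 1))) powr (1 / p)) sequentially"
      using small by simp
    have "(\<lambda>k. (V + 1) powr (p - 1) * (1 / (real k + 1))) \<longlonglongrightarrow> (V + 1) powr (p - 1) * 0"
      using LIMSEQ_inverse_real_of_nat by (intro tendsto_mult tendsto_const) (simp add: inverse_eq_divide add.commute)
    then have "(\<lambda>k. ((V + 1) powr (p - 1) * (1 / (real k + 1))) powr (1 / p)) \<longlonglongrightarrow> 0 powr (1 / p)"
      using p by (intro tendsto_powr') auto
    then show "(\<lambda>k. ((V + 1) powr (p - 1) * (1 / (real k + 1))) powr (1 / p)) \<longlonglongrightarrow> 0" by simp
  qed
  show ?thesis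
  proof (rule that[of \<psi>])
    show "\<psi> n \<in> test_functions \<Omega>" for n unfolding \<psi>_def by (rule \<phi>)
    show "energy \<Omega> p (\<psi> n) \<le> ennreal (2 powr p * 2)" for n unfolding \<psi>_def by (rule E\<phi>)
    show "AE x in lborel. x \<in> \<Omega> \<longrightarrow> (\<lambda>n. \<psi> n x) \<longlonglongrightarrow> u x"
      using r(2) uv
    proof eventually_elim
      case (elim x)
      show ?case
      proof
        assume x: "x \<in> \<Omega>"
        have "(\<lambda>n. \<bar>w (N (r n)) x\<bar> powr p) \<longlonglongrightarrow> 0" using elim(1) x by (simp add: h_def)
        then have "(\<lambda>n. (\<bar>w (N (r n)) x\<bar> powr p) powr (1 / p)) \<longlonglongrightarrow> 0 powr (1 / p)"
          using p by (intro tendsto_powr') auto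
        then have "(\<lambda>n. \<bar>w (N (r n)) x\<bar>) \<longlonglongrightarrow> 0" using p by (simp add: powr_powr)
        then have "(\<lambda>n. w (N (r n)) x) \<longlonglongrightarrow> 0" by (simp add: tendsto_rabs_zero_iff)
        then have "(\<lambda>n. w (N (r n)) x + v x) \<longlonglongrightarrow> 0 + v x" by (intro tendsto_intros)
        then show "(\<lambda>n. \<psi> n x) \<longlonglongrightarrow> u x" using elim(2) x by (simp add: w_def \<psi>_def)
      qed
    qed
    have avg: "average \<Omega> (\<phi> (N k)) = average \<Omega> u + (LINT x|lborel. indicator \<Omega> x * w (N k) x) / measure lborel \<Omega>" for k
    proof -
      have "average \<Omega> (\<phi> (N k)) = mean \<Omega> (\<phi> (N k))"
        using \<phi>m[of "N k"] by (intro average_eq_lborel[OF \<Omega>]) (auto intro!: measurable_restrict_space1 measurable_completion)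
      also have "(\<lambda>x. indicator \<Omega> x * \<phi> (N k) x) = (\<lambda>x. indicator \<Omega> x * v x + indicator \<Omega> x * w (N k) x)"
        by (auto simp: w_def distrib_left[symmetric])
      then have "mean \<Omega> (\<phi> (N k)) = mean \<Omega> v + (LINT x|lborel. indicator \<Omega> x * w (N k) x) / measure lborel \<Omega>"
        unfolding mean_def using intv intw[of k] by (simp add: add_divide_distrib)
      also have "mean \<Omega> v = average \<Omega> u" by (rule average_eq_lborel[OF \<Omega> um v uv, symmetric])
      finally show ?thesis .
    qed
    have "(\<lambda>k. average \<Omega> u + (LINT x|lborel. indicator \<Omega> x * w (N k) x) / measure lborel \<Omega>) \<longlonglongrightarrow> average \<Omega> u + 0 / measure lborel \<Omega>"
      using lim0 by (intro tendsto_add tendsto_const) (simp add: divide_inverse tendsto_mult_left_zero)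
    then have "(\<lambda>k. average \<Omega> (\<phi> (N k))) \<longlonglongrightarrow> average \<Omega> u" by (simp add: avg)
    then show "(\<lambda>n. average \<Omega> (\<psi> n)) \<longlonglongrightarrow> average \<Omega> u"
      using LIMSEQ_subseq_LIMSEQ[OF _ r(1)] by (fastforce simp: \<psi>_def o_def)
  qed
qed

section \<open>Boundedness for small exponents\<close>

text \<open>
  With this weight and the centre below, both cases of \<^const>\<open>mt_X\<close> have the form
  \<open>\<bar>u x - m\<bar> / l x\<close>.
\<close>

definition mt_weight :: "'a::euclidean_space set \<Rightarrow> 'a \<Rightarrow> real" where
  "mt_weight \<Omega> x = (if DIM('a) = 1 then ln (2 * inradius \<Omega> / bdist \<Omega> x) else 1)"

definition mt_centre :: "'a::euclidean_space set \<Rightarrow> ('a \<Rightarrow> real) \<Rightarrow> real" where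
  "mt_centre \<Omega> u = (if DIM('a) = 1 then average \<Omega> u else 0)"

lemma mt_X_eq: "mt_X \<Omega> u x = \<bar>u x - mt_centre \<Omega> u\<bar> / mt_weight \<Omega> x"
  by (simp add: mt_X_def mt_weight_def mt_centre_def)

lemma borel_measurable_mt_weight [measurable]: "mt_weight \<Omega> \<in> borel_measurable borel"
  unfolding mt_weight_def by measurable

lemma mt_weight_ge:
  assumes dom: "bounded_lipschitz_domain \<Omega>" and x: "x \<in> \<Omega>"
  shows "ln 2 \<le> mt_weight \<Omega> x"
proof -
  have "2 \<le> 2 * inradius \<Omega> / bdist \<Omega> x"
    using bdist_pos[OF dom x] bdist_le_inradius[OF dom x] by (simp add: le_divide_eq)
  then have "ln 2 \<le> ln (2 * inradius \<Omega> / bdist \<Omega> x)" by (intro ln_mono) auto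
  moreover have "ln 2 \<le> (1 :: real)" by (rule less_imp_le[OF ln_2_less_1])
  ultimately show ?thesis by (simp add: mt_weight_def)
qed

text \<open>
  Replacing \<open>x\<close> by \<open>y\<close> changes the logarithm by at most \<open>ln 2\<close>, which is a lower bound for the weight.
\<close>

lemma mt_weight_doubling:
  fixes \<Omega> :: "'a::euclidean_space set"
  assumes dom: "bounded_lipschitz_domain \<Omega>" and x: "x \<in> \<Omega>" and y: "y \<in> \<Omega>" and near: "dist x y < bdist \<Omega> x / 2"
  shows "mt_weight \<Omega> y \<le> 2 * mt_weight \<Omega> x"
proof (cases "DIM('a) = 1")
  case True
  define R where "R = 2 * inradius \<Omega>"
  have R: "0 < R" using inradius_pos[OF dom] by (simp add: R_def)
  have p: "0 < bdist \<Omega> x" "0 < bdist \<Omega> y" using bdist_pos[OF dom] x y by auto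
  have "R / bdist \<Omega> y \<le> 2 * (R / bdist \<Omega> x)"
  proof -
    have "R * bdist \<Omega> x \<le> R * (2 * bdist \<Omega> y)"
      using R bdist_comparable(1)[OF near] by (intro mult_left_mono) auto
    then show ?thesis using p by (simp add: divide_le_eq le_divide_eq ac_simps)
  qed
  then have "ln (R / bdist \<Omega> y) \<le> ln (2 * (R / bdist \<Omega> x))" using R p by (intro ln_mono) auto
  also have "\<dots> = ln 2 + ln (R / bdist \<Omega> x)" using R p by (subst ln_mult_pos) auto
  finally have "mt_weight \<Omega> y \<le> ln 2 + mt_weight \<Omega> x" using True by (simp add: mt_weight_def R_def)
  then show ?thesis using mt_weight_ge[OF dom x] by linarith
qed (simp add: mt_weight_def)

lemma mt_integral_eq_lborel:
  fixes \<Omega> :: "'a::euclidean_space set"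
  assumes "\<Omega> \<in> sets borel"
  shows "mt_integral \<Omega> s n0 \<alpha> u = (\<integral>\<^sup>+x. indicator \<Omega> x *
    ennreal (trunc_exp n0 (\<alpha> * mt_X \<Omega> u x powr (real DIM('a) / (real DIM('a) - s))) / bdist \<Omega> x ^ DIM('a)) \<partial>lborel)"
  unfolding mt_integral_def nn_integral_lebesgue_on[OF assms] by (intro nn_integral_cong mult.commute)

lemma hardy_test_functions:
  fixes \<Omega> :: "'a::euclidean_space set" and p :: real
  assumes dom: "bounded_lipschitz_domain \<Omega>" and p: "1 < p"
  obtains H where "0 \<le> H"
    "\<And>u. u \<in> test_functions \<Omega> \<Longrightarrow>
      (\<integral>\<^sup>+x. hardy_density \<Omega> p (mt_weight \<Omega>) u (mt_centre \<Omega> u) x \<partial>lborel) \<le> ennreal H * energy \<Omega> p u"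
proof (cases "DIM('a) = 1")
  case True
  have \<Omega>: "\<Omega> \<in> sets borel" using dom by (simp add: bounded_lipschitz_domain_def)
  obtain H where H: "0 \<le> H" "\<And>u. u \<in> test_functions \<Omega> \<Longrightarrow>
      (\<integral>\<^sup>+x. hardy_density \<Omega> p (\<lambda>x. ln (2 * inradius \<Omega> / bdist \<Omega> x)) u (mean \<Omega> u) x \<partial>lborel) \<le> ennreal H * energy \<Omega> p u"
    by (rule hardy_dimension_one[OF dom True p], rule that)
  have w: "mt_weight \<Omega> = (\<lambda>x. ln (2 * inradius \<Omega> / bdist \<Omega> x))" using True by (simp add: mt_weight_def fun_eq_iff)
  show ?thesis
  proof (rule that[OF H(1)])
    fix u assume u: "u \<in> test_functions \<Omega>"
    have um: "u \<in> borel_measurable borel" by (rule test_function_measurable[OF u])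
    have "average \<Omega> u = mean \<Omega> u"
      using um by (intro average_eq_lborel \<Omega>) (auto intro!: measurable_restrict_space1 measurable_completion)
    then have c: "mt_centre \<Omega> u = mean \<Omega> u" using True by (simp add: mt_centre_def)
    show "(\<integral>\<^sup>+x. hardy_density \<Omega> p (mt_weight \<Omega>) u (mt_centre \<Omega> u) x \<partial>lborel) \<le> ennreal H * energy \<Omega> p u"
      unfolding c w by (rule H(2)[OF u])
  qed
next
  case False
  then have d: "2 \<le> DIM('a)" using DIM_positive[where 'a='a] by linarith
  obtain H where H: "0 \<le> H" "\<And>u. u \<in> test_functions \<Omega> \<Longrightarrow> (\<integral>\<^sup>+x. indicator \<Omega> x * ennreal (\<bar>u x\<bar> powr p / bdist \<Omega> x ^ DIM('a)) \<partial>lborel)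
      \<le> ennreal H * energy \<Omega> p u"
    using p by (rule_tac hardy_higher_dimension[OF dom d, of p]) (auto intro: that)
  have h: "hardy_density \<Omega> p (mt_weight \<Omega>) u (mt_centre \<Omega> u) x = indicator \<Omega> x * ennreal (\<bar>u x\<bar> powr p / bdist \<Omega> x ^ DIM('a))" for u x
    using False by (simp add: hardy_density_def mt_weight_def mt_centre_def)
  show ?thesis
  proof (rule that[OF H(1)])
    fix u assume u: "u \<in> test_functions \<Omega>"
    show "(\<integral>\<^sup>+x. hardy_density \<Omega> p (mt_weight \<Omega>) u (mt_centre \<Omega> u) x \<partial>lborel) \<le> ennreal H * energy \<Omega> p u"
      unfolding h by (rule H(2)[OF u])
  qed
qed

text \<open>
  The bound depends only on the dimension; \<open>M\<close> enters through \<open>\<alpha>0\<close>.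
\<close>

lemma moser_trudinger_test_functions:
  fixes \<Omega> :: "'a::euclidean_space set" and p s M :: real
  assumes dom: "bounded_lipschitz_domain \<Omega>" and s: "0 < s" and p: "1 < p" and sp: "s * p = real DIM('a)"
    and n0: "p - 1 \<le> real n0" and M: "0 < M"
  obtains \<alpha>0 where "0 < \<alpha>0"
    "\<And>\<alpha> u. 0 \<le> \<alpha> \<Longrightarrow> \<alpha> < \<alpha>0 \<Longrightarrow> u \<in> test_functions \<Omega> \<Longrightarrow> energy \<Omega> p u \<le> ennreal M \<Longrightarrow>
      mt_integral \<Omega> s n0 \<alpha> u \<le> ennreal (2 * kernel_const DIM('a))"
proof -
  have \<Omega> [measurable]: "\<Omega> \<in> sets borel" using dom by (simp add: bounded_lipschitz_domain_def)
  obtain H where H: "0 \<le> H" "\<And>u. u \<in> test_functions \<Omega> \<Longrightarrow>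
      (\<integral>\<^sup>+x. hardy_density \<Omega> p (mt_weight \<Omega>) u (mt_centre \<Omega> u) x \<partial>lborel) \<le> ennreal H * energy \<Omega> p u"
    by (rule hardy_test_functions[OF dom p], rule that)
  define W where "W = weighted_const DIM('a) p (ln 2) 2 * (M + H * M)"
  have W: "0 \<le> W" unfolding W_def using weighted_const_nonneg[OF p] M H(1) by (intro mult_nonneg_nonneg add_nonneg_nonneg) auto
  \<comment> \<open>the factor of \<open>\<alpha>\<close> that has to stay below \<open>1 / 2\<close>; adding \<open>1\<close> to \<open>W\<close> makes the constant positive\<close>
  define b where "b = p / (p - 1) * (W + 1) powr (1 / (p - 1)) * exp 1"
  have b: "0 < b" unfolding b_def using p W by (intro mult_pos_pos) auto
  have K: "0 \<le> kernel_const DIM('a)" by (simp add: kernel_const_def)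
  have q: "real DIM('a) / (real DIM('a) - s) = p / (p - 1)"
  proof -
    have "s * p / (s * p - s) = s * p / (s * (p - 1))" by (simp add: algebra_simps)
    then show ?thesis unfolding sp[symmetric] using s by simp
  qed
  show ?thesis
  proof (rule that[of "1 / (2 * b)"])
    show "0 < 1 / (2 * b)" using b by simp
    fix \<alpha> u assume \<alpha>: "0 \<le> \<alpha>" "\<alpha> < 1 / (2 * b)" and u: "u \<in> test_functions \<Omega>" and E: "energy \<Omega> p u \<le> ennreal M"
    have [measurable]: "u \<in> borel_measurable borel" by (rule test_function_measurable[OF u])
    have cont: "isCont u x" for x
      using test_function_continuous[OF u, of UNIV] by (simp add: continuous_on_eq_continuous_at)
    obtain C where C: "\<And>x. \<bar>u x\<bar> \<le> C" using test_function_bounded[OF u] by blast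
    define X where "X x = indicator \<Omega> x * mt_X \<Omega> u x" for x
    have wpos: "0 < mt_weight \<Omega> x" if "x \<in> \<Omega>" for x
      using mt_weight_ge[OF dom that] by (rule less_le_trans[rotated]) simp
    have Hu: "(\<integral>\<^sup>+x. hardy_density \<Omega> p (mt_weight \<Omega>) u (mt_centre \<Omega> u) x \<partial>lborel) \<le> ennreal (H * M)"
    proof -
      have "ennreal H * energy \<Omega> p u \<le> ennreal H * ennreal M" by (intro mult_left_mono E) simp
      also have "\<dots> = ennreal (H * M)" using H(1) M by (simp add: ennreal_mult)
      finally show ?thesis using H(2)[OF u] by (rule order_trans[rotated])
    qed
    have mom: "(\<integral>\<^sup>+x. indicator \<Omega> x * ennreal (X x powr q / bdist \<Omega> x ^ DIM('a)) \<partial>lborel)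
      \<le> ennreal (((W + 1) * q powr (p - 1)) powr (q / p) * kernel_const DIM('a))" if q: "p \<le> q" for q
    proof -
      have "(\<integral>\<^sup>+x. indicator \<Omega> x * ennreal (X x powr q / bdist \<Omega> x ^ DIM('a)) \<partial>lborel) =
        (\<integral>\<^sup>+x. indicator \<Omega> x * ennreal ((\<bar>u x - mt_centre \<Omega> u\<bar> / mt_weight \<Omega> x) powr q / bdist \<Omega> x ^ DIM('a)) \<partial>lborel)"
        by (intro nn_integral_cong) (simp add: X_def mt_X_eq split: split_indicator)
      also have "\<dots> \<le> ennreal ((W * q powr (p - 1)) powr (q / p) * kernel_const DIM('a))"
        unfolding W_def
      proof (rule weighted_moment_bound[OF _ \<Omega> _ cont C p q _ _ _ _ _ E M Hu])
        show "0 < bdist \<Omega> y" if "y \<in> \<Omega>" for y by (rule bdist_pos[OF dom that])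
        show "ln 2 \<le> mt_weight \<Omega> y" if "y \<in> \<Omega>" for y by (rule mt_weight_ge[OF dom that])
        show "mt_weight \<Omega> y \<le> 2 * mt_weight \<Omega> x" if "x \<in> \<Omega>" "y \<in> \<Omega>" "dist x y < bdist \<Omega> x / 2" for x y
          by (rule mt_weight_doubling[OF dom that])
        show "0 \<le> H * M" using H(1) M by simp
      qed simp_all
      also have "\<dots> \<le> ennreal (((W + 1) * q powr (p - 1)) powr (q / p) * kernel_const DIM('a))"
        using W K p q by (intro ennreal_leI mult_right_mono powr_mono2) auto
      finally show ?thesis .
    qed
    have "(\<integral>\<^sup>+x. indicator \<Omega> x * ennreal (trunc_exp n0 (\<alpha> * X x powr (p / (p - 1))) / bdist \<Omega> x ^ DIM('a)) \<partial>lborel) \<le> ennreal (2 * kernel_const DIM('a))"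
    proof (rule exponential_moment_sum[OF _ _ \<Omega> _ _ p n0 \<alpha>(1) _ K mom])
      show "X \<in> borel_measurable borel" unfolding X_def mt_X_eq by measurable
      show "0 \<le> X x" for x
        using wpos[of x] by (cases "x \<in> \<Omega>") (simp_all add: X_def mt_X_eq)
      show "0 < bdist \<Omega> x ^ DIM('a)" if "x \<in> \<Omega>" for x by (intro zero_less_power bdist_pos[OF dom that])
      show "0 < W + 1" using W by simp
      have "\<alpha> * b \<le> 1 / 2" using \<alpha>(2) b by (simp add: less_divide_eq mult.commute)
      then show "\<alpha> * (p / (p - 1) * (W + 1) powr (1 / (p - 1)) * exp 1) \<le> 1 / 2" unfolding b_def .
    qed simp_all
    also have "(\<integral>\<^sup>+x. indicator \<Omega> x * ennreal (trunc_exp n0 (\<alpha> * X x powr (p / (p - 1))) / bdist \<Omega> x ^ DIM('a)) \<partial>lborel) = mt_integral \<Omega> s n0 \<alpha> u"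
      unfolding mt_integral_eq_lborel[OF \<Omega>] q by (intro nn_integral_cong) (simp add: X_def split: split_indicator)
    finally show "mt_integral \<Omega> s n0 \<alpha> u \<le> ennreal (2 * kernel_const DIM('a))" .
  qed
qed

text \<open>
  A function of seminorm at most \<open>1\<close> is an almost everywhere limit of test functions of energy at most
  \<open>2 powr p * 2\<close>, to which the previous estimate applies uniformly.  The means converge too, hence so
  does the integrand, and Fatou's lemma gives the same bound in the limit.
\<close>

theorem moser_trudinger_subcritical:
  fixes \<Omega> :: "'a::euclidean_space set" and p s :: real
  assumes dom: "bounded_lipschitz_domain \<Omega>" and s: "0 < s" "s < 1" and p: "1 < p" and sp: "s * p = real DIM('a)"
    and n0: "p - 1 \<le> real n0"
  obtains \<alpha>0 where "0 < \<alpha>0"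
    "\<And>\<alpha>. 0 \<le> \<alpha> \<Longrightarrow> \<alpha> < \<alpha>0 \<Longrightarrow> (SUP u\<in>{u \<in> wsp0 \<Omega> s p. gagliardo \<Omega> s p u \<le> 1}. mt_integral \<Omega> s n0 \<alpha> u) < \<infinity>"
proof -
  let ?K = "2 * kernel_const DIM('a)" and ?q = "real DIM('a) / (real DIM('a) - s)"
  have op: "open \<Omega>" "bounded \<Omega>" using dom by (auto simp: bounded_lipschitz_domain_def)
  have \<Omega> [measurable]: "\<Omega> \<in> sets borel" using op(1) by simp
  have M: "0 < 2 powr p * (2::real)" by simp
  have "1 \<le> real DIM('a)" using DIM_positive[where 'a='a] by linarith
  then have q: "0 < ?q" using s by (intro divide_pos_pos) linarith+
  obtain \<alpha>0 where \<alpha>0: "0 < \<alpha>0" "\<And>\<alpha> u. 0 \<le> \<alpha> \<Longrightarrow> \<alpha> < \<alpha>0 \<Longrightarrow> u \<in> test_functions \<Omega> \<Longrightarrow> energy \<Omega> p u \<le> ennreal (2 powr p * 2) \<Longrightarrow>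
      mt_integral \<Omega> s n0 \<alpha> u \<le> ennreal ?K"
    by (rule moser_trudinger_test_functions[OF dom s(1) p sp n0 M], rule that)
  show ?thesis
  proof (rule that[OF \<alpha>0(1)])
    fix \<alpha> :: real assume \<alpha>: "0 \<le> \<alpha>" "\<alpha> < \<alpha>0"
    define f where "f u x = indicator \<Omega> x * ennreal (trunc_exp n0 (\<alpha> * mt_X \<Omega> u x powr ?q) / bdist \<Omega> x ^ DIM('a))" for u x
    have int: "mt_integral \<Omega> s n0 \<alpha> u = (\<integral>\<^sup>+x. f u x \<partial>lborel)" for u
      unfolding f_def by (rule mt_integral_eq_lborel[OF \<Omega>])
    have "mt_integral \<Omega> s n0 \<alpha> u \<le> ennreal ?K" if u: "u \<in> wsp0 \<Omega> s p" "gagliardo \<Omega> s p u \<le> 1" for u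
    proof -
      obtain \<psi> where \<psi>: "\<And>n. \<psi> n \<in> test_functions \<Omega>" "\<And>n. energy \<Omega> p (\<psi> n) \<le> ennreal (2 powr p * 2)"
        and ptw: "AE x in lborel. x \<in> \<Omega> \<longrightarrow> (\<lambda>n. \<psi> n x) \<longlonglongrightarrow> u x"
        and avg: "(\<lambda>n. average \<Omega> (\<psi> n)) \<longlonglongrightarrow> average \<Omega> u"
        by (rule wsp0_approximation[OF op p sp u], rule that)
      have [measurable]: "\<psi> n \<in> borel_measurable borel" for n by (rule test_function_measurable[OF \<psi>(1)])
      have [measurable]: "f (\<psi> n) \<in> borel_measurable borel" for n
        unfolding f_def mt_X_eq trunc_exp_def by measurable
      have c: "(\<lambda>n. mt_centre \<Omega> (\<psi> n)) \<longlonglongrightarrow> mt_centre \<Omega> u" using avg by (simp add: mt_centre_def)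
      have lim: "AE x in lborel. (\<lambda>n. f (\<psi> n) x) \<longlonglongrightarrow> f u x"
        using ptw
      proof eventually_elim
        fix x assume x: "x \<in> \<Omega> \<longrightarrow> (\<lambda>n. \<psi> n x) \<longlonglongrightarrow> u x"
        show "(\<lambda>n. f (\<psi> n) x) \<longlonglongrightarrow> f u x"
        proof (cases "x \<in> \<Omega>")
          case True
          have w: "0 < mt_weight \<Omega> x" using mt_weight_ge[OF dom True] by (rule less_le_trans[rotated]) simp
          have "0 < bdist \<Omega> x" by (rule bdist_pos[OF dom True])
          then have b: "bdist \<Omega> x ^ DIM('a) \<noteq> 0" by simp
          have "(\<lambda>n. mt_X \<Omega> (\<psi> n) x) \<longlonglongrightarrow> mt_X \<Omega> u x"
            unfolding mt_X_eq using x True c w by (intro tendsto_intros) auto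
          then have "(\<lambda>n. mt_X \<Omega> (\<psi> n) x powr ?q) \<longlonglongrightarrow> mt_X \<Omega> u x powr ?q"
            by (rule tendsto_powr'[OF _ tendsto_const]) (use q w in \<open>simp add: mt_X_eq\<close>)
          then have "(\<lambda>n. trunc_exp n0 (\<alpha> * mt_X \<Omega> (\<psi> n) x powr ?q)) \<longlonglongrightarrow> trunc_exp n0 (\<alpha> * mt_X \<Omega> u x powr ?q)"
            unfolding trunc_exp_def by (intro tendsto_diff tendsto_exp tendsto_sum tendsto_divide tendsto_power tendsto_mult tendsto_const) auto
          then have "(\<lambda>n. trunc_exp n0 (\<alpha> * mt_X \<Omega> (\<psi> n) x powr ?q) / bdist \<Omega> x ^ DIM('a)) \<longlonglongrightarrow>
            trunc_exp n0 (\<alpha> * mt_X \<Omega> u x powr ?q) / bdist \<Omega> x ^ DIM('a)"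
            by (rule tendsto_divide[OF _ tendsto_const b])
          from tendsto_ennrealI[OF this] show ?thesis using True by (simp add: f_def)
        qed (simp add: f_def)
      qed
      have "(\<integral>\<^sup>+x. f u x \<partial>lborel) = (\<integral>\<^sup>+x. liminf (\<lambda>n. f (\<psi> n) x) \<partial>lborel)"
      proof (rule nn_integral_cong_AE, use lim in eventually_elim)
        fix x assume "(\<lambda>n. f (\<psi> n) x) \<longlonglongrightarrow> f u x"
        then show "f u x = liminf (\<lambda>n. f (\<psi> n) x)" by (rule lim_imp_Liminf[OF sequentially_bot, symmetric])
      qed
      also have "\<dots> \<le> liminf (\<lambda>n. \<integral>\<^sup>+x. f (\<psi> n) x \<partial>lborel)"
        by (rule nn_integral_liminf) measurable
      also have "\<dots> \<le> liminf (\<lambda>n::nat. ennreal ?K)"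
        unfolding int[symmetric] by (intro Liminf_mono always_eventually allI \<alpha>0(2) \<alpha> \<psi>)
      also have "\<dots> = ennreal ?K" by (rule Liminf_const[OF sequentially_bot])
      finally show ?thesis unfolding int .
    qed
    then have "(SUP u\<in>{u \<in> wsp0 \<Omega> s p. gagliardo \<Omega> s p u \<le> 1}. mt_integral \<Omega> s n0 \<alpha> u) \<le> ennreal ?K"
      by (intro SUP_least) blast
    also have "\<dots> < \<infinity>" unfolding infinity_ennreal_def by (rule ennreal_less_top)
    finally show "(SUP u\<in>{u \<in> wsp0 \<Omega> s p. gagliardo \<Omega> s p u \<le> 1}. mt_integral \<Omega> s n0 \<alpha> u) < \<infinity>" .
  qed
qed

theorem theorem1p1:
  fixes \<Omega> :: "'a::euclidean_space set" and p s :: real and n0 :: nat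
  assumes "bounded_lipschitz_domain \<Omega>"
    and "p > 1" and "0 < s" and "s < 1" and "s * p = real DIM('a)"
    and "real n0 \<ge> p - 1" and "p - 1 > real n0 - 1"
  shows "(\<exists>\<alpha>0>0. \<forall>\<alpha>. 0 \<le> \<alpha> \<and> \<alpha> < \<alpha>0 \<longrightarrow>
            (SUP u\<in>{u \<in> wsp0 \<Omega> s p. gagliardo \<Omega> s p u \<le> 1}. mt_integral \<Omega> s n0 \<alpha> u) < \<infinity>) \<and>
         (\<forall>\<alpha>>alpha_star DIM('a) s p.
            (SUP u\<in>{u \<in> wsp0 \<Omega> s p. gagliardo \<Omega> s p u \<le> 1}. mt_integral \<Omega> s n0 \<alpha> u) = \<infinity>)"
proof (rule conjI)
  show "\<exists>\<alpha>0>0. \<forall>\<alpha>. 0 \<le> \<alpha> \<and> \<alpha> < \<alpha>0 \<longrightarrow>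
    (SUP u\<in>{u \<in> wsp0 \<Omega> s p. gagliardo \<Omega> s p u \<le> 1}. mt_integral \<Omega> s n0 \<alpha> u) < \<infinity>"
    by (rule moser_trudinger_subcritical[OF assms(1,3,4,2,5,6)]) blast
  show "\<forall>\<alpha>>alpha_star DIM('a) s p.
    (SUP u\<in>{u \<in> wsp0 \<Omega> s p. gagliardo \<Omega> s p u \<le> 1}. mt_integral \<Omega> s n0 \<alpha> u) = \<infinity>"
    using moser_trudinger_supercritical[OF assms(1,3,4,2,5)] by blast
qed

end
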